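(* Let $\varphi\colon G\times M\to M$ be a left action of a Lie group $G$ on an analytic manifold $M$ (continuous in $G$) that is sated and analytic in $M$. Let $D\subseteq\mathbb{R}$ be an arbitrary interval and $\gamma\colon D\to M$ a free analytic immersion that is not itself a free segment. Then exactly one of the following holds: $\gamma$ admits a unique $\tau$-decomposition; or $\gamma$ admits a compact maximal interval contained in $\mathrm{int}[D]$. In the second case $\gamma$ is either positive or negative (exactly one of the two), and the following holds. If $\gamma$ is negative, then for each compact maximal interval $A\subseteq\mathrm{int}[D]$ and each $A$-decomposition $(\{a_n\}_{n\in\mathfrak n},\{[g_n]\}_{n\in\mathfrak n})$ of $\gamma$ (with diffeomorphisms $\mu_n$): (N1) the intervals $A_n$, $\mathfrak n_-\le n\le\mathfrak n_+$ (including $n=0$), are maximal and are the only maximal intervals; (N2) for each $n\in\mathfrak n$, $\mu_n$ is increasing if $n$ is even and decreasing if $n$ is odd (where $g_n\cdot\gamma|_A\leadsto\gamma|_{A_n}$ for $\mathfrak n_-<n<\mathfrak n_+$ and $g_{\mathfrak n_\pm}\cdot\gamma|_A\rightharpoonup\gamma|_{A_{\mathfrak n_\pm}}$ if $\mathfrak n_\pm\ne\pm\infty$, all w.r.t. $\mu_n$), and $[g_n]=[g_{\sigma(1\cdot\mathrm{sgn}(n))}\cdot g_{\sigma(2\cdot\mathrm{sgn}(n))}\cdots g_{\sigma(|n|\cdot\mathrm{sgn}(n))}]$ with $\sigma(k)=(-1)^{k-1}$ for $k>0$, $\sigma(k)=(-1)^k$ for $k<0$; (N3) $[g_{\pm1}]\subseteq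 G_{\gamma(a_{\pm1})}\setminus G_\gamma$ and $[g_{\pm1}^{-1}]=[g_{\pm1}]$. If $\gamma$ is positive, then: (P1) there is a unique class $[e]\ne[h]\in G/G_\gamma$ such that for each compact maximal $A\subseteq\mathrm{int}[D]$ and each $A$-decomposition of $\gamma$ one has $[h_n]=[h^{\mathrm{sgn}(n)}]$ for all $n\in\mathfrak n$; in particular $[g_n]=[h^n]$ for all $n\in\mathfrak n$, hence $h^n\cdot\gamma|_A\leadsto_+\gamma|_{A_n}$ for $\mathfrak n_-<n<\mathfrak n_+$, $n\neq 0$, and $h^{\mathfrak n_\pm}\cdot\gamma|_A\rightharpoonup\gamma|_{A_{\mathfrak n_\pm}}$ with $\mu_{\mathfrak n_\pm}$ increasing if $\mathfrak n_\pm\neq\pm\infty$; (P2) for each such $A$-decomposition: given $\mathfrak n_-<n\le0$ and $b'\in\mathrm{int}[A_{n-1}]$ there is $b\in\mathrm{int}[A_n]$ such that $[b',b]$ is compact maximal (and positive w.r.t. $\gamma|_{\mathrm{int}[D]}$); given $0\le n<\mathfrak n_+$ and $b\in\mathrm{int}[A_{n+1}]$ there is $b'\in\mathrm{int}[A_n]$ such that $[b',b]$ is compact maximal (and positive w.r.t. $\gamma|_{\mathrm{int}[D]}$); in particular each $t\in\mathrm{int}[D]$ lies in the interior of a compact maximal interval that is positive w.r.t. $\gamma|_{\mathrm{int}[D]}$; (P3) for each $t\in D$ there is a compact maximal interval $B_t\subseteq D$ with $t\in B_t$ that is positive w.r.t. $\overline\gamma$, the maximal analytic immersive extension of $\ga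mma$.
   Context: Intervals are connected subsets of $\mathbb{R}$ with non-empty interior $\mathrm{int}[\cdot]$. $M$ is a finite-dimensional Hausdorff real-analytic manifold without boundary (second countability not assumed); $G$ is a Lie group (same conventions); $\varphi$, $(g,x)\mapsto g\cdot x$, is a left action with $g\mapsto g\cdot x$ continuous for each $x\in M$. $\varphi$ is analytic in $M$ if $x\mapsto g\cdot x$ is analytic for each $g\in G$. $\varphi$ is sated if for mutually different $x,y,z\in M$ there is no sequence $\{g_n\}\subseteq G$ with $\lim_n g_n\cdot y=x=\lim_n g_n\cdot z$. $G_x$ is the stabilizer of $x$. A curve $\gamma\colon D\to M$ is an analytic immersion (embedding) if it is the restriction of an analytic immersion (analytic immersion that is a homeomorphism onto its image) on an open interval containing $D$; every analytic immersion $\gamma$ has a unique maximal analytic immersive extension $\overline\gamma$ to an open interval. An analytic diffeomorphism between intervals is a bijection that extends to an analytic diffeomorphism between open intervals. $(g\cdot\gamma)(t)=g\cdot\gamma(t)$, $G_\gamma=\{g:g\cdot\gamma=\gamma\}$, $[g]=gG_\gamma\in G/G_\gamma$ (stabilizers of $\gamma$, its restrictions to intervals, and $\overline\gamma$ coincide). For analytic immersions, $\gamma\sim_\circ\gamma'$ means $\gamma(J)=\gamma'(J')$ for non-empty open intervals $J\subseteq\mathrm{dom}[\gamma]$, $J'\subseteq\mathrm{dom}[\gamma']$ on which $\gamma,\gamma'$ are embeddings. An analytic immersion $\delta$ is a free segment if $g\cdot\delta\sim_\circ\delta$ implies $g\in G_\delta$ for all $g\in G$. $\gamma$ is free if its restriction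 to some interval is a free segment. An interval $A\subseteq D$ is free if $\gamma|_A$ is a free segment; maximal (w.r.t. $\gamma$) if free and not properly contained in a free interval $A'\subseteq D$. $\tau$-decomposition: for $\tau\in\mathrm{int}[D]$ let $D_-=D\cap(-\infty,\tau]$, $D_+=D\cap[\tau,\infty)$. If $D_\pm$ are free, a $\tau$-decomposition of $\gamma$ is a class $[g]\subseteq G_{\gamma(\tau)}\setminus G_\gamma$ for which there is an analytic diffeomorphism $\mu\colon D_-\supseteq B_-\to B_+\subseteq D_+$ of intervals containing $\tau$ with $\mu(\tau)=\tau$, $g\cdot\gamma|_{B_-}=\gamma|_{B_+}\circ\mu$, and $B_-=D_-$ or $B_+=D_+$. Relations: let $\delta\colon B=[b',b]\to M$ and $\delta'\colon C\to M$ be analytic immersions, $C$ compact or half-open. $\delta\leadsto\delta'$ w.r.t. $\mu$ means: $\mu\colon B\supseteq\mathrm{dom}[\mu]\to C$ is an analytic diffeomorphism between intervals (onto $C$), $\delta|_{\mathrm{dom}[\mu]}=\delta'\circ\mu$, and either $\mathrm{dom}[\mu]=B$ and $C$ is compact, or $\mathrm{dom}[\mu]$ and $C$ are half-open and $\mathrm{dom}[\mu]$ contains an endpoint of $B$; $\leadsto_+$ ($\leadsto_-$) means $\mu$ is increasing (decreasing). $\delta\rightharpoonup\delta'$ w.r.t. $\mu$ means: $\delta|_{B'}=\delta'\circ\mu$ for an analytic diffeomorphism $\mu\colon B\supseteq B'\to C$ with $B'\cap\{b',b\}\ne\emptyset$ and $\mu(B'\cap\{b',b\})\cap(C\setminus\mathrm{int}[C])\ne\emptyset$.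 $A$-decomposition: let $A\subseteq\mathrm{int}[D]$ be compact maximal. An $A$-decomposition of $\gamma$ is a pair $(\{a_n\}_{n\in\mathfrak n},\{[g_n]\}_{n\in\mathfrak n})$ with $\mathfrak n=\{n\in\mathbb{Z}_{\neq0}:\mathfrak n_-\le n\le\mathfrak n_+\}$, $-\infty\le\mathfrak n_-<0<\mathfrak n_+\le\infty$, $a_n\in\mathrm{int}[D]$ strictly increasing in $n$, $g_n\in G$, $[g_{\pm1}]\neq[e]$, such that with $A_0=[a_{-1},a_1]$, $A_n=[a_{n-1},a_n]$ for $\mathfrak n_-<n\le-1$, $A_n=[a_n,a_{n+1}]$ for $1\le n<\mathfrak n_+$, $A_{\mathfrak n_-}=D\cap(-\infty,a_{\mathfrak n_-}]$ if $\mathfrak n_-\ne-\infty$, $A_{\mathfrak n_+}=D\cap[a_{\mathfrak n_+},\infty)$ if $\mathfrak n_+\neq\infty$, one has $A_0=A$, $g_n\cdot\gamma|_A\leadsto\gamma|_{A_n}$ w.r.t. $\mu_n$ for $n\in\mathfrak n\setminus\{\mathfrak n_-,\mathfrak n_+\}$, and $g_{\mathfrak n_\pm}\cdot\gamma|_A\rightharpoonup\gamma|_{A_{\mathfrak n_\pm}}$ w.r.t. $\mu_{\mathfrak n_\pm}$ if $\mathfrak n_\pm\ne\pm\infty$. Put $h_{\pm1}=g_{\pm1}$, $h_n=g_ng_{n+1}^{-1}$ for $\mathfrak n_-\le n\le-2$, $h_n=g_ng_{n-1}^{-1}$ for $2\le n\le\mathfrak n_+$. Positivity: for an analytic immersion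 on an open interval $I$ (such as $\gamma|_{\mathrm{int}[D]}$ or $\overline\gamma$), an $A$-decomposition ($A\subseteq I$ compact maximal) is defined in the same way with $D=I$, but with $\leadsto$ for all $n\in\mathfrak n$ (including $\mathfrak n_\pm$); each compact maximal $A$ has exactly one, and $A$ is positive (negative) if both $g_{\pm1}\cdot\gamma|_A\leadsto_+\gamma|_{A_{\pm1}}$ (resp. both $\leadsto_-$). Such a curve is positive (negative) if it admits a positive (negative) compact maximal interval. For arbitrary $D$, $\gamma\colon D\to M$ admitting a compact maximal interval in $\mathrm{int}[D]$ is called positive (negative) if $\gamma|_{\mathrm{int}[D]}$ is positive (negative). (A compact interval $A\subseteq\mathrm{int}[D]$ is maximal w.r.t. $\gamma$ iff w.r.t. $\gamma|_{\mathrm{int}[D]}$ iff w.r.t. $\overline\gamma$.) *)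

theory Defs
  imports
    "HOL-Analysis.Analysis"
    "HOL-Algebra.Group_Action"
    "HOL-Library.Extended"
begin

section \<open>Real-analytic manifolds and Lie groups\<close>

text \<open>
  \<open>f\<close> is locally the sum of an absolutely convergent power series; the multi-indices are the
  functions \<open>Basis \<rightarrow>\<^sub>E UNIV\<close> into the natural numbers.  Used only for sets \<open>S\<close> that are relatively
  open in a linear subspace \<open>V\<close>; there it is equivalent to analyticity in linear coordinates
  of \<open>V\<close>, and to \<open>f\<close> being locally the restriction of an analytic map on an open subset of the
  ambient space.
\<close>

definition real_analytic_on ::
    "('a::euclidean_space \<Rightarrow> 'b::real_normed_vector) \<Rightarrow> 'a set \<Rightarrow> bool" where
  "real_analytic_on f S \<longleftrightarrow>
    (\<forall>x\<in>S. \<exists>r>0. \<exists>c :: ('a \<Rightarrow> nat) \<Rightarrow> 'b. \<forall>y \<in> S \<inter> ball x r.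
      ((\<lambda>\<alpha>. (\<Prod>b\<in>Basis. ((y - x) \<bullet> b) ^ \<alpha> b) *\<^sub>R c \<alpha>) has_sum f y) (Basis \<rightarrow>\<^sub>E UNIV))"

text \<open>
  A manifold is represented by an atlas of pairs (chart domain, chart map); its points are the
  union of the chart domains, with the topology induced from the ambient Hausdorff type.  Charts
  take values in a common linear subspace \<open>V\<close> of the Euclidean type, so that the dimension
  \<open>dim V\<close> may be 0 (as for discrete groups), which \<open>V = UNIV\<close> would exclude.
\<close>

type_synonym ('a, 'e) atlas = "('a set \<times> ('a \<Rightarrow> 'e)) set"

definition manifold_points :: "('a, 'e) atlas \<Rightarrow> 'a set" where
  "manifold_points M = \<Union> (fst ` M)"

definition analytic_manifold :: "('a::t2_space, 'e::euclidean_space) atlas \<Rightarrow> bool" where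
  "analytic_manifold M \<longleftrightarrow>
    (\<exists>V. subspace V \<and>
      (\<forall>(U, \<psi>) \<in> M. openin (top_of_set (manifold_points M)) U \<and>
         openin (top_of_set V) (\<psi> ` U) \<and> homeomorphism U (\<psi> ` U) \<psi> (inv_into U \<psi>)) \<and>
      (\<forall>(U, \<psi>) \<in> M. \<forall>(W, \<eta>) \<in> M. real_analytic_on (\<eta> \<circ> inv_into U \<psi>) (\<psi> ` (U \<inter> W))))"

definition analytic_map ::
    "('a::t2_space, 'e::euclidean_space) atlas \<Rightarrow> ('b::t2_space, 'f::euclidean_space) atlas
      \<Rightarrow> ('a \<Rightarrow> 'b) \<Rightarrow> bool" where
  "analytic_map M N f \<longleftrightarrow>
    f ` manifold_points M \<subseteq> manifold_points N \<and> continuous_on (manifold_points M) f \<and>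
    (\<forall>(U, \<psi>) \<in> M. \<forall>(W, \<eta>) \<in> N.
      real_analytic_on (\<eta> \<circ> f \<circ> inv_into U \<psi>) (\<psi> ` (U \<inter> f -` W)))"

definition prod_atlas ::
    "('a, 'e) atlas \<Rightarrow> ('b, 'f) atlas \<Rightarrow> ('a \<times> 'b, 'e \<times> 'f) atlas" where
  "prod_atlas M N = {(U \<times> W, map_prod \<psi> \<eta>) | U \<psi> W \<eta>. (U, \<psi>) \<in> M \<and> (W, \<eta>) \<in> N}"

definition lie_group ::
    "('g::t2_space) monoid \<Rightarrow> ('g, 'f::euclidean_space) atlas \<Rightarrow> bool" where
  "lie_group G N \<longleftrightarrow>
    group G \<and> analytic_manifold N \<and> manifold_points N = carrier G \<and>
    analytic_map (prod_atlas N N) N (\<lambda>(x, y). x \<otimes>\<^bsub>G\<^esub> y) \<and>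
    analytic_map N N (\<lambda>x. inv\<^bsub>G\<^esub> x)"

definition sated :: "('g, 'b) monoid_scheme \<Rightarrow> ('g \<Rightarrow> 'm \<Rightarrow> 'm) \<Rightarrow> ('m::t2_space, 'e) atlas \<Rightarrow> bool" where
  "sated G \<phi> M \<longleftrightarrow>
    (\<forall>x \<in> manifold_points M. \<forall>y \<in> manifold_points M. \<forall>z \<in> manifold_points M.
      x \<noteq> y \<and> y \<noteq> z \<and> x \<noteq> z \<longrightarrow>
      \<not> (\<exists>g :: nat \<Rightarrow> 'g. range g \<subseteq> carrier G \<and>
           (\<lambda>n. \<phi> (g n) y) \<longlonglongrightarrow> x \<and> (\<lambda>n. \<phi> (g n) z) \<longlonglongrightarrow> x))"

section \<open>Analytic curves\<close>

text \<open>A curve with domain \<open>D\<close> is a total function of which only the values on \<open>D\<close> matter.\<close>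

definition interval :: "real set \<Rightarrow> bool" where
  "interval D \<longleftrightarrow> connected D \<and> interior D \<noteq> {}"

definition open_interval :: "real set \<Rightarrow> bool" where
  "open_interval I \<longleftrightarrow> interval I \<and> open I"

text \<open>Exactly one of the two ends belongs to \<open>S\<close>; \<open>{a..}\<close> and \<open>{..a}\<close> count as half-open.\<close>

definition half_open :: "real set \<Rightarrow> bool" where
  "half_open S \<longleftrightarrow> interval S \<and> (\<exists>a\<in>S. S \<subseteq> {a..}) \<noteq> (\<exists>b\<in>S. S \<subseteq> {..b})"

definition analytic_diffeo :: "real set \<Rightarrow> real set \<Rightarrow> (real \<Rightarrow> real) \<Rightarrow> bool" where
  "analytic_diffeo B C \<mu> \<longleftrightarrow>
    interval B \<and> interval C \<and> bij_betw \<mu> B C \<and>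
    (\<exists>I I' \<nu>. open_interval I \<and> open_interval I' \<and> B \<subseteq> I \<and> C \<subseteq> I' \<and> bij_betw \<nu> I I' \<and>
       real_analytic_on \<nu> I \<and> real_analytic_on (inv_into I \<nu>) I' \<and> (\<forall>t\<in>B. \<nu> t = \<mu> t))"

definition open_immersion ::
    "('m::t2_space, 'e::euclidean_space) atlas \<Rightarrow> real set \<Rightarrow> (real \<Rightarrow> 'm) \<Rightarrow> bool" where
  "open_immersion M I \<gamma> \<longleftrightarrow>
    open_interval I \<and> analytic_map {(I, id)} M \<gamma> \<and>
    (\<forall>(U, \<psi>) \<in> M. \<forall>t \<in> I \<inter> \<gamma> -` U.
      \<exists>v. v \<noteq> 0 \<and> ((\<psi> \<circ> \<gamma>) has_vector_derivative v) (at t))"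

definition analytic_immersion ::
    "('m::t2_space, 'e::euclidean_space) atlas \<Rightarrow> real set \<Rightarrow> (real \<Rightarrow> 'm) \<Rightarrow> bool" where
  "analytic_immersion M D \<gamma> \<longleftrightarrow>
    interval D \<and> (\<exists>I \<gamma>'. D \<subseteq> I \<and> open_immersion M I \<gamma>' \<and> (\<forall>t\<in>D. \<gamma>' t = \<gamma> t))"

definition analytic_embedding ::
    "('m::t2_space, 'e::euclidean_space) atlas \<Rightarrow> real set \<Rightarrow> (real \<Rightarrow> 'm) \<Rightarrow> bool" where
  "analytic_embedding M D \<gamma> \<longleftrightarrow>
    interval D \<and> (\<exists>I \<gamma>'. D \<subseteq> I \<and> open_immersion M I \<gamma>' \<and>
      homeomorphism I (\<gamma>' ` I) \<gamma>' (inv_into I \<gamma>') \<and> (\<forall>t\<in>D. \<gamma>' t = \<gamma> t))"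

definition maximal_extension ::
    "('m::t2_space, 'e::euclidean_space) atlas \<Rightarrow> real set \<Rightarrow> (real \<Rightarrow> 'm)
      \<Rightarrow> real set \<Rightarrow> (real \<Rightarrow> 'm) \<Rightarrow> bool" where
  "maximal_extension M D \<gamma> I \<delta> \<longleftrightarrow>
    D \<subseteq> I \<and> open_immersion M I \<delta> \<and> (\<forall>t\<in>D. \<delta> t = \<gamma> t) \<and>
    (\<forall>I' \<delta>'. I \<subseteq> I' \<and> open_immersion M I' \<delta>' \<and> (\<forall>t\<in>I. \<delta>' t = \<delta> t) \<longrightarrow> I' = I)"

definition curve_sim ::
    "('m::t2_space, 'e::euclidean_space) atlas \<Rightarrow> real set \<Rightarrow> (real \<Rightarrow> 'm)
      \<Rightarrow> real set \<Rightarrow> (real \<Rightarrow> 'm) \<Rightarrow> bool" where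
  "curve_sim M D \<gamma> D' \<gamma>' \<longleftrightarrow>
    (\<exists>J J'. open_interval J \<and> open_interval J' \<and> J \<subseteq> D \<and> J' \<subseteq> D' \<and>
       analytic_embedding M J \<gamma> \<and> analytic_embedding M J' \<gamma>' \<and> \<gamma> ` J = \<gamma>' ` J')"

section \<open>Free curves and maximal intervals\<close>

definition curve_stab ::
    "('g, 'b) monoid_scheme \<Rightarrow> ('g \<Rightarrow> 'm \<Rightarrow> 'm) \<Rightarrow> real set \<Rightarrow> (real \<Rightarrow> 'm) \<Rightarrow> 'g set" where
  "curve_stab G \<phi> D \<gamma> = {g \<in> carrier G. \<forall>t\<in>D. \<phi> g (\<gamma> t) = \<gamma> t}"

definition curve_class ::
    "('g, 'b) monoid_scheme \<Rightarrow> ('g \<Rightarrow> 'm \<Rightarrow> 'm) \<Rightarrow> real set \<Rightarrow> (real \<Rightarrow> 'm) \<Rightarrow> 'g \<Rightarrow> 'g set" where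
  "curve_class G \<phi> D \<gamma> g = g <#\<^bsub>G\<^esub> curve_stab G \<phi> D \<gamma>"

definition free_segment ::
    "('g, 'b) monoid_scheme \<Rightarrow> ('g \<Rightarrow> 'm \<Rightarrow> 'm) \<Rightarrow> ('m::t2_space, 'e::euclidean_space) atlas
      \<Rightarrow> real set \<Rightarrow> (real \<Rightarrow> 'm) \<Rightarrow> bool" where
  "free_segment G \<phi> M D \<delta> \<longleftrightarrow>
    analytic_immersion M D \<delta> \<and>
    (\<forall>g \<in> carrier G. curve_sim M D (\<phi> g \<circ> \<delta>) D \<delta> \<longrightarrow> g \<in> curve_stab G \<phi> D \<delta>)"

definition free_interval ::
    "('g, 'b) monoid_scheme \<Rightarrow> ('g \<Rightarrow> 'm \<Rightarrow> 'm) \<Rightarrow> ('m::t2_space, 'e::euclidean_space) atlas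
      \<Rightarrow> real set \<Rightarrow> (real \<Rightarrow> 'm) \<Rightarrow> real set \<Rightarrow> bool" where
  "free_interval G \<phi> M D \<gamma> A \<longleftrightarrow> interval A \<and> A \<subseteq> D \<and> free_segment G \<phi> M A \<gamma>"

definition free_curve ::
    "('g, 'b) monoid_scheme \<Rightarrow> ('g \<Rightarrow> 'm \<Rightarrow> 'm) \<Rightarrow> ('m::t2_space, 'e::euclidean_space) atlas
      \<Rightarrow> real set \<Rightarrow> (real \<Rightarrow> 'm) \<Rightarrow> bool" where
  "free_curve G \<phi> M D \<gamma> \<longleftrightarrow> analytic_immersion M D \<gamma> \<and> (\<exists>A. free_interval G \<phi> M D \<gamma> A)"

definition maximal_interval ::
    "('g, 'b) monoid_scheme \<Rightarrow> ('g \<Rightarrow> 'm \<Rightarrow> 'm) \<Rightarrow> ('m::t2_space, 'e::euclidean_space) atlas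
      \<Rightarrow> real set \<Rightarrow> (real \<Rightarrow> 'm) \<Rightarrow> real set \<Rightarrow> bool" where
  "maximal_interval G \<phi> M D \<gamma> A \<longleftrightarrow>
    free_interval G \<phi> M D \<gamma> A \<and> \<not> (\<exists>A'. free_interval G \<phi> M D \<gamma> A' \<and> A \<subset> A')"

definition inner_compact_maximal ::
    "('g, 'b) monoid_scheme \<Rightarrow> ('g \<Rightarrow> 'm \<Rightarrow> 'm) \<Rightarrow> ('m::t2_space, 'e::euclidean_space) atlas
      \<Rightarrow> real set \<Rightarrow> (real \<Rightarrow> 'm) \<Rightarrow> real set \<Rightarrow> bool" where
  "inner_compact_maximal G \<phi> M D \<gamma> A \<longleftrightarrow>
    compact A \<and> A \<subseteq> interior D \<and> maximal_interval G \<phi> M D \<gamma> A"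

section \<open>Decompositions\<close>

text \<open>The argument \<open>c\<close> is the class \<open>[g]\<close>.\<close>

definition tau_decomposition ::
    "('g, 'b) monoid_scheme \<Rightarrow> ('g \<Rightarrow> 'm \<Rightarrow> 'm) \<Rightarrow> ('m::t2_space, 'e::euclidean_space) atlas
      \<Rightarrow> real set \<Rightarrow> (real \<Rightarrow> 'm) \<Rightarrow> real \<Rightarrow> 'g set \<Rightarrow> bool" where
  "tau_decomposition G \<phi> M D \<gamma> \<tau> c \<longleftrightarrow>
    \<tau> \<in> interior D \<and>
    free_interval G \<phi> M D \<gamma> (D \<inter> {..\<tau>}) \<and> free_interval G \<phi> M D \<gamma> (D \<inter> {\<tau>..}) \<and>
    (\<exists>g \<in> carrier G.
      c = curve_class G \<phi> D \<gamma> g \<and> c \<subseteq> stabilizer G \<phi> (\<gamma> \<tau>) - curve_stab G \<phi> D \<gamma> \<and>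
      (\<exists>B\<^sub>m B\<^sub>p \<mu>. B\<^sub>m \<subseteq> D \<inter> {..\<tau>} \<and> B\<^sub>p \<subseteq> D \<inter> {\<tau>..} \<and> \<tau> \<in> B\<^sub>m \<and> \<tau> \<in> B\<^sub>p \<and>
        analytic_diffeo B\<^sub>m B\<^sub>p \<mu> \<and> \<mu> \<tau> = \<tau> \<and> (\<forall>t\<in>B\<^sub>m. \<phi> g (\<gamma> t) = \<gamma> (\<mu> t)) \<and>
        (B\<^sub>m = D \<inter> {..\<tau>} \<or> B\<^sub>p = D \<inter> {\<tau>..})))"

text \<open>
  In both relations the curve \<open>\<delta>\<close> has domain \<open>{b'..b}\<close>, the curve \<open>\<delta>'\<close> has domain \<open>C\<close>, and \<open>P\<close>
  is the domain of \<open>\<mu>\<close>.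
\<close>

definition leadsto ::
    "real \<Rightarrow> real \<Rightarrow> (real \<Rightarrow> 'm) \<Rightarrow> real set \<Rightarrow> (real \<Rightarrow> 'm) \<Rightarrow> real set \<Rightarrow> (real \<Rightarrow> real) \<Rightarrow> bool" where
  "leadsto b' b \<delta> C \<delta>' P \<mu> \<longleftrightarrow>
    P \<subseteq> {b'..b} \<and> analytic_diffeo P C \<mu> \<and> (\<forall>t\<in>P. \<delta> t = \<delta>' (\<mu> t)) \<and>
    (P = {b'..b} \<and> compact C \<or> half_open P \<and> half_open C \<and> P \<inter> {b', b} \<noteq> {})"

definition leadsto_inc ::
    "real \<Rightarrow> real \<Rightarrow> (real \<Rightarrow> 'm) \<Rightarrow> real set \<Rightarrow> (real \<Rightarrow> 'm) \<Rightarrow> bool" where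
  "leadsto_inc b' b \<delta> C \<delta>' \<longleftrightarrow> (\<exists>P \<mu>. leadsto b' b \<delta> C \<delta>' P \<mu> \<and> strict_mono_on P \<mu>)"

definition leadsto_dec ::
    "real \<Rightarrow> real \<Rightarrow> (real \<Rightarrow> 'm) \<Rightarrow> real set \<Rightarrow> (real \<Rightarrow> 'm) \<Rightarrow> bool" where
  "leadsto_dec b' b \<delta> C \<delta>' \<longleftrightarrow> (\<exists>P \<mu>. leadsto b' b \<delta> C \<delta>' P \<mu> \<and> strict_antimono_on P \<mu>)"

definition harpoon ::
    "real \<Rightarrow> real \<Rightarrow> (real \<Rightarrow> 'm) \<Rightarrow> real set \<Rightarrow> (real \<Rightarrow> 'm) \<Rightarrow> real set \<Rightarrow> (real \<Rightarrow> real) \<Rightarrow> bool" where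
  "harpoon b' b \<delta> C \<delta>' P \<mu> \<longleftrightarrow>
    P \<subseteq> {b'..b} \<and> analytic_diffeo P C \<mu> \<and> (\<forall>t\<in>P. \<delta> t = \<delta>' (\<mu> t)) \<and>
    P \<inter> {b', b} \<noteq> {} \<and> \<mu> ` (P \<inter> {b', b}) \<inter> (C - interior C) \<noteq> {}"

text \<open>
  \<open>n\<^sub>m\<close> and \<open>n\<^sub>p\<close> are the (possibly infinite) lower and upper index bounds, \<open>idx n\<^sub>m n\<^sub>p\<close> is the
  index set without 0, and \<open>piece D a n\<^sub>m n\<^sub>p n\<close> is the interval \<open>A\<^sub>n\<close>.
\<close>

definition idx :: "int extended \<Rightarrow> int extended \<Rightarrow> int set" where
  "idx n\<^sub>m n\<^sub>p = {n. n \<noteq> 0 \<and> n\<^sub>m \<le> Fin n \<and> Fin n \<le> n\<^sub>p}"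

definition piece ::
    "real set \<Rightarrow> (int \<Rightarrow> real) \<Rightarrow> int extended \<Rightarrow> int extended \<Rightarrow> int \<Rightarrow> real set" where
  "piece D a n\<^sub>m n\<^sub>p n =
    (if n = 0 then {a (-1)..a 1}
     else if n < 0 then (if Fin n = n\<^sub>m then D \<inter> {..a n} else {a (n - 1)..a n})
     else (if Fin n = n\<^sub>p then D \<inter> {a n..} else {a n..a (n + 1)}))"

text \<open>
  The conditions common to decompositions of curves on arbitrary and on open intervals.  The
  classes \<open>[g\<^sub>n]\<close> are given by representatives \<open>g n\<close>.
\<close>

definition decomposition_frame ::
    "('g, 'b) monoid_scheme \<Rightarrow> ('g \<Rightarrow> 'm \<Rightarrow> 'm) \<Rightarrow> ('m::t2_space, 'e::euclidean_space) atlas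
      \<Rightarrow> real set \<Rightarrow> (real \<Rightarrow> 'm) \<Rightarrow> real set
      \<Rightarrow> int extended \<Rightarrow> int extended \<Rightarrow> (int \<Rightarrow> real) \<Rightarrow> (int \<Rightarrow> 'g) \<Rightarrow> bool" where
  "decomposition_frame G \<phi> M D \<gamma> A n\<^sub>m n\<^sub>p a g \<longleftrightarrow>
    inner_compact_maximal G \<phi> M D \<gamma> A \<and> n\<^sub>m < Fin 0 \<and> Fin 0 < n\<^sub>p \<and>
    (\<forall>n \<in> idx n\<^sub>m n\<^sub>p. a n \<in> interior D \<and> g n \<in> carrier G) \<and> strict_mono_on (idx n\<^sub>m n\<^sub>p) a \<and>
    (\<forall>n \<in> {-1, 1}. curve_class G \<phi> D \<gamma> (g n) \<noteq> curve_class G \<phi> D \<gamma> \<one>\<^bsub>G\<^esub>) \<and>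
    piece D a n\<^sub>m n\<^sub>p 0 = A"

text \<open>The relation required between \<open>\<delta>\<close> (restricted to \<open>A\<close>) and \<open>\<gamma>\<close> (restricted to \<open>A\<^sub>n\<close>).\<close>

definition piece_link ::
    "real set \<Rightarrow> (real \<Rightarrow> 'm) \<Rightarrow> int extended \<Rightarrow> int extended \<Rightarrow> (int \<Rightarrow> real)
      \<Rightarrow> (real \<Rightarrow> 'm) \<Rightarrow> int \<Rightarrow> real set \<Rightarrow> (real \<Rightarrow> real) \<Rightarrow> bool" where
  "piece_link D \<gamma> n\<^sub>m n\<^sub>p a \<delta> n P \<mu> \<longleftrightarrow>
    (if Fin n = n\<^sub>m \<or> Fin n = n\<^sub>p then harpoon (a (-1)) (a 1) \<delta> (piece D a n\<^sub>m n\<^sub>p n) \<gamma> P \<mu>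
     else leadsto (a (-1)) (a 1) \<delta> (piece D a n\<^sub>m n\<^sub>p n) \<gamma> P \<mu>)"

definition A_decomposition ::
    "('g, 'b) monoid_scheme \<Rightarrow> ('g \<Rightarrow> 'm \<Rightarrow> 'm) \<Rightarrow> ('m::t2_space, 'e::euclidean_space) atlas
      \<Rightarrow> real set \<Rightarrow> (real \<Rightarrow> 'm) \<Rightarrow> real set
      \<Rightarrow> int extended \<Rightarrow> int extended \<Rightarrow> (int \<Rightarrow> real) \<Rightarrow> (int \<Rightarrow> 'g) \<Rightarrow> bool" where
  "A_decomposition G \<phi> M D \<gamma> A n\<^sub>m n\<^sub>p a g \<longleftrightarrow>
    decomposition_frame G \<phi> M D \<gamma> A n\<^sub>m n\<^sub>p a g \<and>
    (\<forall>n \<in> idx n\<^sub>m n\<^sub>p. \<exists>P \<mu>. piece_link D \<gamma> n\<^sub>m n\<^sub>p a (\<phi> (g n) \<circ> \<gamma>) n P \<mu>)"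

definition open_A_decomposition ::
    "('g, 'b) monoid_scheme \<Rightarrow> ('g \<Rightarrow> 'm \<Rightarrow> 'm) \<Rightarrow> ('m::t2_space, 'e::euclidean_space) atlas
      \<Rightarrow> real set \<Rightarrow> (real \<Rightarrow> 'm) \<Rightarrow> real set
      \<Rightarrow> int extended \<Rightarrow> int extended \<Rightarrow> (int \<Rightarrow> real) \<Rightarrow> (int \<Rightarrow> 'g) \<Rightarrow> bool" where
  "open_A_decomposition G \<phi> M I \<gamma> A n\<^sub>m n\<^sub>p a g \<longleftrightarrow>
    open_interval I \<and> decomposition_frame G \<phi> M I \<gamma> A n\<^sub>m n\<^sub>p a g \<and>
    (\<forall>n \<in> idx n\<^sub>m n\<^sub>p. \<exists>P \<mu>.
       leadsto (a (-1)) (a 1) (\<phi> (g n) \<circ> \<gamma>) (piece I a n\<^sub>m n\<^sub>p n) \<gamma> P \<mu>)"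

text \<open>The open interval \<open>I\<close> is the domain of \<open>\<gamma>\<close>.\<close>

definition positive_interval ::
    "('g, 'b) monoid_scheme \<Rightarrow> ('g \<Rightarrow> 'm \<Rightarrow> 'm) \<Rightarrow> ('m::t2_space, 'e::euclidean_space) atlas
      \<Rightarrow> real set \<Rightarrow> (real \<Rightarrow> 'm) \<Rightarrow> real set \<Rightarrow> bool" where
  "positive_interval G \<phi> M I \<gamma> A \<longleftrightarrow>
    (\<exists>n\<^sub>m n\<^sub>p a g. open_A_decomposition G \<phi> M I \<gamma> A n\<^sub>m n\<^sub>p a g \<and>
      (\<forall>n \<in> {-1, 1}. leadsto_inc (a (-1)) (a 1) (\<phi> (g n) \<circ> \<gamma>) (piece I a n\<^sub>m n\<^sub>p n) \<gamma>))"

definition negative_interval ::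
    "('g, 'b) monoid_scheme \<Rightarrow> ('g \<Rightarrow> 'm \<Rightarrow> 'm) \<Rightarrow> ('m::t2_space, 'e::euclidean_space) atlas
      \<Rightarrow> real set \<Rightarrow> (real \<Rightarrow> 'm) \<Rightarrow> real set \<Rightarrow> bool" where
  "negative_interval G \<phi> M I \<gamma> A \<longleftrightarrow>
    (\<exists>n\<^sub>m n\<^sub>p a g. open_A_decomposition G \<phi> M I \<gamma> A n\<^sub>m n\<^sub>p a g \<and>
      (\<forall>n \<in> {-1, 1}. leadsto_dec (a (-1)) (a 1) (\<phi> (g n) \<circ> \<gamma>) (piece I a n\<^sub>m n\<^sub>p n) \<gamma>))"

definition positive_curve ::
    "('g, 'b) monoid_scheme \<Rightarrow> ('g \<Rightarrow> 'm \<Rightarrow> 'm) \<Rightarrow> ('m::t2_space, 'e::euclidean_space) atlas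
      \<Rightarrow> real set \<Rightarrow> (real \<Rightarrow> 'm) \<Rightarrow> bool" where
  "positive_curve G \<phi> M D \<gamma> \<longleftrightarrow> (\<exists>A. positive_interval G \<phi> M (interior D) \<gamma> A)"

definition negative_curve ::
    "('g, 'b) monoid_scheme \<Rightarrow> ('g \<Rightarrow> 'm \<Rightarrow> 'm) \<Rightarrow> ('m::t2_space, 'e::euclidean_space) atlas
      \<Rightarrow> real set \<Rightarrow> (real \<Rightarrow> 'm) \<Rightarrow> bool" where
  "negative_curve G \<phi> M D \<gamma> \<longleftrightarrow> (\<exists>A. negative_interval G \<phi> M (interior D) \<gamma> A)"

definition sigma :: "int \<Rightarrow> int" where
  "sigma k = (if k > 0 then (-1) ^ nat (k - 1) else (-1) ^ nat (- k))"

text \<open>The ordered product of \<open>g (sigma (j * sgn n))\<close> over \<open>j = 1, ..., \<bar>n\<bar>\<close>.\<close>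

definition alternating_prod :: "('g, 'b) monoid_scheme \<Rightarrow> (int \<Rightarrow> 'g) \<Rightarrow> int \<Rightarrow> 'g" where
  "alternating_prod G g n = foldr (\<lambda>j x. g (sigma (j * sgn n)) \<otimes>\<^bsub>G\<^esub> x) [1..\<bar>n\<bar>] \<one>\<^bsub>G\<^esub>"

definition step_elem :: "('g, 'b) monoid_scheme \<Rightarrow> (int \<Rightarrow> 'g) \<Rightarrow> int \<Rightarrow> 'g" where
  "step_elem G g n =
    (if \<bar>n\<bar> = 1 then g n
     else if n < 0 then g n \<otimes>\<^bsub>G\<^esub> inv\<^bsub>G\<^esub> (g (n + 1))
     else g n \<otimes>\<^bsub>G\<^esub> inv\<^bsub>G\<^esub> (g (n - 1)))"

text \<open>
  \<open>c\<close> is a nontrivial class \<open>[h]\<close> such that \<open>[h\<^sub>n] = [h\<^sup>\<plusminus>\<^sup>1]\<close>, with sign that of \<open>n\<close>, for all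
  decompositions of \<open>\<gamma>\<close>.  All representatives \<open>h\<close> of \<open>c\<close> are required to satisfy this, as
  \<open>[h\<^sup>-\<^sup>1]\<close> is not determined by \<open>[h]\<close> for purely group-theoretic reasons.
\<close>

definition step_class ::
    "('g, 'b) monoid_scheme \<Rightarrow> ('g \<Rightarrow> 'm \<Rightarrow> 'm) \<Rightarrow> ('m::t2_space, 'e::euclidean_space) atlas
      \<Rightarrow> real set \<Rightarrow> (real \<Rightarrow> 'm) \<Rightarrow> 'g set \<Rightarrow> bool" where
  "step_class G \<phi> M D \<gamma> c \<longleftrightarrow>
    c \<in> curve_class G \<phi> D \<gamma> ` carrier G \<and> c \<noteq> curve_class G \<phi> D \<gamma> \<one>\<^bsub>G\<^esub> \<and>
    (\<forall>h \<in> c. \<forall>A n\<^sub>m n\<^sub>p a g. A_decomposition G \<phi> M D \<gamma> A n\<^sub>m n\<^sub>p a g \<longrightarrow>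
      (\<forall>n \<in> idx n\<^sub>m n\<^sub>p.
        curve_class G \<phi> D \<gamma> (step_elem G g n) = curve_class G \<phi> D \<gamma> (h [^]\<^bsub>G\<^esub> sgn n)))"

end

theory Submission
  imports Defs "HOL-Complex_Analysis.Complex_Analysis" "HOL-Real_Asymp.Real_Asymp"
begin

text \<open>
  Call \<open>R\<close> a displacement by \<open>g\<close> if \<open>\<phi> g \<circ> c = c \<circ> R\<close> for the analytic curve \<open>c\<close> on its maximal domain
  \<open>I\<close>. Analyticity continues a displacement until it leaves \<open>I\<close>, so an interval is free iff only
  elements of the stabilizer \<open>S\<close> displace one of its points to another. The action being sated, displacements
  cannot collapse intervals, and only finitely many classes modulo \<open>S\<close> displace a free interval into a
  compact one. Hence at the end \<open>b\<close> of a maximal free interval the obstruction to enlarging it is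
  attained: either by a decreasing displacement fixing \<open>b\<close> (a reflection) or by an increasing one
  carrying one end of the interval to the other (a translation). Translations have no fixed points and
  exclude reflections, which separates the positive from the negative curves; without compact
  maximal intervals only one reflection remains, and it gives the \<open>\<tau>\<close>-decomposition. Iterating the
  reflections or translations at the ends yields the pieces of a decomposition, which cannot accumulate
  by satedness; comparing displacements near a common end of two pieces determines their classes
  and orientations inductively. A translation slides a maximal interval along the whole curve.
\<close>

text \<open>The curve \<open>c\<close> need not be injective, and this shapes the proof: an element
  of \<open>S\<close> may displace points nontrivially (along a periodic curve even the identity
  does), so membership in \<open>S\<close> does not make \<open>R\<close> the identity. Inside a
  maximal interval this must be derived from the obstructions at its ends (\<open>inj_mx\<close>).
  Displacements are therefore treated like lifts to a covering: \<open>c\<close> is locally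
  injective, so the element and a single value determine them. Cosets of \<open>S\<close> cannot be
  multiplied freely, since \<open>S\<close> need not be normal; the calculus works because elements
  that displace the curve normalise \<open>S\<close>. A free interval may extend to an end of
  \<open>I\<close>, which is not a point of the curve, so a translation obstructing there is
  described by a limit (\<open>winc\<close>). In the arguments on order, analysis enters only
  through the assumptions of \<open>curve_orbit\<close>. To obtain these, power series in several
  real variables are composed with a curve and extended to a complex disc, where isolated zeros and
  inverse functions are facts on holomorphic functions. Statements on left neighbourhoods come from
  those on right ones by reversing the parameter.\<close>

abbreviation smono :: "'a::ord set => ('a => 'b::ord) => bool" where "smono A f \<equiv> strict_mono_on A f"
abbreviation santi :: "'a::ord set => ('a => 'b::ord) => bool" where "santi A f \<equiv> strict_antimono_on A f"

section \<open>Displacements of a curve along itself\<close>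

lemma ivl_sub: "[|is_interval K; x : K; y : K|] ==> {x..y} \<subseteq> K" for x y :: real
 unfolding is_interval_1 by (meson atLeastAtMost_iff subsetI)

text \<open>Between two points with equal values \<open>f\<close> would have an extremum in the open
  interval between them, whereas a continuous injective function is strictly monotone near every
  point.\<close>

lemma local_inj_imp_inj:
 fixes f :: "real => real"
 assumes cont: "continuous_on K f" and K: "is_interval K"
  and loc: "!!x. x : K ==> EX e>0. inj_on f (K \<inter> ball x e)"
 shows "inj_on f K"
proof -
 have "f x ~= f y" if xy: "x < y" "x : K" "y : K" for x y
 proof -
 have sub: "{x..y} \<subseteq> K" using ivl_sub[OF K] xy by blast
 have noext: False if z: "x < z" "z < y"
  and ext: "(ALL w:{x..y}. f w <= f z) | (ALL w:{x..y}. f z <= f w)" for z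
 proof -
  obtain e where e: "e > 0" "inj_on f (K \<inter> ball z e)" using loc[of z] z sub by (meson atLeastAtMost_iff less_imp_le subsetD)
  define d where "d = min (e/2) (min (z - x) (y - z))"
  have d: "d > 0" "d < e" "d <= z - x" "d <= y - z" using e z unfolding d_def by auto
  have s: "{z-d..z+d} \<subseteq> K \<inter> ball z e" 
  proof
   fix w assume "w : {z-d..z+d}"
   then have "x <= w" "w <= y" "\<bar>z - w\<bar> < e" using d by auto
   then show "w : K \<inter> ball z e" using sub by (auto simp: dist_real_def)
  qed
  have m: "(f (z-d) < f z & f z < f (z+d)) | (f (z+d) < f z & f z < f (z-d))"
  proof (rule continuous_inj_imp_mono[where f = f])
   show "continuous_on {z-d..z+d} f" using cont s continuous_on_subset by blast
   show "inj_on f {z-d..z+d}" using e s inj_on_subset by blast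
  qed (use d in auto)
  have "z - d : {x..y}" "z + d : {x..y}" using d z by auto
  then have "f (z-d) <= f z & f (z+d) <= f z | f z <= f (z-d) & f z <= f (z+d)" using ext by blast
  then show False using m by linarith
 qed
 show "f x ~= f y"
 proof
  assume eq: "f x = f y"
  have ne: "{x..y} ~= {}" using xy by auto
  have c': "continuous_on {x..y} f" using cont sub continuous_on_subset by blast
  obtain z1 where z1: "z1 : {x..y}" "ALL w:{x..y}. f w <= f z1"
   using continuous_attains_sup[OF compact_Icc ne c'] by blast
  obtain z2 where z2: "z2 : {x..y}" "ALL w:{x..y}. f z2 <= f w"
   using continuous_attains_inf[OF compact_Icc ne c'] by blast
  have "z1 : {x, y}"
  proof (rule ccontr)
   assume "z1 ~: {x, y}"
   then show False using noext[of z1] z1 by auto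
  qed
  then have e1: "f z1 = f x" using eq by auto
  have "z2 : {x, y}"
  proof (rule ccontr)
   assume "z2 ~: {x, y}"
   then show False using noext[of z2] z2 by auto
  qed
  then have e2: "f z2 = f x" using eq by auto
  \<comment> \<open>With both extrema at the ends, where the values agree, \<open>f\<close> is
    constant and the midpoint is an interior extremum.\<close>
  have "(x+y)/2 : {x..y}" using xy by auto
  then have "f ((x+y)/2) = f x" using z1(2) z2(2) e1 e2 by fastforce
  then have "ALL w:{x..y}. f w <= f ((x+y)/2)" using z1(2) e1 by simp
  moreover have "x < (x+y)/2" "(x+y)/2 < y" using xy by auto
  ultimately show False using noext[of "(x+y)/2"] by blast
 qed
 qed
 then show ?thesis by (metis inj_onI linorder_neqE_linordered_idom)
qed

text \<open>The sign of \<open>f b - f a\<close> is the same for all pairs with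
  \<open>a < b\<close>: ordered pairs form a convex set, and along the segment joining two of them
  the difference never vanishes.\<close>

lemma cont_inj_strict_mono:
 fixes f :: "real => real"
 assumes cont: "continuous_on K f" and K: "is_interval K" and inj: "inj_on f K"
 shows "smono K f | santi K f"
proof -
 have same: "(f a < f b) = (f x < f y)" if ab: "a < b" "a : K" "b : K" and xy: "x < y" "x : K" "y : K"
  for a b x y
 proof -
  define h where "h t = f ((1-t) * b + t * y) - f ((1-t) * a + t * x)" for t
  have in1: "(1-t) * u + t * v : K" if "t : {0..1}" "u : K" "v : K" for t u v
   using convexD_alt[of K u v t] K that by (auto simp: is_interval_convex_1)
  have ch: "continuous_on {0..1} h"
   unfolding h_def
   by (intro continuous_on_diff continuous_on_compose2[OF cont] continuous_intros)
    (use in1[OF _ ab(2) xy(2)] in1[OF _ ab(3) xy(3)] in blast)+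
  have nz: "h t ~= 0" if t: "t : {0..1}" for t
  proof -
   have "(1-t) * a + t * x < (1-t) * b + t * y"
   proof (cases "t = 0")
    case False
    have "(1-t) * a <= (1-t) * b" using t ab by (intro mult_left_mono) auto
    moreover have "t * x < t * y" using False t xy by auto
    ultimately show ?thesis by linarith
   qed (use ab in auto)
   then have "f ((1-t) * a + t * x) ~= f ((1-t) * b + t * y)"
    using inj_onD[OF inj _ in1[OF t ab(2) xy(2)] in1[OF t ab(3) xy(3)]] by (metis less_irrefl)
   then show ?thesis unfolding h_def by simp
  qed
  have "(h 0 > 0) = (h 1 > 0)"
  proof (rule ccontr)
   assume "(h 0 > 0) ~= (h 1 > 0)"
   then have "h 0 <= 0 & 0 <= h 1 | h 1 <= 0 & 0 <= h 0" by auto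
   then obtain t where "t : {0..1}" "h t = 0"
    using IVT'[of h 0 0 1] IVT2'[of h 1 0 0] ch by auto
   then show False using nz by blast
  qed
  then show ?thesis unfolding h_def by auto
 qed
 show ?thesis
 proof (cases "EX a b. a < b & a : K & b : K & f a < f b")
  case True
  then obtain a b where "a < b" "a : K" "b : K" "f a < f b" by blast
  then have "f x < f y" if "x < y" "x : K" "y : K" for x y
   using same[of a b x y] that by blast
  then show ?thesis by (auto simp: monotone_on_def)
 next
  case False
  have "f y < f x" if "x < y" "x : K" "y : K" for x y
   using False that inj_onD[OF inj, of x y] by (metis less_irrefl not_less_iff_gr_or_eq)
  then show ?thesis by (auto simp: monotone_on_def)
 qed
qed

text \<open>All of the theory of walls and chains rests on these properties; \<open>orbit\<close>
  derives them from analyticity and satedness. \<open>ident\<close> is the identity theorem for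
  \<open>\<phi> g \<circ> c\<close> and \<open>c\<close>. In \<open>ext\<close> the points
  \<open>x n\<close> differ from \<open>s\<close>, because an isolated coincidence of the two curves
  does not continue; the points \<open>y n\<close> may equal \<open>t\<close>.
  \<open>no_collapse\<close> is satedness.\<close>

locale curve_orbit = group_action G X \<phi>
 for G :: "'g monoid" (structure) and X :: "'m::t2_space set" and \<phi> :: "'g => 'm => 'm" +
 fixes I :: "real set" and c :: "real => 'm"
 assumes open_I: "open I" and interval_I: "is_interval I"
  and c_in: "c ` I \<subseteq> X" and cont_c: "continuous_on I c"
  and loc_inj: "t : I ==> EX e>0. inj_on c (I \<inter> ball t e)"
  and ident: "[|g : carrier G; t : I; t islimpt {s : I. \<phi> g (c s) = c s}; s : I|]
    ==> \<phi> g (c s) = c s"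
  and ext: "[|g : carrier G; s : I; t : I; !!n. x n : I - {s}; !!n. y n : I;
    x \<longlonglongrightarrow> s; y \<longlonglongrightarrow> t; !!n. \<phi> g (c (x n)) = c (y n)|]
    ==> EX e>0. EX R. ball s e \<subseteq> I & continuous_on (ball s e) R & R s = t &
       R ` ball s e \<subseteq> I & (ALL x:ball s e. \<phi> g (c x) = c (R x))"
  and no_collapse: "[|p : X; q : X; r : X; p ~= q; q ~= r; p ~= r; !!n. h n : carrier G;
    (%n. \<phi> (h n) q) \<longlonglongrightarrow> p; (%n. \<phi> (h n) r) \<longlonglongrightarrow> p|] ==> False"
begin

sublocale grp: group G
 by (rule group_hom.axioms(1)[OF group_hom])

abbreviation mI :: "real set" where "mI \<equiv> uminus ` I"
abbreviation mc :: "real => 'm" where "mc \<equiv> \<lambda>x. c (- x)"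

definition S :: "'g set" where
 "S = {g : carrier G. ALL t:I. \<phi> g (c t) = c t}"

definition dv :: "'g => real set => (real => real) => bool" where
 "dv g K R \<longleftrightarrow> g : carrier G & open K & is_interval K & K \<subseteq> I & continuous_on K R &
  R ` K \<subseteq> I & (ALL x:K. \<phi> g (c x) = c (R x))"

text \<open>Maximality is tested against displacements by the same element that share a single value
  with \<open>R\<close>; by uniqueness of lifts they agree with \<open>R\<close> on the whole
  overlap.\<close>

definition mdv :: "'g => real set => (real => real) => bool" where
 "mdv g K R \<longleftrightarrow> dv g K R & (ALL K' R'. dv g K' R' & (EX x:K \<inter> K'. R' x = R x) --> K' \<subseteq> K)"

lemma dvD:
 assumes "dv g K R"
 shows "g : carrier G" "open K" "is_interval K" "K \<subseteq> I" "continuous_on K R" "R ` K \<subseteq> I"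
  "x : K ==> x : I" "x : K ==> R x : I" "x : K ==> \<phi> g (c x) = c (R x)"
 using assms unfolding dv_def by auto

lemma mdvD: "mdv g K R ==> dv g K R"
 unfolding mdv_def by auto

lemma cX: "x : I ==> c x : X"
 using c_in by auto

lemma act_inj: "[|g : carrier G; x : X; y : X; \<phi> g x = \<phi> g y|] ==> x = y"
 using inj_prop inj_on_eq_iff by metis

lemma act_one: "x : X ==> \<phi> \<one> x = x"
 using id_eq_one by (metis restrict_apply')

lemma act_mult: "[|g : carrier G; h : carrier G; x : X|] ==> \<phi> (g \<otimes> h) x = \<phi> g (\<phi> h x)"
 using composition_rule by auto

lemma act_inv: "[|g : carrier G; x : X; \<phi> g x = y|] ==> \<phi> (inv g) y = x"
 using orbit_sym_aux by auto

lemma S_carrier: "g : S ==> g : carrier G"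
 unfolding S_def by auto

lemma S_act: "[|g : S; t : I|] ==> \<phi> g (c t) = c t"
 unfolding S_def by auto

lemma S_subgroup: "subgroup S G"
proof (rule grp.subgroupI)
 show "S \<subseteq> carrier G" unfolding S_def by auto
 have "\<one> : S" unfolding S_def using act_one cX by auto
 then show "S ~= {}" by auto
 show "inv a : S" if "a : S" for a
  using that act_inv cX unfolding S_def by auto
 show "a \<otimes> b : S" if "a : S" "b : S" for a b
  using that act_mult cX unfolding S_def by auto
qed

lemma S_one: "\<one> : S" and S_inv: "g : S ==> inv g : S"
 and S_mult: "[|g : S; h : S|] ==> g \<otimes> h : S"
 using S_subgroup subgroup.one_closed subgroup.m_inv_closed subgroup.m_closed by metis+

lemma S_open:
 assumes "g : carrier G" "open U" "U \<subseteq> I" "U ~= {}" "!!t. t : U ==> \<phi> g (c t) = c t"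
 shows "g : S"
proof -
 obtain t where t: "t : U" using assms by auto
 have "t islimpt U" using assms t open_imp_islimpt by blast
 then have "t islimpt {s : I. \<phi> g (c s) = c s}"
  by (rule islimpt_subset) (use assms in auto)
 then show ?thesis using ident[OF assms(1) _ ] t assms unfolding S_def by auto
qed

lemma S_cancel_right:
 assumes "g : carrier G" "h : carrier G" "inv g \<otimes> h : S" "h : S" shows "g : S"
proof -
 have "inv g = (inv g \<otimes> h) \<otimes> inv h" using assms by (simp add: grp.m_assoc)
 then have "inv g : S" using assms S_mult S_inv by metis
 then show ?thesis using S_inv assms by (metis grp.inv_inv)
qed

lemma S_cancel_left:
 assumes "g : carrier G" "h : carrier G" "inv g \<otimes> h : S" "g : S" shows "h : S"
proof -
 have "h = g \<otimes> (inv g \<otimes> h)" using assms by (simp add: grp.m_assoc[symmetric])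
 then show ?thesis using assms S_mult by metis
qed

lemma S_trans:
 assumes "g : carrier G" "h : carrier G" "k : carrier G" "inv g \<otimes> h : S" "inv h \<otimes> k : S"
 shows "inv g \<otimes> k : S"
proof -
 have "inv g \<otimes> k = (inv g \<otimes> h) \<otimes> (inv h \<otimes> k)"
  using assms by (simp add: grp.m_assoc) (simp add: grp.m_assoc[symmetric])
 then show ?thesis using assms S_mult by metis
qed

lemma S_same_act:
 assumes "g : carrier G" "h : carrier G" "inv g \<otimes> h : S" "t : I"
 shows "\<phi> h (c t) = \<phi> g (c t)"
proof -
 have "h = g \<otimes> (inv g \<otimes> h)" using assms by (simp add: grp.m_assoc[symmetric])
 then have "\<phi> h (c t) = \<phi> g (\<phi> (inv g \<otimes> h) (c t))" using act_mult assms cX by (metis S_carrier)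
 then show ?thesis using S_act assms by auto
qed

lemma S_class_iff:
 assumes "g : carrier G" "h : carrier G"
 shows "g <# S = h <# S \<longleftrightarrow> inv g \<otimes> h : S"
proof
 assume "g <# S = h <# S"
 then have "h : g <# S" using S_one assms unfolding l_coset_def by force
 then obtain q where "q : S" "h = g \<otimes> q" unfolding l_coset_def by auto
 then show "inv g \<otimes> h : S" using assms S_carrier by (simp add: grp.m_assoc[symmetric])
next
 assume a: "inv g \<otimes> h : S"
 have "h = g \<otimes> (inv g \<otimes> h)" using assms by (simp add: grp.m_assoc[symmetric])
 then have "h : g <# S" using a unfolding l_coset_def by auto
 then show "g <# S = h <# S" using grp.l_repr_independence assms S_subgroup by metis
qed

text \<open>As for lifts to a covering: \<open>c\<close> is locally injective, so the set where
  \<open>r\<close> and \<open>r'\<close> agree is open in \<open>K\<close>, and it is closed by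
  continuity.\<close>

lemma lift_unique:
 assumes K: "is_interval K" and r: "continuous_on K r" "r ` K \<subseteq> I"
  and r': "continuous_on K r'" "r' ` K \<subseteq> I"
  and eq: "!!x. x : K ==> c (r x) = c (r' x)" and x: "x : K" "r x = r' x" and y: "y : K"
 shows "r y = r' y"
proof -
 have "closedin (top_of_set K) {x : K. r x - r' x = 0}"
  using r r' by (intro continuous_closedin_preimage_constant continuous_intros)
 moreover have "openin (top_of_set K) {x : K. r x - r' x = 0}"
 proof (subst openin_contains_ball, intro conjI ballI)
  fix z assume z: "z : {x : K. r x - r' x = 0}"
  then have zK: "z : K" and rz: "r' z = r z" by auto
  obtain e where e: "e > 0" "inj_on c (I \<inter> ball (r z) e)" using loc_inj[of "r z"] r zK by auto
  obtain d1 where d1: "d1 > 0" "!!w. [|w : K; dist w z < d1|] ==> dist (r w) (r z) < e"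
   using r(1) zK e unfolding continuous_on_iff by meson
  obtain d2 where d2: "d2 > 0" "!!w. [|w : K; dist w z < d2|] ==> dist (r' w) (r z) < e"
   using r'(1) zK e rz unfolding continuous_on_iff by metis
  have "r w = r' w" if "w : K" "dist w z < min d1 d2" for w
  proof (rule inj_onD[OF e(2)])
   show "c (r w) = c (r' w)" using eq that by auto
   show "r w : I \<inter> ball (r z) e" "r' w : I \<inter> ball (r z) e"
    using d1(2)[of w] d2(2)[of w] that r r' by (auto simp: dist_commute)
  qed
  then have "ball z (min d1 d2) \<inter> K \<subseteq> {x : K. r x - r' x = 0}" by (auto simp: dist_commute)
  then show "EX e>0. ball z e \<inter> K \<subseteq> {x : K. r x - r' x = 0}"
   using d1(1) d2(1) by (metis min_less_iff_conj)
 qed auto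
 moreover have "connected K" using K by (simp add: is_interval_connected)
 ultimately have "{x : K. r x - r' x = 0} = {} | {x : K. r x - r' x = 0} = K"
  unfolding connected_clopen by blast
 then show ?thesis using x y by force
qed

text \<open>\<open>\<phi> g\<close> is injective and \<open>c\<close> locally so; hence
  \<open>R\<close> is locally injective, which is enough on an interval.\<close>

lemma dv_inj:
 assumes d: "dv g K R" shows "inj_on R K"
proof (rule local_inj_imp_inj)
 fix x assume x: "x : K"
 obtain e where e: "e > 0" "inj_on c (I \<inter> ball x e)" using loc_inj dvD(7)[OF d x] by auto
 have "inj_on R (K \<inter> ball x e)"
 proof (rule inj_onI)
  fix u v assume uv: "u : K \<inter> ball x e" "v : K \<inter> ball x e" "R u = R v"
  then have "\<phi> g (c u) = \<phi> g (c v)" using dvD(9)[OF d] by auto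
  then have "c u = c v" using act_inj[of g "c u" "c v"] cX dvD[OF d] uv by blast
  then show "u = v" using inj_onD[OF e(2)] uv dvD(4)[OF d] by blast
 qed
 then show "EX e>0. inj_on R (K \<inter> ball x e)" using e by auto
qed (use dvD[OF d] in auto)

lemma dv_mono:
 assumes "dv g K R" shows "smono K R | santi K R"
 using cont_inj_strict_mono dv_inj[OF assms] dvD[OF assms] by blast

lemma dv_restrict:
 assumes "dv g K R" "K' \<subseteq> K" "open K'" "is_interval K'" shows "dv g K' R"
 using assms continuous_on_subset unfolding dv_def by blast

lemma dv_comp:
 assumes d: "dv g K R" and d': "dv g' K' R'" and s: "R ` K \<subseteq> K'"
 shows "dv (g' \<otimes> g) K (R' \<circ> R)"
proof -
 have "continuous_on K (R' \<circ> R)"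
  using dvD[OF d] dvD[OF d'] s continuous_on_subset by (intro continuous_on_compose) auto
 moreover have "\<phi> (g' \<otimes> g) (c x) = c ((R' \<circ> R) x)" if "x : K" for x
  using act_mult[OF dvD(1)[OF d'] dvD(1)[OF d]] cX dvD(7,9)[OF d] dvD(9)[OF d'] s that by auto
 ultimately show ?thesis using dvD[OF d] dvD[OF d'] s unfolding dv_def by auto
qed

lemma dv_image:
 assumes d: "dv g K R" shows "open (R ` K)" "is_interval (R ` K)"
proof -
 show "is_interval (R ` K)"
  using dvD[OF d] connected_continuous_image is_interval_connected_1 by metis
 show "open (R ` K)"
  using dvD[OF d] dv_inj[OF d] invariance_of_domain by blast
qed

lemma dv_inverse:
 assumes d: "dv g K R" shows "dv (inv g) (R ` K) (inv_into K R)"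
proof -
 have "path_connected K" using dvD(3)[OF d] is_interval_path_connected by blast
 then obtain h where h: "homeomorphism K (R ` K) R h"
  using injective_into_1d_eq_homeomorphism[OF dvD(5)[OF d]] dv_inj[OF d] by blast
 have "continuous_on (R ` K) (inv_into K R) = continuous_on (R ` K) h"
  by (rule continuous_on_cong) (use h dv_inj[OF d] in \<open>auto simp: homeomorphism_def\<close>)
 then have cont: "continuous_on (R ` K) (inv_into K R)" using h by (auto simp: homeomorphism_def)
 have "\<phi> (inv g) (c y) = c (inv_into K R y)" if y: "y : R ` K" for y
 proof -
  obtain x where x: "x : K" "y = R x" using y by blast
  then show ?thesis using act_inv[OF dvD(1)[OF d] cX[OF dvD(7)[OF d x(1)]] dvD(9)[OF d x(1)]] dv_inj[OF d] by simp
 qed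
 moreover have "inv_into K R ` R ` K \<subseteq> I" using dvD[OF d] dv_inj[OF d] by force
 ultimately show ?thesis using dv_image[OF d] dvD[OF d] cont unfolding dv_def by auto
qed

text \<open>All members take the value \<open>y0\<close> at \<open>x0\<close>, so any two of them
  agree on their overlap by uniqueness of lifts and can be glued.\<close>

lemma dv_union:
 assumes F: "!!p. p : F ==> dv g (fst p) (snd p)"
  and x0: "!!p. p : F ==> x0 : fst p & snd p x0 = y0" and ne: "F ~= {}"
 shows "EX r. dv g (\<Union>p\<in>F. fst p) r & (ALL p:F. ALL x:fst p. r x = snd p x)"
proof -
 define K' where "K' = (\<Union>p\<in>F. fst p)"
 have agree: "snd p x = snd q x" if pq: "p : F" "q : F" and x: "x : fst p" "x : fst q" for p q x
 proof (rule lift_unique[of "fst p \<inter> fst q" "snd p" "snd q" x0])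
  note d1 = F[OF pq(1)] and d2 = F[OF pq(2)]
  show "is_interval (fst p \<inter> fst q)" using dvD(3)[OF d1] dvD(3)[OF d2] by (rule is_interval_Int)
  show "continuous_on (fst p \<inter> fst q) (snd p)" "continuous_on (fst p \<inter> fst q) (snd q)"
   using dvD(5)[OF d1] dvD(5)[OF d2] continuous_on_subset by blast+
  show "snd p ` (fst p \<inter> fst q) \<subseteq> I" "snd q ` (fst p \<inter> fst q) \<subseteq> I"
   using dvD(6)[OF d1] dvD(6)[OF d2] by auto
  show "c (snd p x) = c (snd q x)" if "x : fst p \<inter> fst q" for x
   using dvD(9)[OF d1] dvD(9)[OF d2] that by (metis IntE)
  show "x0 : fst p \<inter> fst q" "snd p x0 = snd q x0" using x0 pq by auto
 qed (use x in auto)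
 define r where "r x = snd (SOME p. p : F & x : fst p) x" for x
 have r: "r x = snd p x" if "p : F" "x : fst p" for p x
  unfolding r_def
 proof (rule someI2[of "%p. p : F & x : fst p" p])
  show "snd q x = snd p x" if "q : F & x : fst q" for q
   using agree[of q p x] that \<open>p : F\<close> \<open>x : fst p\<close> by blast
 qed (use that in blast)
 have "dv g K' r" unfolding dv_def
 proof (intro conjI)
  obtain p where "p : F" using ne by auto
  then show "g : carrier G" using dvD(1)[OF F] by blast
  show "open K'" unfolding K'_def using dvD(2)[OF F] by blast
  have "connected K'" unfolding K'_def
  proof (rule connected_Union)
   show "connected s" if "s : fst ` F" for s
    using that dvD(3)[OF F] by (auto simp: is_interval_connected)
   show "\<Inter> (fst ` F) ~= {}" using x0 by blast
  qed
  then show "is_interval K'" by (simp add: is_interval_connected_1)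
  show "K' \<subseteq> I" unfolding K'_def using dvD(4)[OF F] by blast
  show "continuous_on K' r" unfolding K'_def
  proof (rule continuous_on_open_UN)
   show "open (fst p)" if "p : F" for p using dvD(2)[OF F[OF that]] .
   show "continuous_on (fst p) r" if "p : F" for p
    using dvD(5)[OF F[OF that]] r[OF that] continuous_on_cong[OF refl, of "fst p" r "snd p"] by blast
  qed
  show "r ` K' \<subseteq> I"
  proof
   fix y assume "y : r ` K'"
   then obtain p x where "p : F" "x : fst p" "y = r x" unfolding K'_def by blast
   then show "y : I" using r dvD(8)[OF F] by simp
  qed
  show "ALL x:K'. \<phi> g (c x) = c (r x)"
  proof
   fix x assume "x : K'"
   then obtain p where "p : F" "x : fst p" unfolding K'_def by blast
   then show "\<phi> g (c x) = c (r x)" using r dvD(9)[OF F] by simp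
  qed
 qed
 then show ?thesis using r unfolding K'_def by blast
qed

lemma dv_maximal:
 assumes d: "dv g K R" and x0: "x0 : K"
 shows "EX K' R'. mdv g K' R' & K \<subseteq> K' & (ALL x:K. R' x = R x)"
proof -
 define F where "F = {p. dv g (fst p) (snd p) & x0 : fst p & snd p x0 = R x0}"
 have mem: "(K, R) : F" unfolding F_def using d x0 by auto
 have "EX r. dv g (\<Union>p\<in>F. fst p) r & (ALL p:F. ALL x:fst p. r x = snd p x)"
  by (rule dv_union[of F g x0 "R x0"]) (use mem in \<open>auto simp: F_def\<close>)
 then obtain r where r: "dv g (\<Union>p\<in>F. fst p) r" "ALL p:F. ALL x:fst p. r x = snd p x" by blast
 define L where "L = (\<Union>p\<in>F. fst p)"
 have L: "dv g L r" "K \<subseteq> L" using r mem unfolding L_def by force+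
 have rK: "r x = R x" if "x : K" for x using r(2) mem that by force
 have "K' \<subseteq> L" if d': "dv g K' R'" and x: "x : L" "x : K'" "R' x = r x" for K' R' x
 proof -
  \<comment> \<open>A displacement meeting \<open>r\<close> at some \<open>x\<close> is glued to it
    there; the result agrees with \<open>R\<close> at \<open>x0\<close> and so already belongs to
    \<open>F\<close>.\<close>
  define F2 where "F2 = {(L, r), (K', R')}"
  have "EX r2. dv g (\<Union>p\<in>F2. fst p) r2 & (ALL p:F2. ALL x:fst p. r2 x = snd p x)"
   by (rule dv_union[of F2 g x "r x"]) (use d' L x in \<open>auto simp: F2_def\<close>)
  then obtain r2 where r2: "dv g (L \<union> K') r2" "ALL y:L. r2 y = r y" unfolding F2_def by auto
  have "(L \<union> K', r2) : F" unfolding F_def using r2 x0 L(2) rK[OF x0] by auto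
  then show ?thesis unfolding L_def by force
 qed
 then have "mdv g L r" unfolding mdv_def using L(1) by auto
 then show ?thesis using L(2) rK by blast
qed

text \<open>A maximal displacement cannot stop inside a compact box: at a first missing point
  \<open>s\<close> the values would accumulate in \<open>{p..q}\<close>, and \<open>ext\<close>
  would continue the displacement across \<open>s\<close>. So, followed from \<open>x0\<close> to
  the right, it lasts until \<open>x1\<close> is reached or the value arrives at an end of the
  box.\<close>

lemma box_right:
 assumes m: "mdv g K R" and x0: "x0 : K" and x1: "x1 : I" "x0 <= x1"
  and pq: "{p..q} \<subseteq> I" "p <= R x0" "R x0 <= q"
 shows "EX x:K. x0 <= x & x <= x1 & R ` {x0..x} \<subseteq> {p..q} & (x = x1 | R x = p | R x = q)"
proof -
 note d = mdvD[OF m]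
 define E where "E = {x : K. x0 <= x & x <= x1 & R ` {x0..x} \<subseteq> {p..q}}"
 have x0E: "x0 : E" unfolding E_def using x0 x1 pq by auto
 have bdd: "bdd_above E" unfolding E_def by (rule bdd_aboveI[of _ x1]) auto
 define s where "s = Sup E"
 have s0: "x0 <= s" unfolding s_def by (rule cSup_upper[OF x0E bdd])
 have s1: "s <= x1" unfolding s_def by (rule cSup_least) (use x0E in \<open>auto simp: E_def\<close>)
 note s = s0 s1
 have sI: "s : I" using ivl_sub[OF interval_I dvD(7)[OF d x0] x1(1)] s by auto
 have below: "x : K & R x : {p..q}" if x: "x0 <= x" "x < s" for x
 proof -
  have "EX e:E. x < e" using x(2) less_cSup_iff[OF _ bdd] x0E unfolding s_def by blast
  then obtain e where e: "e : E" "x < e" by blast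
  then have eK: "e : K" "R ` {x0..e} \<subseteq> {p..q}" unfolding E_def by blast+
  have "x : {x0..e}" using x e by simp
  then show ?thesis using ivl_sub[OF dvD(3)[OF d] x0 eK(1)] eK(2) by blast
 qed
 have sK: "s : K"
 proof (rule ccontr)
  assume "s ~: K"
  then have lt: "x0 < s" using s x0 by (cases "x0 = s") auto
  \<comment> \<open>A sequence tending to \<open>s\<close> from below, inside the part already
    covered; its values have a convergent subsequence in the box.\<close>
  define x where "x n = s - (s - x0) / real (n + 2)" for n
  have x: "x0 <= x n" "x n < s" for n
   unfolding x_def using lt mult_right_mono[of x0 s "real n"] by (auto simp: field_simps)
  have xs: "x \<longlonglongrightarrow> s" unfolding x_def by real_asymp
  have "seq_compact {p..q}" by (simp add: compact_imp_seq_compact)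
  moreover have "ALL n. (%n. R (x n)) n : {p..q}" using below[OF x] by blast
  ultimately obtain t f where t: "t : {p..q}" "strict_mono f" "((%n. R (x n)) \<circ> f) \<longlonglongrightarrow> t"
   by (rule seq_compactE)
  have tI: "t : I" using t pq by auto
  have xfs: "(x \<circ> f) \<longlonglongrightarrow> s" using xs t(2) LIMSEQ_subseq_LIMSEQ by blast
  have "EX e>0. EX r. ball s e \<subseteq> I & continuous_on (ball s e) r & r s = t &
       r ` ball s e \<subseteq> I & (ALL x:ball s e. \<phi> g (c x) = c (r x))"
  proof (rule ext[of g s t "x \<circ> f" "(%n. R (x n)) \<circ> f"])
   have xK: "x (f n) : K" for n using below[OF x] by blast
   show "(x \<circ> f) n : I - {s}" for n using x(2)[of "f n"] dvD(7)[OF d xK[of n]] by simp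
   show "((%n. R (x n)) \<circ> f) n : I" for n using dvD(8)[OF d xK[of n]] by simp
   show "\<phi> g (c ((x \<circ> f) n)) = c (((%n. R (x n)) \<circ> f) n)" for n
    using dvD(9)[OF d xK[of n]] by simp
  qed (fact dvD(1)[OF d] sI tI xfs t(3))+
  then obtain e r where e: "e > 0" "ball s e \<subseteq> I" "continuous_on (ball s e) r" "r s = t"
   "r ` ball s e \<subseteq> I" "!!x. x : ball s e ==> \<phi> g (c x) = c (r x)" by blast
  have dr: "dv g (ball s e) r" unfolding dv_def using e dvD(1)[OF d] by (auto simp: is_interval_ball_real)
  \<comment> \<open>The continuation \<open>r\<close> is compared with \<open>R\<close> at one point
    so close to \<open>s\<close> that both values lie in a ball where \<open>c\<close> is injective;
    maximality of \<open>K\<close> then absorbs the ball around \<open>s\<close>.\<close>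
  obtain w where w: "w > 0" "inj_on c (I \<inter> ball t w)" using loc_inj[OF tI] by auto
  have "isCont r s" using e by (simp add: continuous_on_eq_continuous_at)
  then have "(%n. r ((x \<circ> f) n)) \<longlonglongrightarrow> t" using xfs e(4) isCont_tendsto_compose by blast
  then have "\<forall>\<^sub>F n in sequentially. dist (r ((x \<circ> f) n)) t < w" using w tendstoD by blast
  moreover have "\<forall>\<^sub>F n in sequentially. dist (((%n. R (x n)) \<circ> f) n) t < w" using w t tendstoD by blast
  moreover have "\<forall>\<^sub>F n in sequentially. dist ((x \<circ> f) n) s < e" using e xfs tendstoD by blast
  ultimately have "\<forall>\<^sub>F n in sequentially. dist (r ((x \<circ> f) n)) t < w &
   dist (((%n. R (x n)) \<circ> f) n) t < w & dist ((x \<circ> f) n) s < e" by eventually_elim auto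
  then obtain n where n: "dist (r ((x \<circ> f) n)) t < w" "dist (((%n. R (x n)) \<circ> f) n) t < w" "dist ((x \<circ> f) n) s < e"
   using eventually_happens'[OF sequentially_bot] by blast
  define z where "z = x (f n)"
  have zb: "z : ball s e" using n unfolding z_def by (auto simp: dist_commute)
  have zK: "z : K" using below[OF x] unfolding z_def by blast
  have "c (r z) = c (R z)" using e(6)[OF zb] dvD(9)[OF d zK] by auto
  moreover have "r z : I" using e(5) zb by blast
  ultimately have "r z = R z"
   using inj_onD[OF w(2), of "r z" "R z"] n e(5) zb dvD(8)[OF d zK]
   unfolding z_def by (auto simp: dist_commute)
  then have "ball s e \<subseteq> K" using m dr zb zK unfolding mdv_def by blast
  then show False using \<open>s ~: K\<close> e(1) centre_in_ball by blast
 qed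
 have icK: "isCont R s" using dvD(2,5)[OF d] sK by (simp add: continuous_on_eq_continuous_at)
 have rs: "R s : {p..q}"
 proof (cases "x0 = s")
  case False
  then have lt: "x0 < s" using s by auto
  have "(R \<longlongrightarrow> R s) (at_left s)" using icK by (simp add: isCont_def filterlim_at_split)
  moreover have "\<forall>\<^sub>F x in at_left s. R x : {p..q}"
   using eventually_at_left_real[OF lt] by eventually_elim (use below[OF less_imp_le] in force)
  ultimately show ?thesis by (intro Lim_in_closed_set[of "{p..q}" R "at_left s" "R s"]) simp_all
 qed (use pq in auto)
 have im: "R ` {x0..s} \<subseteq> {p..q}"
 proof
  fix y assume "y : R ` {x0..s}"
  then obtain x where "x0 <= x" "x <= s" "y = R x" by auto
  then show "y : {p..q}" using below[of x] rs by (cases "x = s") simp_all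
 qed
 \<comment> \<open>If none of the three stops holds at \<open>s\<close>, the box condition persists
   a little beyond, against the choice of the supremum.\<close>
 have "s = x1 | R s = p | R s = q"
 proof (rule ccontr)
  assume n: "~ ?thesis"
  then have "R s : {p<..<q}" "s < x1" using rs s by auto
  then have "\<forall>\<^sub>F x in at s. R x : {p<..<q} & x : K"
   using icK dvD(2)[OF d] sK unfolding isCont_def
   by (intro eventually_conj topological_tendstoD) (auto simp: eventually_at_in_open')
  then obtain e where e: "e > 0" "!!x. [|x ~= s; dist x s < e|] ==> R x : {p<..<q} & x : K"
   unfolding eventually_at by auto
  define z where "z = min x1 (s + e/2)"
  have z: "s < z" "z <= x1" "dist z s < e" unfolding z_def using \<open>s < x1\<close> e by (auto simp: dist_real_def)
  have "R ` {x0..z} \<subseteq> {p..q}"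
  proof
   fix y assume "y : R ` {x0..z}"
   then obtain x where x: "x0 <= x" "x <= z" "y = R x" by auto
   show "y : {p..q}"
   proof (cases "x <= s")
    case True then show ?thesis using im x by force
   next
    case False
    then have "dist x s < e" using x z by (auto simp: dist_real_def)
    then show ?thesis using e(2)[of x] False x by auto
   qed
  qed
  then have "z : E" unfolding E_def using e(2)[of z] z s by auto
  then show False using cSup_upper[OF _ bdd] z unfolding s_def by fastforce
 qed
 then show ?thesis using sK s im by auto
qed

section \<open>Germs of displacements and their calculus\<close>

definition lnk :: "'g => real => real => bool" where
 "lnk g s t \<longleftrightarrow> (EX K R. dv g K R & s : K & R s = t)"

definition inc :: "'g => real => real => bool" where
 "inc g s t \<longleftrightarrow> (EX K R. dv g K R & smono K R & s : K & R s = t)"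

definition dec :: "'g => real => real => bool" where
 "dec g s t \<longleftrightarrow> (EX K R. dv g K R & santi K R & s : K & R s = t)"

text \<open>Freeness in terms of germs between points; by \<open>free_segment_iff\<close> a curve on
  \<open>A\<close> is a free segment exactly if the interior of \<open>A\<close> has this
  property.\<close>

definition fr :: "real set => bool" where
 "fr U \<longleftrightarrow> (ALL g s t. s : U --> t : U --> lnk g s t --> g : S)"

lemma frD: "[|fr U; s : U; t : U; lnk g s t|] ==> g : S"
 unfolding fr_def by blast

lemma fr_mono: "[|fr U; V \<subseteq> U|] ==> fr V"
 unfolding fr_def by blast

lemma lnk_cases: "lnk g s t ==> inc g s t | dec g s t"
 unfolding lnk_def inc_def dec_def using dv_mono by blast

lemma inc_lnk: "inc g s t ==> lnk g s t"
 unfolding lnk_def inc_def by blast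

lemma dec_lnk: "dec g s t ==> lnk g s t"
 unfolding lnk_def dec_def by blast

lemma lnkD:
 assumes "lnk g s t" shows "g : carrier G" "s : I" "t : I" "\<phi> g (c s) = c t"
proof -
 obtain K R where "dv g K R" "s : K" "R s = t" using assms unfolding lnk_def by blast
 then show "g : carrier G" "s : I" "t : I" "\<phi> g (c s) = c t" unfolding dv_def by auto
qed

lemma dv_local:
 assumes d: "dv g K R" and s: "s : K" and V: "open V" "R s : V"
 shows "EX e>0. ball s e \<subseteq> K & R ` ball s e \<subseteq> V"
proof -
 have "open (K \<inter> R -` V)" using continuous_open_preimage[OF dvD(5)[OF d] dvD(2)[OF d] V(1)] .
 then obtain e where "e > 0" "ball s e \<subseteq> K \<inter> R -` V" using s V open_contains_ball by blast
 then show ?thesis by auto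
qed

lemma ball_ivl: "is_interval (ball s e)" for s :: real
 by (simp add: is_interval_ball_real)

lemma dv_S: assumes "q : S" shows "dv q I (%x. x)"
 using assms open_I interval_I unfolding dv_def S_def by auto

lemma comp_aux:
 assumes d: "dv g K R" "s : K" and d': "dv h K' R'" "R s : K'"
 shows "\<exists>L\<subseteq>K. dv (h \<otimes> g) L (R' \<circ> R) & s : L & R ` L \<subseteq> K'"
proof -
 obtain e where e: "e > 0" "ball s e \<subseteq> K" "R ` ball s e \<subseteq> K'"
  using dv_local[OF d dvD(2)[OF d'(1)] d'(2)] by blast
 have "dv g (ball s e) R" using dv_restrict[OF d(1) e(2)] ball_ivl by blast
 then have "dv (h \<otimes> g) (ball s e) (R' \<circ> R)" using dv_comp d' e by blast
 then show ?thesis using e by (intro exI[of _ "ball s e"]) auto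
qed

lemma mono_comp_aux:
 fixes R R' :: "real => real"
 assumes "L \<subseteq> K" "R ` L \<subseteq> K'"
 shows "[|smono K R; smono K' R'|] ==> smono L (R' \<circ> R)"
  "[|smono K R; santi K' R'|] ==> santi L (R' \<circ> R)"
  "[|santi K R; smono K' R'|] ==> santi L (R' \<circ> R)"
  "[|santi K R; santi K' R'|] ==> smono L (R' \<circ> R)"
 using assms unfolding monotone_on_def by (auto simp: image_subset_iff subset_iff)

lemma inc_inc: assumes "inc g s t" "inc h t u" shows "inc (h \<otimes> g) s u"
proof -
 obtain K R where 1: "dv g K R" "smono K R" "s : K" "R s = t" using assms unfolding inc_def by blast
 obtain K' R' where 2: "dv h K' R'" "smono K' R'" "t : K'" "R' t = u" using assms unfolding inc_def by blast
 obtain L where L: "L \<subseteq> K" "dv (h \<otimes> g) L (R' \<circ> R)" "s : L" "R ` L \<subseteq> K'"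
  using comp_aux[OF 1(1,3) 2(1)] 1 2 by blast
 show ?thesis unfolding inc_def using L(2,3) mono_comp_aux(1)[OF L(1,4) 1(2) 2(2)] 1(4) 2(4)
  by (intro exI[of _ L] exI[of _ "R' \<circ> R"]) auto
qed

lemma inc_dec: assumes "inc g s t" "dec h t u" shows "dec (h \<otimes> g) s u"
proof -
 obtain K R where 1: "dv g K R" "smono K R" "s : K" "R s = t" using assms unfolding inc_def by blast
 obtain K' R' where 2: "dv h K' R'" "santi K' R'" "t : K'" "R' t = u" using assms unfolding dec_def by blast
 obtain L where L: "L \<subseteq> K" "dv (h \<otimes> g) L (R' \<circ> R)" "s : L" "R ` L \<subseteq> K'"
  using comp_aux[OF 1(1,3) 2(1)] 1 2 by blast
 show ?thesis unfolding dec_def using L(2,3) mono_comp_aux(2)[OF L(1,4) 1(2) 2(2)] 1(4) 2(4)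
  by (intro exI[of _ L] exI[of _ "R' \<circ> R"]) auto
qed

lemma dec_inc: assumes "dec g s t" "inc h t u" shows "dec (h \<otimes> g) s u"
proof -
 obtain K R where 1: "dv g K R" "santi K R" "s : K" "R s = t" using assms unfolding dec_def by blast
 obtain K' R' where 2: "dv h K' R'" "smono K' R'" "t : K'" "R' t = u" using assms unfolding inc_def by blast
 obtain L where L: "L \<subseteq> K" "dv (h \<otimes> g) L (R' \<circ> R)" "s : L" "R ` L \<subseteq> K'"
  using comp_aux[OF 1(1,3) 2(1)] 1 2 by blast
 show ?thesis unfolding dec_def using L(2,3) mono_comp_aux(3)[OF L(1,4) 1(2) 2(2)] 1(4) 2(4)
  by (intro exI[of _ L] exI[of _ "R' \<circ> R"]) auto
qed

lemma dec_dec: assumes "dec g s t" "dec h t u" shows "inc (h \<otimes> g) s u"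
proof -
 obtain K R where 1: "dv g K R" "santi K R" "s : K" "R s = t" using assms unfolding dec_def by blast
 obtain K' R' where 2: "dv h K' R'" "santi K' R'" "t : K'" "R' t = u" using assms unfolding dec_def by blast
 obtain L where L: "L \<subseteq> K" "dv (h \<otimes> g) L (R' \<circ> R)" "s : L" "R ` L \<subseteq> K'"
  using comp_aux[OF 1(1,3) 2(1)] 1 2 by blast
 show ?thesis unfolding inc_def using L(2,3) mono_comp_aux(4)[OF L(1,4) 1(2) 2(2)] 1(4) 2(4)
  by (intro exI[of _ L] exI[of _ "R' \<circ> R"]) auto
qed

lemma lnk_lnk: "[|lnk g s t; lnk h t u|] ==> lnk (h \<otimes> g) s u"
 using lnk_cases inc_inc inc_dec dec_inc dec_dec inc_lnk dec_lnk by metis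

lemma inv_into_strict_mono:
 fixes R :: "real => real"
 assumes "smono K R" shows "smono (R ` K) (inv_into K R)"
proof (rule monotone_onI)
 fix x y assume "x : R ` K" "y : R ` K" "x < y"
 then obtain u v where uv: "u : K" "v : K" "x = R u" "y = R v" by blast
 have inj: "inj_on R K" using assms strict_mono_on_imp_inj_on by blast
 have "u < v"
 proof (rule ccontr)
  assume "~ u < v"
  then have "R v <= R u" using assms uv unfolding monotone_on_def by (metis linorder_neqE_linordered_idom less_imp_le order_refl)
  then show False using \<open>x < y\<close> uv by simp
 qed
 then show "inv_into K R x < inv_into K R y" using uv inj by simp
qed

lemma inv_into_strict_antimono:
 fixes R :: "real => real"
 assumes "santi K R" "inj_on R K" shows "santi (R ` K) (inv_into K R)"
proof (rule monotone_onI)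
 fix x y assume "x : R ` K" "y : R ` K" "x < y"
 then obtain u v where uv: "u : K" "v : K" "x = R u" "y = R v" by blast
 have "v < u"
 proof (rule ccontr)
  assume "~ v < u"
  then have "R v <= R u" using assms(1) uv unfolding monotone_on_def by (metis linorder_neqE_linordered_idom less_imp_le order_refl)
  then show False using \<open>x < y\<close> uv by simp
 qed
 then show "inv_into K R y < inv_into K R x" using uv assms(2) by simp
qed

lemma inc_inv: assumes "inc g s t" shows "inc (inv g) t s"
proof -
 obtain K R where 1: "dv g K R" "smono K R" "s : K" "R s = t" using assms unfolding inc_def by blast
 show ?thesis unfolding inc_def
  using dv_inverse[OF 1(1)] inv_into_strict_mono[OF 1(2)] dv_inj[OF 1(1)] 1(3,4)
  by (intro exI[of _ "R ` K"] exI[of _ "inv_into K R"]) auto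
qed

lemma dec_inv: assumes "dec g s t" shows "dec (inv g) t s"
proof -
 obtain K R where 1: "dv g K R" "santi K R" "s : K" "R s = t" using assms unfolding dec_def by blast
 show ?thesis unfolding dec_def
  using dv_inverse[OF 1(1)] inv_into_strict_antimono[OF 1(2) dv_inj[OF 1(1)]] dv_inj[OF 1(1)] 1(3,4)
  by (intro exI[of _ "R ` K"] exI[of _ "inv_into K R"]) auto
qed

lemma lnk_inv: "lnk g s t ==> lnk (inv g) t s"
 using lnk_cases inc_inv dec_inv inc_lnk dec_lnk by metis

text \<open>This and its three variants move a displacement from an end of an interval to a nearby
  pair on prescribed sides, where freeness of the interior applies.\<close>

lemma inc_right:
 assumes "inc g s t" "e > 0"
 shows "EX s' t'. s < s' & s' < s + e & t < t' & t' < t + e & inc g s' t'"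
proof -
 obtain K R where 1: "dv g K R" "smono K R" "s : K" "R s = t" using assms unfolding inc_def by blast
 obtain d where d: "d > 0" "ball s d \<subseteq> K" "R ` ball s d \<subseteq> ball t e"
  using dv_local[OF 1(1,3) open_ball, of t e] assms(2) 1(4) by auto
 define s' where "s' = s + min d e / 2"
 have s': "s < s'" "s' < s + e" "s' : ball s d" using d assms(2) unfolding s'_def by (auto simp: dist_real_def)
 then have K: "s' : K" and "R s' : ball t e" using d by blast+
 moreover have "t < R s'" using 1 s' K unfolding monotone_on_def by blast
 ultimately show ?thesis using s' 1 K unfolding inc_def by (intro exI[of _ s'] exI[of _ "R s'"]) (auto simp: dist_real_def)
qed

lemma inc_left:
 assumes "inc g s t" "e > 0"
 shows "EX s' t'. s - e < s' & s' < s & t - e < t' & t' < t & inc g s' t'"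
proof -
 obtain K R where 1: "dv g K R" "smono K R" "s : K" "R s = t" using assms unfolding inc_def by blast
 obtain d where d: "d > 0" "ball s d \<subseteq> K" "R ` ball s d \<subseteq> ball t e"
  using dv_local[OF 1(1,3) open_ball, of t e] assms(2) 1(4) by auto
 define s' where "s' = s - min d e / 2"
 have s': "s' < s" "s - e < s'" "s' : ball s d" using d assms(2) unfolding s'_def by (auto simp: dist_real_def)
 then have K: "s' : K" and "R s' : ball t e" using d by blast+
 moreover have "R s' < t" using 1 s' K unfolding monotone_on_def by blast
 ultimately show ?thesis using s' 1 K unfolding inc_def by (intro exI[of _ s'] exI[of _ "R s'"]) (auto simp: dist_real_def)
qed

lemma dec_right:
 assumes "dec g s t" "e > 0"
 shows "EX s' t'. s < s' & s' < s + e & t - e < t' & t' < t & dec g s' t'"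
proof -
 obtain K R where 1: "dv g K R" "santi K R" "s : K" "R s = t" using assms unfolding dec_def by blast
 obtain d where d: "d > 0" "ball s d \<subseteq> K" "R ` ball s d \<subseteq> ball t e"
  using dv_local[OF 1(1,3) open_ball, of t e] assms(2) 1(4) by auto
 define s' where "s' = s + min d e / 2"
 have s': "s < s'" "s' < s + e" "s' : ball s d" using d assms(2) unfolding s'_def by (auto simp: dist_real_def)
 then have K: "s' : K" and "R s' : ball t e" using d by blast+
 moreover have "R s' < t" using 1 s' K unfolding monotone_on_def by blast
 ultimately show ?thesis using s' 1 K unfolding dec_def by (intro exI[of _ s'] exI[of _ "R s'"]) (auto simp: dist_real_def)
qed

lemma dec_left:
 assumes "dec g s t" "e > 0"
 shows "EX s' t'. s - e < s' & s' < s & t < t' & t' < t + e & dec g s' t'"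
proof -
 obtain K R where 1: "dv g K R" "santi K R" "s : K" "R s = t" using assms unfolding dec_def by blast
 obtain d where d: "d > 0" "ball s d \<subseteq> K" "R ` ball s d \<subseteq> ball t e"
  using dv_local[OF 1(1,3) open_ball, of t e] assms(2) 1(4) by auto
 define s' where "s' = s - min d e / 2"
 have s': "s' < s" "s - e < s'" "s' : ball s d" using d assms(2) unfolding s'_def by (auto simp: dist_real_def)
 then have K: "s' : K" and "R s' : ball t e" using d by blast+
 moreover have "t < R s'" using 1 s' K unfolding monotone_on_def by blast
 ultimately show ?thesis using s' 1 K unfolding dec_def by (intro exI[of _ s'] exI[of _ "R s'"]) (auto simp: dist_real_def)
qed

lemma open_two: fixes K :: "real set" assumes "open K" "s : K" shows "EX x:K. s < x"
proof -
 obtain e where "e > 0" "ball s e \<subseteq> K" using assms open_contains_ball by blast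
 moreover have "s + e/2 : ball s e" using \<open>e > 0\<close> by (auto simp: dist_real_def)
 ultimately show ?thesis by (intro bexI[of _ "s + e/2"]) auto
qed

text \<open>A displacement is strictly monotone on its whole domain, so two points of the small
  domain decide the orientation of the maximal extension.\<close>

lemma inc_mdv:
 assumes "inc g s t" shows "EX K R. mdv g K R & smono K R & s : K & R s = t"
proof -
 obtain K R where 1: "dv g K R" "smono K R" "s : K" "R s = t" using assms unfolding inc_def by blast
 obtain K' R' where 2: "mdv g K' R'" "K \<subseteq> K'" "ALL x:K. R' x = R x" using dv_maximal[OF 1(1,3)] by blast
 obtain x where x: "x : K" "s < x" using open_two dvD(2)[OF 1(1)] 1(3) by blast
 have lt: "R' s < R' x" using 1(2,3) x 2(3) unfolding monotone_on_def by auto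
 have "~ santi K' R'"
 proof
  assume "santi K' R'"
  then have "R' x < R' s" using x 1(3) 2(2) unfolding monotone_on_def by blast
  then show False using lt by simp
 qed
 then have "smono K' R'" using dv_mono[OF mdvD[OF 2(1)]] by blast
 then show ?thesis using 1 2 by (intro exI[of _ K'] exI[of _ R']) auto
qed

lemma dec_mdv:
 assumes "dec g s t" shows "EX K R. mdv g K R & santi K R & s : K & R s = t"
proof -
 obtain K R where 1: "dv g K R" "santi K R" "s : K" "R s = t" using assms unfolding dec_def by blast
 obtain K' R' where 2: "mdv g K' R'" "K \<subseteq> K'" "ALL x:K. R' x = R x" using dv_maximal[OF 1(1,3)] by blast
 obtain x where x: "x : K" "s < x" using open_two dvD(2)[OF 1(1)] 1(3) by blast
 have lt: "R' x < R' s" using 1(2,3) x 2(3) unfolding monotone_on_def by auto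
 have "~ smono K' R'"
 proof
  assume "smono K' R'"
  then have "R' s < R' x" using x 1(3) 2(2) unfolding monotone_on_def by blast
  then show False using lt by simp
 qed
 then have "santi K' R'" using dv_mono[OF mdvD[OF 2(1)]] by blast
 then show ?thesis using 1 2 by (intro exI[of _ K'] exI[of _ R']) auto
qed

section \<open>Fixed points of displacements\<close>

lemma I_right: "t : I ==> d > 0 ==> EX q:I. t < q & q < t + d"
proof -
 assume t: "t : I" "d > 0"
 then obtain e where e: "e > 0" "ball t e \<subseteq> I" using open_I open_contains_ball by blast
 then have "t + min e d / 2 : I" using t by (auto simp: dist_real_def subset_iff)
 then show ?thesis using e t by (intro bexI[of _ "t + min e d / 2"]) auto
qed

text \<open>Followed to the right from \<open>s\<close>, a decreasing displacement starts on or
  above the diagonal and gets on or below it, either at \<open>t\<close> or where its value is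
  \<open>s\<close>; in between it meets the diagonal.\<close>

lemma dec_fix_aux:
 assumes "dec g s t" "s <= t" shows "EX \<tau>. s <= \<tau> & \<tau> <= t & dec g \<tau> \<tau>"
proof -
 obtain K R where m: "mdv g K R" "santi K R" "s : K" "R s = t" using dec_mdv[OF assms(1)] by blast
 note d = mdvD[OF m(1)]
 have I: "s : I" "t : I" using lnkD[OF dec_lnk[OF assms(1)]] by auto
 \<comment> \<open>Room above \<open>t\<close>, so that a decreasing map starting with the value
   \<open>t\<close> never leaves the box at the top.\<close>
 obtain q where q: "q : I" "t < q" using I_right[OF I(2), of 1] by auto
 have "EX x:K. s <= x & x <= t & R ` {s..x} \<subseteq> {s..q} & (x = t | R x = s | R x = q)"
  by (rule box_right[OF m(1,3) I(2) assms(2) ivl_sub[OF interval_I I(1) q(1)]]) (use m(4) q assms in auto)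
 then obtain x where x: "x : K" "s <= x" "x <= t" "x = t | R x = s | R x = q" by blast
 have le: "R x <= t" using m x unfolding monotone_on_def by (cases "x = s") force+
 have xle: "R x <= x" using x le q by auto
 have sub: "{s..x} \<subseteq> K" using ivl_sub[OF dvD(3)[OF d] m(3) x(1)] .
 have cont: "continuous_on {s..x} (%x. R x - x)"
  using continuous_on_subset[OF dvD(5)[OF d] sub] by (intro continuous_intros)
 obtain \<tau> where \<tau>: "s <= \<tau>" "\<tau> <= x" "R \<tau> - \<tau> = 0"
  using IVT2'[of "%x. R x - x" x 0 s] cont x xle m(4) assms(2) by auto
 have "dec g \<tau> \<tau>" unfolding dec_def using d m(2) \<tau> sub by (intro exI[of _ K] exI[of _ R]) auto
 then show ?thesis using \<tau> x by (intro exI[of _ \<tau>]) auto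
qed

lemma dec_fix:
 assumes "dec g s t" shows "EX \<tau>. min s t <= \<tau> & \<tau> <= max s t & dec g \<tau> \<tau>"
proof (cases "s <= t")
 case True
 then show ?thesis using dec_fix_aux[OF assms True] by auto
next
 case False
 then obtain \<tau> where \<tau>: "t <= \<tau>" "\<tau> <= s" "dec (inv g) \<tau> \<tau>" using dec_fix_aux[OF dec_inv[OF assms]] by auto
 then have "dec g \<tau> \<tau>" using dec_inv[OF \<tau>(3)] lnkD(1)[OF dec_lnk[OF assms]] by simp
 then show ?thesis using \<tau> by auto
qed

text \<open>Near its fixed point a decreasing displacement by an element of \<open>S\<close> and the
  identity are two lifts of \<open>c\<close> with a common value, so they would coincide.\<close>

lemma no_dec_S: assumes "q : S" "dec q s t" shows False
proof -
 obtain \<tau> where "dec q \<tau> \<tau>" using dec_fix[OF assms(2)] by blast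
 then obtain K R where m: "dv q K R" "santi K R" "\<tau> : K" "R \<tau> = \<tau>" unfolding dec_def by blast
 obtain x where x: "x : K" "\<tau> < x" using open_two dvD(2)[OF m(1)] m(3) by blast
 have "R x = x"
 proof (rule lift_unique[of K R "%x. x" \<tau>])
  show "c (R y) = c y" if "y : K" for y
   using S_act[OF assms(1) dvD(7)[OF m(1) that]] dvD(9)[OF m(1) that] by simp
  show "(%x. x) ` K \<subseteq> I" using dvD(4)[OF m(1)] by simp
 qed (use dvD(3,5,6)[OF m(1)] m x in simp_all)
 moreover have "R x < R \<tau>" using m x unfolding monotone_on_def by blast
 ultimately show False using m x by simp
qed

text \<open>Satedness speaks of three different points, one of them the limit. Near a point of
  \<open>U\<close> the curve passes through three different points; at most one of them is
  \<open>c z\<close>, and two others remain.\<close>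

lemma collapse:
 assumes U: "open U" "U \<subseteq> I" "U ~= {}" and g: "!!n::nat. g n : carrier G" and z: "z : I"
  and lim: "!!u. u : U ==> (%n. \<phi> (g n) (c u)) \<longlonglongrightarrow> c z"
 shows False
proof -
 obtain u where u: "u : U" using U by auto
 obtain e where e: "e > 0" "inj_on c (I \<inter> ball u e)" using loc_inj u U by blast
 obtain d where d: "d > 0" "ball u d \<subseteq> U" using U u open_contains_ball by blast
 define r where "r = min d e / 2"
 have r: "r > 0" "r < d" "r < e" using d e unfolding r_def by auto
 have mem: "u + r : U" "u - r : U" "u + r : ball u e" "u - r : ball u e" "u : ball u e"
  using d r e by (auto simp: dist_real_def subset_iff)
 have "inj_on c {u, u + r, u - r}" using e(2) by (rule inj_on_subset) (use mem u U in auto)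
 then have ne: "c u ~= c (u+r)" "c u ~= c (u-r)" "c (u+r) ~= c (u-r)"
  using r unfolding inj_on_def by auto
 have X: "c z : X" "c u : X" "c (u+r) : X" "c (u-r) : X" using cX z u mem U by auto
 have l: "(%n. \<phi> (g n) (c u)) \<longlonglongrightarrow> c z" "(%n. \<phi> (g n) (c (u+r))) \<longlonglongrightarrow> c z"
  "(%n. \<phi> (g n) (c (u-r))) \<longlonglongrightarrow> c z" using lim u mem by auto
 consider "c z = c u" | "c z = c (u+r)" | "c z ~= c u" "c z ~= c (u+r)" by blast
 then show False
 proof cases
  case 1
  show False by (rule no_collapse[OF X(1,3,4) _ _ _ g l(2,3)]) (use 1 ne in auto)
 next
  case 2
  show False by (rule no_collapse[OF X(1,2,4) _ _ _ g l(1,3)]) (use 2 ne in auto)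
 next
  case 3
  show False by (rule no_collapse[OF X(1,2,3) _ _ _ g l(1,2)]) (use 3 ne in auto)
 qed
qed

lemma cont_lim: assumes "f \<longlonglongrightarrow> z" "z : I" "!!n. f n : I" shows "(%n. c (f n)) \<longlonglongrightarrow> c z"
proof -
 have "isCont c z" using cont_c open_I assms(2) by (simp add: continuous_on_eq_continuous_at)
 then show ?thesis using assms(1) by (rule isCont_tendsto_compose)
qed

text \<open>Under iteration of \<open>R\<close> every point just right of \<open>s\<close> decreases
  to a fixed point, which can only be \<open>s\<close>; thus the powers of \<open>g\<close> collapse
  a right neighbourhood of \<open>s\<close> onto \<open>c s\<close>.\<close>

lemma inc_fix_aux:
 assumes d: "dv g K R" and m: "smono K R" and s: "s : K" "R s = s" and e: "e > 0"
  and lt: "!!x. [|s < x; x < s + e|] ==> x : K & R x < x"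
 shows False
proof -
 have gG: "g : carrier G" by (rule dvD(1)[OF d])
 have stay: "s < R x & R x < s + e" if x: "s < x" "x < s + e" for x
 proof -
  have "R s < R x" using m s lt[OF x] x unfolding monotone_on_def by blast
  then show ?thesis using s lt[OF x] x by linarith
 qed
 have it: "s < (R ^^ n) x & (R ^^ n) x < s + e" if x: "s < x" "x < s + e" for x n
  by (induction n) (use x stay in auto)
 have act: "\<phi> (g [^] n) (c x) = c ((R ^^ n) x)" if x: "s < x" "x < s + e" for x and n :: nat
  using x
 proof (induction n arbitrary: x)
  case 0
  have "x : I" using lt[OF 0] dvD(7)[OF d] by blast
  then show ?case using act_one cX by simp
 next
  case (Suc n)
  have xK: "x : K" using lt[OF Suc.prems] by blast
  have "\<phi> (g [^] Suc n) (c x) = \<phi> (g [^] n) (\<phi> g (c x))"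
   using act_mult[of "g [^] n" g "c x"] gG cX dvD(7)[OF d xK] by simp
  also have "\<dots> = \<phi> (g [^] n) (c (R x))" using dvD(9)[OF d xK] by simp
  also have "\<dots> = c ((R ^^ n) (R x))" using Suc.IH stay[OF Suc.prems] by blast
  also have "(R ^^ n) (R x) = (R ^^ Suc n) x" by (simp add: funpow_swap1)
  finally show ?case .
 qed
 have sI: "s : I" by (rule dvD(7)[OF d s(1)])
 show False
 proof (rule collapse[of "{s<..<s+e}" "%n. g [^] n" s])
  show "{s<..<s+e} \<subseteq> I" using lt dvD(7)[OF d] by auto
  show "{s<..<s+e} ~= {}" using e by simp
  show "(%n. \<phi> (g [^] n) (c u)) \<longlonglongrightarrow> c s" if "u : {s<..<s+e}" for u
  proof -
   have u: "s < u" "u < s + e" using that by auto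
   define f where "f n = (R ^^ n) u" for n
   have fs: "s < f n" "f n < s + e" for n using it[OF u] unfolding f_def by auto
   have fS: "f (Suc n) = R (f n)" for n unfolding f_def by simp
   have "decseq f" using lt[OF fs] fS by (intro decseq_SucI) (metis less_imp_le)
   then obtain l where l: "f \<longlonglongrightarrow> l" "!!i. l <= f i"
    using decseq_convergent[of f s] fs by (metis less_imp_le)
   have ls: "s <= l" using LIMSEQ_le_const[OF l(1), of s] fs by (meson less_imp_le)
   have le: "l < s + e" using l(2)[of 0] fs(2)[of 0] by linarith
   have lK: "l : K" using ls le lt[of l] s by (cases "l = s") auto
   have "isCont R l" using dvD(2,5)[OF d] lK by (simp add: continuous_on_eq_continuous_at)
   then have "(%n. R (f n)) \<longlonglongrightarrow> R l" using l(1) isCont_tendsto_compose by blast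
   moreover have "(%n. R (f n)) \<longlonglongrightarrow> l" using LIMSEQ_Suc[OF l(1)] fS by simp
   ultimately have "R l = l" using LIMSEQ_unique by blast
   then have "l = s" using ls le lt[of l] by force
   then have "(%n. c (f n)) \<longlonglongrightarrow> c s" using l(1) sI fs lt dvD(7)[OF d] by (intro cont_lim) auto
   then show ?thesis using act[OF u] unfolding f_def by simp
  qed
 qed (use sI gG in auto)
qed

text \<open>Outside \<open>S\<close> fixed points are isolated by the identity theorem, so
  \<open>R\<close> moves the points just right of \<open>s\<close> all in one direction, and the
  powers of \<open>g\<close> or of its inverse would collapse them.\<close>

lemma inc_fix: assumes "inc g s s" shows "g : S"
proof (rule ccontr)
 assume nS: "g ~: S"
 obtain K R where d: "dv g K R" "smono K R" "s : K" "R s = s" using assms unfolding inc_def by blast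
 have gG: "g : carrier G" and sI: "s : I" using dvD(1,7)[OF d(1)] d(3) by auto
 have "~ s islimpt {x : I. \<phi> g (c x) = c x}"
  using ident[OF gG sI] nS gG unfolding S_def by blast
 then obtain e1 where e1: "e1 > 0" "!!x. [|x : I; \<phi> g (c x) = c x; x ~= s|] ==> ~ dist x s < e1"
  unfolding islimpt_approachable by blast
 obtain e2 where e2: "e2 > 0" "ball s e2 \<subseteq> K" using dvD(2)[OF d(1)] d(3) open_contains_ball by blast
 define e where "e = min e1 e2"
 have e: "e > 0" using e1 e2 unfolding e_def by simp
 have inK: "x : K" if "s < x" "x < s + e" for x
  using that e2 unfolding e_def by (auto simp: dist_real_def subset_iff)
 have nf: "R x ~= x" if "s < x" "x < s + e" for x
  using e1(2)[of x] dvD(7,9)[OF d(1) inK[OF that]] that unfolding e_def by (auto simp: dist_real_def)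
 have cs: "(ALL x. s < x & x < s + e --> R x < x) | (ALL x. s < x & x < s + e --> x < R x)"
 proof (rule ccontr)
  assume "~ ?thesis"
  then obtain u v where uv: "s < u" "u < s + e" "s < v" "v < s + e" "u < R u" "R v < v"
   using nf by (metis linorder_neqE_linordered_idom)
  have cont: "continuous_on {s<..<s+e} (%x. R x - x)"
   using dvD(5)[OF d(1)] inK by (intro continuous_intros) (auto intro: continuous_on_subset)
  have "connected ((%x. R x - x) ` {s<..<s+e})" using connected_continuous_image[OF cont] by simp
  then have "0 : (%x. R x - x) ` {s<..<s+e}"
   using connectedD_interval[of "(%x. R x - x) ` {s<..<s+e}" "R v - v" "R u - u" 0] uv by auto
  then show False using nf by force
 qed
 then show False
 proof
  assume "ALL x. s < x & x < s + e --> R x < x"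
  then show False using inc_fix_aux[OF d e] inK by blast
 next
  assume up: "ALL x. s < x & x < s + e --> x < R x"
  \<comment> \<open>Points move away from \<open>s\<close> under \<open>R\<close>, hence towards it
    under the inverse displacement.\<close>
  define \<sigma> where "\<sigma> = inv_into K R"
  have inj: "inj_on R K" by (rule dv_inj[OF d(1)])
  have d': "dv (inv g) (R ` K) \<sigma>" unfolding \<sigma>_def by (rule dv_inverse[OF d(1)])
  have m': "smono (R ` K) \<sigma>" unfolding \<sigma>_def by (rule inv_into_strict_mono[OF d(2)])
  have s': "s : R ` K" "\<sigma> s = s" unfolding \<sigma>_def using d(3,4) inj inv_into_f_f by (force, metis)
  obtain e' where e': "e' > 0" "ball s e' \<subseteq> R ` K" "\<sigma> ` ball s e' \<subseteq> ball s e"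
   using dv_local[OF d' s'(1) open_ball, of s e] s'(2) e by auto
  show False
  proof (rule inc_fix_aux[OF d' m' s' e'(1)])
   fix y assume y: "s < y" "y < s + e'"
   then have yb: "y : ball s e'" by (auto simp: dist_real_def)
   have yK: "y : R ` K" using e'(2) yb by blast
   have 1: "\<sigma> y : ball s e" using e'(3) yb by blast
   have 2: "s < \<sigma> y" using m' s' yK y unfolding monotone_on_def by metis
   have "R (\<sigma> y) = y" unfolding \<sigma>_def using f_inv_into_f[OF yK] .
   moreover have "\<sigma> y < s + e" using 1 2 by (auto simp: dist_real_def)
   ultimately show "y : R ` K & \<sigma> y < y" using up 2 yK by metis
  qed
 qed
qed

text \<open>A fixed point would put \<open>g\<close> into \<open>S\<close>, and then
  \<open>R\<close> and the identity would be lifts agreeing there, against \<open>s < R s\<close>.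
  So the sign of \<open>R x - x\<close> cannot change.\<close>

lemma no_fix_up:
 assumes d: "dv g K R" and m: "smono K R" and s: "s : K" "s < R s" and x: "x : K"
 shows "x < R x"
proof (rule ccontr)
 assume n: "~ x < R x"
 have "continuous_on K (%x. R x - x)" using dvD(5)[OF d] by (intro continuous_intros)
 then have "connected ((%x. R x - x) ` K)"
  using connected_continuous_image is_interval_connected[OF dvD(3)[OF d]] by blast
 then have "0 : (%x. R x - x) ` K"
  using connectedD_interval[of "(%x. R x - x) ` K" "R x - x" "R s - s" 0] s x n by auto
 then obtain z where z: "z : K" "R z = z" by auto
 then have gS: "g : S" using inc_fix d m unfolding inc_def by blast
 have "R s = s"
 proof (rule lift_unique[of K R "%x. x" z])
  show "c (R y) = c y" if "y : K" for y
   using S_act[OF gS dvD(7)[OF d that]] dvD(9)[OF d that] by simp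
  show "(%x. x) ` K \<subseteq> I" using dvD(4)[OF d] by simp
 qed (use dvD(3,5,6)[OF d] z s in simp_all)
 then show False using s by simp
qed

text \<open>\<open>q\<close> fixes the curve at the displaced points \<open>R x\<close>, so the
  conjugate fixes it on the open set \<open>K\<close>, hence everywhere. This replaces normality of
  \<open>S\<close>.\<close>

lemma norm_S: assumes "lnk g s t" "q : S" shows "inv g \<otimes> q \<otimes> g : S"
proof -
 obtain K R where d: "dv g K R" "s : K" using assms(1) unfolding lnk_def by blast
 have gG: "g : carrier G" and qG: "q : carrier G" using dvD(1)[OF d(1)] S_carrier assms by auto
 have "\<phi> (inv g \<otimes> q \<otimes> g) (c x) = c x" if x: "x : K" for x
 proof -
  have X: "c x : X" "c (R x) : X" using cX dvD(7,8)[OF d(1) x] by auto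
  have "\<phi> (inv g \<otimes> q \<otimes> g) (c x) = \<phi> (inv g) (\<phi> q (c (R x)))"
   using act_mult[of "inv g \<otimes> q" g] act_mult[of "inv g" q] gG qG X dvD(9)[OF d(1) x] by simp
  also have "\<dots> = c x"
   using S_act[OF assms(2) dvD(8)[OF d(1) x]] act_inv[OF gG X(1) dvD(9)[OF d(1) x]] by simp
  finally show ?thesis .
 qed
 then show ?thesis using S_open[of "inv g \<otimes> q \<otimes> g" K] dvD(2,4)[OF d(1)] d(2) gG qG by blast
qed

lemma norm_S': assumes "lnk g s t" "q : S" shows "g \<otimes> q \<otimes> inv g : S"
 using norm_S[OF lnk_inv[OF assms(1)] assms(2)] lnkD(1)[OF assms(1)] by simp

text \<open>The basic uniqueness principle: \<open>inv h \<otimes> g\<close> displaces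
  \<open>s\<close> to \<open>s'\<close> within the free set \<open>U\<close>.\<close>

lemma fr_class: "[|fr U; lnk g s t; lnk h s' t; s : U; s' : U|] ==> inv h \<otimes> g : S"
 using lnk_lnk[OF _ lnk_inv] frD by blast

section \<open>Reversal of the parameter\<close>

lemma mirror: "curve_orbit G X \<phi> mI mc"
proof unfold_locales
 have mem: "x : uminus ` I \<longleftrightarrow> - x : I" for x by force
 show "open (uminus ` I)" using open_I open_negations by blast
 show "is_interval (uminus ` I)" using interval_I by simp
 show "(%x. c (- x)) ` uminus ` I \<subseteq> X" using c_in by auto
 show "continuous_on mI mc"
 proof (rule continuous_on_compose2[OF cont_c])
  show "continuous_on (uminus ` I) (%x. - x)" by (rule continuous_on_minus[OF continuous_on_id])
  show "(%x. - x) ` uminus ` I \<subseteq> I" by (simp add: image_image)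
 qed
 show "EX e>0. inj_on (%x. c (- x)) (uminus ` I \<inter> ball t e)" if t: "t : uminus ` I" for t
 proof -
  obtain e where e: "e > 0" "inj_on c (I \<inter> ball (- t) e)" using loc_inj[OF t[unfolded mem]] by blast
  have "inj_on (%x. c (- x)) (uminus ` I \<inter> ball t e)"
  proof (rule inj_onI)
   fix x y assume xy: "x : uminus ` I \<inter> ball t e" "y : uminus ` I \<inter> ball t e" "c (- x) = c (- y)"
   then have "- x : I \<inter> ball (- t) e" "- y : I \<inter> ball (- t) e" using mem by (auto simp: dist_real_def)
   then have "- x = - y" using inj_onD[OF e(2) xy(3)] by blast
   then show "x = y" by simp
  qed
  then show ?thesis using e by blast
 qed
 show "\<phi> g (c (- s)) = c (- s)"
  if g: "g : carrier G" "t : uminus ` I" "t islimpt {s : uminus ` I. \<phi> g (c (- s)) = c (- s)}" "s : uminus ` I" for g t s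
 proof -
  have "- t islimpt {s : I. \<phi> g (c s) = c s}"
   unfolding islimpt_approachable
  proof (intro allI impI)
   fix e :: real assume "e > 0"
   then obtain x where x: "x : {s : uminus ` I. \<phi> g (c (- s)) = c (- s)}" "x ~= t" "dist x t < e"
    using g(3) unfolding islimpt_approachable by blast
   then show "EX x':{s : I. \<phi> g (c s) = c s}. x' ~= - t & dist x' (- t) < e"
    using mem by (intro bexI[of _ "- x"]) (auto simp: dist_real_def)
  qed
  then show ?thesis using ident[OF g(1) g(2)[unfolded mem] _ g(4)[unfolded mem]] by blast
 qed
 show "EX e>0. EX R. ball s e \<subseteq> uminus ` I & continuous_on (ball s e) R & R s = t &
     R ` ball s e \<subseteq> uminus ` I & (ALL x:ball s e. \<phi> g (c (- x)) = c (- R x))"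
  if g: "g : carrier G" "s : uminus ` I" "t : uminus ` I" "!!n. x n : uminus ` I - {s}"
   "!!n. y n : uminus ` I" "x \<longlonglongrightarrow> s" "y \<longlonglongrightarrow> t" "!!n. \<phi> g (c (- x n)) = c (- y n)" for g s t x y
 proof -
  have "EX e>0. EX R. ball (-s) e \<subseteq> I & continuous_on (ball (-s) e) R & R (-s) = -t &
     R ` ball (-s) e \<subseteq> I & (ALL x:ball (-s) e. \<phi> g (c x) = c (R x))"
  proof (rule ext[of g "-s" "-t" "%n. - x n" "%n. - y n"])
   show "- x n : I - {- s}" for n using g(4)[of n] mem by auto
   show "- y n : I" for n using g(5)[of n] mem by auto
   show "(%n. - x n) \<longlonglongrightarrow> - s" "(%n. - y n) \<longlonglongrightarrow> - t" using g(6,7) by (auto intro: tendsto_minus)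
  qed (use g mem in auto)
  then obtain e R where e: "e > 0" "ball (-s) e \<subseteq> I" "continuous_on (ball (-s) e) R" "R (-s) = -t"
   "R ` ball (-s) e \<subseteq> I" "ALL x:ball (-s) e. \<phi> g (c x) = c (R x)" by blast
  have b: "x : ball s e \<longleftrightarrow> - x : ball (-s) e" for x by (auto simp: dist_real_def)
  have "continuous_on (ball s e) (%x. R (- x))"
   by (rule continuous_on_compose2[OF e(3) continuous_on_minus[OF continuous_on_id]]) (use b in blast)
  then have "continuous_on (ball s e) (%x. - R (- x))" by (rule continuous_on_minus)
  moreover have "ball s e \<subseteq> uminus ` I" using e(2) b mem by (simp add: subset_iff)
  moreover have "(%x. - R (- x)) ` ball s e \<subseteq> uminus ` I" using e(5) b by blast
  ultimately show ?thesis using e b by (intro exI[of _ e] exI[of _ "%x. - R (- x)"]) auto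
 qed
qed (use no_collapse in blast)

lemma mirror_S: "curve_orbit.S G \<phi> mI mc = S"
proof -
 interpret m: curve_orbit G X \<phi> mI mc by (rule mirror)
 show ?thesis unfolding m.S_def S_def by force
qed

text \<open>Argument and value both change sign, so increasing displacements stay increasing and
  only left and right are exchanged; the element stays the same.\<close>

lemma mirror_dv_imp:
 assumes "dv g K R"
 shows "curve_orbit.dv G \<phi> mI mc g (uminus ` K) (%x. - R (- x))"
proof -
 interpret m: curve_orbit G X \<phi> mI mc by (rule mirror)
 have "continuous_on (uminus ` K) (%x. - R (- x))"
  using dvD(5)[OF assms] by (intro continuous_on_minus continuous_on_compose2[OF dvD(5)[OF assms]] continuous_intros) auto
 then show ?thesis
  using assms unfolding m.dv_def dv_def by (auto simp: open_negations)
qed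

text \<open>Reversal is an involution, so the converse is the same implication for the reversed
  curve.\<close>

lemma mirror_dv:
 "curve_orbit.dv G \<phi> mI mc g K R \<longleftrightarrow> dv g (uminus ` K) (%x. - R (- x))"
proof -
 interpret m: curve_orbit G X \<phi> mI mc by (rule mirror)
 have "m.dv g K R" if "dv g (uminus ` K) (%x. - R (- x))"
  using mirror_dv_imp[OF that] by (simp add: image_image)
 moreover have "dv g (uminus ` K) (%x. - R (- x))" if "m.dv g K R"
  using m.mirror_dv_imp[OF that] by (simp add: image_image)
 ultimately show ?thesis by blast
qed

lemma mirror_lnk_imp:
 assumes "lnk g s t" shows "curve_orbit.lnk G \<phi> mI mc g (- s) (- t)"
proof -
 interpret m: curve_orbit G X \<phi> mI mc by (rule mirror)
 show ?thesis using assms mirror_dv_imp unfolding lnk_def m.lnk_def by force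
qed

lemma mono_neg:
 fixes R :: "real => real"
 shows "smono K R ==> smono (uminus ` K) (%x. - R (- x))"
  "santi K R ==> santi (uminus ` K) (%x. - R (- x))"
 unfolding monotone_on_def by auto

lemma mirror_inc_imp:
 assumes "inc g s t" shows "curve_orbit.inc G \<phi> mI mc g (- s) (- t)"
proof -
 interpret m: curve_orbit G X \<phi> mI mc by (rule mirror)
 obtain K R where "dv g K R" "smono K R" "s : K" "R s = t" using assms unfolding inc_def by blast
 then show ?thesis unfolding m.inc_def using mirror_dv_imp mono_neg(1)
  by (intro exI[of _ "uminus ` K"] exI[of _ "%x. - R (- x)"]) auto
qed

lemma mirror_dec_imp:
 assumes "dec g s t" shows "curve_orbit.dec G \<phi> mI mc g (- s) (- t)"
proof -
 interpret m: curve_orbit G X \<phi> mI mc by (rule mirror)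
 obtain K R where "dv g K R" "santi K R" "s : K" "R s = t" using assms unfolding dec_def by blast
 then show ?thesis unfolding m.dec_def using mirror_dv_imp mono_neg(2)
  by (intro exI[of _ "uminus ` K"] exI[of _ "%x. - R (- x)"]) auto
qed

lemma mirror_lnk: "curve_orbit.lnk G \<phi> mI mc g s t \<longleftrightarrow> lnk g (- s) (- t)"
proof -
 interpret m: curve_orbit G X \<phi> mI mc by (rule mirror)
 show ?thesis using mirror_lnk_imp[of g "-s" "-t"] m.mirror_lnk_imp[of g s t] by (auto simp: image_image)
qed

lemma mirror_inc: "curve_orbit.inc G \<phi> mI mc g s t \<longleftrightarrow> inc g (- s) (- t)"
proof -
 interpret m: curve_orbit G X \<phi> mI mc by (rule mirror)
 show ?thesis using mirror_inc_imp[of g "-s" "-t"] m.mirror_inc_imp[of g s t] by (auto simp: image_image)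
qed

lemma mirror_dec: "curve_orbit.dec G \<phi> mI mc g s t \<longleftrightarrow> dec g (- s) (- t)"
proof -
 interpret m: curve_orbit G X \<phi> mI mc by (rule mirror)
 show ?thesis using mirror_dec_imp[of g "-s" "-t"] m.mirror_dec_imp[of g s t] by (auto simp: image_image)
qed

lemma mirror_fr: "curve_orbit.fr G \<phi> mI mc U \<longleftrightarrow> fr (uminus ` U)"
proof -
 interpret m: curve_orbit G X \<phi> mI mc by (rule mirror)
 show ?thesis unfolding m.fr_def fr_def mirror_S mirror_lnk by force
qed

lemma mirror_mdv:
 assumes "mdv g K R"
 shows "curve_orbit.mdv G \<phi> mI mc g (uminus ` K) (%x. - R (- x))"
proof -
 interpret m: curve_orbit G X \<phi> mI mc by (rule mirror)
 have "K' \<subseteq> uminus ` K" if d: "m.dv g K' R'" and x: "x : uminus ` K" "x : K'" "R' x = - R (- x)" for K' R' x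
 proof -
  have "dv g (uminus ` K') (%x. - R' (- x))" using d mirror_dv by blast
  moreover have "- x : K \<inter> uminus ` K'" "- R' (- (- x)) = R (- x)" using x by auto
  ultimately have "uminus ` K' \<subseteq> K" using assms unfolding mdv_def by blast
  then show ?thesis by force
 qed
 then show ?thesis unfolding m.mdv_def using mirror_dv_imp[OF mdvD[OF assms]] by blast
qed

lemma box_left:
 assumes m: "mdv g K R" and x0: "x0 : K" and x1: "x1 : I" "x1 <= x0"
  and pq: "{p..q} \<subseteq> I" "p <= R x0" "R x0 <= q"
 shows "EX x:K. x1 <= x & x <= x0 & R ` {x..x0} \<subseteq> {p..q} & (x = x1 | R x = p | R x = q)"
proof -
 interpret m: curve_orbit G X \<phi> mI mc by (rule mirror)
 have "EX x:uminus ` K. - x0 <= x & x <= - x1 & (%x. - R (- x)) ` {- x0..x} \<subseteq> {- q.. - p} &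
   (x = - x1 | - R (- x) = - q | - R (- x) = - p)"
 proof (rule m.box_right[OF mirror_mdv[OF m]])
  show "{- q.. - p} \<subseteq> uminus ` I"
  proof
   fix x assume "x : {- q.. - p}"
   then have "- x : I" using pq(1) by auto
   then show "x : uminus ` I" by force
  qed
 qed (use assms in auto)
 then obtain x where x: "x : K" "x1 <= x" "x <= x0" "(%x. - R (- x)) ` {- x0..- x} \<subseteq> {- q.. - p}"
   "x = x1 | R x = q | R x = p" by auto
 have "R ` {x..x0} \<subseteq> {p..q}"
 proof
  fix y assume "y : R ` {x..x0}"
  then obtain z where z: "x <= z" "z <= x0" "y = R z" by auto
  then have "- R (- (- z)) : {- q.. - p}" using x(4) by (metis atLeastAtMost_iff image_subset_iff neg_le_iff_le)
  then show "y : {p..q}" using z by auto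
 qed
 then show ?thesis using x by blast
qed

section \<open>Walls of free intervals\<close>

text \<open>The part of \<open>I\<close> between \<open>a\<close> and a wall at \<open>b\<close>.
  The lower end is an extended real because a free interval may be unbounded below.\<close>

definition lft :: "ereal => real => real set" where
 "lft a b = {x : I. a < ereal x & x < b}"

lemma ereal_room: "a < ereal x ==> EX e>0. a < ereal (x - e)"
proof (cases a)
 case (real r)
 assume "a < ereal x"
 then show ?thesis using real by (intro exI[of _ "(x - r)/2"]) (auto simp: field_simps)
qed (auto intro: exI[of _ 1])

lemma lft_lower: "[|x : lft a b; x <= y; y < b; y : I|] ==> y : lft a b"
 unfolding lft_def by (auto intro: less_le_trans)

lemma lft_I: "lft a b \<subseteq> I"
 unfolding lft_def by auto

lemma lft_open: "open (lft a b)"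
proof -
 have "lft a b = I \<inter> {x. a < ereal x} \<inter> {..<b}" unfolding lft_def by auto
 moreover have "open {x. a < ereal x}"
 proof (cases a)
  case (real r)
  then have "{x. a < ereal x} = {r<..}" by auto
  then show ?thesis by simp
 qed simp_all
 ultimately show ?thesis using open_I by (simp add: open_Int)
qed

lemma lft_interval: "is_interval (lft a b)"
 unfolding is_interval_1
proof (intro ballI allI impI)
 fix x y z assume "x : lft a b" "z : lft a b" "x <= y & y <= z"
 then show "y : lft a b" using ivl_sub[OF interval_I, of x z] unfolding lft_def
  by (auto intro: less_le_trans)
qed

text \<open>Points slightly below \<open>x\<close> would go to points slightly below
  \<open>b\<close>, so the displacement would act within the free set.\<close>

lemma sweep_aux:
 assumes f: "fr (lft a b)" and i: "inc g x b" and n: "g ~: S" and x: "a < ereal x" "x < b"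
 shows False
proof -
 obtain e where e: "e > 0" "a < ereal (x - e)" using ereal_room[OF x(1)] by blast
 obtain s t where st: "x - e < s" "s < x" "b - e < t" "t < b" "inc g s t"
  using inc_left[OF i e(1)] by blast
 have "s : I" "t : I" using lnkD[OF inc_lnk[OF st(5)]] by auto
 moreover have "a < ereal s" by (rule less_trans[OF e(2)]) (use st in simp)
 moreover have "a < ereal t" by (rule less_trans[OF e(2)]) (use st x in simp)
 ultimately have "s : lft a b" "t : lft a b" using st x unfolding lft_def by auto
 then show False using frD[OF f _ _ inc_lnk[OF st(5)]] n by blast
qed

text \<open>Followed to the left from \<open>s\<close>, the values of an increasing displacement
  decrease from \<open>t\<close>, and by \<open>sweep_aux\<close> they cannot come down to
  \<open>b\<close>. They never leave the box \<open>{b..q}\<close>, so all points of the free set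
  left of \<open>s\<close> are carried beyond \<open>b\<close>.\<close>

lemma sweep:
 assumes f: "fr (lft a b)" and i: "inc g s t" and n: "g ~: S" and st: "s < t" "b <= t" and s: "a < ereal s"
  and b: "b : I"
 shows "EX K R. mdv g K R & smono K R & s : K & R s = t &
  (ALL u:lft a b. u <= s --> u : K & b < R u & R u <= t)"
proof -
 obtain K R where m: "mdv g K R" "smono K R" "s : K" "R s = t" using inc_mdv[OF i] by blast
 note d = mdvD[OF m(1)]
 have up: "x < R x" if "x : K" for x using no_fix_up[OF d m(2,3) _ that] m(4) st by simp
 have nb: "R x ~= b" if x: "x : K" "a < ereal x" for x
 proof
  assume e: "R x = b"
  then have "inc g x b" using d m(2) x unfolding inc_def by blast
  then show False using sweep_aux[OF f _ n x(2)] up[OF x(1)] e by simp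
 qed
 have tI: "t : I" using lnkD[OF inc_lnk[OF i]] by simp
 obtain q where q: "q : I" "t < q" using I_right[OF tI, of 1] by auto
 have "u : K & b < R u & R u <= t" if u: "u : lft a b" "u <= s" for u
 proof -
  have uI: "u : I" "a < ereal u" "u < b" using u unfolding lft_def by auto
  have "EX x:K. u <= x & x <= s & R ` {x..s} \<subseteq> {b..q} & (x = u | R x = b | R x = q)"
   by (rule box_left[OF m(1,3) uI(1) u(2) ivl_sub[OF interval_I b q(1)]]) (use m(4) st q in auto)
  then obtain x where x: "x : K" "u <= x" "x <= s" "R ` {x..s} \<subseteq> {b..q}" "x = u | R x = b | R x = q" by blast
  have le: "R x <= t" using m(2,3,4) x(1,3) unfolding monotone_on_def by (cases "x = s") (simp, metis less_le)
  have "a < ereal x" using uI(2) x(2) by (auto intro: less_le_trans)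
  then have nb': "R x ~= b" using nb x(1) by blast
  then have "x = u" using x(5) le q by auto
  moreover have "R x : {b..q}" using x(3,4) by (metis atLeastAtMost_iff image_subset_iff order_refl)
  ultimately show ?thesis using x(1) le nb' by auto
 qed
 then show ?thesis using m by blast
qed

definition cls :: "real set => real => real => 'g set set" where
 "cls U p q = {g <# S | g K R. dv g K R & U \<subseteq> K & R ` U \<subseteq> {p..q}}"

text \<open>Different classes displace \<open>U\<close> onto disjoint intervals. Infinitely many
  disjoint intervals in the compact \<open>{p..q}\<close> shrink to a point along a subsequence, and
  the corresponding elements would collapse \<open>U\<close>.\<close>

lemma finite_cls:
 assumes f: "fr U" and U: "open U" "is_interval U" "U ~= {}" "U \<subseteq> I" and pq: "{p..q} \<subseteq> I"
 shows "finite (cls U p q)"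
proof (rule ccontr)
 assume "infinite (cls U p q)"
 then obtain F :: "nat => 'g set" where F: "inj F" "range F \<subseteq> cls U p q" using infinite_countable_subset by blast
 then have "ALL n. EX g K R. F n = g <# S & dv g K R & U \<subseteq> K & R ` U \<subseteq> {p..q}" unfolding cls_def by blast
 then obtain g K R where g: "!!n. F n = g n <# S" "!!n. dv (g n) (K n) (R n)" "!!n. U \<subseteq> K n" "!!n. R n ` U \<subseteq> {p..q}"
  by metis
 have gG: "g n : carrier G" for n using dvD(1)[OF g(2)] .
 have disj: "n = m" if "u : U" "v : U" "R n u = R m v" for n m u v
 proof -
  have "lnk (g n) u (R n u)" "lnk (g m) v (R n u)" unfolding lnk_def using g(2,3) that by fastforce+
  then have "inv (g m) \<otimes> g n : S" using fr_class[OF f] that by blast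
  then have "F m = F n" using g(1) S_class_iff gG by simp
  then show ?thesis using F(1) by (auto dest: injD)
 qed
 obtain u0 where u0: "u0 : U" using U by auto
 have "seq_compact {p..q}" by (simp add: compact_imp_seq_compact)
 moreover have "ALL n. (%n. R n u0) n : {p..q}" using g(4) u0 by blast
 ultimately obtain z h where z: "z : {p..q}" "strict_mono h" "((%n. R n u0) \<circ> h) \<longlonglongrightarrow> z"
  by (rule seq_compactE)
 have zI: "z : I" using z pq by blast
 \<comment> \<open>A given value \<open>w\<close> is taken in at most one of the disjoint images.
   Used with the two points at distance \<open>e/2\<close> from \<open>z\<close>, this confines all
   later images, which are connected.\<close>
 have avoid: "EX N. ALL n>=N. ALL v:U. R (h n) v ~= w" for w
 proof (cases "EX n v. v : U & R (h n) v = w")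
  case True
  then obtain n v where nv: "v : U" "R (h n) v = w" by blast
  have "R (h m) v' ~= w" if "m >= Suc n" "v' : U" for m v'
  proof
   assume "R (h m) v' = w"
   then have "h m = h n" using disj[OF that(2) nv(1), of "h m" "h n"] nv(2) by simp
   then have "m = n" using z(2) strict_mono_eq by blast
   then show False using that by simp
  qed
  then show ?thesis by blast
 qed blast
 have lim: "(%n. R (h n) u) \<longlonglongrightarrow> z" if u: "u : U" for u
  unfolding LIMSEQ_iff
 proof (intro allI impI)
  fix e :: real assume e: "e > 0"
  obtain N1 where N1: "ALL n>=N1. norm (R (h n) u0 - z) < e/2"
   using z(3) e unfolding LIMSEQ_iff by (metis comp_apply half_gt_zero)
  obtain N2 where N2: "ALL n>=N2. ALL v:U. R (h n) v ~= z + e/2" using avoid by blast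
  obtain N3 where N3: "ALL n>=N3. ALL v:U. R (h n) v ~= z - e/2" using avoid by blast
  have "norm (R (h n) u - z) < e" if n: "n >= max N1 (max N2 N3)" for n
  proof -
   have "dv (g (h n)) U (R (h n))" using dv_restrict[OF g(2,3) U(1,2)] .
   then have iv: "is_interval (R (h n) ` U)" by (rule dv_image(2))
   have m: "R (h n) u0 : R (h n) ` U" "R (h n) u : R (h n) ` U" using u u0 by auto
   have 1: "z + e/2 ~: R (h n) ` U" "z - e/2 ~: R (h n) ` U" using N2 N3 n by fastforce+
   have 2: "\<bar>R (h n) u0 - z\<bar> < e/2" using N1 n by auto
   have "R (h n) u < z + e/2"
   proof (rule ccontr)
    assume "~ ?thesis"
    then have "R (h n) u0 <= z + e/2" "z + e/2 <= R (h n) u" using 2 e by linarith+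
    then have "z + e/2 : {R (h n) u0..R (h n) u}" by simp
    then show False using ivl_sub[OF iv m] 1 by blast
   qed
   moreover have "z - e/2 < R (h n) u"
   proof (rule ccontr)
    assume "~ ?thesis"
    then have "R (h n) u <= z - e/2" "z - e/2 <= R (h n) u0" using 2 e by linarith+
    then have "z - e/2 : {R (h n) u..R (h n) u0}" by simp
    then show False using ivl_sub[OF iv m(2,1)] 1 by blast
   qed
   ultimately show ?thesis using e by auto
  qed
  then show "EX no. ALL n>=no. norm (R (h n) u - z) < e" by blast
 qed
 show False
 proof (rule collapse[OF U(1,4,3), of "%n. g (h n)" z])
  fix u assume u: "u : U"
  have "(%n. c (R (h n) u)) \<longlonglongrightarrow> c z"
   by (rule cont_lim[OF lim[OF u] zI]) (use g(4) u pq in blast)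
  moreover have "\<phi> (g (h n)) (c u) = c (R (h n) u)" for n using dvD(9)[OF g(2)] g(3) u by blast
  ultimately show "(%n. \<phi> (g (h n)) (c u)) \<longlonglongrightarrow> c z" by simp
 qed (use gG zI in auto)
qed

text \<open>A decreasing obstruction yields a reflection, whose centre is at least \<open>b\<close>
  as the part below is free. An increasing one, inverted if necessary so as to move points up,
  sweeps the points below it beyond \<open>b\<close>.\<close>

lemma wall_cases:
 assumes f: "fr (lft a b)" and ne: "lft a b ~= {}" and b: "b : I" and e: "e > 0" and nf: "~ fr (lft a (b + e))"
 shows "(EX g \<tau>. g ~: S & b <= \<tau> & \<tau> < b + e & dec g \<tau> \<tau>) |
  (EX g K R x0. g ~: S & dv g K R & smono K R & x0 : lft a b &
   (ALL u:lft a b. u <= x0 --> u : K & b < R u & R u < b + e))"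
proof -
 have core: ?thesis if i: "inc g s t" "g ~: S" and m: "s : lft a (b + e)" "t : lft a (b + e)" "s < t" for g s t
 proof -
  have bt: "b <= t"
  proof (rule ccontr)
   assume "~ b <= t"
   then have "s : lft a b" "t : lft a b" using m unfolding lft_def by auto
   then show False using frD[OF f _ _ inc_lnk[OF i(1)]] i(2) by blast
  qed
  have sa: "a < ereal s" "s : I" using m unfolding lft_def by auto
  obtain K R where K: "mdv g K R" "smono K R"
   "!!u. [|u:lft a b; u <= s|] ==> u : K & b < R u & R u <= t"
   using sweep[OF f i m(3) bt sa(1) b] by blast
  obtain v where v: "v : lft a b" using ne by auto
  \<comment> \<open>\<open>s\<close> may lie beyond \<open>b\<close>; its minimum with a point
    \<open>v\<close> of the free set belongs to that set.\<close>
  have "min v s : lft a b" using v sa unfolding lft_def by (auto simp: min_def)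
  moreover have "ALL u:lft a b. u <= min v s --> u : K & b < R u & R u < b + e"
   using K(3) m(2) unfolding lft_def by fastforce
  ultimately show ?thesis using mdvD[OF K(1)] K(2) i(2) by blast
 qed
 obtain g s t where g: "g ~: S" "lnk g s t" "s : lft a (b + e)" "t : lft a (b + e)" using nf unfolding fr_def by blast
 have gG: "g : carrier G" using lnkD(1)[OF g(2)] .
 from lnk_cases[OF g(2)] show ?thesis
 proof
  assume "inc g s t"
  show ?thesis
  proof (cases "s < t")
   case True
   then show ?thesis using core \<open>inc g s t\<close> g by blast
  next
   case False
   have "s ~= t" using inc_fix \<open>inc g s t\<close> g(1) by blast
   then have "t < s" using False by simp
   moreover have "inv g ~: S" using S_inv[of "inv g"] g(1) gG by auto
   ultimately show ?thesis using core[OF inc_inv[OF \<open>inc g s t\<close>]] g by blast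
  qed
 next
  assume "dec g s t"
  then obtain \<tau> where \<tau>: "min s t <= \<tau>" "\<tau> <= max s t" "dec g \<tau> \<tau>" using dec_fix by blast
  have "min s t : lft a (b+e)" "max s t : lft a (b+e)" using g(3,4) by (auto simp: min_def max_def)
  then have \<tau>l: "\<tau> : lft a (b+e)" using ivl_sub[OF lft_interval, of "min s t" a "b+e" "max s t"] \<tau> by auto
  have "b <= \<tau>"
  proof (rule ccontr)
   assume "~ b <= \<tau>"
   then have "\<tau> : lft a b" using \<tau>l unfolding lft_def by auto
   then show False using frD[OF f _ _ dec_lnk[OF \<tau>(3)]] g(1) by blast
  qed
  then show ?thesis using \<tau>l g(1) \<tau>(3) unfolding lft_def by blast
 qed
qed

lemma finite_class_seq:
 assumes fin: "finite C" and g: "!!n::nat. g n : carrier G" "!!n. g n <# S : C"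
 shows "EX n0. infinite {n. inv (g n0) \<otimes> g n : S}"
proof -
 have "finite ((%n. g n <# S) ` UNIV)" by (rule finite_subset[OF _ fin]) (use g(2) in auto)
 then obtain n0 where "infinite {n : UNIV. g n <# S = g n0 <# S}" using pigeonhole_infinite[of UNIV] by blast
 moreover have "{n : UNIV. g n <# S = g n0 <# S} = {n. inv (g n0) \<otimes> g n : S}"
  using S_class_iff[OF g(1) g(1)] by (auto simp: eq_commute)
 ultimately show ?thesis by metis
qed

lemma inf_small: assumes "infinite (N::nat set)" "(e::real) > 0" shows "EX n:N. 1 / (real n + 1) < e"
proof -
 obtain m :: nat where m: "1 / (real m + 1) < e" using assms(2) by (metis add.commute nat_approx_posE of_nat_Suc)
 obtain n where n: "n : N" "m <= n" using assms(1) by (meson infinite_nat_iff_unbounded_le)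
 have "1 / (real n + 1) <= 1 / (real m + 1)" using n by (simp add: frac_le)
 then show ?thesis using m n by (intro bexI[of _ n]) auto
qed

text \<open>Suppose only reflections with centres above \<open>b\<close> exist. If all of them below
  \<open>\<tau>m\<close> fold \<open>{\<tau>..\<tau>m}\<close> into \<open>{b..\<tau>}\<close>, they
  collapse a part of the curve onto \<open>c b\<close>. Otherwise one of them, centred at
  \<open>\<tau>s\<close>, takes the value \<open>b\<close>; composing its inverse with the others
  gives increasing displacements that sweep the free interval into one compact interval. So finitely
  many classes occur, and the identity theorem puts one of the reflections into
  \<open>S\<close>.\<close>

lemma wall_dec:
 assumes f: "fr (lft a b)" and ne: "lft a b ~= {}" and b: "b : I"
  and seq: "!!e. e > 0 ==> EX g \<tau>. g ~: S & b <= \<tau> & \<tau> < b + e & dec g \<tau> \<tau>"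
 shows "EX g. g ~: S & dec g b b"
proof (rule ccontr)
 assume no: "~ ?thesis"
 define T where "T g \<tau> \<longleftrightarrow> g ~: S & b < \<tau> & dec g \<tau> \<tau>" for g \<tau>
 have TG: "g : carrier G" "\<tau> : I" if "T g \<tau>" for g \<tau> using lnkD[OF dec_lnk] that unfolding T_def by blast+
 have T: "EX g \<tau>. T g \<tau> & \<tau> < b + e" if e: "e > 0" for e
 proof -
  obtain g \<tau> where "g ~: S" "b <= \<tau>" "\<tau> < b + e" "dec g \<tau> \<tau>" using seq[OF e] by blast
  moreover have "b ~= \<tau>" using no calculation by blast
  ultimately show ?thesis unfolding T_def by (meson order_le_imp_less_or_eq)
 qed
 have Tseq: "EX g \<tau>. ALL n. T (g n) (\<tau> n) & \<tau> n < w & \<tau> n < b + 1 / (real n + 1)" if w: "b < w" for w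
 proof -
  have "EX g \<tau>. T g \<tau> & \<tau> < w & \<tau> < b + 1 / (real n + 1)" for n
  proof -
   have "min (w - b) (1 / (real n + 1)) > 0" using w by simp
   then obtain g \<tau> where g: "T g \<tau>" "\<tau> < b + min (w - b) (1 / (real n + 1))" using T by blast
   have "\<tau> < w" "\<tau> < b + 1 / (real n + 1)"
    using g(2) min.cobounded1[of "w - b" "1 / (real n + 1)"] min.cobounded2[of "w - b" "1 / (real n + 1)"]
    by linarith+
   then show ?thesis using g(1) by blast
  qed
  then show ?thesis by metis
 qed
 obtain gm \<tau>m where m: "T gm \<tau>m" using T[of 1] by auto
 have mI: "\<tau>m : I" "b < \<tau>m" using TG[OF m] m unfolding T_def by auto
 show False
 proof (cases "ALL g \<tau>. T g \<tau> & \<tau> < \<tau>m --> (EX K R. dv g K R & {\<tau>..\<tau>m} \<subseteq> K & R ` {\<tau>..\<tau>m} \<subseteq> {b..\<tau>})")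
  case True
  obtain g \<tau> where g: "!!n. T (g n) (\<tau> n)" "!!n. \<tau> n < \<tau>m" "!!n::nat. \<tau> n < b + 1 / (real n + 1)" using Tseq[OF mI(2)] by blast
  have "ALL n. EX K R. dv (g n) K R & {\<tau> n..\<tau>m} \<subseteq> K & R ` {\<tau> n..\<tau>m} \<subseteq> {b..\<tau> n}" using True g by blast
  then obtain K R where r: "!!n. dv (g n) (K n) (R n)" "!!n. {\<tau> n..\<tau>m} \<subseteq> K n" "!!n. R n ` {\<tau> n..\<tau>m} \<subseteq> {b..\<tau> n}" by metis
  have lim0: "(%n. b + 1 / (real n + 1)) \<longlonglongrightarrow> b" by real_asymp
  have sub: "{b..\<tau>m} \<subseteq> I" by (rule ivl_sub[OF interval_I b mI(1)])
  show False
  proof (rule collapse[of "{b<..<\<tau>m}" g b])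
   show "{b<..<\<tau>m} \<subseteq> I" using sub by force
   show "{b<..<\<tau>m} ~= {}" using mI by simp
   show "g n : carrier G" for n using TG(1)[OF g(1)] .
   show "(%n. \<phi> (g n) (c u)) \<longlonglongrightarrow> c b" if u: "u : {b<..<\<tau>m}" for u
   proof -
    \<comment> \<open>Only finitely many \<open>n\<close> have \<open>u < \<tau> n\<close>; for
      these the value \<open>b\<close> is a harmless default.\<close>
    define f where "f n = (if \<tau> n <= u then R n u else b)" for n
    have fin: "b <= f n & f n <= \<tau> n" for n
    proof (cases "\<tau> n <= u")
     case True
     then have "R n u : {b..\<tau> n}" using r(3)[of n] u by (simp add: image_subset_iff)
     then show ?thesis using True unfolding f_def by simp
    next
     case False
     then show ?thesis using g(1)[of n] unfolding f_def T_def by simp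
    qed
    have "f \<longlonglongrightarrow> b"
    proof (rule tendsto_sandwich[OF _ _ tendsto_const lim0])
     show "\<forall>\<^sub>F n in sequentially. b <= f n" using fin by simp
     show "\<forall>\<^sub>F n in sequentially. f n <= b + 1 / (real n + 1)"
      using fin g(3) by (intro always_eventually allI) (meson less_imp_le order_trans)
    qed
    moreover have "f n : I" for n
    proof -
     have "f n : {b..\<tau>m}" using fin[of n] g(2)[of n] by simp
     then show ?thesis using sub by blast
    qed
    ultimately have 1: "(%n. c (f n)) \<longlonglongrightarrow> c b" by (intro cont_lim[OF _ b])
    have "\<forall>\<^sub>F n in sequentially. b + 1 / (real n + 1) < u" using lim0 u by (intro order_tendstoD) auto
    then have "\<forall>\<^sub>F n in sequentially. c (f n) = \<phi> (g n) (c u)"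
    proof eventually_elim
     case (elim n)
     then have "\<tau> n <= u" using g(3)[of n] by linarith
     moreover have "u : K n" using r(2)[of n] calculation u by (simp add: subset_iff)
     ultimately show ?case using dvD(9)[OF r(1)[of n]] unfolding f_def by simp
    qed
    then show ?thesis by (rule Lim_transform_eventually[OF 1])
   qed
  qed (use b in simp_all)
 next
  case False
  then obtain gs \<tau>s where s: "T gs \<tau>s" "\<tau>s < \<tau>m"
   "~ (EX K R. dv gs K R & {\<tau>s..\<tau>m} \<subseteq> K & R ` {\<tau>s..\<tau>m} \<subseteq> {b..\<tau>s})" by blast
  have sI: "\<tau>s : I" "b < \<tau>s" "gs : carrier G" using TG[OF s(1)] s(1) unfolding T_def by auto
  obtain K R where K: "mdv gs K R" "santi K R" "\<tau>s : K" "R \<tau>s = \<tau>s"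
   using dec_mdv s(1) unfolding T_def by blast
  note d = mdvD[OF K(1)]
  have "EX x:K. \<tau>s <= x & x <= \<tau>m & R ` {\<tau>s..x} \<subseteq> {b..\<tau>m} & (x = \<tau>m | R x = b | R x = \<tau>m)"
   by (rule box_right[OF K(1,3) mI(1) _ ivl_sub[OF interval_I b mI(1)]]) (use K(4) s(2) sI in auto)
  then obtain x where x: "x : K" "\<tau>s <= x" "x <= \<tau>m" "R ` {\<tau>s..x} \<subseteq> {b..\<tau>m}" "x = \<tau>m | R x = b | R x = \<tau>m" by blast
  have sub: "{\<tau>s..x} \<subseteq> K" by (rule ivl_sub[OF dvD(3)[OF d] K(3) x(1)])
  have le: "R y <= \<tau>s" if "y : {\<tau>s..x}" for y
  proof (cases "y = \<tau>s")
   case False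
   then have "R y < R \<tau>s" using K(2,3) that sub unfolding monotone_on_def by (metis atLeastAtMost_iff less_le subsetD)
   then show ?thesis using K(4) by simp
  qed (use K(4) in simp)
  have "x ~= \<tau>m"
  proof
   assume e: "x = \<tau>m"
   have "R ` {\<tau>s..\<tau>m} \<subseteq> {b..\<tau>s}" using x(4) le unfolding e by fastforce
   then show False using s(3) d sub unfolding e by blast
  qed
  then have rx: "R x = b" using x(2,5) le[of x] s(2) by auto
  define k where "k = inv gs"
  have kG: "k : carrier G" unfolding k_def using sI by simp
  \<comment> \<open>On \<open>{b..\<tau>s}\<close> the inverse displacement, by \<open>k\<close>, is
    defined and decreasing with values in \<open>{\<tau>s..x}\<close>.\<close>
  have R: "EX z. \<tau>s <= z & z <= x & dec k y z" if y: "b <= y" "y <= \<tau>s" for y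
  proof -
   have "EX z>=\<tau>s. z <= x & R z = y"
    by (rule IVT2') (use rx y K(4) x(2) continuous_on_subset[OF dvD(5)[OF d] sub] in simp_all)
   then obtain z where z: "\<tau>s <= z" "z <= x" "R z = y" by blast
   have "z : K" using sub z by (simp add: subset_iff)
   then have "dec gs z y" unfolding dec_def using d K(2) z by blast
   then show ?thesis unfolding k_def using dec_inv z by blast
  qed
  have xI: "x : I" by (rule dvD(7)[OF d x(1)])
  \<comment> \<open>The class of \<open>\<one>\<close> is for the reflections \<open>g\<close> with
    \<open>k \<otimes> g\<close> in \<open>S\<close>, to which sweeping does not apply.\<close>
  define C where "C = insert (\<one> <# S) (cls (lft a b) b x)"
  have finC: "finite C" unfolding C_def
   using finite_cls[OF f lft_open lft_interval ne lft_I ivl_sub[OF interval_I b xI]] by simp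
  have inC: "(k \<otimes> g) <# S : C" if g: "T g \<tau>" "\<tau> < \<tau>s" for g \<tau>
  proof (cases "k \<otimes> g : S")
   case True
   then have "\<one> <# S = (k \<otimes> g) <# S" using S_class_iff[of \<one> "k \<otimes> g"] kG TG(1)[OF g(1)] by simp
   then show ?thesis unfolding C_def by simp
  next
   case False
   have bt: "b < \<tau>" "dec g \<tau> \<tau>" using g unfolding T_def by auto
   obtain z where z: "\<tau>s <= z" "z <= x" "dec k \<tau> z" using R[of \<tau>] bt g(2) by auto
   have i: "inc (k \<otimes> g) \<tau> z" by (rule dec_dec[OF bt(2) z(3)])
   obtain v where v: "v : lft a b" using ne by blast
   have a\<tau>: "a < ereal \<tau>"
    by (rule less_trans[of _ "ereal v"]) (use v bt in \<open>auto simp: lft_def\<close>)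
   obtain K1 R1 where K1: "mdv (k \<otimes> g) K1 R1" "ALL u:lft a b. u <= \<tau> --> u : K1 & b < R1 u & R1 u <= z"
    using sweep[OF f i False _ _ a\<tau> b] z g(2) bt by force
   have "lft a b \<subseteq> K1 & R1 ` lft a b \<subseteq> {b..x}"
    using K1(2) z(2) bt(1) unfolding lft_def by fastforce
   then show ?thesis using mdvD[OF K1(1)] unfolding C_def cls_def by blast
  qed
  obtain g \<tau> where g: "!!n. T (g n) (\<tau> n)" "!!n. \<tau> n < \<tau>s" "!!n::nat. \<tau> n < b + 1 / (real n + 1)" using Tseq[OF sI(2)] by blast
  have gG: "g n : carrier G" for n using TG(1)[OF g(1)] .
  obtain n0 where n0: "infinite {n. inv (k \<otimes> g n0) \<otimes> (k \<otimes> g n) : S}"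
   using finite_class_seq[OF finC, of "%n. k \<otimes> g n"] inC[OF g(1,2)] kG gG by auto
  have simpl: "inv (k \<otimes> g n0) \<otimes> (k \<otimes> g n) = inv (g n0) \<otimes> g n" for n
   using kG gG by (simp add: grp.inv_mult_group grp.m_assoc) (simp add: grp.m_assoc[symmetric])
  \<comment> \<open>Elements \<open>g n\<close> in the class of \<open>g n0\<close> act like it on
    the curve, so \<open>g n0\<close> fixes the curve at the centres \<open>\<tau> n\<close>, which
    accumulate at \<open>b\<close>.\<close>
  have "b islimpt {s : I. \<phi> (g n0) (c s) = c s}"
   unfolding islimpt_approachable
  proof (intro allI impI)
   fix e :: real assume "e > 0"
   then obtain n where n: "inv (g n0) \<otimes> g n : S" "1 / (real n + 1) < e" using inf_small[OF n0] simpl by auto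
   have \<tau>I: "\<tau> n : I" "b < \<tau> n" "dec (g n) (\<tau> n) (\<tau> n)" using TG(2)[OF g(1)] g(1) unfolding T_def by blast+
   have "\<phi> (g n0) (c (\<tau> n)) = \<phi> (g n) (c (\<tau> n))" using S_same_act[OF gG gG n(1) \<tau>I(1)] by simp
   then have "\<phi> (g n0) (c (\<tau> n)) = c (\<tau> n)" using lnkD(4)[OF dec_lnk[OF \<tau>I(3)]] by simp
   moreover have "dist (\<tau> n) b < e" using g(3)[of n] n(2) \<tau>I(2) by (simp add: dist_real_def)
   ultimately show "EX x':{s : I. \<phi> (g n0) (c s) = c s}. x' ~= b & dist x' b < e"
    using \<tau>I by (intro bexI[of _ "\<tau> n"]) auto
  qed
  then have "g n0 : S" using ident[OF gG b] gG unfolding S_def by blast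
  then show False using g(1) unfolding T_def by blast
 qed
qed

text \<open>Obstruction by a translation, also when the free interval has no lower end point in
  \<open>I\<close>: \<open>h\<close> carries the points left of \<open>x0\<close> beyond
  \<open>b\<close>, with values arbitrarily close to \<open>b\<close>. If the lower end is a point
  of \<open>I\<close>, then \<open>h\<close> carries it to \<open>b\<close>, see
  \<open>winc_real\<close>.\<close>

definition winc :: "ereal => real => 'g => real set => (real => real) => real => bool" where
 "winc a b h K R x0 \<longleftrightarrow> h ~: S & dv h K R & smono K R & x0 : lft a b &
  (ALL u:lft a b. u <= x0 --> u : K & b < R u) & (ALL e>0. EX u:lft a b. u <= x0 & R u < b + e)"

text \<open>If every candidate kept a positive distance from \<open>b\<close>, candidates with ever
  smaller values would still lie in finitely many classes. Two of one class act alike on the curve,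
  so near \<open>b\<close>, where \<open>c\<close> is injective, they take the same values; yet one
  of them comes closer to \<open>b\<close> than the other ever does.\<close>

lemma wall_inc:
 assumes f: "fr (lft a b)" and ne: "lft a b ~= {}" and b: "b : I"
  and seq: "!!e. e > 0 ==> EX g K R x0. g ~: S & dv g K R & smono K R & x0 : lft a b &
   (ALL u:lft a b. u <= x0 --> u : K & b < R u & R u < b + e)"
 shows "EX h K R x0. winc a b h K R x0"
proof (rule ccontr)
 assume no: "~ ?thesis"
 define M where "M e g K R x0 \<longleftrightarrow> g ~: S & dv g K R & smono K R & x0 : lft a b &
   (ALL u:lft a b. u <= x0 --> u : K & b < R u & R u < b + e)" for e g K R x0
 have away: "EX e0>0. ALL u:lft a b. u <= x0 --> b + e0 <= R u" if "M e g K R x0" for e g K R x0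
 proof (rule ccontr)
  assume "~ ?thesis"
  then have "ALL e0>0. EX u:lft a b. u <= x0 & R u < b + e0" by (meson not_le)
  then have "winc a b g K R x0" using that unfolding M_def winc_def by blast
  then show False using no by blast
 qed
 obtain gm Km Rm xm where m: "M 1 gm Km Rm xm" using seq[of 1] unfolding M_def by auto
 obtain em where em: "em > 0" "!!u. [|u:lft a b; u <= xm|] ==> b + em <= Rm u" using away[OF m] by blast
 have dm: "dv gm Km Rm" "xm : lft a b" "xm : Km" "b < Rm xm" using m unfolding M_def by auto
 define y where "y = Rm xm"
 have y: "y : I" "b + em <= y" "lnk gm xm y" unfolding y_def
  using dvD(8)[OF dm(1,3)] em(2)[OF dm(2)] dm lnk_def by blast+
 have gmG: "gm : carrier G" by (rule dvD(1)[OF dm(1)])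
 \<comment> \<open>Either an element has the class of \<open>gm\<close>, or its displacement keeps
   the whole free interval below \<open>y\<close>, since reaching the value \<open>y\<close> would
   give it that class.\<close>
 define C where "C = insert (gm <# S) (cls (lft a b) b y)"
 have finC: "finite C" unfolding C_def
  using finite_cls[OF f lft_open lft_interval ne lft_I ivl_sub[OF interval_I b y(1)]] by simp
 have inC: "g <# S : C" if M: "M e g K R x0" "e <= em" for e g K R x0
 proof (cases "inv gm \<otimes> g : S")
  case True
  have "g : carrier G" using M dvD(1) unfolding M_def by blast
  then have "gm <# S = g <# S" using S_class_iff[OF gmG] True by blast
  then show ?thesis unfolding C_def by blast
 next
  case False
  have x0: "x0 : lft a b" "x0 : K" "b < R x0" "R x0 < b + e" using M unfolding M_def by auto
  have i: "inc g x0 (R x0)" using M x0 unfolding M_def inc_def by blast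
  have gS: "g ~: S" using M unfolding M_def by blast
  have x0b: "a < ereal x0" "x0 < b" "x0 < R x0" using x0 unfolding lft_def by auto
  obtain K' R' where K': "mdv g K' R'" "smono K' R'" "x0 : K'" "R' x0 = R x0"
   "!!u. [|u : lft a b; u <= x0|] ==> u : K' & b < R' u & R' u <= R x0"
   using sweep[OF f i gS x0b(3) less_imp_le[OF x0(3)] x0b(1) b] by blast
  have "u : K' & R' u : {b..y}" if u: "u : lft a b" for u
  proof (cases "u <= x0")
   case True
   then show ?thesis using K'(5)[OF u] x0(4) M(2) y(2) by force
  next
   case False
   have uI: "u : I" using u lft_I by blast
   have "EX x:K'. x0 <= x & x <= u & R' ` {x0..x} \<subseteq> {b..y} & (x = u | R' x = b | R' x = y)"
    by (rule box_right[OF K'(1,3) uI _ ivl_sub[OF interval_I b y(1)]]) (use False K'(4) x0 M(2) y(2) in auto)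
   then obtain x where x: "x : K'" "x0 <= x" "x <= u" "R' ` {x0..x} \<subseteq> {b..y}" "x = u | R' x = b | R' x = y" by blast
   have "R' x0 <= R' x" using K'(2,3) x(1,2) unfolding monotone_on_def by (cases "x = x0") (simp, metis less_le)
   then have "R' x ~= b" using K'(4) x0(3) by simp
   moreover have "R' x ~= y"
   proof
    assume e: "R' x = y"
    have "lnk g x y" using mdvD[OF K'(1)] x(1) e unfolding lnk_def by blast
    moreover have "x : lft a b" using ivl_sub[OF lft_interval x0(1) u] x by auto
    ultimately have "inv gm \<otimes> g : S" using fr_class[OF f _ y(3) _ dm(2)] by blast
    then show False using False \<open>inv gm \<otimes> g ~: S\<close> by blast
   qed
   ultimately have "x = u" using x(5) by blast
   moreover have "R' x : {b..y}" using x(2,4) by (metis atLeastAtMost_iff image_subset_iff order_refl)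
   ultimately show ?thesis using x(1) by blast
  qed
  then have "lft a b \<subseteq> K'" "R' ` lft a b \<subseteq> {b..y}" by blast+
  then show ?thesis using mdvD[OF K'(1)] unfolding C_def cls_def by blast
 qed
 have "ALL n::nat. EX g K R x0. M (min em (1 / (real n + 1))) g K R x0"
 proof
  fix n :: nat
  have "min em (1 / (real n + 1)) > 0" using em(1) by simp
  then show "EX g K R x0. M (min em (1 / (real n + 1))) g K R x0" using seq unfolding M_def by blast
 qed
 then obtain g K R x0 where g: "!!n. M (min em (1 / (real n + 1))) (g n) (K n) (R n) (x0 n)" by metis
 have d: "dv (g n) (K n) (R n)" "x0 n : lft a b" for n using g[of n] unfolding M_def by blast+
 have r: "u : K n & b < R n u & R n u < b + 1 / (real n + 1)" if "u : lft a b" "u <= x0 n" for n u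
  using g[of n] that unfolding M_def by fastforce
 have gG: "g n : carrier G" for n by (rule dvD(1)[OF d(1)])
 obtain n0 where n0: "infinite {n. inv (g n0) \<otimes> g n : S}"
  using finite_class_seq[of C g, OF finC gG inC[OF g min.cobounded1]] by blast
 obtain r0 where r0: "r0 > 0" "inj_on c (I \<inter> ball b r0)" using loc_inj[OF b] by blast
 obtain n1 where n1: "inv (g n0) \<otimes> g n1 : S" "1 / (real n1 + 1) < r0" using inf_small[OF n0 r0(1)] by blast
 obtain e1 where e1: "e1 > 0" "!!u. [|u:lft a b; u <= x0 n1|] ==> b + e1 <= R n1 u" using away[OF g] by blast
 \<comment> \<open>The second index is chosen after the distance \<open>e1\<close> kept by the first
   one is known.\<close>
 obtain n2 where n2: "inv (g n0) \<otimes> g n2 : S" "1 / (real n2 + 1) < min r0 e1"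
  using inf_small[OF n0, of "min r0 e1"] r0(1) e1(1) by auto
 define u where "u = min (x0 n1) (x0 n2)"
 have u: "u : lft a b" "u <= x0 n1" "u <= x0 n2" unfolding u_def using d(2)[of n1] d(2)[of n2] by (auto simp: min_def)
 have uI: "u : I" using u lft_I by blast
 have r1: "u : K n1" "b < R n1 u" "R n1 u < b + 1 / (real n1 + 1)" using r[OF u(1,2)] by auto
 have r2: "u : K n2" "b < R n2 u" "R n2 u < b + 1 / (real n2 + 1)" using r[OF u(1,3)] by auto
 have "c (R n1 u) = c (R n2 u)"
  using S_same_act[OF gG gG n1(1) uI] S_same_act[OF gG gG n2(1) uI] dvD(9)[OF d(1) r1(1)] dvD(9)[OF d(1) r2(1)] by simp
 moreover have "R n1 u : I \<inter> ball b r0" "R n2 u : I \<inter> ball b r0"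
  using dvD(8)[OF d(1) r1(1)] dvD(8)[OF d(1) r2(1)] r1 r2 n1(2) n2(2) by (auto simp: dist_real_def)
 ultimately have "R n1 u = R n2 u" using inj_onD[OF r0(2)] by blast
 then show False using e1(2)[OF u(1,2)] r2(3) n2(2) by simp
qed

text \<open>Reflections with centres in \<open>{b..<b + e}\<close> either exist for all
  \<open>e\<close> or are absent for some \<open>e0\<close>; below \<open>e0\<close> only the
  increasing alternative of \<open>wall_cases\<close> is left.\<close>

theorem wall:
 assumes f: "fr (lft a b)" and ne: "lft a b ~= {}" and b: "b : I"
  and nf: "!!e. e > 0 ==> ~ fr (lft a (b + e))"
 shows "(EX g. g ~: S & dec g b b) | (EX h K R x0. winc a b h K R x0)"
proof (cases "ALL e>0. EX g \<tau>. g ~: S & b <= \<tau> & \<tau> < b + e & dec g \<tau> \<tau>")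
 case True
 then show ?thesis using wall_dec[OF f ne b] by blast
next
 case False
 then obtain e0 where e0: "e0 > 0" "~ (EX g \<tau>. g ~: S & b <= \<tau> & \<tau> < b + e0 & dec g \<tau> \<tau>)" by blast
 have "EX g K R x0. g ~: S & dv g K R & smono K R & x0 : lft a b &
   (ALL u:lft a b. u <= x0 --> u : K & b < R u & R u < b + e)" if e: "e > 0" for e
 proof -
  define e' where "e' = min e e0"
  have e': "e' > 0" "e' <= e" "e' <= e0" using e e0 unfolding e'_def by auto
  have "~ (EX g \<tau>. g ~: S & b <= \<tau> & \<tau> < b + e' & dec g \<tau> \<tau>)" using e0(2) e'(3) by force
  then obtain g K R x0 where g: "g ~: S" "dv g K R" "smono K R" "x0 : lft a b"
   "!!u. [|u:lft a b; u <= x0|] ==> u : K & b < R u & R u < b + e'"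
   using wall_cases[OF f ne b e'(1) nf[OF e'(1)]] by blast
  have "ALL u:lft a b. u <= x0 --> u : K & b < R u & R u < b + e" using g(5) e'(2) by fastforce
  then show ?thesis using g(1-4) by blast
 qed
 then show ?thesis using wall_inc[OF f ne b] by blast
qed

section \<open>Injectivity and sliding of free intervals\<close>

lemma lft_real: "[|a : I; b : I|] ==> lft (ereal a) b = {a<..<b}"
 using ivl_sub[OF interval_I, of a b] unfolding lft_def by force

lemma inc_ext:
 assumes d: "dv g K R" and m: "smono K R" and s: "s : K"
 shows "EX K' R'. mdv g K' R' & smono K' R' & K \<subseteq> K' & (ALL x:K. R' x = R x)"
proof -
 obtain K' R' where 2: "mdv g K' R'" "K \<subseteq> K'" "ALL x:K. R' x = R x" using dv_maximal[OF d s] by blast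
 obtain x where x: "x : K" "s < x" using open_two dvD(2)[OF d] s by blast
 have lt: "R' s < R' x" using m s x 2(3) unfolding monotone_on_def by auto
 have "~ santi K' R'"
 proof
  assume "santi K' R'"
  then have "R' x < R' s" using x s 2(2) unfolding monotone_on_def by blast
  then show False using lt by simp
 qed
 then have "smono K' R'" using dv_mono[OF mdvD[OF 2(1)]] by blast
 then show ?thesis using 2 by blast
qed

lemma hit:
 assumes w: "winc a b h K R x0" and y: "b < y" "y <= R x0"
 shows "EX u:lft a b. u <= x0 & R u = y & inc h u y"
proof -
 have d: "dv h K R" "smono K R" "x0 : lft a b" "x0 : K" using w unfolding winc_def by auto
 obtain u1 where u1: "u1 : lft a b" "u1 <= x0" "R u1 < y"
  using w y(1) unfolding winc_def by (metis add.commute diff_add_cancel diff_gt_0_iff_gt)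
 have u1K: "u1 : K" using w u1 unfolding winc_def by blast
 have sub: "{u1..x0} \<subseteq> K" by (rule ivl_sub[OF dvD(3)[OF d(1)] u1K d(4)])
 have "EX x>=u1. x <= x0 & R x = y"
  by (rule IVT') (use u1 y continuous_on_subset[OF dvD(5)[OF d(1)] sub] in simp_all)
 then obtain u where u: "u1 <= u" "u <= x0" "R u = y" by blast
 have "u : lft a b" using ivl_sub[OF lft_interval u1(1) d(3)] u by auto
 moreover have "u : K" using sub u by (simp add: subset_iff)
 then have "inc h u y" unfolding inc_def using d u(3) by blast
 ultimately show ?thesis using u by blast
qed

lemma wincD:
 assumes "winc a b h K R x0"
 shows "h ~: S" "dv h K R" "smono K R" "x0 : lft a b" "x0 : K" "b < R x0"
  "[|u : lft a b; u <= x0|] ==> u : K" "[|u : lft a b; u <= x0|] ==> b < R u"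
 using assms unfolding winc_def by auto

lemma lnk_mult_S: "[|g : carrier G; q : S; g \<otimes> q : S|] ==> g : S"
 using S_mult[of "g \<otimes> q" "inv q"] S_inv[of q] S_carrier[of q] by (simp add: grp.m_assoc)

text \<open>Elements of \<open>S\<close> displace increasingly. Going right from \<open>s\<close>,
  the values stay ahead of the points, so they arrive at \<open>b\<close> while the point is still
  inside the free set.\<close>

lemma inj_core:
 assumes q: "q : S" and l: "lnk q s t" and s: "s : lft a b" and t: "t : lft a b" and st: "s < t" and b: "b : I"
 shows "EX x:lft a b. inc q x b"
proof -
 have "inc q s t" using lnk_cases[OF l] no_dec_S[OF q] by blast
 then obtain K R where m: "mdv q K R" "smono K R" "s : K" "R s = t" using inc_mdv by blast
 note d = mdvD[OF m(1)]
 have up: "x < R x" if "x : K" for x using no_fix_up[OF d m(2,3) _ that] m(4) st by simp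
 have sI: "s : I" "s < b" "t < b" using s t unfolding lft_def by auto
 have "EX x:K. s <= x & x <= b & R ` {s..x} \<subseteq> {s..b} & (x = b | R x = s | R x = b)"
  by (rule box_right[OF m(1,3) b _ ivl_sub[OF interval_I sI(1) b]]) (use m(4) st sI in auto)
 then obtain x where x: "x : K" "s <= x" "x <= b" "R ` {s..x} \<subseteq> {s..b}" "x = b | R x = s | R x = b" by blast
 have "R x <= b" using x(2,4) by (metis atLeastAtMost_iff image_subset_iff order_refl)
 then have rx: "R x = b" "x < b" using x up[OF x(1)] by auto
 have "x : lft a b" using lft_lower[OF s x(2) rx(2) dvD(7)[OF d x(1)]] .
 moreover have "inc q x b" using d m(2) x(1) rx unfolding inc_def by blast
 ultimately show ?thesis by blast
qed

lemma inj_sym: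
 assumes "!!q s t. [|q : S; lnk q s t; s : U; t : U; s < t|] ==> False"
  and "q : S" "lnk q s t" "s : U" "t : U"
 shows "s = t"
 using assms(1)[OF assms(2,3,4,5)] assms(1)[OF S_inv[OF assms(2)] lnk_inv[OF assms(3)] assms(5,4)] by fastforce

text \<open>Combined with the reflection at \<open>b\<close>, a nontrivial displacement by
  \<open>q\<close> would send points right of \<open>x\<close> to points left of \<open>b\<close>,
  both in the free set; then \<open>g \<otimes> q\<close>, and so \<open>g\<close>, would lie in
  \<open>S\<close>.\<close>

lemma inj_dec:
 assumes f: "fr (lft a b)" and g: "g ~: S" "dec g b b" and q: "q : S" "lnk q s t" "s : lft a b" "t : lft a b"
 shows "s = t"
proof (rule inj_sym[OF _ q])
 fix q s t assume q: "q : S" "lnk q s t" "s : lft a b" "t : lft a b" "s < t"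
 have b: "b : I" and gG: "g : carrier G" using lnkD[OF dec_lnk[OF g(2)]] by auto
 obtain x where x: "x : lft a b" "inc q x b" using inj_core[OF q b] by blast
 have xb: "x < b" using x unfolding lft_def by simp
 have "dec (g \<otimes> q) x b" by (rule inc_dec[OF x(2) g(2)])
 then obtain x' t' where x': "x < x'" "x' < x + (b - x)" "b - (b - x) < t'" "t' < b" "dec (g \<otimes> q) x' t'"
  using dec_right[of "g \<otimes> q" x b "b - x"] xb by auto
 note l = dec_lnk[OF x'(5)]
 have "x' : lft a b" "t' : lft a b" using x' lnkD[OF l] by (auto intro!: lft_lower[OF x(1)])
 then have "g \<otimes> q : S" using frD[OF f _ _ l] by blast
 then show False using lnk_mult_S[OF gG q(1)] g(1) by blast
qed

text \<open>A point just beyond \<open>b\<close> would be reached from the free set both by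
  \<open>q\<close> and by the translation \<open>h\<close>; the two would have the same class, and
  \<open>h\<close> would lie in \<open>S\<close>.\<close>

lemma inj_winc:
 assumes f: "fr (lft a b)" and w: "winc a b h K R x0" and b: "b : I"
  and q: "q : S" "lnk q s t" "s : lft a b" "t : lft a b"
 shows "s = t"
proof (rule inj_sym[OF _ q])
 fix q s t assume q: "q : S" "lnk q s t" "s : lft a b" "t : lft a b" "s < t"
 obtain x where x: "x : lft a b" "inc q x b" using inj_core[OF q b] by blast
 have xb: "x < b" using x unfolding lft_def by simp
 define e where "e = min (b - x) (R x0 - b)"
 have e: "e > 0" "e <= b - x" "e <= R x0 - b" using xb wincD(6)[OF w] unfolding e_def by auto
 obtain x' y where x': "x < x'" "x' < x + e" "b < y" "y < b + e" "inc q x' y" using inc_right[OF x(2) e(1)] by blast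
 have x'l: "x' : lft a b" using x' e lnkD[OF inc_lnk[OF x'(5)]] by (intro lft_lower[OF x(1)]) auto
 obtain u where u: "u : lft a b" "inc h u y" using hit[OF w x'(3)] x' e by force
 have "inv h \<otimes> q : S" by (rule fr_class[OF f inc_lnk[OF x'(5)] inc_lnk[OF u(2)] x'l u(1)])
 then have "h : S" using S_cancel_right[OF _ S_carrier[OF q(1)] _ q(1)] lnkD(1)[OF inc_lnk[OF u(2)]] by blast
 then show False using wincD(1)[OF w] by blast
qed

text \<open>In \<open>qstep\<close> the two points are located relative to \<open>b\<close>;
  shifting the pair slightly excludes that one of them is \<open>b\<close>.\<close>

lemma perturb:
 assumes l: "lnk g s t" and V: "open V" "s : V" "t : V"
 shows "EX s' t'. lnk g s' t' & s' : V & t' : V & s' ~= (b::real) & t' ~= b"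
proof -
 obtain e1 where e1: "e1 > 0" "ball s e1 \<subseteq> V" using V open_contains_ball by blast
 obtain e2 where e2: "e2 > 0" "ball t e2 \<subseteq> V" using V open_contains_ball by blast
 define e where "e = min (min e1 e2) (min (if s = b then 1 else \<bar>s - b\<bar>) (if t = b then 1 else \<bar>t - b\<bar>))"
 have e: "e > 0" "e <= e1" "e <= e2" "s ~= b ==> e <= \<bar>s - b\<bar>" "t ~= b ==> e <= \<bar>t - b\<bar>"
  using e1 e2 unfolding e_def by auto
 have "EX s' t'. lnk g s' t' & s' ~= s & t' ~= t & \<bar>s' - s\<bar> < e & \<bar>t' - t\<bar> < e"
  using lnk_cases[OF l]
 proof
  assume "inc g s t"
  then obtain s' t' where "s < s'" "s' < s + e" "t < t'" "t' < t + e" "inc g s' t'" using inc_right e(1) by blast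
  then show ?thesis using inc_lnk by (intro exI[of _ s'] exI[of _ t']) auto
 next
  assume "dec g s t"
  then obtain s' t' where "s < s'" "s' < s + e" "t - e < t'" "t' < t" "dec g s' t'" using dec_right e(1) by blast
  then show ?thesis using dec_lnk by (intro exI[of _ s'] exI[of _ t']) auto
 qed
 then obtain s' t' where st: "lnk g s' t'" "s' ~= s" "t' ~= t" "\<bar>s' - s\<bar> < e" "\<bar>t' - t\<bar> < e" by blast
 have "s' : ball s e1" "t' : ball t e2" using st e by (auto simp: dist_real_def)
 then have "s' : V" "t' : V" using e1 e2 by blast+
 moreover have "s' ~= b" using st(2,4) e(4) by (cases "s = b") auto
 moreover have "t' ~= b" using st(3,5) e(5) by (cases "t = b") auto
 ultimately show ?thesis using st(1) by blast
qed

text \<open>The slid interval is cut at \<open>b\<close>. Its left part lies in the free set and its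
  right part consists of \<open>h\<close>-images of points left of \<open>x\<close>, so an element
  displacing within one part is reduced to the free set, if necessary by conjugation with
  \<open>h\<close>. Nothing is displaced between the parts: by injectivity on the free set a point
  right of \<open>x\<close> would equal one left of \<open>x\<close>.\<close>

lemma qstep:
 assumes f: "fr (lft a b)" and b: "b : I" and w: "winc a b h K R x0" and x: "x : lft a b" "x <= x0"
 shows "fr {x<..<R x}"
 unfolding fr_def
proof (intro allI impI)
 fix g s0 t0 assume st0: "s0 : {x<..<R x}" "t0 : {x<..<R x}" "lnk g s0 t0"
 obtain s t where st: "lnk g s t" "s : {x<..<R x}" "t : {x<..<R x}" "s ~= b" "t ~= b"
  using perturb[OF st0(3) open_greaterThanLessThan st0(1,2), of b] by blast
 have gG: "g : carrier G" and stI: "s : I" "t : I" using lnkD[OF st(1)] by auto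
 note wD = wincD[OF w]
 have "x : K" by (rule wD(7)[OF x])
 moreover have "R x <= R x0"
  using wD(3,5) calculation x(2) unfolding monotone_on_def by (cases "x = x0") (auto simp: less_imp_le)
 ultimately have xK: "x : K" "R x <= R x0" by blast+
 have low: "z : lft a b" if "z : {x<..<R x}" "z < b" "z : I" for z
  using lft_lower[OF x(1) _ that(2,3)] that(1) by simp
 have high: "EX u:lft a b. u < x & inc h u z" if z: "z : {x<..<R x}" "b < z" for z
 proof -
  obtain u where u: "u : lft a b" "u <= x0" "R u = z" "inc h u z" using hit[OF w z(2)] z(1) xK(2) by force
  have uK: "u : K" by (rule wD(7)[OF u(1,2)])
  have "u < x"
  proof (rule ccontr)
   assume "~ u < x"
   then have "R x <= R u" using wD(3) xK(1) uK unfolding monotone_on_def by (cases "u = x") (auto simp: less_imp_le)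
   then show False using u(3) z(1) by simp
  qed
  then show ?thesis using u by blast
 qed
 have mixed: False if l: "lnk k s t" and s: "s : {x<..<R x}" "s < b" "s : I" and t: "t : {x<..<R x}" "b < t" for k s t
 proof -
  obtain u where u: "u : lft a b" "u < x" "inc h u t" using high[OF t] by blast
  have sl: "s : lft a b" by (rule low[OF s])
  have "lnk (inv h \<otimes> k) s u" by (rule lnk_lnk[OF l lnk_inv[OF inc_lnk[OF u(3)]]])
  moreover have "inv h \<otimes> k : S" by (rule fr_class[OF f l inc_lnk[OF u(3)] sl u(1)])
  ultimately have "s = u" using inj_winc[OF f w b _ _ sl u(1)] by blast
  then show False using u(2) s(1) by simp
 qed
 consider "s < b" "t < b" | "s < b" "b < t" | "b < s" "t < b" | "b < s" "b < t" using st(4,5) by linarith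
 then show "g : S"
 proof cases
  case 1
  then show ?thesis using frD[OF f low[OF st(2)] low[OF st(3)] st(1)] stI by blast
 next
  case 2
  then show ?thesis using mixed[OF st(1,2) _ stI(1) st(3)] by blast
 next
  case 3
  then show ?thesis using mixed[OF lnk_inv[OF st(1)] st(3) _ stI(2) st(2)] by blast
 next
  case 4
  obtain u v where uv: "u : lft a b" "inc h u s" "v : lft a b" "inc h v t"
   using high[OF st(2) 4(1)] high[OF st(3) 4(2)] by blast
  have hG: "h : carrier G" using lnkD(1)[OF inc_lnk[OF uv(2)]] .
  have "lnk (inv h \<otimes> (g \<otimes> h)) u v"
   by (rule lnk_lnk[OF lnk_lnk[OF inc_lnk[OF uv(2)] st(1)] lnk_inv[OF inc_lnk[OF uv(4)]]])
  then have "inv h \<otimes> (g \<otimes> h) : S" using frD[OF f uv(1,3)] by blast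
  then have "h \<otimes> (inv h \<otimes> (g \<otimes> h)) \<otimes> inv h : S" by (rule norm_S'[OF inc_lnk[OF uv(2)]])
  moreover have "h \<otimes> (inv h \<otimes> (g \<otimes> h)) \<otimes> inv h = g"
   using hG gG by (simp add: grp.m_assoc[symmetric]) (simp add: grp.m_assoc)
  ultimately show ?thesis by simp
 qed
qed

lemma winc_real_intro:
 assumes d: "dv h K R" "smono K R" and h: "h ~: S" and a: "a : K" "a < R a"
  and x: "x : K" "a < x" "x < R a"
 shows "winc (ereal a) (R a) h K R x"
proof -
 have I: "a : I" "R a : I" using dvD(7,8)[OF d(1) a(1)] by auto
 have l: "lft (ereal a) (R a) = {a<..<R a}" by (rule lft_real[OF I])
 have sub: "{a..x} \<subseteq> K" by (rule ivl_sub[OF dvD(3)[OF d(1)] a(1) x(1)])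
 have 1: "u : K & R a < R u" if "u : {a<..<R a}" "u <= x" for u
 proof -
  have "u : K" using sub that by (simp add: subset_iff)
  then show ?thesis using d(2) a(1) that unfolding monotone_on_def by simp
 qed
 have 2: "EX u:{a<..<R a}. u <= x & R u < R a + e" if "e > 0" for e
 proof -
  have "inc h a (R a)" using d a unfolding inc_def by blast
  obtain e' where e': "e' > 0" "ball a e' \<subseteq> K" "R ` ball a e' \<subseteq> ball (R a) e"
   using dv_local[OF d(1) a(1) open_ball, of "R a" e] \<open>e > 0\<close> by auto
  define u where "u = min x (a + e'/2)"
  have u: "a < u" "u <= x" "u : ball a e'" unfolding u_def using x e'(1) by (auto simp: dist_real_def)
  then have "R u : ball (R a) e" using e'(3) by blast
  then show ?thesis using u x by (intro bexI[of _ u]) (auto simp: dist_real_def)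
 qed
 show ?thesis unfolding winc_def l using d h x 1 2 by auto
qed

lemma qcont_right:
 assumes d: "dv h K R" "smono K R" and h: "h ~: S" and a: "a : K" "a < R a" and f: "fr {a<..<R a}"
  and x: "x : K" "a <= x" "x < R a"
 shows "fr {x<..<R x}"
proof (cases "x = a")
 case False
 have I: "a : I" "R a : I" using dvD(7,8)[OF d(1) a(1)] by auto
 have l: "lft (ereal a) (R a) = {a<..<R a}" by (rule lft_real[OF I])
 show ?thesis
  by (rule qstep[OF _ I(2) winc_real_intro[OF d h a x(1) _ x(3)]]) (use f l x False in auto)
qed (use f in simp)

end

text \<open>In the reversed parameter the inverse displacement carries \<open>- R x\<close> to
  \<open>- x\<close>, so sliding to the left becomes sliding to the right, starting from the
  interval between \<open>- R a\<close> and \<open>- a\<close>.\<close>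

lemma (in curve_orbit) qcont_left:
 assumes d: "dv h K R" "smono K R" and h: "h ~: S" and a: "a : K" "a < R a" and f: "fr {a<..<R a}"
  and x: "x : K" "x <= a" "a < R x"
 shows "fr {x<..<R x}"
proof -
 interpret m: curve_orbit G X \<phi> mI mc by (rule mirror)
 define \<sigma> where "\<sigma> = (%y. - inv_into K R (- y))"
 have inj: "inj_on R K" by (rule dv_inj[OF d(1)])
 have dm: "m.dv (inv h) (uminus ` R ` K) \<sigma>" unfolding \<sigma>_def by (rule mirror_dv_imp[OF dv_inverse[OF d(1)]])
 have mm: "smono (uminus ` R ` K) \<sigma>" unfolding \<sigma>_def by (rule mono_neg(1)[OF inv_into_strict_mono[OF d(2)]])
 have \<sigma>: "\<sigma> (- R y) = - y" if "y : K" for y unfolding \<sigma>_def using inj that by simp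
 have hm: "inv h ~: m.S" using h S_inv[of "inv h"] dvD(1)[OF d(1)] unfolding mirror_S by auto
 have neg: "uminus ` {- v<..<- u} = {u<..<v}" for u v :: real
  by (auto simp: image_iff intro: bexI[of _ "- x" for x])
 have le: "R x <= R a" using d(2) x a unfolding monotone_on_def by (cases "x = a") (auto simp: less_imp_le)
 have "m.fr {- R x<..<\<sigma> (- R x)}"
 proof (rule m.qcont_right[OF dm mm hm])
  show "- R a : uminus ` R ` K" "- R x : uminus ` R ` K" using a x by auto
  show "- R a < \<sigma> (- R a)" using \<sigma>[OF a(1)] a by simp
  show "m.fr {- R a<..<\<sigma> (- R a)}" using f unfolding \<sigma>[OF a(1)] mirror_fr neg .
  show "- R a <= - R x" using le by simp
  show "- R x < \<sigma> (- R a)" unfolding \<sigma>[OF a(1)] using x by simp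
 qed
 then show ?thesis unfolding \<sigma>[OF x(1)] mirror_fr neg .
qed

context curve_orbit
begin

text \<open>The set of \<open>x\<close> for which the interval up to \<open>R x\<close> is free is
  open, by sliding a little in both directions. Its complement in \<open>K\<close> is open as well,
  since an obstruction between two interior points survives small shifts of the ends.
  \<open>K\<close> is connected.\<close>

lemma qcont:
 assumes d: "dv h K R" "smono K R" and h: "h ~: S" and a: "a : K" "a < R a" and f: "fr {a<..<R a}"
  and x: "x : K"
 shows "fr {x<..<R x}"
proof -
 define Q where "Q = {x : K. fr {x<..<R x}}"
 have up: "y < R y" if "y : K" for y by (rule no_fix_up[OF d a that])
 have near: "EX e>0. ball y e \<subseteq> K & (ALL z:ball y e. z < R y & y < R z)" if y: "y : K" for y
 proof -
  define m where "m = (y + R y) / 2"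
  have m: "y < m" "m < R y" unfolding m_def using up[OF y] by auto
  obtain e where e: "e > 0" "ball y e \<subseteq> K" "R ` ball y e \<subseteq> {m<..}"
   using dv_local[OF d(1) y open_greaterThan, of m] m by auto
  define e' where "e' = min e (m - y)"
  have "e' > 0" "ball y e' \<subseteq> K" unfolding e'_def using e m by auto
  moreover have "z < R y & y < R z" if "z : ball y e'" for z
  proof -
   have "z : ball y e" "z < m" using that unfolding e'_def by (auto simp: dist_real_def)
   moreover have "R z : {m<..}" using e(3) calculation(1) by blast
   ultimately show ?thesis using m by auto
  qed
  ultimately show ?thesis by blast
 qed
 have "open Q" unfolding open_contains_ball
 proof
  fix y assume "y : Q"
  then have y: "y : K" "fr {y<..<R y}" unfolding Q_def by auto
  obtain e where e: "e > 0" "ball y e \<subseteq> K" "ALL z:ball y e. z < R y & y < R z" using near[OF y(1)] by blast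
  have "z : Q" if z: "z : ball y e" for z
  proof -
   have zK: "z : K" using e(2) z by blast
   have "fr {z<..<R z}"
   proof (cases "y <= z")
    case True
    then show ?thesis using qcont_right[OF d h y(1) up[OF y(1)] y(2) zK] e(3) z by blast
   next
    case False
    then show ?thesis using qcont_left[OF d h y(1) up[OF y(1)] y(2) zK] e(3) z by auto
   qed
   then show ?thesis unfolding Q_def using zK by blast
  qed
  then show "EX e>0. ball y e \<subseteq> Q" using e(1) by blast
 qed
 moreover have "open (K - Q)" unfolding open_contains_ball
 proof
  fix y assume "y : K - Q"
  then have y: "y : K" "~ fr {y<..<R y}" unfolding Q_def by auto
  obtain g s t where g: "g ~: S" "lnk g s t" "s : {y<..<R y}" "t : {y<..<R y}" using y(2) unfolding fr_def by blast
  obtain e where e: "e > 0" "ball y e \<subseteq> K" "R ` ball y e \<subseteq> {max s t<..}"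
   using dv_local[OF d(1) y(1) open_greaterThan, of "max s t"] g by auto
  define e' where "e' = min e (min s t - y)"
  have e': "e' > 0" unfolding e'_def using e g by auto
  have "z : K - Q" if z: "z : ball y e'" for z
  proof -
   have zb: "z : ball y e" "z < s" "z < t" using z unfolding e'_def by (auto simp: dist_real_def)
   have "R z : {max s t<..}" using e(3) zb(1) by blast
   then have "s : {z<..<R z}" "t : {z<..<R z}" using zb by auto
   then have "~ fr {z<..<R z}" using g(1,2) frD by blast
   then show ?thesis using e(2) zb(1) unfolding Q_def by blast
  qed
  then show "EX e>0. ball y e \<subseteq> K - Q" using e' by blast
 qed
 moreover have "connected K" using dvD(3)[OF d(1)] is_interval_connected by blast
 moreover have "Q \<inter> (K - Q) \<inter> K = {}" "K \<subseteq> Q \<union> (K - Q)" by auto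
 ultimately have "Q \<inter> K = {} | (K - Q) \<inter> K = {}" using connectedD by blast
 moreover have "a : Q" unfolding Q_def using a f by simp
 ultimately have "x : Q" using a(1) x by blast
 then show ?thesis unfolding Q_def by simp
qed

section \<open>Maximal intervals\<close>

text \<open>Maximality of the compact interval from \<open>a\<close> to \<open>b\<close>, tested on
  open intervals: freeness depends on the interior only, so enlarging beyond an end makes this end
  an interior point. The condition refers to \<open>I\<close> and is thus the same for all
  subdomains with \<open>a\<close> and \<open>b\<close> in their interior.\<close>

definition mx :: "real => real => bool" where
 "mx a b \<longleftrightarrow> a < b & a : I & b : I & fr {a<..<b} &
  (ALL V. open V --> is_interval V --> V \<subseteq> I --> {a<..<b} \<subseteq> V --> fr V --> a ~: V & b ~: V)"

definition ng :: "real => real => bool" where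
 "ng a b \<longleftrightarrow> (EX g. g ~: S & dec g a a) & (EX g. g ~: S & dec g b b)"

definition ps :: "'g => real => real => bool" where
 "ps h a b \<longleftrightarrow> h ~: S & inc h a b"

lemma mxD:
 assumes "mx a b" shows "a < b" "a : I" "b : I" "fr {a<..<b}" "{a..b} \<subseteq> I" "{a<..<b} \<subseteq> I"
proof -
 show 1: "a < b" "a : I" "b : I" "fr {a<..<b}" using assms unfolding mx_def by auto
 show "{a..b} \<subseteq> I" by (rule ivl_sub[OF interval_I 1(2,3)])
 then show "{a<..<b} \<subseteq> I" by force
qed

lemma mxV:
 "[|mx a b; open V; is_interval V; V \<subseteq> I; {a<..<b} \<subseteq> V; fr V|] ==> a ~: V & b ~: V"
 unfolding mx_def by simp

lemma mx_right: assumes "mx a b" "fr {a<..<b'}" "b' : I" shows "b' <= b"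
proof (rule ccontr)
 assume n: "~ b' <= b"
 note m = mxD[OF assms(1)]
 have "{a<..<b'} \<subseteq> I" using ivl_sub[OF interval_I m(2) assms(3)] by force
 then have "b ~: {a<..<b'}" using assms(1,2) n unfolding mx_def
  by (metis greaterThanLessThan_subseteq_greaterThanLessThan is_interval_oo not_le less_imp_le open_greaterThanLessThan order_refl)
 then show False using m n by auto
qed

lemma mx_left: assumes "mx a b" "fr {a'<..<b}" "a' : I" shows "a <= a'"
proof (rule ccontr)
 assume n: "~ a <= a'"
 note m = mxD[OF assms(1)]
 have "{a'<..<b} \<subseteq> I" using ivl_sub[OF interval_I assms(3) m(3)] by force
 then have "a ~: {a'<..<b}" using assms(1,2) n unfolding mx_def
  by (metis greaterThanLessThan_subseteq_greaterThanLessThan is_interval_oo not_le less_imp_le open_greaterThanLessThan order_refl)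
 then show False using m n by auto
qed

lemma mx_unique_left: assumes "mx a b" "mx a b'" shows "b = b'"
 using mx_right[OF assms(1) mxD(4,3)[OF assms(2)]] mx_right[OF assms(2) mxD(4,3)[OF assms(1)]] by simp

lemma mx_unique_right: assumes "mx a b" "mx a' b" shows "a = a'"
 using mx_left[OF assms(1) mxD(4,2)[OF assms(2)]] mx_left[OF assms(2) mxD(4,2)[OF assms(1)]] by simp

lemma open_end_left:
 assumes "open V" "b : V" "a < b" shows "EX e>0. ALL s. b - e < s & s <= b --> s : V & a < (s::real)"
proof -
 obtain e where e: "e > 0" "ball b e \<subseteq> V" using assms open_contains_ball by blast
 show ?thesis
 proof (intro exI[of _ "min e (b - a)"] conjI allI impI)
  show "min e (b - a) > 0" using e assms by simp
  fix s assume s: "b - min e (b - a) < s & s <= b"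
  then have "s : ball b e" by (auto simp: dist_real_def)
  then show "s : V" using e by blast
  show "a < s" using s by auto
 qed
qed

lemma open_end_right:
 assumes "open V" "a : V" "a < b" shows "EX e>0. ALL s. a <= s & s < a + e --> s : V & s < (b::real)"
proof -
 obtain e where e: "e > 0" "ball a e \<subseteq> V" using assms open_contains_ball by blast
 show ?thesis
 proof (intro exI[of _ "min e (b - a)"] conjI allI impI)
  show "min e (b - a) > 0" using e assms by simp
  fix s assume s: "a <= s & s < a + min e (b - a)"
  then have "s : ball a e" by (auto simp: dist_real_def)
  then show "s : V" using e by blast
  show "s < b" using s by auto
 qed
qed

text \<open>\<open>h\<close> relates a point just beyond one end to a point inside the interval next
  to the other end, so no open interval containing an end is free.\<close>

lemma ps_mx:
 assumes ab: "a < b" and f: "fr {a<..<b}" and p: "ps h a b" shows "mx a b"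
proof -
 have i: "inc h a b" "h ~: S" using p unfolding ps_def by auto
 note I = lnkD[OF inc_lnk[OF i(1)]]
 have "a ~: V & b ~: V" if V: "open V" "is_interval V" "V \<subseteq> I" "{a<..<b} \<subseteq> V" "fr V" for V
 proof (intro conjI notI)
  assume aV: "a : V"
  obtain e1 where e1: "e1 > 0" "ALL s. a - e1 < s & s <= a --> s : V & a - 1 < s"
   using open_end_left[OF V(1) aV, of "a - 1"] by auto
  define e where "e = min e1 (b - a)"
  have e: "e > 0" "e <= e1" "e <= b - a" using e1 ab unfolding e_def by auto
  obtain s t where st: "a - e < s" "s < a" "b - e < t" "t < b" "inc h s t" using inc_left[OF i(1) e(1)] by blast
  have "s : V" using e1(2) st e by simp
  moreover have "t : V" using V(4) st e by (simp add: subset_iff)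
  ultimately show False using frD[OF V(5) _ _ inc_lnk[OF st(5)]] i(2) by blast
 next
  assume bV: "b : V"
  obtain e1 where e1: "e1 > 0" "ALL s. b <= s & s < b + e1 --> s : V & s < b + 1"
   using open_end_right[OF V(1) bV, of "b + 1"] by auto
  define e where "e = min e1 (b - a)"
  have e: "e > 0" "e <= e1" "e <= b - a" using e1 ab unfolding e_def by auto
  obtain s t where st: "a < s" "s < a + e" "b < t" "t < b + e" "inc h s t" using inc_right[OF i(1) e(1)] by blast
  have "t : V" using e1(2) st e by simp
  moreover have "s : V" using V(4) st e by (simp add: subset_iff)
  ultimately show False using frD[OF V(5) _ _ inc_lnk[OF st(5)]] i(2) by blast
 qed
 then show ?thesis unfolding mx_def using ab f I by blast
qed

lemma winc_mx:
 assumes f: "fr (lft a b)" and b: "b : I" and w: "winc a b h K R x0" and x: "x : lft a b" "x <= x0"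
 shows "mx x (R x)" "ps h x (R x)"
proof -
 note wD = wincD[OF w]
 have xb: "x < b" "b < R x" "x : K" using x wD(7,8)[OF x] unfolding lft_def by auto
 show p: "ps h x (R x)" unfolding ps_def inc_def using wD(1-3) xb(3) by blast
 show "mx x (R x)" using ps_mx[OF _ qstep[OF f b w x] p] xb by simp
qed

lemma ps_winc:
 assumes ab: "a < b" and p: "ps h a b"
 shows "EX K R x0. winc (ereal a) b h K R x0"
proof -
 have i: "inc h a b" "h ~: S" using p unfolding ps_def by auto
 obtain K R where m: "mdv h K R" "smono K R" "a : K" "R a = b" using inc_mdv[OF i(1)] by blast
 note d = mdvD[OF m(1)]
 obtain e where e: "e > 0" "ALL s. a <= s & s < a + e --> s : K & s < b" using open_end_right[OF dvD(2)[OF d] m(3) ab] by blast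
 have x: "a + e/2 : K" "a < a + e/2" "a + e/2 < b" using e by auto
 show ?thesis using winc_real_intro[OF d m(2) i(2) m(3) _ x(1,2)] m(4) ab x(3) by auto
qed

text \<open>The maximal displacement reaches \<open>a\<close>, as its values stay in a box above
  \<open>b\<close>; its value at \<open>a\<close> is below all values further right, which come
  arbitrarily close to \<open>b\<close>.\<close>

lemma winc_real:
 assumes w: "winc (ereal a) b h K R x0" and I: "a : I" "b : I"
 shows "inc h a b"
proof -
 note wD = wincD[OF w]
 have l: "lft (ereal a) b = {a<..<b}" by (rule lft_real[OF I])
 obtain K' R' where m: "mdv h K' R'" "smono K' R'" "K \<subseteq> K'" "!!x. x:K ==> R' x = R x"
  using inc_ext[OF wD(2,3,5)] by blast
 note d = mdvD[OF m(1)]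
 have x0: "a < x0" "x0 < b" "x0 : K'" using wD(4,5) m(3) unfolding l by auto
 have rI: "R x0 : I" by (rule dvD(8)[OF wD(2,5)])
 obtain q where q: "q : I" "R x0 < q" using I_right[OF rI, of 1] by auto
 have "EX x:K'. a <= x & x <= x0 & R' ` {x..x0} \<subseteq> {b..q} & (x = a | R' x = b | R' x = q)"
  by (rule box_left[OF m(1) x0(3) I(1) _ ivl_sub[OF interval_I I(2) q(1)]]) (use x0 q wD(5,6) m(4)[OF wD(5)] in auto)
 then obtain x where x: "x : K'" "a <= x" "x <= x0" "R' ` {x..x0} \<subseteq> {b..q}" "x = a | R' x = b | R' x = q" by blast
 have "x = a"
 proof (rule ccontr)
  assume "x ~= a"
  then have xl: "x : lft (ereal a) b" unfolding l using x x0 by auto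
  have xK: "x : K" "b < R x" using wD(7,8)[OF xl x(3)] by auto
  have "R x <= R x0" using wD(3) xK(1) wD(5) x(3) unfolding monotone_on_def by (cases "x = x0") (auto simp: less_imp_le)
  then show False using x(5) \<open>x ~= a\<close> xK m(4)[OF xK(1)] q by auto
 qed
 then have aK: "a : K'" "b <= R' a" using x(1,3,4) by (auto simp: image_subset_iff)
 have "R' a <= b"
 proof (rule field_le_epsilon)
  fix e :: real assume "e > 0"
  then obtain u where u: "u : lft (ereal a) b" "u <= x0" "R u < b + e" using w unfolding winc_def by blast
  have uK: "u : K" by (rule wD(7)[OF u(1,2)])
  have "R' a < R' u" using m(2,3) aK(1) uK u(1) unfolding l monotone_on_def by auto
  then show "R' a <= b + e" using m(4)[OF uK] u(3) by simp
 qed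
 then show ?thesis unfolding inc_def using d m(2) aK by (intro exI[of _ K'] exI[of _ R']) auto
qed

lemma right_wall:
 assumes m: "mx a b" shows "(EX g. g ~: S & dec g b b) | (EX h. ps h a b)"
proof -
 note mD = mxD[OF m]
 have l: "lft (ereal a) b = {a<..<b}" by (rule lft_real[OF mD(2,3)])
 have "~ fr (lft (ereal a) (b + e))" if e: "e > 0" for e
 proof
  assume f: "fr (lft (ereal a) (b + e))"
  have "{a<..<b} \<subseteq> lft (ereal a) (b + e)" using mD(6) e unfolding lft_def by force
  from mxV[OF m lft_open lft_interval lft_I this f] have "b ~: lft (ereal a) (b + e)" by blast
  then show False using mD(1,3) e unfolding lft_def by simp
 qed
 moreover have "fr (lft (ereal a) b)" "lft (ereal a) b ~= {}" unfolding l using mD(1,4) by auto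
 ultimately have "(EX g. g ~: S & dec g b b) | (EX h K R x0. winc (ereal a) b h K R x0)" using wall mD(3) by blast
 then show ?thesis unfolding ps_def using winc_real[OF _ mD(2,3)] wincD(1) by blast
qed

lemma neg_ivl: "uminus ` {- v<..<- u} = {u<..<v}" "uminus ` {u<..<v} = {- v<..<- u}" for u v :: real
 by (auto simp: image_iff intro: bexI[of _ "- x" for x])

lemma mirror_mx_imp:
 assumes m: "mx a b" shows "curve_orbit.mx G \<phi> mI mc (- b) (- a)"
proof -
 interpret m: curve_orbit G X \<phi> mI mc by (rule mirror)
 note mD = mxD[OF m]
 have "- b ~: V & - a ~: V" if V: "open V" "is_interval V" "V \<subseteq> uminus ` I" "{- b<..<- a} \<subseteq> V" "m.fr V" for V
 proof -
  have "open (uminus ` V)" "is_interval (uminus ` V)" using V open_negations by auto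
  moreover have "uminus ` V \<subseteq> I" using V(3) by auto
  moreover have "{a<..<b} \<subseteq> uminus ` V" using image_mono[OF V(4), of uminus] neg_ivl by simp
  moreover have "fr (uminus ` V)" using V(5) unfolding mirror_fr .
  ultimately have "a ~: uminus ` V & b ~: uminus ` V" using m unfolding mx_def by blast
  then show ?thesis by force
 qed
 moreover have "m.fr {- b<..<- a}" using mD(4) by (simp only: mirror_fr neg_ivl(1))
 ultimately show ?thesis unfolding m.mx_def using mD by auto
qed

lemma mirror_mx: "curve_orbit.mx G \<phi> mI mc a b \<longleftrightarrow> mx (- b) (- a)"
proof -
 interpret m: curve_orbit G X \<phi> mI mc by (rule mirror)
 show ?thesis using mirror_mx_imp[of "-b" "-a"] m.mirror_mx_imp[of a b] by (auto simp: image_image)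
qed

lemma left_wall:
 assumes m: "mx a b" shows "(EX g. g ~: S & dec g a a) | (EX h. ps h a b)"
proof -
 interpret m: curve_orbit G X \<phi> mI mc by (rule mirror)
 have "(EX g. g ~: m.S & m.dec g (- a) (- a)) | (EX h. m.ps h (- b) (- a))"
  by (rule m.right_wall[OF mirror_mx_imp[OF m]])
 then show ?thesis
 proof
  assume "EX g. g ~: m.S & m.dec g (- a) (- a)"
  then show ?thesis unfolding mirror_S mirror_dec by auto
 next
  assume "EX h. m.ps h (- b) (- a)"
  then obtain h where h: "h ~: S" "inc h b a" unfolding m.ps_def mirror_S mirror_inc by auto
  have "inv h ~: S" using S_inv[of "inv h"] h lnkD(1)[OF inc_lnk[OF h(2)]] by auto
  then show ?thesis unfolding ps_def using inc_inv[OF h(2)] by blast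
 qed
qed

text \<open>A translation joins both ends, so it suffices that one end is obstructed by a
  translation; otherwise both ends carry reflections.\<close>

lemma mx_cases: "mx a b ==> (EX h. ps h a b) | ng a b"
 using left_wall right_wall unfolding ng_def by blast

text \<open>A point just beyond \<open>b\<close> would be reached both by the reflection and by the
  translation, so \<open>inv h \<otimes> g\<close> would lie in \<open>S\<close> and reverse
  orientation.\<close>

lemma ps_no_dec:
 assumes m: "mx a b" and p: "ps h a b" and g: "g ~: S" "dec g b b" shows False
proof -
 note mD = mxD[OF m]
 obtain K R x0 where w: "winc (ereal a) b h K R x0" using ps_winc[OF mD(1) p] by blast
 note wD = wincD[OF w]
 have l: "lft (ereal a) b = {a<..<b}" by (rule lft_real[OF mD(2,3)])
 define e where "e = min (b - a) (R x0 - b)"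
 have e: "e > 0" "e <= b - a" "e <= R x0 - b" using mD(1) wD(6) unfolding e_def by auto
 obtain s t where st: "b - e < s" "s < b" "b < t" "t < b + e" "dec g s t" using dec_left[OF g(2) e(1)] by blast
 obtain u where u: "u : {a<..<b}" "inc h u t" using hit[OF w st(3)] st e unfolding l by force
 have sm: "s : {a<..<b}" using st e by simp
 have "inv h \<otimes> g : S" by (rule fr_class[OF mD(4) dec_lnk[OF st(5)] inc_lnk[OF u(2)] sm u(1)])
 moreover have "dec (inv h \<otimes> g) s u" by (rule dec_inc[OF st(5) inc_inv[OF u(2)]])
 ultimately show False by (rule no_dec_S)
qed

text \<open>The interval slides along the domain of the maximal displacement by \<open>h\<close>,
  which is followed until an end of the slid interval meets the corresponding end of the other one;
  maximal intervals with a common left or right end coincide.\<close>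

lemma ps_all:
 assumes m: "mx a b" and p: "ps h a b" and m': "mx a' b'" shows "ps h a' b'"
proof -
 note mD = mxD[OF m] and mD' = mxD[OF m']
 have i: "inc h a b" "h ~: S" using p unfolding ps_def by auto
 obtain K R where K: "mdv h K R" "smono K R" "a : K" "R a = b" using inc_mdv[OF i(1)] by blast
 note d = mdvD[OF K(1)]
 have up: "x < R x" if "x : K" for x using no_fix_up[OF d K(2,3) _ that] K(4) mD(1) by simp
 have psx: "ps h x (R x)" if "x : K" for x unfolding ps_def inc_def using i(2) d K(2) that by blast
 have mxx: "mx x (R x)" if x: "x : K" for x
 proof (rule ps_mx[OF up[OF x] _ psx[OF x]])
  show "fr {x<..<R x}" by (rule qcont[OF d K(2) i(2) K(3) up[OF K(3)] _ x]) (use K(4) mD(4) in simp)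
 qed
 show ?thesis
 proof (cases "a' <= a")
  case True
  obtain q where q: "q : I" "b < q" using I_right[OF mD(3), of 1] by auto
  have "EX x:K. a' <= x & x <= a & R ` {x..a} \<subseteq> {a'..q} & (x = a' | R x = a' | R x = q)"
   by (rule box_left[OF K(1,3) mD'(2) True ivl_sub[OF interval_I mD'(2) q(1)]]) (use K(4) True mD(1) q in auto)
  then obtain x where x: "x : K" "a' <= x" "x <= a" "x = a' | R x = a' | R x = q" by blast
  have "R x <= R a" using K(2,3) x(1,3) unfolding monotone_on_def by (cases "x = a") (auto simp: less_imp_le)
  then have "x = a'" using x up[OF x(1)] q K(4) by auto
  then have aK: "a' : K" using x(1) by simp
  then have "R a' = b'" using mx_unique_left[OF mxx[OF aK] m'] by simp
  then show ?thesis using psx[OF aK] by simp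
 next
  case False
  \<comment> \<open>Otherwise the second interval could be enlarged to the left inside the free
    interval from \<open>a\<close> to \<open>b\<close>.\<close>
  have "b < b'"
  proof (rule ccontr)
   assume "~ b < b'"
   then have "fr {a<..<b'}" by (intro fr_mono[OF mD(4)]) auto
   then show False using mx_left[OF m' _ mD(2)] False by simp
  qed
  have ab': "a < b'" using \<open>b < b'\<close> mD(1) by simp
  have "EX x:K. a <= x & x <= b' & R ` {a..x} \<subseteq> {a..b'} & (x = b' | R x = a | R x = b')"
   by (rule box_right[OF K(1,3) mD'(3) _ ivl_sub[OF interval_I mD(2) mD'(3)]]) (use K(4) mD(1) \<open>b < b'\<close> in auto)
  then obtain x where x: "x : K" "a <= x" "x <= b'" "R ` {a..x} \<subseteq> {a..b'}" "x = b' | R x = a | R x = b'" by blast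
  have "R x <= b'" using x(2,4) by (metis atLeastAtMost_iff image_subset_iff order_refl)
  then have "R x = b'" using x(2,5) up[OF x(1)] by auto
  then have "x = a'" using mx_unique_right[OF _ m'] mxx[OF x(1)] by simp
  then show ?thesis using psx[OF x(1)] \<open>R x = b'\<close> by simp
 qed
qed

lemma ps_ng: "[|mx a b; ps h a b; mx a' b'; ng a' b'|] ==> False"
 using ps_all ps_no_dec unfolding ng_def by blast

lemma inj_mx:
 assumes m: "mx a b" and q: "q : S" "lnk q s t" "s : {a<..<b}" "t : {a<..<b}" shows "s = t"
proof -
 note mD = mxD[OF m]
 have l: "lft (ereal a) b = {a<..<b}" by (rule lft_real[OF mD(2,3)])
 from right_wall[OF m] show ?thesis
 proof
  assume "EX g. g ~: S & dec g b b"
  then show ?thesis using inj_dec[of "ereal a" b] mD(4) q unfolding l by blast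
 next
  assume "EX h. ps h a b"
  then obtain h K R x0 where "winc (ereal a) b h K R x0" using ps_winc[OF mD(1)] by blast
  then show ?thesis using inj_winc[of "ereal a" b] mD(3,4) q unfolding l by blast
 qed
qed

section \<open>Images of free and maximal intervals under displacements\<close>

lemma pre_interval:
 fixes R :: "real => real"
 assumes K: "is_interval K" and V: "is_interval V" and m: "smono K R | santi K R"
 shows "is_interval {x : K. R x : V}"
 unfolding is_interval_1
proof (intro ballI allI impI)
 fix x z y assume xz: "x : {x : K. R x : V}" "z : {x : K. R x : V}" "x <= y & y <= z"
 then have yK: "y : K" using ivl_sub[OF K, of x z] by auto
 have "R x <= R y & R y <= R z | R z <= R y & R y <= R x"
 proof (cases "x = y | y = z")
  case True
  then show ?thesis by auto
 next
  case False
  then have "x < y" "y < z" using xz by auto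
  then show ?thesis using m xz yK unfolding monotone_on_def by (auto simp: less_imp_le)
 qed
 then have "R y : V" using ivl_sub[OF V, of "R x" "R z"] ivl_sub[OF V, of "R z" "R x"] xz by auto
 then show "y : {x : K. R x : V}" using yK by simp
qed

lemma dv_pre:
 assumes d: "dv g K R" and V: "open V" "is_interval V" shows "dv g {x : K. R x : V} R"
proof (rule dv_restrict[OF d])
 show "is_interval {x : K. R x : V}" by (rule pre_interval[OF dvD(3)[OF d] V(2) dv_mono[OF d]])
 have "{x : K. R x : V} = K \<inter> R -` V" by auto
 then show "open {x : K. R x : V}" using continuous_open_preimage[OF dvD(5,2)[OF d] V(1)] by simp
qed auto

lemma dv_comp_pre:
 assumes d: "dv g K R" and d': "dv h K' R'" shows "dv (h \<otimes> g) {x : K. R x : K'} (R' \<circ> R)"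
 using dv_comp[OF dv_pre[OF d dvD(2,3)[OF d']] d'] by blast

text \<open>Displacements within \<open>U\<close> become displacements within \<open>V\<close> after
  conjugation by \<open>g\<close>, and conjugation by a displacing element preserves
  \<open>S\<close>.\<close>

lemma fr_pre:
 assumes d: "dv g K R" and U: "U \<subseteq> K" "R ` U \<subseteq> V" and f: "fr V" shows "fr U"
 unfolding fr_def
proof (intro allI impI)
 fix k s t assume k: "s : U" "t : U" "lnk k s t"
 have l: "lnk g s (R s)" "lnk g t (R t)" using d U k unfolding lnk_def by blast+
 have G: "g : carrier G" "k : carrier G" using lnkD(1) l k by blast+
 have "lnk (g \<otimes> (k \<otimes> inv g)) (R s) (R t)" by (rule lnk_lnk[OF lnk_lnk[OF lnk_inv[OF l(1)] k(3)] l(2)])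
 then have "g \<otimes> (k \<otimes> inv g) : S" using frD[OF f] U k by blast
 then have "inv g \<otimes> (g \<otimes> (k \<otimes> inv g)) \<otimes> g : S" by (rule norm_S[OF l(1)])
 moreover have "inv g \<otimes> (g \<otimes> (k \<otimes> inv g)) \<otimes> g = k"
  using G by (simp add: grp.m_assoc[symmetric]) (simp add: grp.m_assoc)
 ultimately show "k : S" by simp
qed

lemma fr_img:
 assumes d: "dv g K R" and U: "U \<subseteq> K" and f: "fr U" shows "fr (R ` U)"
 by (rule fr_pre[OF dv_inverse[OF d] image_mono[OF U] _ f]) (use dv_inj[OF d] U in \<open>auto simp: subset_iff\<close>)

text \<open>An open free interval around the image is pulled back by \<open>R\<close> to one around
  the original interval.\<close>

lemma mx_image_aux:
 assumes d: "dv g K R" and m: "mx l r" and K: "{l..r} \<subseteq> K"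
  and im: "R ` {l<..<r} = {l'<..<r'}" and e: "{l', r'} = {R l, R r}" and lt: "l' < r'"
 shows "mx l' r'"
proof -
 note mD = mxD[OF m]
 have lrK: "l : K" "r : K" using K mD(1) by (auto simp: subset_iff)
 have I: "l' : I" "r' : I" using e dvD(8)[OF d lrK(1)] dvD(8)[OF d lrK(2)] by (auto simp: doubleton_eq_iff)
 have sub: "{l<..<r} \<subseteq> K" using K by (auto simp: subset_iff)
 have f: "fr {l'<..<r'}" using fr_img[OF d sub mD(4)] unfolding im .
 have "l' ~: V & r' ~: V" if V: "open V" "is_interval V" "V \<subseteq> I" "{l'<..<r'} \<subseteq> V" "fr V" for V
 proof -
  define W where "W = {x : K. R x : V}"
  have dW: "dv g W R" unfolding W_def by (rule dv_pre[OF d V(1,2)])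
  have "R ` {l<..<r} \<subseteq> V" using im V(4) by simp
  then have "{l<..<r} \<subseteq> W" unfolding W_def using sub by blast
  moreover have "fr W" by (rule fr_pre[OF d _ _ V(5)]) (auto simp: W_def)
  ultimately have "l ~: W & r ~: W" using m dvD(2,3,4)[OF dW] unfolding mx_def by blast
  then have "R l ~: V" "R r ~: V" unfolding W_def using lrK by auto
  then show ?thesis using e by (auto simp: doubleton_eq_iff)
 qed
 then show ?thesis unfolding mx_def using lt I f by blast
qed

lemma mono_image_ivl:
 fixes R :: "real => real"
 assumes c: "continuous_on {l..r} R" and lr: "l <= r"
 shows "smono {l..r} R ==> R ` {l..r} = {R l..R r} & R ` {l<..<r} = {R l<..<R r}"
  and "santi {l..r} R ==> R ` {l..r} = {R r..R l} & R ` {l<..<r} = {R r<..<R l}"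
proof -
 assume m: "smono {l..r} R"
 then have lt: "!!x y. [|l <= x; x < y; y <= r|] ==> R x < R y" unfolding monotone_on_def by auto
 have 1: "EX x>=l. x <= r & R x = y" if "R l <= y" "y <= R r" for y by (rule IVT') (use that c lr in auto)
 have le: "R x <= R y" if "l <= x" "x <= y" "y <= r" for x y using lt[of x y] that by (cases "x = y") auto
 have a: "R ` {l..r} = {R l..R r}" using le 1 by (fastforce simp: image_iff)
 have "R ` {l<..<r} = {R l<..<R r}"
 proof (intro equalityI subsetI)
  fix y assume y: "y : {R l<..<R r}"
  then obtain x where x: "l <= x" "x <= r" "R x = y" using 1[of y] by auto
  then have "x ~= l" "x ~= r" using y by auto
  then show "y : R ` {l<..<r}" using x by auto
 qed (use lt in auto)
 then show "R ` {l..r} = {R l..R r} & R ` {l<..<r} = {R l<..<R r}" using a by blast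
next
 assume m: "santi {l..r} R"
 then have lt: "!!x y. [|l <= x; x < y; y <= r|] ==> R y < R x" unfolding monotone_on_def by auto
 have 1: "EX x>=l. x <= r & R x = y" if "R r <= y" "y <= R l" for y by (rule IVT2') (use that c lr in auto)
 have le: "R y <= R x" if "l <= x" "x <= y" "y <= r" for x y using lt[of x y] that by (cases "x = y") auto
 have a: "R ` {l..r} = {R r..R l}" using le 1 by (fastforce simp: image_iff)
 have "R ` {l<..<r} = {R r<..<R l}"
 proof (intro equalityI subsetI)
  fix y assume y: "y : {R r<..<R l}"
  then obtain x where x: "l <= x" "x <= r" "R x = y" using 1[of y] by auto
  then have "x ~= l" "x ~= r" using y by auto
  then show "y : R ` {l<..<r}" using x by auto
 qed (use lt in auto)
 then show "R ` {l..r} = {R r..R l} & R ` {l<..<r} = {R r<..<R l}" using a by blast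
qed

lemma mx_image:
 assumes d: "dv g K R" and m: "mx l r" and K: "{l..r} \<subseteq> K" and im: "R ` {l..r} = {l'..r'}"
 shows "mx l' r'" "(smono K R & R l = l' & R r = r') | (santi K R & R l = r' & R r = l')"
proof -
 note mD = mxD[OF m]
 have c: "continuous_on {l..r} R" using continuous_on_subset[OF dvD(5)[OF d] K] .
 have lr: "l : {l..r}" "r : {l..r}" using mD(1) by auto
 have "mx l' r' & ((smono K R & R l = l' & R r = r') | (santi K R & R l = r' & R r = l'))"
  using dv_mono[OF d]
 proof
  assume mo: "smono K R"
  have i: "R ` {l..r} = {R l..R r}" "R ` {l<..<r} = {R l<..<R r}"
   using mono_image_ivl(1)[OF c less_imp_le[OF mD(1)] monotone_on_subset[OF mo K]] by auto
  have lt: "R l < R r" using mo K lr mD(1) unfolding monotone_on_def by blast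
  then have "R l = l'" "R r = r'" using i(1) im by (auto simp: Icc_eq_Icc)
  then show ?thesis using mx_image_aux[OF d m K i(2) _ lt] mo by auto
 next
  assume mo: "santi K R"
  have i: "R ` {l..r} = {R r..R l}" "R ` {l<..<r} = {R r<..<R l}"
   using mono_image_ivl(2)[OF c less_imp_le[OF mD(1)] monotone_on_subset[OF mo K]] by auto
  have lt: "R r < R l" using mo K lr mD(1) unfolding monotone_on_def by blast
  then have "R l = r'" "R r = l'" using i(1) im by (auto simp: Icc_eq_Icc)
  then show ?thesis using mx_image_aux[OF d m K i(2) _ lt] mo by auto
 qed
 then show "mx l' r'" "(smono K R & R l = l' & R r = r') | (santi K R & R l = r' & R r = l')" by auto
qed

section \<open>Compact maximal interval or isolated reflection\<close>

definition mfr :: "real set => real set => bool" where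
 "mfr J U \<longleftrightarrow> open U & is_interval U & U \<subseteq> J & U ~= {} & fr U &
  (ALL V. open V --> is_interval V --> U \<subseteq> V --> V \<subseteq> J --> fr V --> V = U)"

lemma mfrD:
 assumes "mfr J U"
 shows "open U" "is_interval U" "U \<subseteq> J" "U ~= {}" "fr U"
  "[|open V; is_interval V; U \<subseteq> V; V \<subseteq> J; fr V|] ==> V = U"
 using assms unfolding mfr_def by auto

text \<open>Zorn's lemma: the union of a chain is free because any two of its points already lie in
  one member.\<close>

lemma mfr_exists:
 assumes U0: "open U0" "is_interval U0" "U0 \<subseteq> J" "U0 ~= {}" "fr U0"
 shows "EX U. mfr J U & U0 \<subseteq> U"
proof -
 define A where "A = {U. U0 \<subseteq> U & open U & is_interval U & U \<subseteq> J & fr U}"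
 have ne: "A ~= {}" unfolding A_def using U0 by blast
 have "\<Union>\<C> : A" if C: "\<C> ~= {}" "subset.chain A \<C>" for \<C>
 proof -
  have CA: "\<C> \<subseteq> A" and tot: "!!P Q. [|P : \<C>; Q : \<C>|] ==> P \<subseteq> Q | Q \<subseteq> P"
   using C(2) unfolding subset.chain_def by blast+
  have "connected (\<Union>\<C>)"
  proof (rule connected_Union)
   show "connected s" if "s : \<C>" for s using that CA unfolding A_def by (auto intro: is_interval_connected)
   show "\<Inter>\<C> ~= {}" using CA U0(4) unfolding A_def by blast
  qed
  then have "is_interval (\<Union>\<C>)" by (simp add: is_interval_connected_1)
  moreover have "open (\<Union>\<C>)" using CA unfolding A_def by (intro open_Union) blast
  moreover have "U0 \<subseteq> \<Union>\<C>" "\<Union>\<C> \<subseteq> J" using CA C(1) unfolding A_def by blast+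
  moreover have "fr (\<Union>\<C>)"
   unfolding fr_def
  proof (intro allI impI)
   fix g s t assume st: "s : \<Union>\<C>" "t : \<Union>\<C>" "lnk g s t"
   then obtain P Q where "P : \<C>" "Q : \<C>" "s : P" "t : Q" by blast
   then obtain R where R: "R : \<C>" "s : R" "t : R" using tot by blast
   then have "fr R" using CA unfolding A_def by blast
   then show "g : S" using frD R st by blast
  qed
  ultimately show ?thesis unfolding A_def by blast
 qed
 then have "EX U:A. ALL V:A. U \<subseteq> V --> V = U" using subset_Zorn_nonempty[OF ne] by blast
 then obtain U where U: "U : A" "!!V. [|V : A; U \<subseteq> V|] ==> V = U" by blast
 have U': "U0 \<subseteq> U" "open U" "is_interval U" "U \<subseteq> J" "fr U" using U(1) unfolding A_def by auto
 have "V = U" if "open V" "is_interval V" "U \<subseteq> V" "V \<subseteq> J" "fr V" for V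
  by (rule U(2)) (use that U' in \<open>auto simp: A_def\<close>)
 then have "mfr J U" unfolding mfr_def using U' U0(4) by auto
 then show ?thesis using U(1) unfolding A_def by blast
qed

lemma mfr_mx:
 assumes m: "mfr J {a<..<b}" and J: "open J" "is_interval J" "J \<subseteq> I" and ab: "a : J" "b : J"
 shows "mx a b"
proof -
 note mD = mfrD[OF m]
 have "a ~: V & b ~: V" if V: "open V" "is_interval V" "V \<subseteq> I" "{a<..<b} \<subseteq> V" "fr V" for V
 proof -
  have "V \<inter> J = {a<..<b}"
  proof (rule mD(6))
   show "open (V \<inter> J)" using V J by blast
   show "is_interval (V \<inter> J)" using V J is_interval_Int by blast
   show "{a<..<b} \<subseteq> V \<inter> J" using V mD(3) by blast
   show "fr (V \<inter> J)" by (rule fr_mono[OF V(5)]) blast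
  qed blast
  moreover have "a ~: {a<..<b}" "b ~: {a<..<b}" by auto
  ultimately show ?thesis using ab by blast
 qed
 then show ?thesis unfolding mx_def using mD(4,5) ab J(3) by auto
qed

lemma open_interval_bounds_above:
 fixes U :: "real set"
 assumes U: "open U" "is_interval U" "u : U" and J: "is_interval J" "U \<subseteq> J" and x: "x : J" "x ~: U" "u < x"
 shows "Sup U : J & Sup U ~: U & u < Sup U & (ALL v:U. v < Sup U) & (ALL y. u <= y & y < Sup U --> y : U)"
proof -
 have lt: "v < x" if "v : U" for v
 proof (rule ccontr)
  assume "~ v < x"
  then have "x : {u..v}" using x by auto
  then show False using ivl_sub[OF U(2,3) that] x by blast
 qed
 have bdd: "bdd_above U" using lt by (meson bdd_aboveI less_imp_le)
 have le: "v <= Sup U" if "v : U" for v using cSup_upper[OF that bdd] .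
 have sx: "Sup U <= x" using cSup_least[of U x] U(3) lt by (metis empty_iff less_imp_le)
 have nU: "Sup U ~: U"
 proof
  assume "Sup U : U"
  then obtain v where "v : U" "Sup U < v" using open_two U(1) by blast
  then show False using le by force
 qed
 have lt': "v < Sup U" if "v : U" for v using le[OF that] nU that by (metis less_le)
 have "y : U" if y: "u <= y" "y < Sup U" for y
 proof -
  obtain v where "v : U" "y < v" using y(2) less_cSup_iff[OF _ bdd] U(3) by blast
  then show ?thesis using ivl_sub[OF U(2,3)] y(1) by (meson atLeastAtMost_iff less_imp_le subsetD)
 qed
 moreover have "Sup U : J" using ivl_sub[OF J(1), of u x] J(2) U(3) x(1) sx le[OF U(3)] by (meson atLeastAtMost_iff subsetD)
 ultimately show ?thesis using nU lt' U(3) by blast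
qed

lemma open_interval_bounds_below:
 fixes U :: "real set"
 assumes U: "open U" "is_interval U" "u : U" and J: "is_interval J" "U \<subseteq> J" and x: "x : J" "x ~: U" "x < u"
 shows "EX p:J. p ~: U & p < u & (ALL v:U. p < v) & (ALL y. p < y & y <= u --> y : U)"
proof -
 have mem: "y : uminus ` V \<longleftrightarrow> - y : V" for y :: real and V by force
 define s where "s = Sup (uminus ` U)"
 have s: "s : uminus ` J & s ~: uminus ` U & - u < s & (ALL v:uminus ` U. v < s) &
   (ALL y. - u <= y & y < s --> y : uminus ` U)"
  unfolding s_def
  by (rule open_interval_bounds_above[of "uminus ` U" "-u" "uminus ` J" "-x"])
   (use U J x open_negations in \<open>auto simp: mem\<close>)
 show ?thesis
 proof (intro bexI[of _ "- s"] conjI ballI allI impI)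
  show "- s : J" "- s ~: U" "- s < u" using s mem by auto
  show "- s < v" if "v : U" for v using s that by force
  show "y : U" if "- s < y & y <= u" for y
  proof -
   have "- u <= - y & - y < s" using that by linarith
   then have "- y : uminus ` U" using s by blast
   then show ?thesis by auto
  qed
 qed
qed

definition tau_split :: "real set => real => bool" where
 "tau_split J \<tau> \<longleftrightarrow> \<tau> : J & (EX g. g ~: S & dec g \<tau> \<tau>) & fr (J \<inter> {..<\<tau>}) & fr (J \<inter> {\<tau><..})"

text \<open>The wall at the right end \<open>b\<close> of a maximal free interval decides. A
  translation yields compact maximal intervals close to the wall. A reflection makes a right
  neighbourhood of \<open>b\<close> free, and a maximal free interval \<open>V\<close> containing it
  begins at \<open>b\<close>. If \<open>V\<close> ends inside \<open>J\<close>, it gives the wanted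
  interval; if \<open>U\<close> begins inside \<open>J\<close>, then \<open>U\<close> does;
  otherwise \<open>b\<close> splits \<open>J\<close> into two free halves.\<close>

lemma dich_above:
 assumes J: "open J" "is_interval J" "J \<subseteq> I" and m: "mfr J U" and u: "u : U" and x: "x : J" "x ~: U" "u < x"
 shows "(EX a b. a : J & b : J & mx a b) | (EX \<tau>. tau_split J \<tau>)"
proof -
 note mD = mfrD[OF m]
 define b where "b = Sup U"
 have b: "b : J" "b ~: U" "u < b" "!!v. v : U ==> v < b" "!!y. [|u <= y; y < b|] ==> y : U"
  using open_interval_bounds_above[OF mD(1,2) u J(2) mD(3) x] unfolding b_def by auto
 have bI: "b : I" using b(1) J(3) by blast
 \<comment> \<open>The infimum in the extended reals, so that \<open>U\<close> has the form
   \<open>lft a b\<close> also when it is unbounded below.\<close>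
 define a where "a = Inf (ereal ` U)"
 have au: "a < ereal v" if v: "v : U" for v
 proof -
  obtain e where e: "e > 0" "ball v e \<subseteq> U" using mD(1) v open_contains_ball by blast
  have "v - e/2 : ball v e" using e(1) by (auto simp: dist_real_def)
  then have "a <= ereal (v - e/2)" unfolding a_def using e(2) by (intro Inf_lower) blast
  also have "\<dots> < ereal v" using e(1) by simp
  finally show ?thesis .
 qed
 have aw: "EX v:U. v < y" if y: "a < ereal y" for y
  using y unfolding a_def Inf_less_iff by auto
 have Ul: "U = lft a b"
 proof (intro equalityI subsetI)
  fix y assume y: "y : lft a b"
  then obtain v where v: "v : U" "v < y" using aw unfolding lft_def by blast
  show "y : U"
  proof (cases "u <= y")
   case True then show ?thesis using b(5) y unfolding lft_def by blast
  next
   case False then show ?thesis using ivl_sub[OF mD(2) v(1) u] v(2) by (meson atLeastAtMost_iff less_imp_le not_le subsetD)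
  qed
 qed (use au b(4) mD(3) J(3) in \<open>auto simp: lft_def\<close>)
 have f: "fr (lft a b)" and ne: "lft a b ~= {}" using mD(4,5) Ul by auto
 obtain r where r: "r > 0" "ball b r \<subseteq> J" using J(1) b(1) open_contains_ball by blast
 have nf: "~ fr (lft a (b + e))" if e: "e > 0" for e
 proof
  assume fe: "fr (lft a (b + e))"
  have "lft a (b + e) \<inter> J = U"
  proof (rule mD(6))
   show "open (lft a (b + e) \<inter> J)" using lft_open J by blast
   show "is_interval (lft a (b + e) \<inter> J)" using lft_interval J is_interval_Int by blast
   show "U \<subseteq> lft a (b + e) \<inter> J" using Ul mD(3) e unfolding lft_def by auto
   show "fr (lft a (b + e) \<inter> J)" by (rule fr_mono[OF fe]) blast
  qed blast
  moreover have "b : lft a (b + e) \<inter> J"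
   using b(1,3) bI e less_trans[OF au[OF u], of "ereal b"] unfolding lft_def by simp
  ultimately show False using b(2) by blast
 qed
 from wall[OF f ne bI nf] show ?thesis
 proof
  assume "EX h K R x0. winc a b h K R x0"
  then obtain h K R x0 where w: "winc a b h K R x0" by blast
  obtain v where v: "v : lft a b" "v <= x0" "R v < b + r" using w r(1) unfolding winc_def by blast
  have "b < R v" using wincD(8)[OF w v(1,2)] .
  then have "R v : ball b r" using v(3) by (auto simp: dist_real_def)
  then have "R v : J" using r(2) by blast
  moreover have "v : J" using v(1) Ul mD(3) by blast
  ultimately show ?thesis using winc_mx(1)[OF f bI w v(1,2)] by blast
 next
  assume "EX g. g ~: S & dec g b b"
  then obtain g where g: "g ~: S" "dec g b b" by blast
  have gnot: "b ~: V" if "fr V" for V using frD[OF that _ _ dec_lnk[OF g(2)]] g(1) by blast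
  obtain K R where d: "dv g K R" "santi K R" "b : K" "R b = b" using g(2) unfolding dec_def by blast
  obtain e where e: "e > 0" "ball b e \<subseteq> K" "R ` ball b e \<subseteq> {u<..}"
   using dv_local[OF d(1,3) open_greaterThan, of u] d(4) b(3) by auto
  \<comment> \<open>Small enough to be reflected into \<open>U\<close> and to stay inside
    \<open>J\<close>.\<close>
  define V0 where "V0 = {b<..<b + min e r}"
  have V0: "open V0" "is_interval V0" "V0 ~= {}" unfolding V0_def using e(1) r(1) by auto
  have V0b: "V0 \<subseteq> ball b e" "V0 \<subseteq> J" using r(2) unfolding V0_def by (force simp: dist_real_def)+
  have im: "R ` V0 \<subseteq> U"
  proof
   fix y assume "y : R ` V0"
   then obtain z where z: "z : V0" "y = R z" by blast
   have zK: "z : K" "b < z" using z(1) V0b e(2) unfolding V0_def by auto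
   have "R z < R b" using d(2,3) zK unfolding monotone_on_def by blast
   moreover have "u < R z" using e(3) z(1) V0b(1) by blast
   ultimately show "y : U" using b(5)[of y] d(4) z(2) by simp
  qed
  have "V0 \<subseteq> K" using V0b(1) e(2) by blast
  then have fV0: "fr V0" by (rule fr_pre[OF d(1) _ im mD(5)])
  obtain V where V: "mfr J V" "V0 \<subseteq> V" using mfr_exists[OF V0(1,2) V0b(2) V0(3) fV0] by blast
  note vD = mfrD[OF V(1)]
  have bV: "b ~: V" using gnot[OF vD(5)] .
  define w where "w = b + min e r / 2"
  have w: "w : V0" "b < w" unfolding w_def V0_def using e(1) r(1) by auto
  then have wV: "w : V" using V(2) by blast
  have Vb: "b < v" if "v : V" for v
  proof (rule ccontr)
   assume "~ b < v"
   then have "b : {v..w}" using w by simp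
   then show False using ivl_sub[OF vD(2) that wV] bV by blast
  qed
  have low: "y : V" if "b < y" "y <= w" for y
  proof -
   have "y : V0" using that w unfolding V0_def by simp
   then show ?thesis using V(2) by blast
  qed
  show ?thesis
  proof (cases "EX x:J. w < x & x ~: V")
   case True
   then obtain x where "x : J" "w < x" "x ~: V" by blast
   then have dd: "Sup V : J" "w < Sup V" "!!v. v : V ==> v < Sup V" "!!y. [|w <= y; y < Sup V|] ==> y : V"
    using open_interval_bounds_above[OF vD(1,2) wV J(2) vD(3)] by auto
   have "V = {b<..<Sup V}"
   proof (intro equalityI subsetI)
    fix y assume "y : {b<..<Sup V}"
    then show "y : V" using low[of y] dd(4)[of y] by (cases "y <= w") auto
   qed (use Vb dd(3) in auto)
   then have "mx b (Sup V)" using mfr_mx[OF _ J b(1) dd(1)] V(1) by metis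
   then show ?thesis using b(1) dd(1) by blast
  next
   case False
   have Vall: "J \<inter> {b<..} \<subseteq> V"
   proof
    fix y assume y: "y : J \<inter> {b<..}"
    then show "y : V" using low[of y] False by (cases "y <= w") auto
   qed
   show ?thesis
   proof (cases "EX x:J. x < u & x ~: U")
    case True
    then obtain x where x': "x : J" "x < u" "x ~: U" by blast
    obtain p where p: "p : J" "p < u" "!!v. v : U ==> p < v" "!!y. [|p < y; y <= u|] ==> y : U"
     using open_interval_bounds_below[OF mD(1,2) u J(2) mD(3) x'(1,3,2)] by auto
    have "U = {p<..<b}"
    proof (intro equalityI subsetI)
     fix y assume "y : {p<..<b}"
     then show "y : U" using p(4)[of y] b(5)[of y] by (cases "y <= u") auto
    qed (use p(3) b(4) in auto)
    then have "mx p b" using mfr_mx[OF _ J p(1) b(1)] m by metis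
    then show ?thesis using b(1) p(1) by blast
   next
    case noU: False
    have "J \<inter> {..<b} \<subseteq> U"
    proof
     fix y assume y: "y : J \<inter> {..<b}"
     then show "y : U" using b(5)[of y] noU u by (cases "y < u") auto
    qed
    then have "tau_split J b" unfolding tau_split_def
     using b(1) g fr_mono[OF mD(5)] fr_mono[OF vD(5) Vall] by blast
    then show ?thesis by blast
   qed
  qed
 qed
qed

end

lemma (in curve_orbit) mirror_mfr_imp:
 assumes m: "mfr J U" shows "curve_orbit.mfr G \<phi> mI mc (uminus ` J) (uminus ` U)"
proof -
 interpret m: curve_orbit G X \<phi> mI mc by (rule mirror)
 note mD = mfrD[OF m]
 have nn: "uminus ` uminus ` V = V" for V :: "real set" by (simp add: image_image)
 have "V = uminus ` U" if V: "open V" "is_interval V" "uminus ` U \<subseteq> V" "V \<subseteq> uminus ` J" "m.fr V" for V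
 proof -
  have "uminus ` V = U"
  proof (rule mD(6))
   show "open (uminus ` V)" "is_interval (uminus ` V)" using V(1,2) open_negations by auto
   show "U \<subseteq> uminus ` V" "uminus ` V \<subseteq> J" using image_mono[OF V(3), of uminus] image_mono[OF V(4), of uminus] nn by auto
   show "fr (uminus ` V)" using V(5) unfolding mirror_fr .
  qed
  then show ?thesis using nn by metis
 qed
 moreover have "m.fr (uminus ` U)" unfolding mirror_fr nn by (rule mD(5))
 ultimately show ?thesis unfolding m.mfr_def using mD(1-4) open_negations by auto
qed

context curve_orbit
begin

theorem dichotomy:
 assumes J: "open J" "is_interval J" "J \<subseteq> I" and U0: "open U0" "is_interval U0" "U0 \<subseteq> J" "U0 ~= {}" "fr U0"
  and nf: "~ fr J"
 shows "(EX a b. a : J & b : J & mx a b) | (EX \<tau>. tau_split J \<tau>)"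
proof -
 obtain U where U: "mfr J U" using mfr_exists[OF U0] by blast
 note mD = mfrD[OF U]
 obtain x where x: "x : J" "x ~: U" using nf mD(3,5) by (metis subsetI subset_antisym)
 obtain u where u: "u : U" using mD(4) by blast
 show ?thesis
 proof (cases "u < x")
  case True
  then show ?thesis using dich_above[OF J U u x] by blast
 next
  case False
  then have lt: "x < u" using u x by (cases "x = u") auto
  interpret m: curve_orbit G X \<phi> mI mc by (rule mirror)
  have mem: "y : uminus ` V \<longleftrightarrow> - y : V" for y :: real and V by force
  have "(EX a b. a : uminus ` J & b : uminus ` J & m.mx a b) | (EX \<tau>. m.tau_split (uminus ` J) \<tau>)"
   by (rule m.dich_above[OF _ _ _ mirror_mfr_imp[OF U], of "-u" "-x"]) (use J u x lt open_negations in \<open>auto simp: mem\<close>)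
  then show ?thesis
  proof
   assume "EX a b. a : uminus ` J & b : uminus ` J & m.mx a b"
   then show ?thesis unfolding mirror_mx mem by blast
  next
   assume "EX \<tau>. m.tau_split (uminus ` J) \<tau>"
   then obtain \<tau> where t: "- \<tau> : J" "EX g. g ~: S & dec g (- \<tau>) (- \<tau>)"
    "fr (uminus ` (uminus ` J \<inter> {..<\<tau>}))" "fr (uminus ` (uminus ` J \<inter> {\<tau><..}))"
    unfolding m.tau_split_def mirror_S mirror_dec mirror_fr mem by blast
   have "uminus ` (uminus ` J \<inter> {..<\<tau>}) = J \<inter> {- \<tau><..}" "uminus ` (uminus ` J \<inter> {\<tau><..}) = J \<inter> {..<- \<tau>}"
    by (auto simp: mem)
   then have "tau_split J (- \<tau>)" unfolding tau_split_def using t by simp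
   then show ?thesis by blast
  qed
 qed
qed

text \<open>The centre of a reflection outside \<open>S\<close> lies in no free set, hence in
  neither of the two halves at \<open>\<tau>'\<close>.\<close>

lemma tau_unique: assumes t: "tau_split J \<tau>" and t': "fr (J \<inter> {..<\<tau>'})" "fr (J \<inter> {\<tau>'<..})" shows "\<tau> = \<tau>'"
proof (rule ccontr)
 assume "\<tau> ~= \<tau>'"
 then have "\<tau> : J \<inter> {..<\<tau>'} | \<tau> : J \<inter> {\<tau>'<..}" using t unfolding tau_split_def by auto
 moreover obtain g where "g ~: S" "lnk g \<tau> \<tau>" using t dec_lnk unfolding tau_split_def by blast
 ultimately show False using frD t' by blast
qed

lemma mx_no_tau:
 assumes t: "fr (J \<inter> {..<\<tau>})" "fr (J \<inter> {\<tau><..})" and g: "\<tau> ~: {a<..<b}"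
  and m: "mx a b" and J: "open J" "is_interval J" "J \<subseteq> I" "a : J" "b : J"
 shows False
proof -
 note mD = mxD[OF m]
 have "b <= \<tau> | \<tau> <= a" using g by auto
 moreover have sub: "{a<..<b} \<subseteq> J" using ivl_sub[OF J(2,4,5)] by force
 moreover have "is_interval (J \<inter> {..<\<tau>})" by (rule is_interval_Int[OF J(2)]) (simp add: is_interval_1)
 moreover have "is_interval (J \<inter> {\<tau><..})" by (rule is_interval_Int[OF J(2)]) (simp add: is_interval_1)
 moreover have "open (J \<inter> {..<\<tau>})" "open (J \<inter> {\<tau><..})" using J(1) by auto
 ultimately have "a ~: J \<inter> {..<\<tau>} | b ~: J \<inter> {\<tau><..}" "b <= \<tau> ==> a ~: J \<inter> {..<\<tau>}" "\<tau> <= a ==> b ~: J \<inter> {\<tau><..}"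
  using mxV[OF m, of "J \<inter> {..<\<tau>}"] mxV[OF m, of "J \<inter> {\<tau><..}"] t J(3) by fastforce+
 then show False using \<open>b <= \<tau> | \<tau> <= a\<close> mD(1) J(4,5) by auto
qed

section \<open>Chains of translates\<close>

text \<open>Translation and reflection at the right end in one form: \<open>w\<close> carries an end
  \<open>e\<close> of the interval to \<open>r\<close>, so that the displaced copy continues beyond
  \<open>r\<close> towards the image of the other end \<open>z\<close>.\<close>

lemma next_wall:
 assumes m: "mx l r"
 shows "EX w K R e z. w : carrier G & mdv w K R & e : K & R e = r &
  ((e = l & z = r & smono K R) | (e = r & z = l & santi K R))"
 using right_wall[OF m]
proof
 assume "EX g. g ~: S & dec g r r"
 then obtain g where "dec g r r" by blast
 then show ?thesis using dec_mdv[of g r r] dvD(1)[OF mdvD] by metis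
next
 assume "EX h. ps h l r"
 then obtain h where "inc h l r" unfolding ps_def by blast
 then show ?thesis using inc_mdv[of h l r] dvD(1)[OF mdvD] by metis
qed

lemma next_exit:
 assumes m: "mx l r" and k: "mdv w K R" "e : K" "R e = r"
  and ez: "(e = l & z = r & smono K R) | (e = r & z = l & santi K R)"
  and q: "q : I" "r <= q"
 shows "(z : K & R z <= q) | (EX x:K. l <= x & x <= r & R x = q)"
 using ez
proof
 note mD = mxD[OF m]
 assume a: "e = l & z = r & smono K R"
 have lK: "l : K" using k a by simp
 have "EX x:K. l <= x & x <= r & R ` {l..x} \<subseteq> {l..q} & (x = r | R x = l | R x = q)"
  by (rule box_right[OF k(1) lK mD(3) _ ivl_sub[OF interval_I mD(2) q(1)]]) (use k(3) a mD(1) q in auto)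
 then obtain x where x: "x : K" "l <= x" "x <= r" "R ` {l..x} \<subseteq> {l..q}" "x = r | R x = l | R x = q" by blast
 have "r <= R x" using a k(2,3) x(1,2) unfolding monotone_on_def by (cases "x = l") (auto simp: less_imp_le)
 moreover have "R x <= q" using x(2,4) by (metis atLeastAtMost_iff image_subset_iff order_refl)
 ultimately show ?thesis using x a mD(1) by auto
next
 note mD = mxD[OF m]
 assume a: "e = r & z = l & santi K R"
 have rK: "r : K" using k a by simp
 have "EX x:K. l <= x & x <= r & R ` {x..r} \<subseteq> {l..q} & (x = l | R x = l | R x = q)"
  by (rule box_left[OF k(1) rK mD(2) _ ivl_sub[OF interval_I mD(2) q(1)]]) (use k(3) a mD(1) q in auto)
 then obtain x where x: "x : K" "l <= x" "x <= r" "R ` {x..r} \<subseteq> {l..q}" "x = l | R x = l | R x = q" by blast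
 have "r <= R x"
 proof (cases "x = r")
  case False
  then have "R r < R x" using a rK x(1,3) unfolding monotone_on_def by (metis less_le)
  then show ?thesis using k(3) a by simp
 qed (use k(3) a in simp)
 moreover have "R x <= q" using x(3,4) by (metis atLeastAtMost_iff image_subset_iff order_refl)
 ultimately show ?thesis using x a mD(1) by auto
qed

definition lk :: "real => real => 'g => real => real => bool" where
 "lk a b g l r \<longleftrightarrow> (EX K R. dv g K R & {a..b} \<subseteq> K & R ` {a..b} = {l..r})"

text \<open>The last link of a chain: only the part \<open>P\<close> of the interval is carried onto
  the rest \<open>C\<close> of the domain, and an end of the interval goes to the cut point
  \<open>r\<close>.\<close>

definition endlk :: "real => real => 'g => real set => real => bool" where
 "endlk a b g C r \<longleftrightarrow> (EX K R P. dv g K R & P \<subseteq> K & P \<subseteq> {a..b} & is_interval P & R ` P = C &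
  (EX e:P \<inter> {a, b}. R e = r))"

text \<open>The wall at \<open>r\<close> copies the piece \<open>{l..r}\<close> beyond
  \<open>r\<close>. Either the whole copy ends in the interior of \<open>D\<close>, or by
  \<open>next_exit\<close> it hits every remaining point of \<open>D\<close>.\<close>

lemma chain_step:
 assumes m: "mx a b" and l: "lk a b g l r" and D: "is_interval D" "D \<subseteq> I" and r: "r : interior D"
 shows "(EX r':interior D. r < r' & (EX g'. lk a b g' r r')) | (EX g'. endlk a b g' (D \<inter> {r..}) r)"
proof -
 note mD = mxD[OF m]
 obtain K1 \<mu> where 1: "dv g K1 \<mu>" "{a..b} \<subseteq> K1" "\<mu> ` {a..b} = {l..r}" using l unfolding lk_def by blast
 have mlr: "mx l r" by (rule mx_image(1)[OF 1(1) m 1(2,3)])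
 note mD' = mxD[OF mlr]
 obtain w K R e z where k: "mdv w K R" "e : K" "R e = r"
  and ez: "(e = l & z = r & smono K R) | (e = r & z = l & santi K R)"
  using next_wall[OF mlr] by blast
 note d = mdvD[OF k(1)]
 define \<nu> where "\<nu> = R \<circ> \<mu>"
 define K2 where "K2 = {x : K1. \<mu> x : K}"
 have d2: "dv (w \<otimes> g) K2 \<nu>" unfolding K2_def \<nu>_def by (rule dv_comp_pre[OF 1(1) d])
 have rz: "r < R z" if zK: "z : K"
  using ez
 proof
  assume a: "e = l & z = r & smono K R"
  then have "R l < R r" using k(2) zK mD'(1) unfolding monotone_on_def by blast
  then show ?thesis using a k(3) by simp
 next
  assume a: "e = r & z = l & santi K R"
  then have "R r < R l" using k(2) zK mD'(1) unfolding monotone_on_def by blast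
  then show ?thesis using a k(3) by simp
 qed
 show ?thesis
 proof (cases "z : K & R z : interior D")
  case True
  have lrK: "{l..r} \<subseteq> K" using ivl_sub[OF dvD(3)[OF d]] True k(2) ez by blast
  have cont: "continuous_on {l..r} R" using continuous_on_subset[OF dvD(5)[OF d] lrK] .
  have im: "R ` {l..r} = {r..R z}"
   using ez
  proof
   assume a: "e = l & z = r & smono K R"
   then show ?thesis using mono_image_ivl(1)[OF cont less_imp_le[OF mD'(1)] monotone_on_subset[OF _ lrK]] k(3) by auto
  next
   assume a: "e = r & z = l & santi K R"
   then show ?thesis using mono_image_ivl(2)[OF cont less_imp_le[OF mD'(1)] monotone_on_subset[OF _ lrK]] k(3) by auto
  qed
  have "\<mu> ` {a..b} \<subseteq> K" using 1(3) lrK by simp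
  then have "{a..b} \<subseteq> K2" unfolding K2_def using 1(2) by blast
  moreover have "\<nu> ` {a..b} = {r..R z}" unfolding \<nu>_def image_comp[symmetric] 1(3) im ..
  ultimately have "lk a b (w \<otimes> g) r (R z)" unfolding lk_def using d2 by blast
  then show ?thesis using True rz by blast
 next
  case False
  have reach: "EX x:K. x : {l..r} & R x = q" if q: "q : D \<inter> {r..}" for q
  proof -
   have qI: "q : I" "r <= q" using q D by auto
   have "(z : K & R z <= q) | (EX x:K. l <= x & x <= r & R x = q)" by (rule next_exit[OF mlr k ez qI])
   then show ?thesis
   proof
    assume zq: "z : K & R z <= q"
    \<comment> \<open>A copy ending before \<open>q\<close> would end in the interior of
      \<open>D\<close>, which is the other case.\<close>
    have "R z = q"
    proof (rule ccontr)
     assume "R z ~= q"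
     then have in1: "R z : {r<..<q}" using zq rz by auto
     have "{r<..<q} \<subseteq> {r..q}" by auto
     also have "\<dots> \<subseteq> D" using ivl_sub[OF D(1)] r q interior_subset by blast
     finally have "{r<..<q} \<subseteq> interior D" using interior_maximal open_greaterThanLessThan by blast
     then show False using in1 False zq by blast
    qed
    moreover have "z : {l..r}" using ez mD'(1) by auto
    ultimately show ?thesis using zq by blast
   qed auto
  qed
  define P where "P = {a..b} \<inter> {x : K2. \<nu> x : D \<inter> {r..}}"
  have "is_interval (D \<inter> {r..})" by (rule is_interval_Int[OF D(1)]) (simp add: is_interval_1)
  then have "is_interval P" unfolding P_def
   by (rule is_interval_Int[OF is_interval_cc pre_interval[OF dvD(3)[OF d2] _ dv_mono[OF d2]]])
  moreover have "\<nu> ` P = D \<inter> {r..}"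
  proof
   show "\<nu> ` P \<subseteq> D \<inter> {r..}" unfolding P_def by blast
   show "D \<inter> {r..} \<subseteq> \<nu> ` P"
   proof
    fix q assume q: "q : D \<inter> {r..}"
    obtain x where x: "x : K" "x : {l..r}" "R x = q" using reach[OF q] by blast
    obtain y where y: "y : {a..b}" "\<mu> y = x" using x(2) unfolding 1(3)[symmetric] by blast
    have "y : K2" unfolding K2_def using y 1(2) x(1) by blast
    then show "q : \<nu> ` P" unfolding P_def \<nu>_def using y x q by (intro image_eqI[of _ _ y]) auto
   qed
  qed
  moreover have "EX e:P \<inter> {a, b}. \<nu> e = r"
  proof -
   have "e : {l, r}" using ez by auto
   then obtain y where y: "y : {a, b}" "\<mu> y = e" using mx_image(2)[OF 1(1) m 1(2,3)] by blast
   have yab: "y : {a..b}" using y(1) mD(1) by auto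
   then have "y : K2" unfolding K2_def using 1(2) y(2) k(2) by blast
   moreover have "\<nu> y = r" unfolding \<nu>_def using y(2) k(3) by simp
   moreover have "r : D \<inter> {r..}" using r interior_subset by auto
   ultimately show ?thesis unfolding P_def using y(1) yab by (intro bexI[of _ y]) auto
  qed
  moreover have "P \<subseteq> K2" "P \<subseteq> {a..b}" unfolding P_def by auto
  ultimately have "endlk a b (w \<otimes> g) (D \<inter> {r..}) r" unfolding endlk_def using d2 by blast
  then show ?thesis by blast
 qed
qed

definition rchain :: "real => real => real set => int extended => (int => real) => (int => 'g) => bool" where
 "rchain a b D N p g \<longleftrightarrow> Fin 0 < N & p 1 = b &
  (ALL n. 1 <= n & Fin n <= N --> p n : interior D & g n : carrier G) &
  (ALL n. 1 <= n & Fin n < N --> p n < p (n + 1) & lk a b (g n) (p n) (p (n + 1))) &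
  (ALL n. 1 <= n & Fin n = N --> endlk a b (g n) (D \<inter> {p n..}) (p n))"

lemma lk_carrier: "lk a b g l r ==> g : carrier G"
 unfolding lk_def using dvD(1) by blast

lemma endlk_carrier: "endlk a b g C r ==> g : carrier G"
 unfolding endlk_def using dvD(1) by blast

text \<open>Pieces are chosen recursively as long as there is a further full copy inside
  \<open>D\<close>; where this fails for the first time, the other alternative of
  \<open>chain_step\<close> is the final link.\<close>

lemma rchain_exists:
 assumes m: "mx a b" and D: "is_interval D" "D \<subseteq> I" and b: "b : interior D"
 shows "EX N p g. rchain a b D N p g"
proof -
 note mD = mxD[OF m]
 define ok where "ok s \<longleftrightarrow> (case s of (l, r, g) => lk a b g l r & r : interior D)" for s
 define succ where "succ s s' \<longleftrightarrow> ok s' & fst s' = fst (snd s) & fst (snd s) < fst (snd s')" for s s' :: "real \<times> real \<times> 'g"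
 \<comment> \<open>A state is a piece together with its element; a state without successor is
   repeated, which makes \<open>f\<close> total.\<close>
 define f where "f = rec_nat (a, b, \<one>) (%n s. if EX s'. succ s s' then SOME s'. succ s s' else s)"
 have f0: "f 0 = (a, b, \<one>)" unfolding f_def by simp
 have fS: "f (Suc n) = (if EX s'. succ (f n) s' then SOME s'. succ (f n) s' else f n)" for n unfolding f_def by simp
 define good where "good n \<longleftrightarrow> (EX s'. succ (f n) s')" for n
 have step: "succ (f n) (f (Suc n))" if "good n" for n
 proof -
  have "f (Suc n) = (SOME s'. succ (f n) s')" using that fS unfolding good_def by simp
  then show ?thesis using that someI_ex[of "%s'. succ (f n) s'"] unfolding good_def by simp
 qed
 have "lk a b \<one> a b" unfolding lk_def using dv_S[OF S_one] mD(5) by (intro exI[of _ I] exI[of _ "%x. x"]) auto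
 then have ok0: "ok (f 0)" unfolding f0 ok_def using b by simp
 have okn: "ok (f n)" if "!!i. i < n ==> good i" for n
  using ok0 step[of "n - 1"] that unfolding succ_def by (cases n) auto
 \<comment> \<open>The cut point \<open>p n\<close> is the right end of state \<open>n - 1\<close>,
   the piece before it, whereas \<open>h n\<close> belongs to state \<open>n\<close>, the piece
   after it; state 0 is the interval from \<open>a\<close> to \<open>b\<close>.\<close>
 define p where "p n = fst (snd (f (nat (n - 1))))" for n
 define h where "h n = snd (snd (f (nat n)))" for n
 have p1: "p 1 = b" unfolding p_def f0[simplified] by (simp add: f0)
 have inner: "p n : interior D & p n < p (n + 1) & lk a b (h n) (p n) (p (n + 1)) & p (n + 1) : interior D"
  if n: "1 <= n" and g: "!!i. i <= nat (n - 1) ==> good i" for n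
 proof -
  have e: "Suc (nat (n - 1)) = nat n" using n by simp
  have s: "succ (f (nat (n - 1))) (f (nat n))" using step[OF g[OF order_refl]] e by simp
  have o: "ok (f (nat (n - 1)))" by (rule okn) (use g in auto)
  have e2: "nat (n + 1 - 1) = nat n" by simp
  show ?thesis using s o unfolding p_def h_def e2 succ_def ok_def by (auto split: prod.splits)
 qed
 show ?thesis
 proof (cases "ALL n. good n")
  case True
  then have in': "p n : interior D" "p n < p (n + 1)" "lk a b (h n) (p n) (p (n + 1))" if "1 <= n" for n
   using inner[OF that] by auto
  have "rchain a b D Pinf p h" unfolding rchain_def
   using p1 in' lk_carrier[OF in'(3)] by auto
  then show ?thesis by blast
 next
  case False
  define k where "k = (LEAST n. ~ good n)"
  have k: "~ good k" "!!i. i < k ==> good i" unfolding k_def using False LeastI_ex[of "%n. ~ good n"] not_less_Least by blast+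
  have okk: "ok (f k)" by (rule okn) (use k in auto)
  obtain l r g0 where fk: "f k = (l, r, g0)" by (cases "f k")
  have "lk a b g0 l r" "r : interior D" using okk unfolding fk ok_def by auto
  then have "(EX r':interior D. r < r' & (EX g'. lk a b g' r r')) | (EX g'. endlk a b g' (D \<inter> {r..}) r)"
   by (intro chain_step[OF m _ D])
  moreover have "~ (EX r':interior D. r < r' & (EX g'. lk a b g' r r'))"
  proof
   assume "EX r':interior D. r < r' & (EX g'. lk a b g' r r')"
   then obtain r' g' where "r' : interior D" "r < r'" "lk a b g' r r'" by blast
   then have "succ (f k) (r, r', g')" unfolding succ_def ok_def fk by simp
   then show False using k(1) unfolding good_def by blast
  qed
  ultimately obtain g' where g': "endlk a b g' (D \<inter> {r..}) r" by blast
  define h' where "h' n = (if n = int k + 1 then g' else h n)" for n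
  have pk: "p (int k + 1) = r" unfolding p_def by (simp add: fk)
  have inn: "p n : interior D & p n < p (n + 1) & lk a b (h n) (p n) (p (n + 1))" if n: "1 <= n" "n < int k + 1" for n
  proof -
   have "good i" if "i <= nat (n - 1)" for i using k(2)[of i] that n by linarith
   then show ?thesis using inner[OF n(1)] by blast
  qed
  have "rchain a b D (Fin (int k + 1)) p h'" unfolding rchain_def
  proof (intro conjI allI impI)
   fix n assume n: "1 <= n & Fin n <= Fin (int k + 1)"
   show "p n : interior D" 
   proof (cases "n = int k + 1")
    case True
    then show ?thesis using pk \<open>r : interior D\<close> by simp
   next
    case False
    then show ?thesis using inn[of n] n by simp
   qed
   show "h' n : carrier G"
   proof (cases "n = int k + 1")
    case True
    then show ?thesis using endlk_carrier[OF g'] unfolding h'_def by simp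
   next
    case False
    then show ?thesis using inn[of n] n lk_carrier unfolding h'_def by fastforce
   qed
  next
   fix n assume n: "1 <= n & Fin n < Fin (int k + 1)"
   then show "p n < p (n + 1)" "lk a b (h' n) (p n) (p (n + 1))" using inn[of n] unfolding h'_def by auto
  next
   fix n assume n: "1 <= n & Fin n = Fin (int k + 1)"
   then show "endlk a b (h' n) (D \<inter> {p n..}) (p n)" using g' pk unfolding h'_def by auto
  qed (use p1 in auto)
  then show ?thesis by blast
 qed
qed

end

lemma (in curve_orbit) mirror_lk:
 assumes "curve_orbit.lk G \<phi> mI mc (- b) (- a) g l r" shows "lk a b g (- r) (- l)"
proof -
 interpret m: curve_orbit G X \<phi> mI mc by (rule mirror)
 obtain K R where d: "m.dv g K R" "{- b..- a} \<subseteq> K" "R ` {- b..- a} = {l..r}" using assms unfolding m.lk_def by blast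
 have "dv g (uminus ` K) (%x. - R (- x))" using d(1) mirror_dv by blast
 moreover have "{a..b} \<subseteq> uminus ` K" using image_mono[OF d(2), of uminus] by simp
 moreover have "(%x. - R (- x)) ` {a..b} = uminus ` R ` uminus ` {a..b}" by (simp only: image_image)
 then have "(%x. - R (- x)) ` {a..b} = {- r..- l}" using d(3) by simp
 ultimately show ?thesis unfolding lk_def by blast
qed

lemma (in curve_orbit) mirror_endlk:
 assumes "curve_orbit.endlk G \<phi> mI mc (- b) (- a) g C r" shows "endlk a b g (uminus ` C) (- r)"
proof -
 interpret m: curve_orbit G X \<phi> mI mc by (rule mirror)
 obtain K R P e where d: "m.dv g K R" "P \<subseteq> K" "P \<subseteq> {- b..- a}" "is_interval P" "R ` P = C" "e : P \<inter> {- b, - a}" "R e = r"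
  using assms unfolding m.endlk_def by blast
 have "dv g (uminus ` K) (%x. - R (- x))" using d(1) mirror_dv by blast
 moreover have "uminus ` P \<subseteq> uminus ` K" "uminus ` P \<subseteq> {a..b}" using d(2) image_mono[OF d(3), of uminus] by auto
 moreover have "(%x. - R (- x)) ` uminus ` P = uminus ` C"
  unfolding d(5)[symmetric] by (simp only: image_image minus_minus)
 moreover have "- e : uminus ` P \<inter> {a, b}" "- R (- (- e)) = - r" using d(6,7) by auto
 moreover have "is_interval (uminus ` P)" using d(4) by simp
 ultimately show ?thesis unfolding endlk_def by blast
qed

context curve_orbit
begin

definition lchain :: "real => real => real set => int extended => (int => real) => (int => 'g) => bool" where
 "lchain a b D N p g \<longleftrightarrow> Fin 0 < N & p 1 = a &
  (ALL n. 1 <= n & Fin n <= N --> p n : interior D & g n : carrier G) &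
  (ALL n. 1 <= n & Fin n < N --> p (n + 1) < p n & lk a b (g n) (p (n + 1)) (p n)) &
  (ALL n. 1 <= n & Fin n = N --> endlk a b (g n) (D \<inter> {..p n}) (p n))"

lemma interior_negate: "interior (uminus ` D) = uminus ` interior D" for D :: "real set"
 using interior_negations by blast

lemma lchain_exists:
 assumes m: "mx a b" and D: "is_interval D" "D \<subseteq> I" and a: "a : interior D"
 shows "EX N p g. lchain a b D N p g"
proof -
 interpret m: curve_orbit G X \<phi> mI mc by (rule mirror)
 obtain N p g where r: "m.rchain (- b) (- a) (uminus ` D) N p g"
  using m.rchain_exists[OF mirror_mx_imp[OF m], of "uminus ` D"] D(1) image_mono[OF D(2), of uminus] a
  unfolding interior_negate by auto
 have e: "uminus ` (uminus ` D \<inter> {x..}) = D \<inter> {..- x}" for x by force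
 have "lchain a b D N (%n. - p n) g" unfolding lchain_def
 proof (intro conjI allI impI)
  show "Fin 0 < N" "- p 1 = a" using r unfolding m.rchain_def by auto
  fix n
  show "- p n : interior D" "g n : carrier G" if "1 <= n & Fin n <= N"
   using r that unfolding m.rchain_def interior_negate by force+
  show "- p (n + 1) < - p n" "lk a b (g n) (- p (n + 1)) (- p n)" if "1 <= n & Fin n < N"
   using r that mirror_lk unfolding m.rchain_def by force+
  show "endlk a b (g n) (D \<inter> {..- p n}) (- p n)" if n: "1 <= n & Fin n = N"
  proof -
   have "m.endlk (- b) (- a) (g n) (uminus ` D \<inter> {p n..}) (p n)" using r n unfolding m.rchain_def by blast
   then show ?thesis using mirror_endlk e by metis
  qed
 qed
 then show ?thesis by blast
qed

section \<open>Sliding a translated interval\<close>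

lemma ps_translation:
 assumes m: "mx a b" and p: "ps h a b"
 shows "EX K R. mdv h K R & smono K R & a : K & R a = b & (ALL x:K. x < R x & mx x (R x))"
proof -
 note mD = mxD[OF m]
 have i: "inc h a b" "h ~: S" using p unfolding ps_def by auto
 obtain K R where K: "mdv h K R" "smono K R" "a : K" "R a = b" using inc_mdv[OF i(1)] by blast
 note d = mdvD[OF K(1)]
 have up: "x < R x" if "x : K" for x using no_fix_up[OF d K(2,3) _ that] K(4) mD(1) by simp
 have "mx x (R x)" if x: "x : K" for x
 proof (rule ps_mx[OF up[OF x]])
  show "fr {x<..<R x}" by (rule qcont[OF d K(2) i(2) K(3) up[OF K(3)] _ x]) (use K(4) mD(4) in simp)
  show "ps h x (R x)" unfolding ps_def inc_def using i(2) d K(2) x by blast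
 qed
 then show ?thesis using K up by blast
qed

text \<open>The maximal translation extends to the left down to \<open>t\<close>: its values lie
  above its arguments and cannot exceed \<open>b\<close>, so they never leave the box. Starting it
  at \<open>t\<close> or slightly before gives the two intervals.\<close>

lemma ps_left:
 assumes m: "mx a b" and p: "ps h a b" and t: "t : I" "t < a" and e: "e > 0"
 shows "EX y. mx t y & y < b" "EX x y. t - e < x & x < t & t < y & y < b & mx x y"
proof -
 note mD = mxD[OF m]
 obtain K R where K: "mdv h K R" "smono K R" "a : K" "R a = b"
  and up: "!!x. x:K ==> x < R x" and mx: "!!x. x:K ==> mx x (R x)" using ps_translation[OF m p] by blast
 note d = mdvD[OF K(1)]
 obtain q where q: "q : I" "b < q" using I_right[OF mD(3), of 1] by auto
 have "EX x:K. t <= x & x <= a & R ` {x..a} \<subseteq> {t..q} & (x = t | R x = t | R x = q)"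
  by (rule box_left[OF K(1,3) t(1) _ ivl_sub[OF interval_I t(1) q(1)]]) (use K(4) t mD(1) q in auto)
 then obtain x where x: "x : K" "t <= x" "x <= a" "x = t | R x = t | R x = q" by blast
 have "R x <= R a" using K(2,3) x(1,3) unfolding monotone_on_def by (cases "x = a") (auto simp: less_imp_le)
 then have "x = t" using x up[OF x(1)] q K(4) by auto
 then have tK: "t : K" using x by simp
 have lt: "R x < b" if "x : K" "x < a" for x using K(2,3,4) that unfolding monotone_on_def by auto
 show "EX y. mx t y & y < b" using mx[OF tK] lt[OF tK t(2)] by blast
 obtain r where r: "r > 0" "ball t r \<subseteq> K" "R ` ball t r \<subseteq> {t<..}"
  using dv_local[OF d tK open_greaterThan, of t] up[OF tK] by auto
 define s where "s = t - min r e / 2"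
 have s: "s : ball t r" "t - e < s" "s < t" unfolding s_def using r(1) e by (auto simp: dist_real_def)
 have sK: "s : K" "R s : {t<..}" using r s by blast+
 have "R s < b" using lt[OF sK(1)] s(3) t(2) by simp
 then show "EX x y. t - e < x & x < t & t < y & y < b & mx x y" using s sK mx[OF sK(1)] by auto
qed

lemma ps_right:
 assumes m: "mx a b" and p: "ps h a b" and t: "t : I" "b < t" and e: "e > 0"
 shows "EX x. mx x t & a < x" "EX x y. a < x & x < t & t < y & y < t + e & mx x y"
proof -
 note mD = mxD[OF m]
 obtain K R where K: "mdv h K R" "smono K R" "a : K" "R a = b"
  and up: "!!x. x:K ==> x < R x" and mx: "!!x. x:K ==> mx x (R x)" using ps_translation[OF m p] by blast
 note d = mdvD[OF K(1)]
 have "EX x:K. a <= x & x <= t & R ` {a..x} \<subseteq> {a..t} & (x = t | R x = a | R x = t)"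
  by (rule box_right[OF K(1,3) t(1) _ ivl_sub[OF interval_I mD(2) t(1)]]) (use K(4) t mD(1) in auto)
 then obtain x where x: "x : K" "a <= x" "x <= t" "R ` {a..x} \<subseteq> {a..t}" "x = t | R x = a | R x = t" by blast
 have "R x <= t" using x(2,4) by (metis atLeastAtMost_iff image_subset_iff order_refl)
 then have rx: "R x = t" using x up[OF x(1)] by auto
 then have xa: "a < x" using x(2) K(4) t(2) by (cases "x = a") auto
 show "EX x. mx x t & a < x" using mx[OF x(1)] rx xa by auto
 have "inc h x t" unfolding inc_def using d K(2) x(1) rx by blast
 have xt: "x < t" using up[OF x(1)] rx by simp
 obtain r where r: "r > 0" "ball x r \<subseteq> K" "R ` ball x r \<subseteq> ball t e"
  using dv_local[OF d x(1) open_ball, of t e] rx e by auto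
 define d0 where "d0 = min r (t - x)"
 have "d0 > 0" "d0 <= r" "d0 <= t - x" using r(1) xt unfolding d0_def by auto
 moreover define s where "s = x + d0 / 2"
 ultimately have "x < s" "s < t" "s - x < r" by linarith+
 then have s: "s : ball x r" "x < s" "s < t" by (auto simp: dist_real_def)
 have sK: "s : K" "R s : ball t e" using r s by blast+
 have "t < R s" using K(2) x(1) sK(1) s(2) rx unfolding monotone_on_def by auto
 moreover have "R s < t + e" using sK(2) by (auto simp: dist_real_def)
 ultimately show "EX x y. a < x & x < t & t < y & y < t + e & mx x y" using s xa mx[OF sK(1)] by (intro exI[of _ s] exI[of _ "R s"]) auto
qed

section \<open>Orientations and classes at a common end\<close>

definition orr :: "bool => 'g => real => real => bool" where
 "orr \<sigma> g s t \<longleftrightarrow> (if \<sigma> then inc g s t else dec g s t)"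

text \<open>Orientations are truth values, \<open>True\<close> for increasing; a composite is
  increasing exactly if the two orientations agree, which is equality of truth values.\<close>

lemma orr_comp: "[|orr \<sigma> g s t; orr \<tau> h t u|] ==> orr (\<sigma> = \<tau>) (h \<otimes> g) s u"
 unfolding orr_def by (cases \<sigma>; cases \<tau>) (auto intro: inc_inc inc_dec dec_inc dec_dec)

lemma orr_inv: "orr \<sigma> g s t ==> orr \<sigma> (inv g) t s"
 unfolding orr_def by (auto intro: inc_inv dec_inv split: if_splits)

lemma orr_lnk: "orr \<sigma> g s t ==> lnk g s t"
 unfolding orr_def by (auto intro: inc_lnk dec_lnk split: if_splits)

lemma orr_S: "[|q : S; orr \<sigma> q s t|] ==> \<sigma>"
 unfolding orr_def using no_dec_S by (auto split: if_splits)

lemma orr_dv: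
 assumes "dv g K R" "s : K" "if \<sigma> then smono K R else santi K R"
 shows "orr \<sigma> g s (R s)"
proof (cases \<sigma>)
 case True
 then show ?thesis using assms unfolding orr_def inc_def by (simp only: if_True) blast
next
 case False
 then show ?thesis using assms unfolding orr_def dec_def by (simp only: if_False) blast
qed

text \<open>\<open>inv h \<otimes> g\<close> displaces within the free interval, so it lies in
  \<open>S\<close>; elements of \<open>S\<close> preserve orientation and, by \<open>inj_mx\<close>,
  move no point inside a maximal interval. All comparisons of pieces rest on this.\<close>

lemma orr_same:
 assumes m: "mx a b" and 1: "orr \<sigma> g s y" "s : {a<..<b}" and 2: "orr \<tau> h s' y" "s' : {a<..<b}"
 shows "inv h \<otimes> g : S" "\<sigma> = \<tau>" "s = s'"
proof -
 have o: "orr (\<sigma> = \<tau>) (inv h \<otimes> g) s s'" by (rule orr_comp[OF 1(1) orr_inv[OF 2(1)]])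
 show S: "inv h \<otimes> g : S" by (rule fr_class[OF mxD(4)[OF m] orr_lnk[OF 1(1)] orr_lnk[OF 2(1)] 1(2) 2(2)])
 show "\<sigma> = \<tau>" using orr_S[OF S o] .
 show "s = s'" by (rule inj_mx[OF m S orr_lnk[OF o] 1(2) 2(2)])
qed

lemma orr_adj:
 assumes m: "mx a b" and 1: "orr \<tau> k s x" "s : {a<..<b}" and 2: "orr \<sigma> g x y" and 3: "orr \<omega> h s' y" "s' : {a<..<b}"
 shows "inv h \<otimes> (g \<otimes> k) : S" "\<omega> = (\<sigma> = \<tau>)"
 using orr_same[OF m orr_comp[OF 1(1) 2] 1(2) 3] by auto

text \<open>A one-sided germ: \<open>g\<close> covers a right neighbourhood of \<open>p\<close> by
  points of the interval. By \<open>nearR_same\<close> such a germ determines the class of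
  \<open>g\<close> and the orientation.\<close>

definition nearR :: "real => real => bool => 'g => real => bool" where
 "nearR a b \<sigma> g p \<longleftrightarrow> (EX e>0. ALL y. p < y & y < p + e --> (EX s:{a<..<b}. orr \<sigma> g s y))"

definition nearL :: "real => real => bool => 'g => real => bool" where
 "nearL a b \<sigma> g p \<longleftrightarrow> (EX e>0. ALL y. p - e < y & y < p --> (EX s:{a<..<b}. orr \<sigma> g s y))"

text \<open>Points just right of \<open>p\<close> are reached through \<open>g\<close> from points
  just outside the interval: beyond \<open>b\<close> if \<open>R\<close> is increasing, before
  \<open>a\<close> if it is decreasing. Those come from the interval by \<open>g1\<close> or
  \<open>g2\<close>, which gives the class of the next piece; a decreasing \<open>R\<close> also
  reverses the orientation.\<close>

lemma stepR:
 assumes m: "mx a b" and d: "dv g K R" "{a..b} \<subseteq> K" "R ` {a..b} = {l..p}"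
  and 1: "nearR a b \<tau>1 g1 b" and 2: "nearL a b \<tau>2 g2 a" and h: "nearR a b \<omega> h p"
 shows "(smono K R & inv h \<otimes> (g \<otimes> g1) : S & \<omega> = \<tau>1) |
  (santi K R & inv h \<otimes> (g \<otimes> g2) : S & \<omega> = (~ \<tau>2))"
proof -
 note mD = mxD[OF m]
 have abK: "a : K" "b : K" using d(2) mD(1) by (auto simp: subset_iff)
 obtain e1 where e1: "e1 > 0" "!!y. [|b < y; y < b + e1|] ==> EX s:{a<..<b}. orr \<tau>1 g1 s y" using 1 unfolding nearR_def by blast
 obtain e2 where e2: "e2 > 0" "!!y. [|a - e2 < y; y < a|] ==> EX s:{a<..<b}. orr \<tau>2 g2 s y" using 2 unfolding nearL_def by blast
 obtain e3 where e3: "e3 > 0" "!!y. [|p < y; y < p + e3|] ==> EX s:{a<..<b}. orr \<omega> h s y" using h unfolding nearR_def by blast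
 from mx_image(2)[OF d(1) m d(2,3)] show ?thesis
 proof
  assume A: "smono K R & R a = l & R b = p"
  then have "inc g b p" unfolding inc_def using d(1) abK by blast
  moreover obtain e where e: "e > 0" "e <= e1" "e <= e3" using e1(1) e3(1) by (metis linear order_refl)
  ultimately obtain x y where xy: "b < x" "x < b + e" "p < y" "y < p + e" "inc g x y"
   using inc_right by blast
  obtain s where s: "s : {a<..<b}" "orr \<tau>1 g1 s x" using e1(2)[of x] xy e by auto
  obtain s' where s': "s' : {a<..<b}" "orr \<omega> h s' y" using e3(2)[of y] xy e by auto
  have "orr True g x y" using xy(5) unfolding orr_def by simp
  from orr_adj[OF m s(2,1) this s'(2,1)] show ?thesis using A by auto
 next
  assume A: "santi K R & R a = p & R b = l"
  then have "dec g a p" unfolding dec_def using d(1) abK by blast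
  moreover obtain e where e: "e > 0" "e <= e2" "e <= e3" using e2(1) e3(1) by (metis linear order_refl)
  ultimately obtain x y where xy: "a - e < x" "x < a" "p < y" "y < p + e" "dec g x y"
   using dec_left by blast
  obtain s where s: "s : {a<..<b}" "orr \<tau>2 g2 s x" using e2(2)[of x] xy e by auto
  obtain s' where s': "s' : {a<..<b}" "orr \<omega> h s' y" using e3(2)[of y] xy e by auto
  have "orr False g x y" using xy(5) unfolding orr_def by simp
  from orr_adj[OF m s(2,1) this s'(2,1)] show ?thesis using A by auto
 qed
qed

lemma stepL:
 assumes m: "mx a b" and d: "dv g K R" "{a..b} \<subseteq> K" "R ` {a..b} = {p..r}"
  and 1: "nearR a b \<tau>1 g1 b" and 2: "nearL a b \<tau>2 g2 a" and h: "nearL a b \<omega> h p"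
 shows "(smono K R & inv h \<otimes> (g \<otimes> g2) : S & \<omega> = \<tau>2) |
  (santi K R & inv h \<otimes> (g \<otimes> g1) : S & \<omega> = (~ \<tau>1))"
proof -
 note mD = mxD[OF m]
 have abK: "a : K" "b : K" using d(2) mD(1) by (auto simp: subset_iff)
 obtain e1 where e1: "e1 > 0" "!!y. [|b < y; y < b + e1|] ==> EX s:{a<..<b}. orr \<tau>1 g1 s y" using 1 unfolding nearR_def by blast
 obtain e2 where e2: "e2 > 0" "!!y. [|a - e2 < y; y < a|] ==> EX s:{a<..<b}. orr \<tau>2 g2 s y" using 2 unfolding nearL_def by blast
 obtain e3 where e3: "e3 > 0" "!!y. [|p - e3 < y; y < p|] ==> EX s:{a<..<b}. orr \<omega> h s y" using h unfolding nearL_def by blast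
 from mx_image(2)[OF d(1) m d(2,3)] show ?thesis
 proof
  assume A: "smono K R & R a = p & R b = r"
  then have "inc g a p" unfolding inc_def using d(1) abK by blast
  moreover obtain e where e: "e > 0" "e <= e2" "e <= e3" using e2(1) e3(1) by (metis linear order_refl)
  ultimately obtain x y where xy: "a - e < x" "x < a" "p - e < y" "y < p" "inc g x y"
   using inc_left by blast
  obtain s where s: "s : {a<..<b}" "orr \<tau>2 g2 s x" using e2(2)[of x] xy e by auto
  obtain s' where s': "s' : {a<..<b}" "orr \<omega> h s' y" using e3(2)[of y] xy e by auto
  have "orr True g x y" using xy(5) unfolding orr_def by simp
  from orr_adj[OF m s(2,1) this s'(2,1)] show ?thesis using A by auto
 next
  assume A: "santi K R & R a = r & R b = p"
  then have "dec g b p" unfolding dec_def using d(1) abK by blast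
  moreover obtain e where e: "e > 0" "e <= e1" "e <= e3" using e1(1) e3(1) by (metis linear order_refl)
  ultimately obtain x y where xy: "b < x" "x < b + e" "p - e < y" "y < p" "dec g x y"
   using dec_right by blast
  obtain s where s: "s : {a<..<b}" "orr \<tau>1 g1 s x" using e1(2)[of x] xy e by auto
  obtain s' where s': "s' : {a<..<b}" "orr \<omega> h s' y" using e3(2)[of y] xy e by auto
  have "orr False g x y" using xy(5) unfolding orr_def by simp
  from orr_adj[OF m s(2,1) this s'(2,1)] show ?thesis using A by auto
 qed
qed

lemma nearR_dec:
 assumes ab: "a < b" and g: "dec g b b" shows "nearR a b False g b"
proof -
 obtain K R where d: "dv (inv g) K R" "santi K R" "b : K" "R b = b" using dec_inv[OF g] unfolding dec_def by blast
 have gG: "g : carrier G" using lnkD(1)[OF dec_lnk[OF g]] .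
 obtain e where e: "e > 0" "ball b e \<subseteq> K" "R ` ball b e \<subseteq> {a<..}"
  using dv_local[OF d(1,3) open_greaterThan, of a] d(4) ab by auto
 have "EX s:{a<..<b}. orr False g s y" if y: "b < y" "y < b + e" for y
 proof -
  have yb: "y : ball b e" using y by (simp add: dist_real_def)
  have yK: "y : K" "R y : {a<..}" using e(2,3) yb by blast+
  have "R y < b" using d(2,3,4) yK(1) y(1) unfolding monotone_on_def by auto
  moreover have "dec (inv g) y (R y)" unfolding dec_def using d yK by blast
  then have "dec g (R y) y" using dec_inv[of "inv g" y "R y"] gG by simp
  ultimately show ?thesis using yK(2) unfolding orr_def by (intro bexI[of _ "R y"]) auto
 qed
 then show ?thesis unfolding nearR_def using e(1) by blast
qed

lemma nearR_ps:
 assumes m: "mx a b" and p: "ps h a b" shows "nearR a b True h b"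
proof -
 note mD = mxD[OF m]
 obtain K R x0 where w: "winc (ereal a) b h K R x0" using ps_winc[OF mD(1) p] by blast
 have l: "lft (ereal a) b = {a<..<b}" by (rule lft_real[OF mD(2,3)])
 have "EX s:{a<..<b}. orr True h s y" if y: "b < y" "y < b + (R x0 - b)" for y
  using hit[OF w y(1)] y(2) unfolding l orr_def by auto
 then show ?thesis unfolding nearR_def using wincD(6)[OF w] by (intro exI[of _ "R x0 - b"]) auto
qed

end

lemma (in curve_orbit) mirror_orr: "curve_orbit.orr G \<phi> mI mc \<sigma> g s t \<longleftrightarrow> orr \<sigma> g (- s) (- t)"
proof -
 interpret m: curve_orbit G X \<phi> mI mc by (rule mirror)
 show ?thesis unfolding m.orr_def orr_def mirror_inc mirror_dec ..
qed

lemma (in curve_orbit) mirror_nearR: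
 assumes "curve_orbit.nearR G \<phi> mI mc (- b) (- a) \<sigma> g (- p)" shows "nearL a b \<sigma> g p"
proof -
 interpret m: curve_orbit G X \<phi> mI mc by (rule mirror)
 obtain e where e: "e > 0" "!!y. [|- p < y; y < - p + e|] ==> EX s:{- b<..<- a}. orr \<sigma> g (- s) (- y)"
  using assms unfolding m.nearR_def mirror_orr by blast
 have "EX s:{a<..<b}. orr \<sigma> g s y" if y: "p - e < y & y < p" for y
 proof -
  have "- p < - y" "- y < - p + e" using y by auto
  then obtain s where "s : {- b<..<- a}" "orr \<sigma> g (- s) (- (- y))" using e(2) by blast
  then show ?thesis by (intro bexI[of _ "- s"]) auto
 qed
 then show ?thesis unfolding nearL_def using e(1) by blast
qed

context curve_orbit
begin

lemma nearL_dec: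
 assumes ab: "a < b" and g: "dec g a a" shows "nearL a b False g a"
proof -
 interpret m: curve_orbit G X \<phi> mI mc by (rule mirror)
 have "m.dec g (- a) (- a)" unfolding mirror_dec using g by simp
 then show ?thesis by (intro mirror_nearR m.nearR_dec) (use ab in auto)
qed

lemma nearL_ps:
 assumes m: "mx a b" and p: "ps h a b" shows "nearL a b True (inv h) a"
proof -
 interpret m: curve_orbit G X \<phi> mI mc by (rule mirror)
 have h: "h ~: S" "inc h a b" using p unfolding ps_def by auto
 have "inv h ~: S" using S_inv[of "inv h"] h lnkD(1)[OF inc_lnk[OF h(2)]] by auto
 then have "m.ps (inv h) (- b) (- a)" unfolding m.ps_def mirror_S mirror_inc using inc_inv[OF h(2)] by simp
 then show ?thesis by (intro mirror_nearR m.nearR_ps mirror_mx_imp[OF m])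
qed

lemma nearR_same:
 assumes m: "mx a b" and 1: "nearR a b \<sigma> g p" and 2: "nearR a b \<tau> h p" shows "inv h \<otimes> g : S" "\<sigma> = \<tau>"
proof -
 obtain e1 where e1: "e1 > 0" "!!y. [|p < y; y < p + e1|] ==> EX s:{a<..<b}. orr \<sigma> g s y" using 1 unfolding nearR_def by blast
 obtain e2 where e2: "e2 > 0" "!!y. [|p < y; y < p + e2|] ==> EX s:{a<..<b}. orr \<tau> h s y" using 2 unfolding nearR_def by blast
 define y where "y = p + min e1 e2 / 2"
 have y: "p < y" "y < p + e1" "y < p + e2" unfolding y_def using e1(1) e2(1) by auto
 obtain s where s: "s : {a<..<b}" "orr \<sigma> g s y" using e1(2)[OF y(1,2)] by blast
 obtain s' where s': "s' : {a<..<b}" "orr \<tau> h s' y" using e2(2)[OF y(1,3)] by blast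
 show "inv h \<otimes> g : S" "\<sigma> = \<tau>" using orr_same[OF m s(2,1) s'(2,1)] by auto
qed

lemma nearL_same:
 assumes m: "mx a b" and 1: "nearL a b \<sigma> g p" and 2: "nearL a b \<tau> h p" shows "inv h \<otimes> g : S" "\<sigma> = \<tau>"
proof -
 obtain e1 where e1: "e1 > 0" "!!y. [|p - e1 < y; y < p|] ==> EX s:{a<..<b}. orr \<sigma> g s y" using 1 unfolding nearL_def by blast
 obtain e2 where e2: "e2 > 0" "!!y. [|p - e2 < y; y < p|] ==> EX s:{a<..<b}. orr \<tau> h s y" using 2 unfolding nearL_def by blast
 define y where "y = p - min e1 e2 / 2"
 have y: "y < p" "p - e1 < y" "p - e2 < y" unfolding y_def using e1(1) e2(1) by auto
 obtain s where s: "s : {a<..<b}" "orr \<sigma> g s y" using e1(2)[OF y(2,1)] by blast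
 obtain s' where s': "s' : {a<..<b}" "orr \<tau> h s' y" using e2(2)[OF y(3,1)] by blast
 show "inv h \<otimes> g : S" "\<sigma> = \<tau>" using orr_same[OF m s(2,1) s'(2,1)] by auto
qed

text \<open>The maximal extension has values strictly between \<open>l\<close> and \<open>r\<close>
  at all inner points, so the box \<open>{l..r}\<close> does not stop it before the ends;
  compactness of the image then yields the closed interval.\<close>

lemma close_link:
 assumes ab: "a < b" "{a..b} \<subseteq> I" and lr: "{l..r} \<subseteq> I" "l < r" and d: "dv g {a<..<b} \<mu>" and im: "\<mu> ` {a<..<b} = {l<..<r}"
 shows "EX K R. dv g K R & {a..b} \<subseteq> K & R ` {a..b} = {l..r} & (ALL x:{a<..<b}. R x = \<mu> x)"
proof -
 define m where "m = (a + b) / 2"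
 have m: "m : {a<..<b}" unfolding m_def using ab(1) by simp
 obtain K R where k: "mdv g K R" "{a<..<b} \<subseteq> K" "!!x. x:{a<..<b} ==> R x = \<mu> x" using dv_maximal[OF d m] by blast
 have mK: "m : K" using m k(2) by blast
 have rin: "R x : {l<..<r}" if "x : {a<..<b}" for x using im k(3)[OF that] that by blast
 have I: "a : I" "b : I" using ab by (auto simp: subset_iff)
 have bK: "b : K & R b : {l..r}"
 proof -
  have "EX x:K. m <= x & x <= b & R ` {m..x} \<subseteq> {l..r} & (x = b | R x = l | R x = r)"
   by (rule box_right[OF k(1) mK I(2) _ lr(1)]) (use m rin[OF m] in auto)
  then obtain x where x: "x : K" "m <= x" "x <= b" "R ` {m..x} \<subseteq> {l..r}" "x = b | R x = l | R x = r" by blast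
  have "x = b" using rin[of x] x m by fastforce
  then show ?thesis using x(1,2,4) by (metis atLeastAtMost_iff image_subset_iff order_refl)
 qed
 have aK: "a : K & R a : {l..r}"
 proof -
  have "EX x:K. a <= x & x <= m & R ` {x..m} \<subseteq> {l..r} & (x = a | R x = l | R x = r)"
   by (rule box_left[OF k(1) mK I(1) _ lr(1)]) (use m rin[OF m] in auto)
  then obtain x where x: "x : K" "a <= x" "x <= m" "R ` {x..m} \<subseteq> {l..r}" "x = a | R x = l | R x = r" by blast
  have "x = a" using rin[of x] x m by fastforce
  then show ?thesis using x(1,3,4) by (metis atLeastAtMost_iff image_subset_iff order_refl)
 qed
 note dK = mdvD[OF k(1)]
 have sub: "{a..b} \<subseteq> K" using ivl_sub[OF dvD(3)[OF dK]] aK bK by blast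
 have "compact (R ` {a..b})" by (rule compact_continuous_image[OF continuous_on_subset[OF dvD(5)[OF dK] sub] compact_Icc])
 then have cl: "closed (R ` {a..b})" by (rule compact_imp_closed)
 have "{l<..<r} \<subseteq> R ` {a..b}"
 proof
  fix y assume "y : {l<..<r}"
  then obtain x where "x : {a<..<b}" "y = \<mu> x" using im by blast
  then show "y : R ` {a..b}" using k(3) by (intro image_eqI[of _ _ x]) auto
 qed
 then have "closure {l<..<r} \<subseteq> R ` {a..b}" using cl closure_minimal by blast
 then have 1: "{l..r} \<subseteq> R ` {a..b}" using lr(2) by simp
 have "R x : {l..r}" if "x : {a..b}" for x
  using that aK bK rin[of x] by (cases "x = a | x = b") auto
 then have "R ` {a..b} = {l..r}" using 1 by blast
 then show ?thesis using dK sub k(3) by blast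
qed

text \<open>Copies of one interval that shrink to a point of \<open>I\<close> would collapse
  it.\<close>

lemma no_accumulation:
 assumes ab: "a < b" "{a<..<b} \<subseteq> I" and lk: "!!n::nat. lk a b (g n) (p n) (q n)"
  and z: "z : I" and lim: "p \<longlonglongrightarrow> z" "q \<longlonglongrightarrow> z"
 shows False
proof -
 have "ALL n. EX K R. dv (g n) K R & {a..b} \<subseteq> K & R ` {a..b} = {p n..q n}" using lk unfolding lk_def by blast
 then obtain K R where d: "!!n. dv (g n) (K n) (R n)" "!!n. {a..b} \<subseteq> K n" "!!n. R n ` {a..b} = {p n..q n}" by metis
 show False
 proof (rule collapse[of "{a<..<b}" g z])
  show "(%n. \<phi> (g n) (c u)) \<longlonglongrightarrow> c z" if u: "u : {a<..<b}" for u
  proof -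
   have uK: "u : K n" for n using d(2)[of n] u by (auto simp: subset_iff)
   have "R n u : {p n..q n}" for n using d(3)[of n] u by (metis greaterThanLessThan_iff atLeastAtMost_iff image_eqI less_imp_le)
   then have "(%n. R n u) \<longlonglongrightarrow> z" by (intro tendsto_sandwich[OF _ _ lim]) auto
   then have "(%n. c (R n u)) \<longlonglongrightarrow> c z" by (rule cont_lim[OF _ z]) (use dvD(8)[OF d(1) uK] in blast)
   then show ?thesis using dvD(9)[OF d(1) uK] by simp
  qed
 qed (use ab z dvD(1)[OF d(1)] in auto)
qed

end

section \<open>Real-analytic germs\<close>

abbreviation cx :: "real \<Rightarrow> complex" where "cx \<equiv> complex_of_real"

text \<open>A real-analytic germ at \<open>t\<close>, given by a holomorphic function on a complex
  disc; this makes identity theorem, inverse functions and uniform limits available. With the real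
  part in the definition, \<open>h\<close> itself may be non-real on the real axis;
  \<open>ran_ext\<close> repairs this.\<close>

definition ran :: "(real => real) => real => bool" where
 "ran u t \<longleftrightarrow> (EX r>0. EX h. h holomorphic_on ball (cx t) r &
  (ALL s. \<bar>s - t\<bar> < r --> u s = Re (h (cx s))))"

lemma of_real_ball: "cx s : ball (cx t) r \<longleftrightarrow> \<bar>s - t\<bar> < r"
 by (simp add: dist_commute dist_real_def)

text \<open>The mean of \<open>h\<close> and its Schwarz reflection is holomorphic and equals the
  real part of \<open>h\<close> on the real axis.\<close>

lemma ran_ext:
 assumes "ran u t"
 shows "EX r>0. EX h. h holomorphic_on ball (cx t) r &
  (ALL s. \<bar>s - t\<bar> < r --> h (cx s) = cx (u s))"
proof -
 obtain r h where h: "r > 0" "h holomorphic_on ball (cx t) r"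
  "!!s. \<bar>s - t\<bar> < r ==> u s = Re (h (cx s))" using assms unfolding ran_def by blast
 let ?B = "ball (cx t) r"
 have "cnj z : ?B" if "z : ?B" for z
 proof -
  have "dist (cx t) (cnj z) = dist (cx t) z"
   by (metis complex_cnj_complex_of_real complex_cnj_diff complex_mod_cnj dist_norm)
  then show ?thesis using that by simp
 qed
 then have "cnj ` ?B \<subseteq> ?B" by blast
 then have "h holomorphic_on cnj ` ?B" using h(2) holomorphic_on_subset by blast
 then have "cnj \<circ> h \<circ> cnj holomorphic_on ?B" by (rule holomorphic_on_compose_cnj_cnj) simp
 then have "(%z. cnj (h (cnj z))) holomorphic_on ?B" by (simp add: o_def)
 then have "(%z. (h z + cnj (h (cnj z))) / 2) holomorphic_on ?B" using h(2) by (intro holomorphic_on_divide holomorphic_on_add holomorphic_on_const) auto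
 moreover have "(h (cx s) + cnj (h (cnj (cx s)))) / 2 = cx (u s)" if "\<bar>s - t\<bar> < r" for s
  using h(3)[OF that] by (simp add: complex_eq_iff)
 ultimately show ?thesis using h(1) by blast
qed

lemma ranI:
 assumes "r > 0" "h holomorphic_on ball (cx t) r"
  "!!s. \<bar>s - t\<bar> < r ==> u s = Re (h (cx s))"
 shows "ran u t"
 using assms unfolding ran_def by blast

lemma ran_cong:
 assumes "ran u t" "e > 0" "!!s. \<bar>s - t\<bar> < e ==> v s = u s" shows "ran v t"
proof -
 obtain r h where h: "r > 0" "h holomorphic_on ball (cx t) r"
  "!!s. \<bar>s - t\<bar> < r ==> u s = Re (h (cx s))" using assms(1) unfolding ran_def by blast
 show ?thesis
  by (rule ranI[of "min r e" h]) (use h assms(2,3) in \<open>auto intro: holomorphic_on_subset\<close>)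
qed

lemma ran_const: "ran (%s. k) t"
 by (rule ranI[of 1 "%z. cx k"]) auto

lemma ran_id: "ran (%s. s) t"
 by (rule ranI[of 1 "%z. z"]) auto

lemma ran_diff: assumes "ran u t" "ran v t" shows "ran (%s. u s - v s) t"
proof -
 obtain r h where h: "r > 0" "h holomorphic_on ball (cx t) r"
  "!!s. \<bar>s - t\<bar> < r ==> u s = Re (h (cx s))" using assms(1) unfolding ran_def by blast
 obtain r' h' where h': "r' > 0" "h' holomorphic_on ball (cx t) r'"
  "!!s. \<bar>s - t\<bar> < r' ==> v s = Re (h' (cx s))" using assms(2) unfolding ran_def by blast
 show ?thesis
 proof (rule ranI[of "min r r'" "%z. h z - h' z"])
  have "h holomorphic_on ball (cx t) (min r r')" "h' holomorphic_on ball (cx t) (min r r')"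
   using h(2) h'(2) by (auto intro: holomorphic_on_subset)
  then show "(%z. h z - h' z) holomorphic_on ball (cx t) (min r r')" by (intro holomorphic_intros)
 qed (use h h' in auto)
qed

lemma ran_near: assumes "ran u t" shows "EX e>0. ALL s. \<bar>s - t\<bar> < e --> ran u s"
proof -
 obtain r h where h: "r > 0" "h holomorphic_on ball (cx t) r"
  "!!s. \<bar>s - t\<bar> < r ==> u s = Re (h (cx s))" using assms(1) unfolding ran_def by blast
 have "ran u s" if s: "\<bar>s - t\<bar> < r" for s
 proof (rule ranI[of "r - \<bar>s - t\<bar>" h])
  show "h holomorphic_on ball (cx s) (r - \<bar>s - t\<bar>)"
  proof (rule holomorphic_on_subset[OF h(2)])
   show "ball (cx s) (r - \<bar>s - t\<bar>) \<subseteq> ball (cx t) r"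
   proof
    fix z assume "z : ball (cx s) (r - \<bar>s - t\<bar>)"
    moreover have "dist (cx t) z <= dist (cx t) (cx s) + dist (cx s) z"
     by (rule dist_triangle)
    moreover have "dist (cx t) (cx s) = \<bar>s - t\<bar>" by (simp add: dist_real_def)
    ultimately show "z : ball (cx t) r" by simp
   qed
  qed
 qed (use s h(3) in auto)
 then show ?thesis using h(1) by blast
qed

lemma ran_vec_deriv:
 assumes h: "h holomorphic_on ball (cx t) r" "r > 0"
  and u: "!!s. \<bar>s - t\<bar> < r ==> u s = Re (h (cx s))"
  and D: "(h has_field_derivative D) (at (cx t))"
 shows "(u has_real_derivative Re D) (at t)"
proof -
 have "((%s. h (cx s)) has_vector_derivative D) (at t)"
  using has_vector_derivative_real_field[OF D] by simp
 then have "((%s. Re (h (cx s))) has_real_derivative Re D) (at t)"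
  by (rule has_field_derivative_Re)
 then show ?thesis
  by (rule has_field_derivative_transform_within_open[of _ _ _ "ball t r"])
   (use h(2) u in \<open>auto simp: dist_commute dist_real_def\<close>)
qed

lemma hol_deriv_at:
 assumes "h holomorphic_on ball z r" "r > 0" shows "(h has_field_derivative deriv h z) (at z)"
 using assms by (intro holomorphic_derivI[of h "ball z r"]) auto

lemma ran_deriv: assumes "ran u t" shows "EX d. (u has_real_derivative d) (at t)"
proof -
 obtain r h where h: "r > 0" "h holomorphic_on ball (cx t) r"
  "!!s. \<bar>s - t\<bar> < r ==> u s = Re (h (cx s))" using assms(1) unfolding ran_def by blast
 show ?thesis using ran_vec_deriv[OF h(2,1,3) hol_deriv_at[OF h(2,1)]] by blast
qed

lemma ran_isCont: "ran u t ==> isCont u t"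
 using ran_deriv DERIV_isCont by blast

lemma ran_comp: assumes "ran u t" "ran v (u t)" shows "ran (%s. v (u s)) t"
proof -
 obtain r h where h: "r > 0" "h holomorphic_on ball (cx t) r"
  "!!s. \<bar>s - t\<bar> < r ==> h (cx s) = cx (u s)" using ran_ext[OF assms(1)] by blast
 obtain r' h' where h': "r' > 0" "h' holomorphic_on ball (cx (u t)) r'"
  "!!s. \<bar>s - u t\<bar> < r' ==> v s = Re (h' (cx s))" using assms(2) unfolding ran_def by blast
 have ht: "h (cx t) = cx (u t)" using h(3)[of t] h(1) by simp
 have "continuous_on (ball (cx t) r) h" using h(2) holomorphic_on_imp_continuous_on by blast
 then have "isCont h (cx t)" using h(1) by (simp add: continuous_on_eq_continuous_at)
 then obtain d where d: "d > 0" "!!z. dist z (cx t) < d ==> dist (h z) (cx (u t)) < r'"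
  unfolding continuous_at_eps_delta using h'(1) ht by metis
 define q where "q = min r d"
 have sub: "h ` ball (cx t) q \<subseteq> ball (cx (u t)) r'"
  unfolding q_def using d(2) by (auto simp: dist_commute)
 have hol: "(h' \<circ> h) holomorphic_on ball (cx t) q"
  by (rule holomorphic_on_compose_gen[OF _ h'(2) sub]) (use h(2) in \<open>auto intro: holomorphic_on_subset simp: q_def\<close>)
 show ?thesis
 proof (rule ranI[OF _ hol])
  show "q > 0" unfolding q_def using h(1) d(1) by simp
  fix s assume s: "\<bar>s - t\<bar> < q"
  then have hs: "h (cx s) = cx (u s)" using h(3) unfolding q_def by simp
  have "h (cx s) : ball (cx (u t)) r'"
   using sub s of_real_ball[of s t q] by blast
  then have "\<bar>u s - u t\<bar> < r'" unfolding hs of_real_ball .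
  then show "v (u s) = Re ((h' \<circ> h) (cx s))" using h'(3) hs by simp
 qed
qed

lemma ran_zero:
 assumes "ran u t" "t islimpt {s. u s = 0}" shows "EX e>0. ALL s. \<bar>s - t\<bar> < e --> u s = 0"
proof -
 obtain r h where h: "r > 0" "h holomorphic_on ball (cx t) r"
  "!!s. \<bar>s - t\<bar> < r ==> h (cx s) = cx (u s)" using ran_ext[OF assms(1)] by blast
 define U where "U = cx ` {s. u s = 0 & \<bar>s - t\<bar> < r}"
 have "h (cx s) = 0" if s: "\<bar>s - t\<bar> < r" for s
 proof (rule analytic_continuation[OF h(2)])
  show "U \<subseteq> ball (cx t) r" unfolding U_def using of_real_ball by blast
  show "cx t islimpt U" unfolding islimpt_approachable
  proof (intro allI impI)
   fix e :: real assume "e > 0"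
   then have "min e r > 0" using h(1) by simp
   then obtain s where "u s = 0" "s ~= t" "dist s t < min e r" using assms(2) unfolding islimpt_approachable by blast
   then show "EX x':U. x' ~= cx t & dist x' (cx t) < e"
    unfolding U_def by (intro bexI[of _ "cx s"]) (auto simp: dist_real_def)
  qed
  show "h z = 0" if "z : U" for z using that h(3) unfolding U_def by auto
 qed (use h(1) of_real_ball s in auto)
 then have "u s = 0" if "\<bar>s - t\<bar> < r" for s using that h(3)[OF that] by simp
 then show ?thesis using h(1) by blast
qed

text \<open>The complex derivative is nonzero because its real part is \<open>d\<close>, so the
  holomorphic extension is locally injective; its inverse is holomorphic and restricts to the real
  one.\<close>

lemma ran_inverse:
 assumes "ran u t" "(u has_real_derivative d) (at t)" "d ~= 0"
 shows "EX v e. e > 0 & ran v (u t) & (ALL s. \<bar>s - t\<bar> < e --> v (u s) = s)"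
proof -
 obtain r h where h: "r > 0" "h holomorphic_on ball (cx t) r"
  "!!s. \<bar>s - t\<bar> < r ==> h (cx s) = cx (u s)" using ran_ext[OF assms(1)] by blast
 let ?t = "cx t"
 have "(u has_real_derivative Re (deriv h ?t)) (at t)"
  by (rule ran_vec_deriv[OF h(2,1) _ hol_deriv_at[OF h(2,1)]]) (use h(3) in simp)
 then have "d = Re (deriv h ?t)" using assms(2) DERIV_unique by blast
 then have "deriv h ?t ~= 0" using assms(3) by auto
 then obtain r1 where r1: "r1 > 0" "ball ?t r1 \<subseteq> ball ?t r" "inj_on h (ball ?t r1)"
  using has_complex_derivative_locally_injective[OF h(2), of ?t] h(1) by auto
 have hol: "h holomorphic_on ball ?t r1" using h(2) r1(2) holomorphic_on_subset by blast
 obtain g where g: "g holomorphic_on (h ` ball ?t r1)" "!!z. z : ball ?t r1 ==> g (h z) = z"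
  using holomorphic_has_inverse[OF hol open_ball r1(3)] by metis
 have "open (h ` ball ?t r1)" using open_mapping_thm3[OF hol open_ball r1(3)] .
 moreover have "h ?t : h ` ball ?t r1" using r1(1) by simp
 ultimately obtain r2 where r2: "r2 > 0" "ball (h ?t) r2 \<subseteq> h ` ball ?t r1" using open_contains_ball by blast
 have ht: "h ?t = cx (u t)" using h(1,3) by simp
 have "ran (%y. Re (g (cx y))) (u t)"
  by (rule ranI[OF r2(1), of g]) (use g(1) r2(2) ht in \<open>auto intro: holomorphic_on_subset\<close>)
 moreover have "Re (g (cx (u s))) = s" if s: "\<bar>s - t\<bar> < r1" for s
 proof -
  have b: "cx s : ball ?t r1" using s of_real_ball by blast
  then have "\<bar>s - t\<bar> < r" using r1(2) of_real_ball by blast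
  then show ?thesis using g(2)[OF b] h(3) by simp
 qed
 ultimately show ?thesis using r1(1) by (intro exI[of _ "%y. Re (g (cx y))"] exI[of _ r1]) auto
qed

text \<open>The series of \<open>F\<close> is known to converge only at points of \<open>T\<close>,
  which gives no complex neighbourhood to compose in. Instead each monomial is composed with the
  holomorphic extensions \<open>H b\<close> of the coordinates of the curve, and all of them are
  dominated near \<open>t\<close> by their values at one real parameter \<open>t1\<close>, where the
  series converges absolutely. By the M-test the sum is holomorphic. Termwise differentiation gives
  the second claim, the part of the chain rule needed for immersions.\<close>

lemma ran_comp_series:
 fixes F :: "'a::euclidean_space => 'b::euclidean_space" and c :: "real => 'a"
 assumes F: "real_analytic_on F T" and e: "e > 0" "!!s. \<bar>s - t\<bar> < e ==> c s : T"
  and c: "!!b. b : Basis ==> ran (%s. c s \<bullet> b) t"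
 shows "ran (%s. F (c s) \<bullet> m) t"
  and "(!!b. b : Basis ==> ((%s. c s \<bullet> b) has_real_derivative 0) (at t)) ==>
   ((%s. F (c s) \<bullet> m) has_real_derivative 0) (at t)"
proof -
 let ?t = "cx t"
 define x where "x = c t"
 define A where "A = (Basis \<rightarrow>\<^sub>E UNIV :: ('a => nat) set)"
 have xT: "x : T" unfolding x_def using e by simp
 obtain r d where r: "r > 0" and d: "!!y. y : T \<inter> ball x r ==>
   ((%\<alpha>. (\<Prod>b\<in>Basis. ((y - x) \<bullet> b) ^ \<alpha> b) *\<^sub>R d \<alpha>) has_sum F y) A"
  using F xT unfolding real_analytic_on_def A_def by blast
 define u where "u b s = (c s - x) \<bullet> b" for b s
 have ranu: "ran (u b) t" if "b : Basis" for b
  using ran_diff[OF c[OF that] ran_const[of "x \<bullet> b"]] unfolding u_def by (simp add: inner_diff_left)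
 have "ALL b:Basis. EX r h. r > 0 & h holomorphic_on ball ?t r & (ALL s. \<bar>s - t\<bar> < r --> h (cx s) = cx (u b s))"
  using ran_ext[OF ranu] by blast
 then obtain rb H where H0: "!!b. b : Basis ==> rb b > 0 & H b holomorphic_on ball ?t (rb b) &
   (ALL s. \<bar>s - t\<bar> < rb b --> H b (cx s) = cx (u b s))" by metis
 define r0 where "r0 = Min (rb ` Basis)"
 have r0: "r0 > 0" "!!b. b : Basis ==> r0 <= rb b" unfolding r0_def using H0 by auto
 have H: "H b holomorphic_on ball ?t r0" "!!s. \<bar>s - t\<bar> < r0 ==> H b (cx s) = cx (u b s)" if "b : Basis" for b
  using H0[OF that] r0(2)[OF that] by (auto intro: holomorphic_on_subset)
 have Ht: "H b ?t = 0" if "b : Basis" for b using H(2)[OF that, of t] r0(1) unfolding u_def x_def by simp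
 have Hcont: "isCont (H b) ?t" if "b : Basis" for b
  using holomorphic_on_imp_continuous_on[OF H(1)[OF that]] r0(1) by (simp add: continuous_on_eq_continuous_at)
 \<comment> \<open>A coordinate whose extension vanishes on the whole disc cannot be made nonzero at
   \<open>t1\<close>; it is dominated trivially.\<close>
 define Z where "Z b \<longleftrightarrow> (ALL z:ball ?t r0. H b z = 0)" for b
 have ev1: "\<forall>\<^sub>F s in at t. Z b | u b s ~= 0" if b: "b : Basis" for b
 proof (cases "t islimpt {s. u b s = 0}")
  case True
  obtain e1 where e1: "e1 > 0" "!!s. \<bar>s - t\<bar> < e1 ==> u b s = 0" using ran_zero[OF ranu[OF b] True] by blast
  have "H b z = 0" if z: "z : ball ?t r0" for z
  proof (rule analytic_continuation[OF H(1)[OF b] open_ball connected_ball])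
   let ?U = "cx ` {s. \<bar>s - t\<bar> < min e1 r0}"
   show "?U \<subseteq> ball ?t r0" using of_real_ball by auto
   show "?t islimpt ?U" unfolding islimpt_approachable
   proof (intro allI impI)
    fix q :: real assume q: "q > 0"
    define p where "p = min q (min e1 r0) / 2"
    have p: "p > 0" "p < q" "p < e1" "p < r0" unfolding p_def using q e1(1) r0(1) by auto
    have "dist (cx (t + p)) ?t = \<bar>p\<bar>" unfolding dist_norm of_real_diff[symmetric] norm_of_real by simp
    moreover have "cx (t + p) : ?U" by (rule imageI) (use p in simp)
    moreover have "cx (t + p) ~= ?t" using p by simp
    ultimately show "EX x':?U. x' ~= ?t & dist x' ?t < q" using p
     by (intro bexI[of _ "cx (t + p)"]) auto
   qed
   show "H b w = 0" if "w : ?U" for w using that e1(2) H(2)[OF b] by auto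
  qed (use z r0(1) in auto)
  then show ?thesis unfolding Z_def by simp
 next
  case False
  then show ?thesis unfolding islimpt_iff_eventually by (auto elim: eventually_mono)
 qed
 have evr: "\<forall>\<^sub>F s in at t. c s : ball x r"
 proof -
  have "(c \<longlongrightarrow> x) (at t)"
   unfolding tendsto_componentwise_iff[of c] x_def
   using ran_isCont[OF c] by (auto simp: isCont_def)
  then have "\<forall>\<^sub>F s in at t. dist (c s) x < r" using r tendstoD by blast
  then show ?thesis by eventually_elim (simp add: dist_commute)
 qed
 then obtain e2 where e2: "e2 > 0" "!!s. \<bar>s - t\<bar> < e2 ==> c s : ball x r"
 proof -
  obtain e2 where e2: "e2 > 0" "!!s. s ~= t ==> dist s t < e2 ==> c s : ball x r" using evr unfolding eventually_at by blast
  have "c s : ball x r" if "\<bar>s - t\<bar> < e2" for s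
   using e2(2)[of s] that r unfolding x_def by (cases "s = t") (auto simp: dist_real_def)
  then show ?thesis using that e2(1) by blast
 qed
 have "\<forall>\<^sub>F s in at t. (ALL b:Basis. Z b | u b s ~= 0) & \<bar>s - t\<bar> < min (min e e2) r0"
 proof (intro eventually_conj)
  show "\<forall>\<^sub>F s in at t. ALL b:Basis. Z b | u b s ~= 0" using ev1 by (intro eventually_ball_finite) auto
  show "\<forall>\<^sub>F s in at t. \<bar>s - t\<bar> < min (min e e2) r0"
   unfolding eventually_at using e(1) e2(1) r0(1) by (intro exI[of _ "min (min e e2) r0"]) (auto simp: dist_real_def)
 qed
 then obtain t1 where t1: "!!b. b : Basis ==> Z b | u b t1 ~= 0" "\<bar>t1 - t\<bar> < e" "\<bar>t1 - t\<bar> < e2" "\<bar>t1 - t\<bar> < r0"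
  using eventually_happens'[OF at_neq_bot] by fastforce
 let ?q = "cx t1"
 \<comment> \<open>\<open>H b\<close> vanishes at \<open>t\<close> and, unless it is identically
   zero, not at \<open>t1\<close>; by continuity its values near \<open>t\<close> are smaller in
   norm than the one at \<open>t1\<close>.\<close>
 have "EX r1>0. ALL z:ball ?t r1. z : ball ?t r0 & (ALL b:Basis. norm (H b z) <= norm (H b ?q))"
 proof -
  have "\<forall>\<^sub>F z in nhds ?t. ALL b:Basis. z : ball ?t r0 --> norm (H b z) <= norm (H b ?q)"
  proof (intro eventually_ball_finite ballI)
   fix b :: 'a assume b: "b : Basis"
   show "\<forall>\<^sub>F z in nhds ?t. z : ball ?t r0 --> norm (H b z) <= norm (H b ?q)"
   proof (cases "Z b")
    case True
    then show ?thesis unfolding Z_def by simp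
   next
    case False
    then have "norm (H b ?q) > 0" using t1(1)[OF b] H(2)[OF b t1(4)] by simp
    moreover have "(H b \<longlongrightarrow> H b ?t) (nhds ?t)"
     using Hcont[OF b] unfolding isCont_def tendsto_at_iff_tendsto_nhds .
    then have "(H b \<longlongrightarrow> 0) (nhds ?t)" using Ht[OF b] by simp
    ultimately have "\<forall>\<^sub>F z in nhds ?t. dist (H b z) 0 < norm (H b ?q)" using tendstoD by blast
    then show ?thesis by eventually_elim simp
   qed
  qed auto
  moreover have "\<forall>\<^sub>F z in nhds ?t. z : ball ?t r0" using r0(1) by (intro eventually_nhds_in_open) auto
  ultimately have "\<forall>\<^sub>F z in nhds ?t. z : ball ?t r0 & (ALL b:Basis. norm (H b z) <= norm (H b ?q))"
   by eventually_elim auto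
  then show ?thesis unfolding eventually_nhds_metric by (auto simp: dist_commute)
 qed
 then obtain r1' where r1': "r1' > 0" "!!z. z : ball ?t r1' ==> z : ball ?t r0"
  "!!z b. [|z : ball ?t r1'; b : Basis|] ==> norm (H b z) <= norm (H b ?q)" by blast
 define r1 where "r1 = r1' / 2"
 have r1: "r1 > 0" "cball ?t r1 \<subseteq> ball ?t r0" "!!z b. [|z : cball ?t r1; b : Basis|] ==> norm (H b z) <= norm (H b ?q)"
  using r1' unfolding r1_def by (auto simp: subset_iff)
 define f where "f \<alpha> z = (\<Prod>b\<in>Basis. H b z ^ \<alpha> b) * cx (d \<alpha> \<bullet> m)" for \<alpha> z
 have freal: "f \<alpha> (cx s) = cx (((\<Prod>b\<in>Basis. ((c s - x) \<bullet> b) ^ \<alpha> b) *\<^sub>R d \<alpha>) \<bullet> m)"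
  if "\<bar>s - t\<bar> < r0" for \<alpha> s
  unfolding f_def using H(2) that by (simp add: u_def)
 have hs: "((%\<alpha>. ((\<Prod>b\<in>Basis. ((c s - x) \<bullet> b) ^ \<alpha> b) *\<^sub>R d \<alpha>) \<bullet> m) has_sum F (c s) \<bullet> m) A"
  if "\<bar>s - t\<bar> < e" "\<bar>s - t\<bar> < e2" for s
  by (rule has_sum_bounded_linear[OF bounded_linear_inner_left d]) (use e(2) e2(2) that in blast)
 \<comment> \<open>For real series unconditional summability is absolute; this yields the dominating
   series.\<close>
 have sm: "(%\<alpha>. norm (f \<alpha> ?q)) summable_on A"
 proof -
  have "(%\<alpha>. ((\<Prod>b\<in>Basis. ((c t1 - x) \<bullet> b) ^ \<alpha> b) *\<^sub>R d \<alpha>) \<bullet> m) summable_on A"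
   using hs[OF t1(2,3)] has_sum_imp_summable by blast
  then have "(%\<alpha>. norm (((\<Prod>b\<in>Basis. ((c t1 - x) \<bullet> b) ^ \<alpha> b) *\<^sub>R d \<alpha>) \<bullet> m)) summable_on A"
   by (rule iffD1[OF summable_on_iff_abs_summable_on_real])
  then show ?thesis unfolding freal[OF t1(4)] norm_of_real real_norm_def .
 qed
 have bound: "norm (f \<alpha> z) <= norm (f \<alpha> ?q)" if "z : cball ?t r1" for \<alpha> z
  unfolding f_def norm_mult prod_norm[symmetric] norm_power
  using r1(3)[OF that] by (intro mult_right_mono prod_mono) (auto intro: power_mono)
 define g where "g z = (\<Sum>\<^sub>\<infinity>\<alpha>\<in>A. f \<alpha> z)" for z
 have ul: "uniform_limit (cball ?t r1) (%X z. \<Sum>\<alpha>\<in>X. f \<alpha> z) g (finite_subsets_at_top A)"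
  unfolding g_def by (rule Weierstrass_m_test_general[OF bound sm])
 have fhol: "f \<alpha> holomorphic_on ball ?t r0" for \<alpha>
  unfolding f_def using H(1) by (intro holomorphic_intros) auto
 have fd: "(f \<alpha> has_field_derivative deriv (f \<alpha>) w) (at w)" if "w : ball ?t r0" for \<alpha> w
  using holomorphic_derivI[OF fhol open_ball that] .
 have cont: "continuous_on (cball ?t r1) (%z. \<Sum>\<alpha>\<in>X. f \<alpha> z)" for X
  by (intro continuous_on_sum continuous_on_subset[OF holomorphic_on_imp_continuous_on[OF fhol] r1(2)])
 have der: "((%z. \<Sum>\<alpha>\<in>X. f \<alpha> z) has_field_derivative (\<Sum>\<alpha>\<in>X. deriv (f \<alpha>) w)) (at w)" if "w : ball ?t r1" for X w
 proof -
  have "w : ball ?t r0" using r1(2) that ball_subset_cball by blast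
  then show ?thesis by (intro DERIV_sum fd)
 qed
 obtain g' where g': "!!w. w : ball ?t r1 ==> (g has_field_derivative (g' w)) (at w) &
   ((%X. \<Sum>\<alpha>\<in>X. deriv (f \<alpha>) w) \<longlongrightarrow> g' w) (finite_subsets_at_top A)"
 proof -
  have ev: "\<forall>\<^sub>F X in finite_subsets_at_top A. continuous_on (cball ?t r1) (%z. \<Sum>\<alpha>\<in>X. f \<alpha> z) &
    (ALL w:ball ?t r1. ((%z. \<Sum>\<alpha>\<in>X. f \<alpha> z) has_field_derivative (\<Sum>\<alpha>\<in>X. deriv (f \<alpha>) w)) (at w))"
   by (rule always_eventually) (intro allI conjI ballI cont der)
  show thesis
  proof (rule has_complex_derivative_uniform_limit[OF ev ul finite_subsets_at_top_neq_bot r1(1)])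
   fix g0 assume "!!w. w : ball ?t r1 ==> (g has_field_derivative (g0 w)) (at w) &
    ((%X. \<Sum>\<alpha>\<in>X. deriv (f \<alpha>) w) \<longlongrightarrow> g0 w) (finite_subsets_at_top A)"
   then show thesis by (rule that)
  qed
 qed
 define r2 where "r2 = min (min r1 r0) (min e e2)"
 have r2: "r2 > 0" "r2 <= r1" "r2 <= r0" "r2 <= e" "r2 <= e2" unfolding r2_def using r1(1) r0(1) e(1) e2(1) by auto
 have ghol: "g holomorphic_on ball ?t r2"
  unfolding holomorphic_on_open[OF open_ball] using g' r2(2) by (metis mem_ball less_le_trans)
 have greal: "F (c s) \<bullet> m = Re (g (cx s))" if s: "\<bar>s - t\<bar> < r2" for s
 proof -
  have "((%\<alpha>. cx (((\<Prod>b\<in>Basis. ((c s - x) \<bullet> b) ^ \<alpha> b) *\<^sub>R d \<alpha>) \<bullet> m)) has_sum cx (F (c s) \<bullet> m)) A"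
   by (rule has_sum_of_real[OF hs]) (use s r2 in auto)
  then have "((%\<alpha>. f \<alpha> (cx s)) has_sum cx (F (c s) \<bullet> m)) A"
   using freal[of s] s r2(3) by simp
  then show ?thesis unfolding g_def using infsumI by fastforce
 qed
 show "ran (%s. F (c s) \<bullet> m) t" by (rule ranI[OF r2(1) ghol greal])
 assume c0: "!!b. b : Basis ==> ((%s. c s \<bullet> b) has_real_derivative 0) (at t)"
 have H0': "(H b has_field_derivative 0) (at ?t)" if b: "b : Basis" for b
 proof -
  have D: "(H b has_field_derivative deriv (H b) ?t) (at ?t)" by (rule hol_deriv_at[OF H(1)[OF b] r0(1)])
  have 1: "((%s. H b (cx s)) has_vector_derivative deriv (H b) ?t) (at t)"
   using has_vector_derivative_real_field[OF D] by simp
  have "(u b has_real_derivative 0) (at t)"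
   using c0[OF b] unfolding u_def inner_diff_left by (auto intro!: derivative_eq_intros)
  then have "((%s. cx (u b s)) has_vector_derivative cx 0) (at t)"
   by (rule has_vector_derivative_of_real)
  then have 2: "((%s. H b (cx s)) has_vector_derivative cx 0) (at t)"
   by (rule has_vector_derivative_transform_within_open[of _ _ _ "ball t r0"])
    (use r0(1) H(2)[OF b] in \<open>auto simp: dist_commute dist_real_def\<close>)
  have "deriv (H b) ?t = 0" using vector_derivative_unique_at[OF 1 2] by simp
  then show ?thesis using D by simp
 qed
 have f0: "deriv (f \<alpha>) ?t = 0" for \<alpha>
 proof -
  have pow: "((%z. H b z ^ n) has_field_derivative 0) (at ?t)" if "b : Basis" for b n
   using DERIV_power[OF H0'[OF that], of n] by simp
  have "((%z. \<Prod>b\<in>B. H b z ^ \<alpha> b) has_field_derivative 0) (at ?t)" if "finite B" "B \<subseteq> Basis" for B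
   using that
  proof (induction B rule: finite_induct)
   case (insert b B)
   have "((%z. H b z ^ \<alpha> b * (\<Prod>b\<in>B. H b z ^ \<alpha> b)) has_field_derivative 0) (at ?t)"
    using DERIV_mult[OF pow[of b "\<alpha> b"] insert.IH] insert.prems by simp
   then show ?case using insert.hyps by simp
  qed simp
  then have "(f \<alpha> has_field_derivative 0) (at ?t)"
   unfolding f_def using DERIV_cmult_right[of "%z. \<Prod>b\<in>Basis. H b z ^ \<alpha> b" 0 ?t UNIV] by fastforce
  then show ?thesis by (rule DERIV_imp_deriv)
 qed
 have tb: "?t : ball ?t r1" using r1(1) by simp
 have "((%X. 0) \<longlongrightarrow> g' ?t) (finite_subsets_at_top A)" using g'[OF tb] f0 by simp
 then have "g' ?t = 0" by (simp add: tendsto_const_iff)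
 then have D0: "(g has_field_derivative 0) (at ?t)" using g'[OF tb] by simp
 have "((%s. F (c s) \<bullet> m) has_real_derivative Re 0) (at t)" by (rule ran_vec_deriv[OF ghol r2(1) greal D0])
 then show "((%s. F (c s) \<bullet> m) has_real_derivative 0) (at t)" by simp
qed

section \<open>Curves in analytic manifolds\<close>

lemma real_analytic_on_cong:
 assumes "!!x. x : S ==> f x = g x" shows "real_analytic_on f S \<longleftrightarrow> real_analytic_on g S"
 unfolding real_analytic_on_def
 by (intro ball_cong[OF refl] ex_cong1 conj_cong[OF refl]) (auto simp: assms)

lemma real_analytic_ran:
 fixes f :: "real => 'e::euclidean_space"
 assumes "real_analytic_on f S" "open S" "t : S" shows "ran (%s. f s \<bullet> b) t"
proof -
 obtain e where e: "e > 0" "ball t e \<subseteq> S" using assms open_contains_ball by blast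
 show ?thesis
  by (rule ran_comp_series(1)[OF assms(1) e(1), of t "%s. s"])
   (use e(2) ran_id in \<open>auto simp: subset_iff dist_real_def abs_minus_commute\<close>)
qed

text \<open>Absolute convergence at \<open>y\<close> comes from convergence at a real point slightly
  farther from \<open>x\<close>, still inside the disc.\<close>

lemma powser_real_sums:
 assumes h: "h holomorphic_on ball (cx x) r" and y: "\<bar>y - x\<bar> < r"
 defines "a \<equiv> %n. (deriv ^^ n) h (cx x) / fact n"
 shows "(%n. Re (a n) * (y - x) ^ n) sums Re (h (cx y))"
  and "summable (%n. \<bar>Re (a n) * (y - x) ^ n\<bar>)"
proof -
 have sums: "(%n. a n * (cx (y - x)) ^ n) sums h (cx y)" if "\<bar>y - x\<bar> < r" for y
  using holomorphic_power_series[OF h, of "cx y"] that of_real_ball unfolding a_def by simp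
 have Re: "Re (a n * (cx w) ^ n) = Re (a n) * w ^ n" for n w
  by (simp flip: of_real_power)
 show "(%n. Re (a n) * (y - x) ^ n) sums Re (h (cx y))"
  using sums_Re[OF sums[OF y]] unfolding Re .
 define w where "w = (\<bar>y - x\<bar> + r) / 2"
 have w: "\<bar>y - x\<bar> < w" "w < r" using y unfolding w_def by auto
 have "\<bar>(x + w) - x\<bar> < r" using w by simp
 then have "summable (%n. a n * (cx ((x + w) - x)) ^ n)" using sums sums_summable by blast
 then have "summable (%n. norm (a n * cx (y - x) ^ n))"
  by (rule powser_insidea) (use w in \<open>simp flip: of_real_diff\<close>)
 then show "summable (%n. \<bar>Re (a n) * (y - x) ^ n\<bar>)"
 proof (rule summable_comparison_test')
  fix n :: nat
  show "norm \<bar>Re (a n) * (y - x) ^ n\<bar> <= norm (a n * cx (y - x) ^ n)"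
   unfolding Re[symmetric] by (simp only: real_norm_def abs_idempotent abs_Re_le_cmod)
 qed
qed

text \<open>The coefficients are the real parts of the Taylor coefficients of the coordinatewise
  holomorphic extensions.\<close>

lemma ran_real_analytic:
 fixes f :: "real => 'e::euclidean_space"
 assumes "!!t b. [|t : S; b : Basis|] ==> ran (%s. f s \<bullet> b) t" shows "real_analytic_on f S"
 unfolding real_analytic_on_def
proof
 fix x assume x: "x : S"
 have "ALL b:Basis. EX r h. r > 0 & h holomorphic_on ball (cx x) r & (ALL s. \<bar>s - x\<bar> < r --> f s \<bullet> b = Re (h (cx s)))"
  using assms[OF x] unfolding ran_def by blast
 then obtain rb h where h: "!!b. b : Basis ==> rb b > 0 & h b holomorphic_on ball (cx x) (rb b) &
  (ALL s. \<bar>s - x\<bar> < rb b --> f s \<bullet> b = Re (h b (cx s)))" by metis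
 define r where "r = Min (rb ` Basis)"
 have r: "r > 0" "!!b. b : Basis ==> r <= rb b" unfolding r_def using h by auto
 define a where "a b n = Re ((deriv ^^ n) (h b) (cx x) / fact n)" for b n
 define C where "C n = (\<Sum>b\<in>Basis. a b n *\<^sub>R b)" for n
 have main: "((%n. (y - x) ^ n *\<^sub>R C n) has_sum f y) UNIV" if y: "\<bar>y - x\<bar> < r" for y
 proof (rule norm_summable_imp_has_sum)
  have s1: "(%n. a b n * (y - x) ^ n) sums (f y \<bullet> b)" and s2: "summable (%n. \<bar>a b n * (y - x) ^ n\<bar>)" if b: "b : Basis" for b
  proof -
   have yb: "\<bar>y - x\<bar> < rb b" using y r(2)[OF b] by simp
   show "(%n. a b n * (y - x) ^ n) sums (f y \<bullet> b)" "summable (%n. \<bar>a b n * (y - x) ^ n\<bar>)"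
    using powser_real_sums[of "h b" x "rb b" y] h[OF b] yb unfolding a_def by auto
  qed
  have e: "(y - x) ^ n *\<^sub>R C n = (\<Sum>b\<in>Basis. (a b n * (y - x) ^ n) *\<^sub>R b)" for n
   unfolding C_def scaleR_sum_right by (simp add: mult.commute)
  have "(%n. \<Sum>b\<in>Basis. (a b n * (y - x) ^ n) *\<^sub>R b) sums (\<Sum>b\<in>Basis. (f y \<bullet> b) *\<^sub>R b)"
   by (intro sums_sum bounded_linear.sums[OF bounded_linear_scaleR_left] s1)
  then show "(%n. (y - x) ^ n *\<^sub>R C n) sums f y" unfolding e euclidean_representation .
  have "summable (%n. \<Sum>b\<in>Basis. \<bar>a b n * (y - x) ^ n\<bar>)" for b by (intro summable_sum s2)
  then show "summable (%n. norm ((y - x) ^ n *\<^sub>R C n))"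
  proof (rule summable_comparison_test')
   fix n :: nat
   show "norm (norm ((y - x) ^ n *\<^sub>R C n)) <= (\<Sum>b\<in>Basis. \<bar>a b n * (y - x) ^ n\<bar>)"
    unfolding e real_norm_def abs_norm_cancel by (rule order_trans[OF norm_sum]) (simp add: sum_mono)
  qed
 qed
 \<comment> \<open>The real line has the single basis vector 1, so multi-indices are natural numbers
   in disguise; \<open>hh\<close> re-indexes the series.\<close>
 define hh where "hh n = (\<lambda>i\<in>{1::real}. n)" for n :: nat
 have inj: "inj hh" by (rule injI) (metis hh_def restrict_apply' singletonI)
 have rng: "range hh = (Basis \<rightarrow>\<^sub>E UNIV)"
 proof (intro equalityI subsetI)
  fix \<alpha> :: "real => nat" assume "\<alpha> : Basis \<rightarrow>\<^sub>E UNIV"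
  then have "\<alpha> = hh (\<alpha> 1)" unfolding hh_def by (auto simp: PiE_iff extensional_def restrict_def)
  then show "\<alpha> : range hh" by blast
 qed (auto simp: hh_def PiE_iff extensional_def split: if_splits)
 show "EX r>0. EX c :: (real => nat) => 'e. ALL y : S \<inter> ball x r.
   ((%\<alpha>. (\<Prod>b\<in>Basis. ((y - x) \<bullet> b) ^ \<alpha> b) *\<^sub>R c \<alpha>) has_sum f y) (Basis \<rightarrow>\<^sub>E UNIV)"
 proof (intro exI[of _ r] conjI r(1) exI[of _ "%\<alpha>. C (\<alpha> 1)"] ballI)
  fix y assume "y : S \<inter> ball x r"
  then have "((%n. (y - x) ^ n *\<^sub>R C n) has_sum f y) UNIV" using main by (auto simp: dist_real_def)
  then have "((%\<alpha>. (\<Prod>b\<in>Basis. ((y - x) \<bullet> b) ^ \<alpha> b) *\<^sub>R C (\<alpha> 1)) \<circ> hh has_sum f y) UNIV"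
   by (simp add: o_def hh_def)
  then show "((%\<alpha>. (\<Prod>b\<in>Basis. ((y - x) \<bullet> b) ^ \<alpha> b) *\<^sub>R C (\<alpha> 1)) has_sum f y) (Basis \<rightarrow>\<^sub>E UNIV)"
   unfolding rng[symmetric] using has_sum_reindex[OF inj] by blast
 qed
qed

lemma vector_derivative_coords:
 fixes f :: "real => 'e::euclidean_space"
 shows "(f has_vector_derivative v) (at t) \<longleftrightarrow> (ALL b:Basis. ((%s. f s \<bullet> b) has_real_derivative v \<bullet> b) (at t))"
proof
 assume f: "(f has_vector_derivative v) (at t)"
 show "ALL b:Basis. ((%s. f s \<bullet> b) has_real_derivative v \<bullet> b) (at t)"
  unfolding has_real_derivative_iff_has_vector_derivative
  using bounded_linear.has_vector_derivative[OF bounded_linear_inner_left f] by blast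
next
 assume f: "ALL b:Basis. ((%s. f s \<bullet> b) has_real_derivative v \<bullet> b) (at t)"
 have "((%s. \<Sum>b\<in>Basis. (f s \<bullet> b) *\<^sub>R b) has_vector_derivative (\<Sum>b\<in>Basis. (v \<bullet> b) *\<^sub>R b)) (at t)"
  using f unfolding has_real_derivative_iff_has_vector_derivative
  by (intro has_vector_derivative_sum bounded_linear.has_vector_derivative[OF bounded_linear_scaleR_left]) auto
 then show "(f has_vector_derivative v) (at t)" by (simp add: euclidean_representation)
qed

locale amanifold =
 fixes M :: "('m::t2_space, 'e::euclidean_space) atlas"
 assumes man: "analytic_manifold M"
begin

abbreviation "X \<equiv> manifold_points M"

lemma chart_at: "p : X ==> EX W \<eta>. (W, \<eta>) : M & p : W"
 unfolding manifold_points_def by force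

lemma chart_open: "(W, \<eta>) : M ==> openin (top_of_set X) W"
 using man unfolding analytic_manifold_def by blast

lemma chart_inj: assumes "(W, \<eta>) : M" shows "inj_on \<eta> W"
proof -
 have "homeomorphism W (\<eta> ` W) \<eta> (inv_into W \<eta>)" using man assms unfolding analytic_manifold_def by blast
 then show ?thesis unfolding homeomorphism_def by (metis inj_onI)
qed

definition acurve :: "real set => (real => 'm) => bool" where
 "acurve K \<alpha> \<longleftrightarrow> open K & \<alpha> ` K \<subseteq> X & continuous_on K \<alpha> &
  (ALL W \<eta> t b. (W, \<eta>) : M --> t : K --> \<alpha> t : W --> ran (%s. \<eta> (\<alpha> s) \<bullet> b) t)"

lemma acurveD:
 assumes "acurve K \<alpha>"
 shows "open K" "\<alpha> ` K \<subseteq> X" "continuous_on K \<alpha>" "t : K ==> \<alpha> t : X"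
  "[|(W, \<eta>) : M; t : K; \<alpha> t : W|] ==> ran (%s. \<eta> (\<alpha> s) \<bullet> b) t"
 using assms unfolding acurve_def by auto

lemma pre_chart_open:
 assumes "open K" "\<alpha> ` K \<subseteq> X" "continuous_on K \<alpha>" "(W, \<eta>) : M" shows "open (K \<inter> \<alpha> -` W)"
proof -
 have "openin (top_of_set K) (K \<inter> \<alpha> -` W)"
  using continuous_openin_preimage[OF assms(3) _ chart_open[OF assms(4)]] assms(2) by blast
 then show ?thesis using assms(1) openin_open_eq by blast
qed

lemma acurve_chart_near:
 assumes a: "acurve K \<alpha>" and W: "(W, \<eta>) : M" and t: "t : K" "\<alpha> t : W"
 shows "EX e>0. ALL s. \<bar>s - t\<bar> < e --> s : K & \<alpha> s : W"
proof -
 have "open (K \<inter> \<alpha> -` W)" by (rule pre_chart_open[OF acurveD(1-3)[OF a] W])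
 then obtain e where e: "e > 0" "ball t e \<subseteq> K \<inter> \<alpha> -` W" using t open_contains_ball by blast
 have "s : K & \<alpha> s : W" if "\<bar>s - t\<bar> < e" for s
 proof -
  have "s : ball t e" using that by (simp add: dist_real_def)
  then show ?thesis using e by blast
 qed
 then show ?thesis using e by blast
qed

lemma acurve_iff:
 assumes K: "open K" shows "analytic_map {(K, id)} M \<alpha> \<longleftrightarrow> acurve K \<alpha>"
proof -
 have pts: "manifold_points {(K, id)} = K" unfolding manifold_points_def by simp
 have eq: "real_analytic_on (\<eta> \<circ> \<alpha> \<circ> inv_into K id) (id ` (K \<inter> \<alpha> -` W)) \<longleftrightarrow>
   (ALL t:K. \<alpha> t : W --> (ALL b. ran (%s. \<eta> (\<alpha> s) \<bullet> b) t))"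
  if W: "(W, \<eta>) : M" and c: "\<alpha> ` K \<subseteq> X" "continuous_on K \<alpha>" for W \<eta>
 proof -
  have inv: "inv_into K id t = t" if "t : K" for t using inv_into_f_f[of id K t] that by simp
  have "real_analytic_on (\<eta> \<circ> \<alpha> \<circ> inv_into K id) (id ` (K \<inter> \<alpha> -` W)) \<longleftrightarrow> real_analytic_on (%s. \<eta> (\<alpha> s)) (K \<inter> \<alpha> -` W)"
   unfolding image_id id_apply by (rule real_analytic_on_cong) (simp add: inv)
  also have "\<dots> \<longleftrightarrow> (ALL t:K. \<alpha> t : W --> (ALL b. ran (%s. \<eta> (\<alpha> s) \<bullet> b) t))"
  proof
   assume "real_analytic_on (%s. \<eta> (\<alpha> s)) (K \<inter> \<alpha> -` W)"
   then show "ALL t:K. \<alpha> t : W --> (ALL b. ran (%s. \<eta> (\<alpha> s) \<bullet> b) t)"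
    using real_analytic_ran[OF _ pre_chart_open[OF K c W]] by blast
  next
   assume r: "ALL t:K. \<alpha> t : W --> (ALL b. ran (%s. \<eta> (\<alpha> s) \<bullet> b) t)"
   show "real_analytic_on (%s. \<eta> (\<alpha> s)) (K \<inter> \<alpha> -` W)" by (rule ran_real_analytic) (use r in blast)
  qed
  finally show ?thesis .
 qed
 show ?thesis unfolding analytic_map_def acurve_def pts using K eq by auto
qed

lemma acurve_subset: "[|acurve K \<alpha>; open L; L \<subseteq> K|] ==> acurve L \<alpha>"
 unfolding acurve_def by (auto intro: continuous_on_subset simp: subset_iff)

lemma open_immersion_iff:
 "open_immersion M I \<gamma> \<longleftrightarrow> interval I & acurve I \<gamma> &
  (ALL W \<eta> t. (W, \<eta>) : M --> t : I --> \<gamma> t : W --> (EX v. v ~= 0 & ((%s. \<eta> (\<gamma> s)) has_vector_derivative v) (at t)))"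
proof -
 have o: "(\<eta> \<circ> \<gamma> has_vector_derivative v) F = ((%s. \<eta> (\<gamma> s)) has_vector_derivative v) F" for \<eta> v F by (simp add: o_def)
 show ?thesis
  unfolding open_immersion_def open_interval_def o
  using acurve_iff[of I \<gamma>] acurveD(1)[of I \<gamma>] by auto
qed

lemma immersionD:
 assumes "open_immersion M I \<gamma>" shows "interval I" "acurve I \<gamma>" "open I" "is_interval I"
  "[|(W, \<eta>) : M; t : I; \<gamma> t : W|] ==> EX v. v ~= 0 & ((%s. \<eta> (\<gamma> s)) has_vector_derivative v) (at t)"
 using assms acurveD(1) unfolding open_immersion_iff interval_def by (auto simp: is_interval_connected_1)

text \<open>\<open>R\<close> is the only candidate for a map with
  \<open>\<alpha> = \<beta> \<circ> R\<close> near \<open>t\<close>. It exists whether or not the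
  curves coincide nearby; every coincidence near the pair \<open>t\<close>, \<open>r\<close> is
  given by it; and if its coincidences accumulate at \<open>t\<close>, it is a lift on a whole
  neighbourhood.\<close>

definition local_lift ::
  "real set => (real => 'm) => real set => (real => 'm) => real => real => real => (real => real) => bool" where
 "local_lift K \<alpha> L \<beta> t r e R \<longleftrightarrow> (ALL s. \<bar>s - t\<bar> < e --> ran R s & s : K & R s : L) & R t = r &
  (ALL x y. \<bar>x - t\<bar> < e --> \<bar>y - r\<bar> < e --> y : L --> \<alpha> x = \<beta> y --> y = R x) &
  (t islimpt {x. \<alpha> x = \<beta> (R x)} --> (ALL x. \<bar>x - t\<bar> < e --> \<alpha> x = \<beta> (R x)))"

lemma local_liftD:
 assumes "local_lift K \<alpha> L \<beta> t r e R"
 shows "\<bar>s - t\<bar> < e ==> ran R s & s : K & R s : L" "R t = r"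
  "[|\<bar>x - t\<bar> < e; \<bar>y - r\<bar> < e; y : L; \<alpha> x = \<beta> y|] ==> y = R x"
  "[|t islimpt {x. \<alpha> x = \<beta> (R x)}; \<bar>x - t\<bar> < e|] ==> \<alpha> x = \<beta> (R x)"
 using assms unfolding local_lift_def by auto

text \<open>Some coordinate \<open>m\<close> of \<open>\<beta>\<close> has nonzero derivative at
  \<open>r\<close> and is locally invertible; \<open>R\<close> is this inverse applied to the same
  coordinate of \<open>\<alpha>\<close>. Accumulating coincidences are zeros of the analytic
  coordinate differences, which therefore vanish.\<close>

lemma lift:
 assumes a: "acurve K \<alpha>" and b: "open_immersion M L \<beta>" and t: "t : K" "r : L" "\<alpha> t = \<beta> r"
 shows "EX e>0. EX R. local_lift K \<alpha> L \<beta> t r e R"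
proof -
 note B = immersionD[OF b]
 obtain W \<eta> where W: "(W, \<eta>) : M" "\<beta> r : W" using chart_at acurveD(4)[OF B(2) t(2)] by blast
 obtain v where v: "v ~= 0" "((%s. \<eta> (\<beta> s)) has_vector_derivative v) (at r)" using B(5)[OF W(1) t(2) W(2)] by blast
 obtain m where m: "m : Basis" "v \<bullet> m ~= 0" using v(1) by (metis euclidean_all_zero_iff)
 define u where "u y = \<eta> (\<beta> y) \<bullet> m" for y
 have ru: "ran u r" unfolding u_def by (rule acurveD(5)[OF B(2) W(1) t(2) W(2)])
 have "(u has_real_derivative v \<bullet> m) (at r)" unfolding u_def using v(2) m(1) unfolding vector_derivative_coords by blast
 then obtain w e0 where w: "e0 > 0" "ran w (u r)" "!!s. \<bar>s - r\<bar> < e0 ==> w (u s) = s" using ran_inverse[OF ru _ m(2)] by blast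
 define z where "z x = \<eta> (\<alpha> x) \<bullet> m" for x
 have aW: "\<alpha> t : W" using W(2) t(3) by simp
 have rz: "ran z t" unfolding z_def by (rule acurveD(5)[OF a W(1) t(1) aW])
 have zt: "z t = u r" unfolding z_def u_def using t(3) by simp
 define R where "R x = w (z x)" for x
 have rr: "ran R t" unfolding R_def by (rule ran_comp[OF rz]) (use w(2) zt in simp)
 have rt: "R t = r" unfolding R_def zt using w(1,3) by simp
 obtain e1 where e1: "e1 > 0" "!!s. \<bar>s - t\<bar> < e1 ==> ran R s" using ran_near[OF rr] by blast
 obtain e2 where e2: "e2 > 0" "!!s. \<bar>s - t\<bar> < e2 ==> s : K & \<alpha> s : W" using acurve_chart_near[OF a W(1) t(1) aW] by blast
 obtain e3 where e3: "e3 > 0" "!!s. \<bar>s - r\<bar> < e3 ==> s : L & \<beta> s : W" using acurve_chart_near[OF B(2) W(1) t(2) W(2)] by blast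
 obtain e4 where e4: "e4 > 0" "!!s. \<bar>s - t\<bar> < e4 ==> \<bar>R s - r\<bar> < e3"
  using ran_isCont[OF rr] e3(1) rt unfolding continuous_at_eps_delta by (metis dist_real_def)
 have "EX e5>0. t islimpt {x. \<alpha> x = \<beta> (R x)} --> (ALL x. \<bar>x - t\<bar> < e5 --> (ALL b:Basis. \<eta> (\<alpha> x) \<bullet> b - \<eta> (\<beta> (R x)) \<bullet> b = 0))"
 proof (cases "t islimpt {x. \<alpha> x = \<beta> (R x)}")
  case True
  have "EX e>0. ALL x. \<bar>x - t\<bar> < e --> \<eta> (\<alpha> x) \<bullet> b - \<eta> (\<beta> (R x)) \<bullet> b = 0" for b
  proof (rule ran_zero)
   show "ran (%s. \<eta> (\<alpha> s) \<bullet> b - \<eta> (\<beta> (R s)) \<bullet> b) t"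
   proof (rule ran_diff)
    show "ran (%s. \<eta> (\<alpha> s) \<bullet> b) t" by (rule acurveD(5)[OF a W(1) t(1) aW])
    show "ran (%s. \<eta> (\<beta> (R s)) \<bullet> b) t"
     by (rule ran_comp[OF rr, of "%y. \<eta> (\<beta> y) \<bullet> b"]) (use acurveD(5)[OF B(2) W(1) t(2) W(2)] rt in simp)
   qed
   show "t islimpt {s. \<eta> (\<alpha> s) \<bullet> b - \<eta> (\<beta> (R s)) \<bullet> b = 0}"
    by (rule islimpt_subset[OF True]) auto
  qed
  then obtain eb where eb: "!!b. eb b > 0" "!!b x. \<bar>x - t\<bar> < eb b ==> \<eta> (\<alpha> x) \<bullet> b - \<eta> (\<beta> (R x)) \<bullet> b = 0" by metis
  have "Min (eb ` Basis) > 0" using eb(1) by simp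
  then show ?thesis using eb(2) by (intro exI[of _ "Min (eb ` Basis)"]) auto
 qed (auto intro: exI[of _ 1])
 then obtain e5 where e5: "e5 > 0" "!!x b. [|t islimpt {x. \<alpha> x = \<beta> (R x)}; \<bar>x - t\<bar> < e5; b:Basis|] ==> \<eta> (\<alpha> x) \<bullet> b = \<eta> (\<beta> (R x)) \<bullet> b"
  by fastforce
 define e where "e = min (min e0 e1) (min e2 (min e4 e5))"
 have e: "e > 0" "e <= e0" "e <= e1" "e <= e2" "e <= e4" "e <= e5" unfolding e_def using w(1) e1(1) e2(1) e4(1) e5(1) by auto
 have 1: "ran R s & s : K & R s : L" if "\<bar>s - t\<bar> < e" for s
  using that e e1(2)[of s] e2(2)[of s] e3(2)[OF e4(2)[of s]] by auto
 have 2: "y = R x" if "\<bar>x - t\<bar> < e" "\<bar>y - r\<bar> < e" "\<alpha> x = \<beta> y" for x y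
  using w(3)[of y] that e unfolding R_def z_def u_def by simp
 have 3: "\<alpha> x = \<beta> (R x)" if l: "t islimpt {x. \<alpha> x = \<beta> (R x)}" and x: "\<bar>x - t\<bar> < e" for x
 proof (rule inj_onD[OF chart_inj[OF W(1)]])
  show "\<eta> (\<alpha> x) = \<eta> (\<beta> (R x))" by (rule euclidean_eqI) (use e5(2)[OF l] x e in auto)
  show "\<alpha> x : W" "\<beta> (R x) : W" using e2(2)[of x] e3(2)[OF e4(2)[of x]] x e by auto
 qed
 have "local_lift K \<alpha> L \<beta> t r e R" unfolding local_lift_def using 1 2 3 rt by blast
 then show ?thesis using e(1) by blast
qed

text \<open>The set that is open and closed in \<open>K\<close> consists of the accumulation points
  of coincidences; its openness is the one-variable identity theorem in a chart.\<close>

lemma acurve_ident: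
 assumes a: "acurve K \<alpha>" and b: "acurve K \<beta>" and K: "is_interval K" and t: "t : K" "t islimpt {s : K. \<alpha> s = \<beta> s}"
  and s: "s : K"
 shows "\<alpha> s = \<beta> s"
proof -
 define E where "E = {s : K. \<alpha> s = \<beta> s}"
 define Q where "Q = {t : K. t islimpt E}"
 have lim: "\<alpha> t = \<beta> t" if t: "t : K" "t islimpt E" for t
 proof -
  obtain f where f: "!!n. f n : E - {t}" "f \<longlonglongrightarrow> t" using t(2) unfolding islimpt_sequential by blast
  have "isCont \<alpha> t" "isCont \<beta> t" using acurveD(1,3)[OF a] acurveD(3)[OF b] t(1) by (auto simp: continuous_on_eq_continuous_at)
  then have "(%n. \<alpha> (f n)) \<longlonglongrightarrow> \<alpha> t" "(%n. \<beta> (f n)) \<longlonglongrightarrow> \<beta> t" using f(2) isCont_tendsto_compose by blast+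
  moreover have "\<alpha> (f n) = \<beta> (f n)" for n using f(1)[of n] unfolding E_def by blast
  ultimately show ?thesis using LIMSEQ_unique by fastforce
 qed
 have near: "EX e>0. ball t e \<subseteq> E" if t: "t : K" "t islimpt E" for t
 proof -
  have eq: "\<alpha> t = \<beta> t" by (rule lim[OF t])
  obtain W \<eta> where W: "(W, \<eta>) : M" "\<alpha> t : W" using chart_at acurveD(4)[OF a t(1)] by blast
  have bW: "\<beta> t : W" using W(2) eq by simp
  obtain e1 where e1: "e1 > 0" "!!s. \<bar>s - t\<bar> < e1 ==> s : K & \<alpha> s : W" using acurve_chart_near[OF a W(1) t(1) W(2)] by blast
  obtain e2 where e2: "e2 > 0" "!!s. \<bar>s - t\<bar> < e2 ==> s : K & \<beta> s : W" using acurve_chart_near[OF b W(1) t(1) bW] by blast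
  have "EX e>0. ALL x. \<bar>x - t\<bar> < e --> \<eta> (\<alpha> x) \<bullet> b - \<eta> (\<beta> x) \<bullet> b = 0" for b
  proof (rule ran_zero)
   show "ran (%s. \<eta> (\<alpha> s) \<bullet> b - \<eta> (\<beta> s) \<bullet> b) t"
    by (rule ran_diff[OF acurveD(5)[OF a W(1) t(1) W(2)] acurveD(5)[OF assms(2) W(1) t(1) bW]])
   show "t islimpt {s. \<eta> (\<alpha> s) \<bullet> b - \<eta> (\<beta> s) \<bullet> b = 0}"
    by (rule islimpt_subset[OF t(2)]) (auto simp: E_def)
  qed
  then obtain eb where eb: "!!b. eb b > 0" "!!b x. \<bar>x - t\<bar> < eb b ==> \<eta> (\<alpha> x) \<bullet> b - \<eta> (\<beta> x) \<bullet> b = 0" by metis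
  define e where "e = min (Min (eb ` Basis)) (min e1 e2)"
  have e: "e > 0" "e <= e1" "e <= e2" "!!b. b : Basis ==> e <= eb b" unfolding e_def using eb(1) e1(1) e2(1) by (auto simp: min.coboundedI1)
  have "s : E" if "s : ball t e" for s
  proof -
   have st: "\<bar>s - t\<bar> < e" using that by (simp add: dist_real_def)
   have "\<alpha> s = \<beta> s"
   proof (rule inj_onD[OF chart_inj[OF W(1)]])
    show "\<eta> (\<alpha> s) = \<eta> (\<beta> s)" by (rule euclidean_eqI) (use eb(2) st e(4) in force)
    show "\<alpha> s : W" "\<beta> s : W" using e1(2)[of s] e2(2)[of s] st e by auto
   qed
   then show ?thesis unfolding E_def using e1(2)[of s] st e by auto
  qed
  then show ?thesis using e(1) by blast
 qed
 have "open Q" unfolding open_contains_ball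
 proof
  fix t assume "t : Q"
  then obtain e where e: "e > 0" "ball t e \<subseteq> E" using near unfolding Q_def by blast
  have "x : Q" if x: "x : ball t e" for x
  proof -
   have "x islimpt ball t e" using x by (simp add: open_imp_islimpt)
   then have "x islimpt E" using e(2) islimpt_subset by blast
   then show ?thesis unfolding Q_def using x e(2) unfolding E_def by blast
  qed
  then show "EX e>0. ball t e \<subseteq> Q" using e(1) by blast
 qed
 moreover have "open (K - Q)"
 proof -
  have "closed {x. x islimpt E}" by (rule closed_limpts)
  then have "open (K - {x. x islimpt E})" using acurveD(1)[OF a] by (intro open_Diff)
  moreover have "K - Q = K - {x. x islimpt E}" unfolding Q_def by blast
  ultimately show ?thesis by simp
 qed
 moreover have "connected K" using K is_interval_connected by blast
 moreover have "Q \<inter> (K - Q) \<inter> K = {}" "K \<subseteq> Q \<union> (K - Q)" by auto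
 ultimately have "Q \<inter> K = {} | (K - Q) \<inter> K = {}" using connectedD by blast
 moreover have "t : Q" using t unfolding Q_def E_def by blast
 ultimately have "s : Q" using s t(1) by blast
 then show ?thesis using lim unfolding Q_def by blast
qed

text \<open>Both claims are \<open>ran_comp_series\<close> for the chart expression of
  \<open>f\<close>; the second is the chain rule for vanishing velocity.\<close>

lemma acurve_act:
 assumes a: "acurve K \<alpha>" and f: "analytic_map M M f" shows "acurve K (f \<circ> \<alpha>)"
  and "[|(U, \<psi>) : M; (W, \<eta>) : M; t : K; \<alpha> t : U; f (\<alpha> t) : W;
   !!b. b : Basis ==> ((%s. \<psi> (\<alpha> s) \<bullet> b) has_real_derivative 0) (at t)|] ==>
   ((%s. \<eta> (f (\<alpha> s)) \<bullet> m) has_real_derivative 0) (at t)"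
proof -
 have fX: "f ` X \<subseteq> X" and fc: "continuous_on X f" using f unfolding analytic_map_def by auto
 have im: "(f \<circ> \<alpha>) ` K \<subseteq> X" using acurveD(2)[OF a] fX by auto
 have ct: "continuous_on K (f \<circ> \<alpha>)"
  by (rule continuous_on_compose[OF acurveD(3)[OF a] continuous_on_subset[OF fc acurveD(2)[OF a]]])
 have key: "ran (%s. \<eta> (f (\<alpha> s)) \<bullet> m) t &
   ((ALL b:Basis. ((%s. \<psi> (\<alpha> s) \<bullet> b) has_real_derivative 0) (at t)) -->
   ((%s. \<eta> (f (\<alpha> s)) \<bullet> m) has_real_derivative 0) (at t))"
  if U: "(U, \<psi>) : M" and W: "(W, \<eta>) : M" and t: "t : K" "\<alpha> t : U" "f (\<alpha> t) : W" for U \<psi> W \<eta> t m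
 proof -
  have F: "real_analytic_on (\<eta> \<circ> f \<circ> inv_into U \<psi>) (\<psi> ` (U \<inter> f -` W))"
  proof -
   have "ALL (U, \<psi>):M. ALL (W, \<eta>):M. real_analytic_on (\<eta> \<circ> f \<circ> inv_into U \<psi>) (\<psi> ` (U \<inter> f -` W))"
    using f unfolding analytic_map_def by simp
   from bspec[OF this U] have "ALL (W, \<eta>):M. real_analytic_on (\<eta> \<circ> f \<circ> inv_into U \<psi>) (\<psi> ` (U \<inter> f -` W))" by simp
   from bspec[OF this W] show ?thesis by simp
  qed
  obtain e1 where e1: "e1 > 0" "!!s. \<bar>s - t\<bar> < e1 ==> s : K & \<alpha> s : U" using acurve_chart_near[OF a U t(1,2)] by blast
  have "open (K \<inter> (f \<circ> \<alpha>) -` W)" by (rule pre_chart_open[OF acurveD(1)[OF a] im ct W])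
  moreover have "t : K \<inter> (f \<circ> \<alpha>) -` W" using t by simp
  ultimately obtain e2 where e2: "e2 > 0" "ball t e2 \<subseteq> K \<inter> (f \<circ> \<alpha>) -` W" using open_contains_ball by blast
  have W': "f (\<alpha> s) : W" if "\<bar>s - t\<bar> < e2" for s
  proof -
   have "s : ball t e2" using that by (simp add: dist_real_def)
   then show ?thesis using e2(2) by auto
  qed
  define e where "e = min e1 e2"
  have e: "e > 0" "e <= e1" "e <= e2" unfolding e_def using e1(1) e2(1) by auto
  have mem: "\<psi> (\<alpha> s) : \<psi> ` (U \<inter> f -` W)" if "\<bar>s - t\<bar> < e" for s using e1(2)[of s] W'[of s] that e by auto
  have eq: "(\<eta> \<circ> f \<circ> inv_into U \<psi>) (\<psi> (\<alpha> s)) = \<eta> (f (\<alpha> s))" if "\<bar>s - t\<bar> < e" for s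
   using inv_into_f_f[OF chart_inj[OF U]] e1(2)[of s] that e by auto
  have rc: "ran (%s. \<psi> (\<alpha> s) \<bullet> b) t" for b by (rule acurveD(5)[OF a U t(1,2)])
  have 1: "ran (%s. (\<eta> \<circ> f \<circ> inv_into U \<psi>) (\<psi> (\<alpha> s)) \<bullet> m) t"
   by (rule ran_comp_series(1)[OF F e(1) mem rc])
  have "ran (%s. \<eta> (f (\<alpha> s)) \<bullet> m) t" by (rule ran_cong[OF 1 e(1)]) (use eq in simp)
  moreover have "((%s. \<eta> (f (\<alpha> s)) \<bullet> m) has_real_derivative 0) (at t)"
   if "ALL b:Basis. ((%s. \<psi> (\<alpha> s) \<bullet> b) has_real_derivative 0) (at t)"
  proof -
   have "((%s. (\<eta> \<circ> f \<circ> inv_into U \<psi>) (\<psi> (\<alpha> s)) \<bullet> m) has_real_derivative 0) (at t)"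
    by (rule ran_comp_series(2)[OF F e(1) mem rc]) (use that in auto)
   then show ?thesis
    by (rule has_field_derivative_transform_within_open[of _ _ _ "ball t e"])
     (use e(1) eq in \<open>auto simp: dist_real_def abs_minus_commute\<close>)
  qed
  ultimately show ?thesis by blast
 qed
 show "acurve K (f \<circ> \<alpha>)" unfolding acurve_def
 proof (intro conjI allI impI)
  fix W \<eta> t b assume W: "(W, \<eta>) : M" "t : K" "(f \<circ> \<alpha>) t : W"
  obtain U \<psi> where "(U, \<psi>) : M" "\<alpha> t : U" using chart_at acurveD(4)[OF a W(2)] by blast
  then show "ran (%s. \<eta> ((f \<circ> \<alpha>) s) \<bullet> b) t" using key[of U \<psi> W \<eta> t b] W by simp
 qed (use acurveD(1)[OF a] im ct in auto)
 show "[|(U, \<psi>) : M; (W, \<eta>) : M; t : K; \<alpha> t : U; f (\<alpha> t) : W;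
   !!b. b : Basis ==> ((%s. \<psi> (\<alpha> s) \<bullet> b) has_real_derivative 0) (at t)|] ==>
   ((%s. \<eta> (f (\<alpha> s)) \<bullet> m) has_real_derivative 0) (at t)" using key by blast
qed

text \<open>If \<open>f \<circ> \<alpha>\<close> had velocity zero at \<open>t\<close>, so would its
  image under \<open>f'\<close>, which is \<open>\<alpha>\<close> again.\<close>

lemma immersion_act:
 assumes a: "open_immersion M I \<alpha>" and f: "analytic_map M M f" and f': "analytic_map M M f'"
  and inv: "!!x. x : X ==> f' (f x) = x"
 shows "open_immersion M I (f \<circ> \<alpha>)"
proof -
 note A = immersionD[OF a]
 have c: "acurve I (f \<circ> \<alpha>)" by (rule acurve_act(1)[OF A(2) f])
 have "EX v. v ~= 0 & ((%s. \<eta> ((f \<circ> \<alpha>) s)) has_vector_derivative v) (at t)"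
  if W: "(W, \<eta>) : M" and t: "t : I" "(f \<circ> \<alpha>) t : W" for W \<eta> t
 proof -
  have "ALL b. EX d. ((%s. \<eta> ((f \<circ> \<alpha>) s) \<bullet> b) has_real_derivative d) (at t)"
   using ran_deriv[OF acurveD(5)[OF c W t]] by blast
  then obtain d where d: "!!b. ((%s. \<eta> ((f \<circ> \<alpha>) s) \<bullet> b) has_real_derivative d b) (at t)" by metis
  define v where "v = (\<Sum>b\<in>Basis. d b *\<^sub>R b)"
  have vb: "v \<bullet> b = d b" if "b : Basis" for b unfolding v_def using that by simp
  have D: "((%s. \<eta> ((f \<circ> \<alpha>) s)) has_vector_derivative v) (at t)"
   unfolding vector_derivative_coords using d vb by simp
  have "v ~= 0"
  proof
   assume "v = 0"
   then have 0: "((%s. \<eta> ((f \<circ> \<alpha>) s) \<bullet> b) has_real_derivative 0) (at t)" if "b : Basis" for b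
    using d[of b] vb[OF that] by simp
   have tX: "\<alpha> t : X" by (rule acurveD(4)[OF A(2) t(1)])
   obtain U \<psi> where U: "(U, \<psi>) : M" "\<alpha> t : U" using chart_at[OF tX] by blast
   obtain w where w: "w ~= 0" "((%s. \<psi> (\<alpha> s)) has_vector_derivative w) (at t)" using A(5)[OF U(1) t(1) U(2)] by blast
   have "((%s. \<psi> (\<alpha> s) \<bullet> b) has_real_derivative 0) (at t)" for b
   proof -
    have "((%s. \<psi> (f' ((f \<circ> \<alpha>) s)) \<bullet> b) has_real_derivative 0) (at t)"
     by (rule acurve_act(2)[OF c f' W U(1) t(1,2) _ 0]) (use inv[OF tX] U(2) in simp)
    then show ?thesis
     by (rule has_field_derivative_transform_within_open[OF _ A(3) t(1)])
      (use inv acurveD(4)[OF A(2)] in simp)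
   qed
   then have "((%s. \<psi> (\<alpha> s)) has_vector_derivative 0) (at t)" unfolding vector_derivative_coords by simp
   then show False using w vector_derivative_unique_at by blast
  qed
  then show ?thesis using D by blast
 qed
 then show ?thesis unfolding open_immersion_iff using A(1) c by blast
qed

end

section \<open>Free intervals of an analytic curve\<close>

lemma (in amanifold) immersion_subset:
 assumes "open_immersion M I \<alpha>" "open J" "interval J" "J \<subseteq> I" shows "open_immersion M J \<alpha>"
 unfolding open_immersion_iff
proof (intro conjI allI impI)
 note 1 = assms(1)[unfolded open_immersion_iff]
 show "acurve J \<alpha>" using acurve_subset[OF _ assms(2,4)] 1 by blast
 show "EX v. v ~= 0 & ((%s. \<eta> (\<alpha> s)) has_vector_derivative v) (at t)"
  if t: "(W, \<eta>) : M" "t : J" "\<alpha> t : W" for W \<eta> t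
  using 1 t assms(4) by (meson subsetD)
qed (rule assms(3))

lemma (in amanifold) embedding_compact:
 assumes a: "open_immersion M I \<alpha>" and J: "open J" "interval J" "J \<subseteq> C" and C: "compact C" "C \<subseteq> I" "inj_on \<alpha> C"
  and eq: "!!t. t : J ==> \<gamma> t = \<alpha> t"
 shows "analytic_embedding M J \<gamma>"
proof -
 have cont: "continuous_on C \<alpha>" using acurveD(3)[OF immersionD(2)[OF a]] C(2) continuous_on_subset by blast
 obtain h where h: "homeomorphism C (\<alpha> ` C) \<alpha> h" using homeomorphism_compact[OF C(1) cont refl C(3)] by blast
 have inj: "inj_on \<alpha> J" using C(3) J(3) inj_on_subset by blast
 have "continuous_on (\<alpha> ` J) (inv_into J \<alpha>)"
 proof (rule continuous_on_eq)
  show "continuous_on (\<alpha> ` J) h" using h J(3) unfolding homeomorphism_def by (meson continuous_on_subset image_mono)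
  show "h x = inv_into J \<alpha> x" if x: "x : \<alpha> ` J" for x
  proof -
   obtain y where y: "y : J" "x = \<alpha> y" using x by blast
   then show ?thesis using h inj J(3) unfolding homeomorphism_def by (metis inv_into_f_f subsetD)
  qed
 qed
 then have "homeomorphism J (\<alpha> ` J) \<alpha> (inv_into J \<alpha>)"
  unfolding homeomorphism_def using cont J(3) continuous_on_subset inj by (auto intro: continuous_on_subset)
 moreover have "open_immersion M J \<alpha>" using immersion_subset[OF a J(1,2)] J(3) C(2) by blast
 ultimately show ?thesis unfolding analytic_embedding_def using J(2) eq by (metis order_refl)
qed

lemma interval_iff: "interval D \<longleftrightarrow> is_interval D & interior D ~= {}"
 unfolding interval_def by (simp add: is_interval_connected_1)

text \<open>All displacements refer to one immersion \<open>\<delta>\<close> on an open interval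
  \<open>I\<close>, and curves on subdomains are compared with it through \<open>sub\<close>. In the
  theorem \<open>\<delta>\<close> is the maximal extension of \<gamma>.\<close>

locale setting = amanifold M for M :: "('m::t2_space, 'e::euclidean_space) atlas" +
 fixes G :: "('g::t2_space) monoid" (structure) and \<phi> :: "'g => 'm => 'm" and I :: "real set" and \<delta> :: "real => 'm"
 assumes act: "group_action G (manifold_points M) \<phi>" and sat: "sated G \<phi> M"
  and an: "!!g. g : carrier G ==> analytic_map M M (\<phi> g)" and imm: "open_immersion M I \<delta>"
begin

lemma imm_act: assumes g: "g : carrier G" shows "open_immersion M I (\<phi> g \<circ> \<delta>)"
proof -
 interpret group_action G X \<phi> by (rule act)
 interpret group G by (rule group_hom.axioms(1)[OF group_hom])
 show ?thesis
  by (rule immersion_act[OF imm an[OF g] an[OF inv_closed[OF g]]]) (use orbit_sym_aux[OF g] in blast)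
qed

text \<open>Local injectivity comes from \<open>lift\<close> applied to \<open>\<delta>\<close> and
  itself, where the lift through a point is unique. \<open>ext\<close> is the last clause of
  \<open>local_lift\<close>, the given sequences being accumulating coincidences.\<close>

lemma orbit: "curve_orbit G X \<phi> I \<delta>"
proof -
 interpret group_action G X \<phi> by (rule act)
 note D = immersionD[OF imm] and A = acurveD[OF immersionD(2)[OF imm]]
 show ?thesis
 proof unfold_locales
  show "open I" "is_interval I" "\<delta> ` I \<subseteq> X" "continuous_on I \<delta>" by (fact D(3) D(4) A(2) A(3))+
  show "EX e>0. inj_on \<delta> (I \<inter> ball t e)" if t: "t : I" for t
  proof -
   obtain e R where e0: "e > 0" and l: "local_lift I \<delta> I \<delta> t t e R" using lift[OF D(2) imm t t refl] by blast
   note e = e0 local_liftD(3)[OF l]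
   have "inj_on \<delta> (I \<inter> ball t e)"
   proof (rule inj_onI)
    fix x y assume xy: "x : I \<inter> ball t e" "y : I \<inter> ball t e" "\<delta> x = \<delta> y"
    then have b: "\<bar>x - t\<bar> < e" "\<bar>y - t\<bar> < e" by (auto simp: dist_real_def)
    have "y = R x" by (rule e(2)[OF b]) (use xy in auto)
    moreover have "x = R x" by (rule e(2)[OF b(1) b(1)]) (use xy in auto)
    ultimately show "x = y" by simp
   qed
   then show ?thesis using e(1) by blast
  qed
  show "\<phi> g (\<delta> s) = \<delta> s"
   if g: "g : carrier G" "t : I" "t islimpt {s : I. \<phi> g (\<delta> s) = \<delta> s}" "s : I" for g t s
   using acurve_ident[OF immersionD(2)[OF imm_act[OF g(1)]] D(2,4) g(2) _ g(4)] g(3) by simp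
  show "EX e>0. EX R. ball s e \<subseteq> I & continuous_on (ball s e) R & R s = t &
       R ` ball s e \<subseteq> I & (ALL x:ball s e. \<phi> g (\<delta> x) = \<delta> (R x))"
   if g: "g : carrier G" "s : I" "t : I" "!!n. x n : I - {s}" "!!n. y n : I" "x \<longlonglongrightarrow> s" "y \<longlonglongrightarrow> t"
    "!!n. \<phi> g (\<delta> (x n)) = \<delta> (y n)" for g s t x y
  proof -
   let ?\<alpha> = "\<phi> g \<circ> \<delta>"
   note a = immersionD(2)[OF imm_act[OF g(1)]]
   have "isCont ?\<alpha> s" "isCont \<delta> t"
    using continuous_on_eq_continuous_at[OF A(1)] acurveD(3)[OF a] A(3) g(2,3) by metis+
   then have "(%n. ?\<alpha> (x n)) \<longlonglongrightarrow> ?\<alpha> s" "(%n. \<delta> (y n)) \<longlonglongrightarrow> \<delta> t" using g(6,7) isCont_tendsto_compose by blast+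
   then have st: "?\<alpha> s = \<delta> t" using g(8) LIMSEQ_unique by fastforce
   obtain e R where e0: "e > 0" and l: "local_lift I ?\<alpha> I \<delta> s t e R" using lift[OF a imm g(2,3) st] by blast
   note e = e0 local_liftD[OF l]
   have "s islimpt {x. ?\<alpha> x = \<delta> (R x)}" unfolding islimpt_approachable
   proof (intro allI impI)
    fix d :: real assume d: "d > 0"
    have "\<forall>\<^sub>F n in sequentially. dist (x n) s < min d e" "\<forall>\<^sub>F n in sequentially. dist (y n) t < e"
     by (rule tendstoD[OF g(6)], use d e(1) in simp) (rule tendstoD[OF g(7) e(1)])
    then have "\<forall>\<^sub>F n in sequentially. dist (x n) s < min d e & dist (y n) t < e" by eventually_elim auto
    then obtain n where n: "dist (x n) s < min d e" "dist (y n) t < e"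
     using eventually_happens'[OF sequentially_bot] by blast
    have "y n = R (x n)" by (rule e(4)) (use n g(5,8) in \<open>auto simp: dist_real_def\<close>)
    then have "?\<alpha> (x n) = \<delta> (R (x n))" using g(8)[of n] by simp
    then show "EX x':{x. ?\<alpha> x = \<delta> (R x)}. x' ~= s & dist x' s < d"
     using g(4)[of n] n(1) by (intro bexI[of _ "x n"]) auto
   qed
   then have eq: "?\<alpha> x = \<delta> (R x)" if "\<bar>x - s\<bar> < e" for x using e(5) that by blast
   have b: "x : ball s e ==> \<bar>x - s\<bar> < e" for x by (simp add: dist_real_def abs_minus_commute)
   have "continuous_on (ball s e) R"
    using ran_isCont e(2) b by (intro continuous_at_imp_continuous_on) blast
   then show ?thesis using e(1,2,3) eq b by (intro exI[of _ e] conjI exI[of _ R]) auto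
  qed
  show False if c: "p : X" "q : X" "r : X" "p ~= q" "q ~= r" "p ~= r" "!!n. h n : carrier G"
   "(%n. \<phi> (h n) q) \<longlonglongrightarrow> p" "(%n. \<phi> (h n) r) \<longlonglongrightarrow> p" for p q r and h :: "nat => 'g"
  proof -
   have "range h \<subseteq> carrier G" using c(7) by blast
   then show ?thesis using sat c unfolding sated_def by blast
  qed
 qed
qed

end

sublocale setting \<subseteq> curve_orbit G "manifold_points M" \<phi> I \<delta>
 by (rule orbit)

context setting
begin

definition sub :: "real set => (real => 'm) => bool" where
 "sub D \<gamma> \<longleftrightarrow> interval D & D \<subseteq> I & (ALL t:D. \<gamma> t = \<delta> t)"

lemma subD: assumes "sub D \<gamma>" shows "interval D" "D \<subseteq> I" "t : D ==> \<gamma> t = \<delta> t" "is_interval D" "interior D ~= {}"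
 using assms unfolding sub_def interval_iff by auto

lemma sub_subset: "[|sub D \<gamma>; interval A; A \<subseteq> D|] ==> sub A \<gamma>"
 unfolding sub_def by auto

lemma stab_eq: assumes "sub A \<gamma>" shows "curve_stab G \<phi> A \<gamma> = S"
proof -
 note sD = subD[OF assms]
 have "g : S" if "g : carrier G" "ALL t:A. \<phi> g (\<gamma> t) = \<gamma> t" for g
 proof (rule S_open[OF that(1) open_interior[of A] _ sD(5)])
  show "interior A \<subseteq> I" using sD(2) interior_subset by blast
  show "\<phi> g (\<delta> t) = \<delta> t" if "t : interior A" for t
   using that interior_subset \<open>ALL t:A. \<phi> g (\<gamma> t) = \<gamma> t\<close> sD(3)[of t] by (metis subsetD)
 qed
 moreover have "\<phi> g (\<gamma> t) = \<gamma> t" if "g : S" "t : A" for g t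
  using S_act[OF that(1)] sD(2,3) that(2) by auto
 ultimately show ?thesis unfolding curve_stab_def using S_carrier by blast
qed

lemma class_eq: "sub D \<gamma> ==> curve_class G \<phi> D \<gamma> g = g <# S"
 unfolding curve_class_def using stab_eq by simp

text \<open>From left to right, the inverse of the embedding on \<open>J'\<close> turns the common
  image into a displacement. Conversely both parameter intervals are shrunk into compact balls where
  the curve is injective, so that the restrictions are embeddings.\<close>

lemma sim_iff:
 assumes s: "sub A \<gamma>" and g: "g : carrier G"
 shows "curve_sim M A (\<phi> g \<circ> \<gamma>) A \<gamma> \<longleftrightarrow> (EX s:interior A. EX t:interior A. lnk g s t)"
proof
 note sD = subD[OF s]
 assume "curve_sim M A (\<phi> g \<circ> \<gamma>) A \<gamma>"
 then obtain J J' where J: "open_interval J" "open_interval J'" "J \<subseteq> A" "J' \<subseteq> A" "analytic_embedding M J' \<gamma>"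
  "(\<phi> g \<circ> \<gamma>) ` J = \<gamma> ` J'" unfolding curve_sim_def by blast
 obtain I1 \<gamma>1 where 1: "J' \<subseteq> I1" "homeomorphism I1 (\<gamma>1 ` I1) \<gamma>1 (inv_into I1 \<gamma>1)" "!!t. t:J' ==> \<gamma>1 t = \<gamma> t"
  using J(5) unfolding analytic_embedding_def by metis
 have JJ: "open J" "is_interval J" "J ~= {}" "open J'" "J \<subseteq> I" "J' \<subseteq> I"
  using J(1-4) sD(2) unfolding open_interval_def interval_iff by auto
 define R where "R = inv_into I1 \<gamma>1 \<circ> (\<phi> g \<circ> \<delta>)"
 have key: "R x : J' & \<phi> g (\<delta> x) = \<delta> (R x) & \<phi> g (\<delta> x) : \<gamma>1 ` I1" if x: "x : J" for x
 proof -
  have "\<phi> g (\<delta> x) = (\<phi> g \<circ> \<gamma>) x" using sD(3)[of x] x J(3) by auto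
  then have "\<phi> g (\<delta> x) : \<gamma> ` J'" using J(6) x by blast
  then obtain y where y: "y : J'" "\<phi> g (\<delta> x) = \<gamma> y" by blast
  have y1: "y : I1" "\<gamma>1 y = \<gamma> y" using 1(1,3) y(1) by auto
  have "inv_into I1 \<gamma>1 (\<gamma>1 y) = y" using 1(2) y1(1) unfolding homeomorphism_def by blast
  then have "R x = y" unfolding R_def using y(2) y1(2) by simp
  moreover have "\<gamma> y : \<gamma>1 ` I1" using y1 by (metis imageI)
  moreover have "\<gamma> y = \<delta> y" using sD(3) y(1) J(4) by blast
  moreover have "\<phi> g (\<delta> x) = \<gamma> y" using y(2) .
  ultimately show ?thesis using y(1) by simp
 qed
 have "continuous_on J (\<phi> g \<circ> \<delta>)"
  using acurveD(3)[OF immersionD(2)[OF imm_act[OF g]]] JJ(5) continuous_on_subset by blast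
 then have "continuous_on J R" unfolding R_def
 proof (rule continuous_on_compose)
  have "continuous_on (\<gamma>1 ` I1) (inv_into I1 \<gamma>1)" using 1(2) unfolding homeomorphism_def by blast
  then show "continuous_on ((\<phi> g \<circ> \<delta>) ` J) (inv_into I1 \<gamma>1)"
   by (rule continuous_on_subset) (use key in \<open>metis comp_apply image_subsetI\<close>)
 qed
 then have d: "dv g J R" unfolding dv_def using g JJ key by auto
 obtain x where x: "x : J" using JJ(3) by blast
 have "x : interior A" using x JJ(1) J(3) interior_maximal by blast
 moreover have "R x : interior A" using key[OF x] JJ(4) J(4) interior_maximal by blast
 moreover have "lnk g x (R x)" unfolding lnk_def using d x by blast
 ultimately show "EX s:interior A. EX t:interior A. lnk g s t" by blast
next
 note sD = subD[OF s]
 assume "EX s:interior A. EX t:interior A. lnk g s t"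
 then obtain s K R where s: "s : interior A" "R s : interior A" "dv g K R" "s : K" unfolding lnk_def by blast
 note d = s(3)
 have AI: "interior A \<subseteq> I" using sD(2) interior_subset by blast
 obtain e1 where e1: "e1 > 0" "inj_on \<delta> (I \<inter> ball s e1)" using loc_inj s(1) AI by blast
 obtain e2 where e2: "e2 > 0" "inj_on \<delta> (I \<inter> ball (R s) e2)" using loc_inj s(2) AI by blast
 obtain r2 where r2: "r2 > 0" "cball (R s) r2 \<subseteq> interior A \<inter> ball (R s) e2"
  using open_contains_cball[THEN iffD1, OF open_Int[OF open_interior open_ball], rule_format, of "R s" A "R s" e2] s(2) e2(1) centre_in_ball by (metis IntI)
 obtain d1 where d1: "d1 > 0" "ball s d1 \<subseteq> K" "R ` ball s d1 \<subseteq> ball (R s) r2"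
  using dv_local[OF d s(4) open_ball, of "R s" r2] r2(1) by auto
 obtain r1 where r1: "r1 > 0" "cball s r1 \<subseteq> interior A \<inter> ball s e1 \<inter> ball s d1"
  using open_contains_cball[THEN iffD1, OF open_Int[OF open_Int[OF open_interior open_ball] open_ball], rule_format, of s A s e1 s d1] s(1) e1(1) d1(1) centre_in_ball by (metis IntI)
 define J where "J = ball s r1"
 have J: "open J" "is_interval J" "J ~= {}" "J \<subseteq> cball s r1" unfolding J_def using r1(1) by (auto simp: ball_ivl)
 have JK: "J \<subseteq> K" "J \<subseteq> A" using J(4) r1(2) d1(2) interior_subset by blast+
 have dJ: "dv g J R" by (rule dv_restrict[OF d JK(1) J(1,2)])
 have J': "open (R ` J)" "is_interval (R ` J)" by (rule dv_image[OF dJ])+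
 have J'A: "R ` J \<subseteq> cball (R s) r2"
 proof -
  have "R ` J \<subseteq> R ` ball s d1" using J(4) r1(2) by blast
  also have "\<dots> \<subseteq> cball (R s) r2" using d1(3) ball_subset_cball by blast
  finally show ?thesis .
 qed
 have iJ: "interval J" "interval (R ` J)" unfolding interval_iff using J J' by (auto simp: interior_open)
 have J'2: "R ` J \<subseteq> A" using J'A r2(2) interior_subset by blast
 have c1: "cball s r1 \<subseteq> I" "cball (R s) r2 \<subseteq> I" using r1(2) r2(2) AI by blast+
 have inj1: "inj_on \<delta> (cball s r1)" using e1(2) by (rule inj_on_subset) (use c1 r1(2) in blast)
 have inj2: "inj_on \<delta> (cball (R s) r2)" using e2(2) by (rule inj_on_subset) (use c1 r2(2) in blast)
 have inj3: "inj_on (\<phi> g \<circ> \<delta>) (cball s r1)"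
 proof (rule inj_onI)
  fix x y assume xy: "x : cball s r1" "y : cball s r1" "(\<phi> g \<circ> \<delta>) x = (\<phi> g \<circ> \<delta>) y"
  then have "\<delta> x = \<delta> y" using act_inj[OF g] cX c1(1) by (metis comp_apply subsetD)
  then show "x = y" using inj_onD[OF inj1] xy by blast
 qed
 have "analytic_embedding M J (\<phi> g \<circ> \<gamma>)"
  by (rule embedding_compact[OF imm_act[OF g] J(1) iJ(1) J(4) compact_cball c1(1) inj3]) (use sD(3) JK(2) in auto)
 moreover have "analytic_embedding M (R ` J) \<gamma>"
  by (rule embedding_compact[OF imm J'(1) iJ(2) J'A compact_cball c1(2) inj2]) (use sD(3) J'2 in auto)
 moreover have "(\<phi> g \<circ> \<gamma>) ` J = \<gamma> ` (R ` J)"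
 proof -
  have "(\<phi> g \<circ> \<gamma>) x = \<gamma> (R x)" if "x : J" for x
  proof -
   have "\<gamma> x = \<delta> x" "\<gamma> (R x) = \<delta> (R x)" using sD(3) that JK(2) J'2 by blast+
   then show ?thesis using dvD(9)[OF dJ that] by simp
  qed
  then show ?thesis unfolding image_image by (intro image_cong) auto
 qed
 ultimately show "curve_sim M A (\<phi> g \<circ> \<gamma>) A \<gamma>" unfolding curve_sim_def open_interval_def
  using J(1) J'(1) iJ JK(2) J'2 by blast
qed

lemma free_segment_iff:
 assumes s: "sub A \<gamma>" shows "free_segment G \<phi> M A \<gamma> \<longleftrightarrow> fr (interior A)"
proof -
 have "analytic_immersion M A \<gamma>" unfolding analytic_immersion_def using subD[OF s] imm by auto
 then have "free_segment G \<phi> M A \<gamma> \<longleftrightarrow> (ALL g:carrier G. (EX s:interior A. EX t:interior A. lnk g s t) --> g : S)"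
  unfolding free_segment_def stab_eq[OF s] using sim_iff[OF s] by simp
 also have "\<dots> \<longleftrightarrow> fr (interior A)"
  unfolding fr_def using lnkD(1) by (metis (no_types))
 finally show ?thesis .
qed

lemma free_interval_iff:
 assumes s: "sub D \<gamma>" shows "free_interval G \<phi> M D \<gamma> A \<longleftrightarrow> interval A & A \<subseteq> D & fr (interior A)"
 unfolding free_interval_def using free_segment_iff[OF sub_subset[OF s]] by blast

lemma interior_ivl: "is_interval D ==> is_interval (interior D)" for D :: "real set"
 by (simp add: is_interval_convex_1 convex_interior)

lemma interior_between:
 fixes D :: "real set"
 assumes "is_interval D" "x : D" "y : D" shows "{x<..<y} \<subseteq> interior D"
proof -
 have "{x<..<y} \<subseteq> {x..y}" by auto
 then have "{x<..<y} \<subseteq> D" using ivl_sub[OF assms] by blast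
 then show ?thesis using interior_maximal open_greaterThanLessThan by blast
qed

text \<open>The interval may touch the boundary of \<open>D\<close>. Any larger interval has
  \<open>x\<close> or \<open>y\<close> in its interior and so is not free.\<close>

lemma mx_maximal:
 assumes s: "sub D \<gamma>" and m: "mx x y" and D: "{x..y} \<subseteq> D" shows "maximal_interval G \<phi> M D \<gamma> {x..y}"
proof -
 note sD = subD[OF s] and mD = mxD[OF m]
 have int: "interval {x..y}" unfolding interval_def using mD(1) by simp
 have no: "~ {x..y} \<subset> A'" if A': "interval A'" "A' \<subseteq> D" "fr (interior A')" for A'
 proof
  assume sub: "{x..y} \<subset> A'"
  have iA: "is_interval A'" using A'(1) unfolding interval_iff by simp
  obtain z where z: "z : A'" "z ~: {x..y}" using sub by blast
  have "x : {x..y}" "y : {x..y}" using mD(1) by auto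
  then have xy: "x : A'" "y : A'" using sub by blast+
  have V: "open (interior A')" "is_interval (interior A')" "interior A' \<subseteq> I"
   using interior_ivl[OF iA] A'(2) sD(2) interior_subset by auto
  have n: "x ~: interior A' & y ~: interior A'" by (rule mxV[OF m V interior_between[OF iA xy] A'(3)])
  have "x : interior A' | y : interior A'"
   using interior_between[OF iA z(1) xy(2)] interior_between[OF iA xy(1) z(1)] z(2) mD(1) by (auto simp: subset_iff)
  then show False using n by blast
 qed
 have "fr (interior {x..y})" using mD(4) by simp
 then show ?thesis unfolding maximal_interval_def free_interval_iff[OF s] using int D no by blast
qed

text \<open>Maximality within \<open>D\<close> passes to \<open>I\<close>: an open free interval
  containing an end of \<open>A\<close> would allow enlarging \<open>A\<close> a little, and there
  is room for this because the ends are interior to \<open>D\<close>.\<close>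

lemma inner_compact_maximal_iff:
 assumes s: "sub D \<gamma>"
 shows "inner_compact_maximal G \<phi> M D \<gamma> A \<longleftrightarrow> (EX a b. A = {a..b} & mx a b & a : interior D & b : interior D)"
proof
 note sD = subD[OF s]
 assume m: "inner_compact_maximal G \<phi> M D \<gamma> A"
 then have A: "compact A" "A \<subseteq> interior D" "interval A" "fr (interior A)"
  and max: "!!A'. [|interval A'; A' \<subseteq> D; fr (interior A'); A \<subset> A'|] ==> False"
  unfolding inner_compact_maximal_def maximal_interval_def free_interval_iff[OF s] by blast+
 obtain a b where ab: "A = {a..b}"
  using A(1,3) connected_compact_interval_1[of A] unfolding interval_def by blast
 have lt: "a < b" using A(3) unfolding ab interval_def by simp
 have aD: "a : interior D" "b : interior D" using A(2) lt unfolding ab by auto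
 then have aD': "a : D" "b : D" using interior_subset by blast+
 have f: "fr {a<..<b}" using A(4) unfolding ab interior_atLeastAtMost_real .
 have "a ~: V & b ~: V" if V: "open V" "is_interval V" "V \<subseteq> I" "{a<..<b} \<subseteq> V" "fr V" for V
 proof (intro conjI notI)
  assume "a : V"
  then obtain e where e: "e > 0" "ball a e \<subseteq> V \<inter> interior D" using openE[OF open_Int[OF V(1) open_interior]] aD(1) by (metis IntI)
  define a' where "a' = a - e/2"
  have a': "a' < a" "a' : V" "a' : interior D" using e unfolding a'_def by (auto simp: dist_real_def subset_iff)
  have sub: "{a'<..<b} \<subseteq> V"
  proof
   fix x assume x: "x : {a'<..<b}"
   show "x : V"
   proof (cases "x <= a")
    case True then show ?thesis using ivl_sub[OF V(2) a'(2) \<open>a : V\<close>] x by auto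
   next
    case False then show ?thesis using V(4) x by auto
   qed
  qed
  show False
  proof (rule max[of "{a'..b}"])
   show "interval {a'..b}" unfolding interval_def using a'(1) lt by simp
   show "{a'..b} \<subseteq> D" using ivl_sub[OF sD(4)] a'(3) aD' interior_subset by blast
   show "fr (interior {a'..b})" unfolding interior_atLeastAtMost_real by (rule fr_mono[OF V(5) sub])
   show "A \<subset> {a'..b}" unfolding ab using a'(1) lt by auto
  qed
 next
  assume "b : V"
  then obtain e where e: "e > 0" "ball b e \<subseteq> V \<inter> interior D" using openE[OF open_Int[OF V(1) open_interior]] aD(2) by (metis IntI)
  define b' where "b' = b + e/2"
  have b': "b < b'" "b' : V" "b' : interior D" using e unfolding b'_def by (auto simp: dist_real_def subset_iff)
  have sub: "{a<..<b'} \<subseteq> V"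
  proof
   fix x assume x: "x : {a<..<b'}"
   show "x : V"
   proof (cases "b <= x")
    case True then show ?thesis using ivl_sub[OF V(2) \<open>b : V\<close> b'(2)] x by auto
   next
    case False then show ?thesis using V(4) x by auto
   qed
  qed
  show False
  proof (rule max[of "{a..b'}"])
   show "interval {a..b'}" unfolding interval_def using b'(1) lt by simp
   show "{a..b'} \<subseteq> D" using ivl_sub[OF sD(4)] b'(3) aD' interior_subset by blast
   show "fr (interior {a..b'})" unfolding interior_atLeastAtMost_real by (rule fr_mono[OF V(5) sub])
   show "A \<subset> {a..b'}" unfolding ab using b'(1) lt by auto
  qed
 qed
 then have "mx a b" unfolding mx_def using lt aD' sD(2) f by blast
 then show "EX a b. A = {a..b} & mx a b & a : interior D & b : interior D" using ab aD by blast
next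
 note sD = subD[OF s]
 assume "EX a b. A = {a..b} & mx a b & a : interior D & b : interior D"
 then obtain a b where ab: "A = {a..b}" "mx a b" "a : interior D" "b : interior D" by blast
 note mD = mxD[OF ab(2)]
 have sub: "{a..b} \<subseteq> interior D" by (rule ivl_sub[OF interior_ivl[OF sD(4)] ab(3,4)])
 then have "{a..b} \<subseteq> D" using interior_subset by blast
 from mx_maximal[OF s ab(2) this] show "inner_compact_maximal G \<phi> M D \<gamma> A"
  unfolding inner_compact_maximal_def ab(1) using sub by simp
qed

text \<open>A displacement is continuous by definition; near \<open>t\<close> it agrees with the
  analytic candidate from \<open>lift\<close>, through which every coincidence of the two curves
  passes.\<close>

lemma dv_ran: assumes d: "dv g K R" and t: "t : K" shows "ran R t"
proof -
 note a = immersionD(2)[OF imm_act[OF dvD(1)[OF d]]]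
 have eq: "(\<phi> g \<circ> \<delta>) x = \<delta> (R x)" if "x : K" for x using dvD(9)[OF d that] by simp
 obtain e r where e0: "e > 0" and l: "local_lift I (\<phi> g \<circ> \<delta>) I \<delta> t (R t) e r"
  using lift[OF a imm dvD(7)[OF d t] dvD(8)[OF d t] eq[OF t]] by blast
 note e = e0 local_liftD[OF l]
 obtain e' where e': "e' > 0" "ball t e' \<subseteq> K" "R ` ball t e' \<subseteq> ball (R t) e"
  using dv_local[OF d t open_ball, of "R t" e] e(1) by auto
 show ?thesis
 proof (rule ran_cong[of r t "min e e'"])
  show "ran r t" using e(1,2) by simp
  fix s assume s: "\<bar>s - t\<bar> < min e e'"
  then have sb: "s : ball t e'" using abs_minus_commute[of s t] by (simp add: dist_real_def)
  then have sK: "s : K" "R s : ball (R t) e" using e'(2,3) by blast+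
  show "R s = r s"
   by (rule e(4)) (use s sK dvD(8)[OF d sK(1)] eq in \<open>auto simp: dist_real_def\<close>)
 qed (use e e' in simp)
qed

lemma dv_analytic: "dv g K R ==> real_analytic_on R K"
 by (rule ran_real_analytic) (use dv_ran in auto)

lemma dv_diffeo:
 assumes d: "dv g K R" and P: "P \<subseteq> K" "interval P" shows "analytic_diffeo P (R ` P) R"
proof -
 have inj: "inj_on R K" by (rule dv_inj[OF d])
 have iP: "interior P \<subseteq> K" "is_interval P" "interior P ~= {}" using P interior_subset unfolding interval_iff by auto
 have "dv g (interior P) R" by (rule dv_restrict[OF d iP(1) open_interior interior_ivl[OF iP(2)]])
 then have "open (R ` interior P)" by (rule dv_image)
 then have "R ` interior P \<subseteq> interior (R ` P)" by (intro interior_maximal image_mono interior_subset)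
 moreover have "connected (R ` P)"
  by (rule connected_continuous_image[OF continuous_on_subset[OF dvD(5)[OF d] P(1)]]) (use iP(2) is_interval_connected in blast)
 ultimately have iC: "interval (R ` P)" unfolding interval_def using iP(3) by blast
 have K: "K ~= {}" using iP by blast
 have oK: "open_interval K" "open_interval (R ` K)"
  unfolding open_interval_def interval_iff using dvD(2,3)[OF d] dv_image[OF d] K by (auto simp: interior_open)
 have "bij_betw R P (R ` P)" using inj_on_subset[OF inj P(1)] by (simp add: bij_betw_def)
 moreover have "bij_betw R K (R ` K)" using inj by (simp add: bij_betw_def)
 ultimately show ?thesis unfolding analytic_diffeo_def
  using P iC oK dv_analytic[OF d] dv_analytic[OF dv_inverse[OF d]]
  by (intro conjI exI[of _ K] exI[of _ "R ` K"] exI[of _ R]) auto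
qed

lemma diffeoD:
 assumes "analytic_diffeo B C \<mu>"
 shows "interval B" "interval C" "bij_betw \<mu> B C" "continuous_on B \<mu>" "\<mu> ` interior B = interior C" "\<mu> ` B = C"
  "smono B \<mu> | santi B \<mu>"
proof -
 obtain J J' \<nu> where \<nu>: "open_interval J" "open_interval J'" "B \<subseteq> J" "C \<subseteq> J'" "bij_betw \<nu> J J'"
  "real_analytic_on \<nu> J" "real_analytic_on (inv_into J \<nu>) J'" "!!t. t:B ==> \<nu> t = \<mu> t"
  using assms unfolding analytic_diffeo_def by metis
 show BC: "interval B" "interval C" "bij_betw \<mu> B C" using assms unfolding analytic_diffeo_def by auto
 then show im: "\<mu> ` B = C" by (simp add: bij_betw_def)
 have oJ: "open J" "open J'" using \<nu>(1,2) unfolding open_interval_def by auto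
 have cont: "continuous_on L f" if "real_analytic_on f L" "open L" for L and f :: "real => real"
  using ran_isCont[OF real_analytic_ran[OF that, of _ 1]] by (intro continuous_at_imp_continuous_on) auto
 have c\<nu>: "continuous_on J \<nu>" "continuous_on J' (inv_into J \<nu>)" using cont \<nu>(6,7) oJ by auto
 show cB: "continuous_on B \<mu>" using continuous_on_subset[OF c\<nu>(1) \<nu>(3)] \<nu>(8) by (metis continuous_on_cong)
 have inj: "inj_on \<nu> J" using \<nu>(5) by (simp add: bij_betw_def)
 have imB: "\<nu> ` B = C" using im \<nu>(8) by (metis image_cong)
 have iJ: "interior B \<subseteq> J" using \<nu>(3) interior_subset by blast
 have "open (\<nu> ` interior B)"
  by (rule invariance_of_domain[OF continuous_on_subset[OF c\<nu>(1) iJ] open_interior inj_on_subset[OF inj iJ]])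
 then have "\<nu> ` interior B \<subseteq> interior C" unfolding imB[symmetric] by (intro interior_maximal image_mono interior_subset)
 moreover have "interior C \<subseteq> \<nu> ` interior B"
 proof -
  have iJ': "interior C \<subseteq> J'" using \<nu>(4) interior_subset by blast
  have inj': "inj_on (inv_into J \<nu>) J'" using \<nu>(5) by (metis bij_betw_inv_into bij_betw_def)
  have o: "open (inv_into J \<nu> ` interior C)"
   by (rule invariance_of_domain[OF continuous_on_subset[OF c\<nu>(2) iJ'] open_interior inj_on_subset[OF inj' iJ']])
  have "inv_into J \<nu> ` interior C \<subseteq> B"
  proof
   fix x assume "x : inv_into J \<nu> ` interior C"
   then obtain y where y: "y : C" "x = inv_into J \<nu> y" using interior_subset by blast
   then obtain b where "b : B" "y = \<nu> b" using imB by blast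
   then show "x : B" using y inj \<nu>(3) by (metis inv_into_f_f subsetD)
  qed
  then have 1: "inv_into J \<nu> ` interior C \<subseteq> interior B" using o interior_maximal by blast
  show ?thesis
  proof
   fix y assume y: "y : interior C"
   then have "y : J'" using iJ' by blast
   then have "\<nu> (inv_into J \<nu> y) = y" using \<nu>(5) by (metis bij_betw_imp_surj_on f_inv_into_f)
   then show "y : \<nu> ` interior B" using 1 y by (metis image_eqI subsetD)
  qed
 qed
 ultimately have "\<nu> ` interior B = interior C" by blast
 moreover have "\<nu> ` interior B = \<mu> ` interior B" using \<nu>(8) interior_subset by (intro image_cong) auto
 ultimately show "\<mu> ` interior B = interior C" by simp
 show "smono B \<mu> | santi B \<mu>"
  by (rule cont_inj_strict_mono[OF cB]) (use BC in \<open>auto simp: interval_iff bij_betw_def\<close>)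
qed

lemma diffeo_dv:
 assumes d: "analytic_diffeo B C \<mu>" and g: "g : carrier G" and B: "B \<subseteq> I" "C \<subseteq> I"
  and eq: "!!t. t : B ==> \<phi> g (\<delta> t) = \<delta> (\<mu> t)"
 shows "dv g (interior B) \<mu>"
 unfolding dv_def
proof (intro conjI ballI)
 note D = diffeoD[OF d]
 show "is_interval (interior B)" using D(1) interior_ivl unfolding interval_iff by blast
 show "interior B \<subseteq> I" using B interior_subset by blast
 show "continuous_on (interior B) \<mu>" using continuous_on_subset[OF D(4) interior_subset] .
 show "\<mu> ` interior B \<subseteq> I" unfolding D(5) using B(2) interior_subset by blast
 show "\<phi> g (\<delta> x) = \<delta> (\<mu> x)" if "x : interior B" for x using eq that interior_subset by blast
qed (use g in auto)

end

context amanifold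
begin

section \<open>Maximal extensions and isolated reflections\<close>

lemma immersion_local:
 assumes L: "open L" "interval L"
  and loc: "!!t. t : L ==> EX K \<alpha>. open_immersion M K \<alpha> & t : K & (ALL s:K. \<beta> s = \<alpha> s)"
 shows "open_immersion M L \<beta>"
proof -
 have near: "EX K \<alpha> e. open_immersion M K \<alpha> & t : K & open K & (ALL s:K. \<beta> s = \<alpha> s) & e > 0 & (ALL s. \<bar>s - t\<bar> < e --> s : K)"
  if t: "t : L" for t
 proof -
  obtain K \<alpha> where K: "open_immersion M K \<alpha>" "t : K" "ALL s:K. \<beta> s = \<alpha> s" using loc[OF t] by blast
  note o = immersionD(3)[OF K(1)]
  obtain e where e: "e > 0" "ball t e \<subseteq> K" using o K(2) open_contains_ball by blast
  have "s : K" if "\<bar>s - t\<bar> < e" for s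
  proof -
   have "s : ball t e" using that abs_minus_commute[of s t] by (simp add: dist_real_def)
   then show ?thesis using e by blast
  qed
  then show ?thesis using K o e(1) by blast
 qed
 have pt: "isCont \<beta> t & \<beta> t : X & (ALL W \<eta>. (W, \<eta>) : M --> \<beta> t : W --> (ALL b. ran (%s. \<eta> (\<beta> s) \<bullet> b) t) &
   (EX v. v ~= 0 & ((%s. \<eta> (\<beta> s)) has_vector_derivative v) (at t)))" if t: "t : L" for t
 proof -
  obtain K \<alpha> e where K: "open_immersion M K \<alpha>" "t : K" "open K" "!!s. s : K ==> \<beta> s = \<alpha> s" "e > 0"
   "!!s. \<bar>s - t\<bar> < e ==> s : K" using near[OF t] by blast
  note D = immersionD[OF K(1)]
  note A = acurveD[OF D(2)]
  have ev: "\<forall>\<^sub>F s in nhds t. \<beta> s = \<alpha> s" using K(2-4) eventually_nhds by blast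
  have "isCont \<alpha> t" using continuous_on_eq_continuous_at[OF K(3)] A(3) K(2) by blast
  then have "isCont \<beta> t" using isCont_cong[OF ev] by simp
  moreover have "\<beta> t : X" using A(4)[OF K(2)] K(4)[OF K(2)] by simp
  moreover have "ran (%s. \<eta> (\<beta> s) \<bullet> b) t" if W: "(W, \<eta>) : M" "\<beta> t : W" for W \<eta> b
  proof (rule ran_cong[of "%s. \<eta> (\<alpha> s) \<bullet> b" t e])
   show "ran (%s. \<eta> (\<alpha> s) \<bullet> b) t" using A(5)[OF W(1) K(2)] W(2) K(4)[OF K(2)] by simp
  qed (use K(4-6) in auto)
  moreover have "EX v. v ~= 0 & ((%s. \<eta> (\<beta> s)) has_vector_derivative v) (at t)" if W: "(W, \<eta>) : M" "\<beta> t : W" for W \<eta>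
  proof -
   obtain v where v: "v ~= 0" "((%s. \<eta> (\<alpha> s)) has_vector_derivative v) (at t)"
    using D(5)[OF W(1) K(2)] W(2) K(4)[OF K(2)] by auto
   have "((%s. \<eta> (\<beta> s)) has_vector_derivative v) (at t)"
    by (rule has_vector_derivative_transform_within_open[OF v(2) K(3,2)]) (simp add: K(4))
   then show ?thesis using v(1) by blast
  qed
  ultimately show ?thesis by blast
 qed
 have c: "continuous_on L \<beta>" using pt by (intro continuous_at_imp_continuous_on) blast
 have im: "\<beta> ` L \<subseteq> X" using pt by blast
 have r: "ran (%s. \<eta> (\<beta> s) \<bullet> b) t" if "(W, \<eta>) : M" "t : L" "\<beta> t : W" for W \<eta> t b using pt[OF that(2)] that by blast
 have v: "EX v. v ~= 0 & ((%s. \<eta> (\<beta> s)) has_vector_derivative v) (at t)" if "(W, \<eta>) : M" "t : L" "\<beta> t : W" for W \<eta> t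
  using pt[OF that(2)] that by blast
 show ?thesis unfolding open_immersion_iff acurve_def using L c im r v by (intro conjI allI impI)
qed

lemma immersion_agree:
 assumes a: "open_immersion M K \<alpha>" and b: "open_immersion M L \<beta>" and D: "interval D" "D \<subseteq> K" "D \<subseteq> L"
  and eq: "!!t. t : D ==> \<alpha> t = \<beta> t" and s: "s : K" "s : L"
 shows "\<alpha> s = \<beta> s"
proof -
 note A = immersionD[OF a] and B = immersionD[OF b]
 have o: "open (K \<inter> L)" using A(3) B(3) by auto
 have i: "is_interval (K \<inter> L)" using A(4) B(4) by (rule is_interval_Int)
 obtain t where t: "t : interior D" using D(1) unfolding interval_iff by blast
 have "t islimpt interior D" by (rule open_imp_islimpt[OF open_interior t])
 moreover have "interior D \<subseteq> {s : K \<inter> L. \<alpha> s = \<beta> s}" using D eq interior_subset[of D] by blast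
 ultimately have l: "t islimpt {s : K \<inter> L. \<alpha> s = \<beta> s}" using islimpt_subset by blast
 have "t : K \<inter> L" using t D interior_subset by blast
 then show ?thesis
  using acurve_ident[OF acurve_subset[OF A(2) o] acurve_subset[OF B(2) o] i _ l] s by blast
qed

text \<open>The union of all immersive extensions to open intervals; any two of them agree on their
  overlap by the identity theorem.\<close>

lemma maximal_extension_exists:
 assumes im: "analytic_immersion M D \<gamma>" shows "EX I \<delta>. maximal_extension M D \<gamma> I \<delta>"
proof -
 define E where "E = {(I, \<delta>). D \<subseteq> I & open_immersion M I \<delta> & (ALL t:D. \<delta> t = \<gamma> t)}"
 define I where "I = \<Union> (fst ` E)"
 define \<delta> where "\<delta> t = snd (SOME x. x : E & t : fst x) t" for t
 have D: "interval D" and ne: "E ~= {}" using im unfolding analytic_immersion_def E_def by auto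
 have ED: "D \<subseteq> K" "open_immersion M K \<alpha>" "t : D ==> \<alpha> t = \<gamma> t" if "(K, \<alpha>) : E" for K \<alpha> t
  using that unfolding E_def by auto
 have eq: "\<delta> t = \<alpha> t" if K: "(K, \<alpha>) : E" "t : K" for K \<alpha> t
 proof -
  define x where "x = (SOME x. x : E & t : fst x)"
  have "(K, \<alpha>) : E & t : fst (K, \<alpha>)" using K by simp
  then have x: "x : E & t : fst x" unfolding x_def by (rule someI)
  obtain L \<beta> where L: "x = (L, \<beta>)" by fastforce
  then have l: "(L, \<beta>) : E" "t : L" using x by auto
  have e: "\<beta> u = \<alpha> u" if "u : D" for u using ED(3)[OF l(1) that] ED(3)[OF K(1) that] by simp
  have "\<beta> t = \<alpha> t" by (rule immersion_agree[OF ED(2)[OF l(1)] ED(2)[OF K(1)] D ED(1)[OF l(1)] ED(1)[OF K(1)] e l(2) K(2)])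
  then show ?thesis unfolding \<delta>_def x_def[symmetric] L by simp
 qed
 have DI: "D \<subseteq> I" using ne ED(1) unfolding I_def by fastforce
 have cov: "EX K \<alpha>. (K, \<alpha>) : E & t : K" if "t : I" for t using that unfolding I_def by fastforce
 have sub: "K \<subseteq> I" if "(K, \<alpha>) : E" for K \<alpha> using that unfolding I_def by force
 have op: "open_immersion M I \<delta>"
 proof (rule immersion_local)
  show "open I" unfolding I_def
  proof (rule open_Union, rule ballI)
   fix K assume "K : fst ` E"
   then obtain \<alpha> where "(K, \<alpha>) : E" by auto
   then show "open K" using immersionD(3) ED(2) by blast
  qed
  have "connected I" unfolding I_def
  proof (rule connected_Union)
   fix K assume "K : fst ` E"
   then obtain \<alpha> where "(K, \<alpha>) : E" by auto
   then show "connected K" using immersionD(4) ED(2) is_interval_connected by blast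
  next
   obtain t where "t : D" using D interior_subset unfolding interval_def by blast
   then have "t : \<Inter> (fst ` E)" using ED(1) by fastforce
   then show "\<Inter> (fst ` E) ~= {}" by blast
  qed
  moreover have "interior I ~= {}" using D DI interior_mono[OF DI] unfolding interval_def by blast
  ultimately show "interval I" unfolding interval_def by blast
  fix t assume "t : I"
  then obtain K \<alpha> where K: "(K, \<alpha>) : E" "t : K" using cov by blast
  have "ALL s:K. \<delta> s = \<alpha> s" using eq[OF K(1)] by blast
  then show "EX K \<alpha>. open_immersion M K \<alpha> & t : K & (ALL s:K. \<delta> s = \<alpha> s)" using ED(2)[OF K(1)] K(2) by blast
 qed
 have on: "\<delta> t = \<gamma> t" if t: "t : D" for t
 proof -
  obtain K \<alpha> where K: "(K, \<alpha>) : E" "t : K" using cov DI t by blast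
  show ?thesis using eq[OF K] ED(3)[OF K(1) t] by simp
 qed
 have "I' = I" if I': "I \<subseteq> I'" "open_immersion M I' \<delta>'" "ALL t:I. \<delta>' t = \<delta> t" for I' \<delta>'
 proof -
  have "ALL t:D. \<delta>' t = \<gamma> t" using I'(3) on DI by (metis subsetD)
  then have "(I', \<delta>') : E" unfolding E_def using I'(1,2) DI by blast
  then show ?thesis using sub I'(1) by blast
 qed
 then show ?thesis unfolding maximal_extension_def using DI op on by blast
qed

end

context setting
begin

section \<open>The \<tau>-decomposition\<close>

lemma l_coset_iff: "x : g <# S \<longleftrightarrow> (EX q:S. x = g \<otimes> q)"
 unfolding l_coset_def by auto

lemma ivl_half:
 assumes D: "is_interval D" and t: "\<tau> : interior D"
 shows "interior (D \<inter> {..\<tau>}) = interior D \<inter> {..<\<tau>}" "interior (D \<inter> {\<tau>..}) = interior D \<inter> {\<tau><..}"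
  "interval (D \<inter> {..\<tau>})" "interval (D \<inter> {\<tau>..})"
proof -
 show 1: "interior (D \<inter> {..\<tau>}) = interior D \<inter> {..<\<tau>}" "interior (D \<inter> {\<tau>..}) = interior D \<inter> {\<tau><..}"
  by (simp_all add: interior_Int)
 obtain e where e: "e > 0" "ball \<tau> e \<subseteq> interior D" using openE[OF open_interior t] by metis
 have "\<tau> - e/2 : interior D \<inter> {..<\<tau>}" "\<tau> + e/2 : interior D \<inter> {\<tau><..}" using e by (auto simp: subset_iff dist_real_def)
 then show "interval (D \<inter> {..\<tau>})" "interval (D \<inter> {\<tau>..})" unfolding interval_iff 1
  using D by (auto simp: is_interval_Int is_interval_ic is_interval_ci)
qed

lemma tauI:
 assumes s: "sub D \<gamma>" and t: "tau_split (interior D) \<tau>" and g: "g ~: S" and d: "dv g K R" "\<tau> : K" "R \<tau> = \<tau>"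
  and B: "B \<subseteq> K" "B \<subseteq> D \<inter> {..\<tau>}" "\<tau> : B" "interval B" "R ` B \<subseteq> D \<inter> {\<tau>..}"
  and e: "B = D \<inter> {..\<tau>} | R ` B = D \<inter> {\<tau>..}"
 shows "tau_decomposition G \<phi> M D \<gamma> \<tau> (g <# S)"
proof -
 note sD = subD[OF s]
 have tD: "\<tau> : interior D" and f: "fr (interior D \<inter> {..<\<tau>})" "fr (interior D \<inter> {\<tau><..})"
  using t unfolding tau_split_def by auto
 note h = ivl_half[OF sD(4) tD]
 have gc: "g : carrier G" using dvD(1)[OF d(1)] .
 have tD': "\<tau> : D" using tD interior_subset by blast
 have \<gamma>: "\<gamma> \<tau> = \<delta> \<tau>" using sD(3)[OF tD'] .
 have fixp: "\<phi> g (\<delta> \<tau>) = \<delta> \<tau>" using dvD(9)[OF d(1,2)] d(3) by simp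
 have "g <# S \<subseteq> stabilizer G \<phi> (\<gamma> \<tau>) - S"
 proof
  fix x assume "x : g <# S"
  then obtain q where q: "q : S" "x = g \<otimes> q" unfolding l_coset_iff by blast
  have tI: "\<tau> : I" using dvD(7)[OF d(1,2)] .
  have "\<phi> x (\<delta> \<tau>) = \<delta> \<tau>" using act_mult[OF gc S_carrier[OF q(1)] cX[OF tI]] S_act[OF q(1) tI] fixp q(2) by simp
  moreover have "x : carrier G" using q gc S_carrier by auto
  moreover have "x ~: S" using lnk_mult_S[OF gc q(1)] g q(2) by blast
  ultimately show "x : stabilizer G \<phi> (\<gamma> \<tau>) - S" unfolding stabilizer_def \<gamma> by blast
 qed
 moreover have "ALL t:B. \<phi> g (\<gamma> t) = \<gamma> (R t)"
 proof
  fix t assume t: "t : B"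
  have "\<gamma> t = \<delta> t" "\<gamma> (R t) = \<delta> (R t)" using sD(3) B(2,5) t by blast+
  then show "\<phi> g (\<gamma> t) = \<gamma> (R t)" using dvD(9)[OF d(1)] B(1) t by auto
 qed
 moreover have "\<tau> : R ` B" using B(3) d(3) by (metis imageI)
 ultimately show ?thesis
  unfolding tau_decomposition_def free_interval_iff[OF s] class_eq[OF s] stab_eq[OF s] h(1,2)
  using tD f h(3,4) gc dv_diffeo[OF d(1) B(1,4)] B(2,3,5) e d(3)
  by (intro conjI bexI[of _ g] exI[of _ B] exI[of _ "R ` B"] exI[of _ R] Int_lower1) (assumption | rule refl)+
qed

text \<open>If the reflection carries the whole left half into \<open>D\<close>, its domain is the
  left half. Otherwise this fails at some \<open>x\<close>, and the left points with values in
  \<open>D\<close> lie right of \<open>x\<close> and cover the whole right half.\<close>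

lemma tau_exists:
 assumes s: "sub D \<gamma>" and t: "tau_split (interior D) \<tau>"
 shows "EX c. tau_decomposition G \<phi> M D \<gamma> \<tau> c"
proof -
 note sD = subD[OF s]
 obtain g where g: "g ~: S" "dec g \<tau> \<tau>" and tD: "\<tau> : interior D" using t unfolding tau_split_def by auto
 note h = ivl_half[OF sD(4) tD]
 obtain K R where m: "mdv g K R" "santi K R" "\<tau> : K" "R \<tau> = \<tau>" using dec_mdv[OF g(2)] by blast
 note d = mdvD[OF m(1)]
 have up: "\<tau> <= R y" if "y : K" "y <= \<tau>" for y
 proof (cases "y = \<tau>")
  case False
  then show ?thesis using monotone_onD[OF m(2) that(1) m(3)] that(2) m(4) by simp
 qed (use m(4) in simp)
 have tD': "\<tau> : D" using tD interior_subset by blast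
 show ?thesis
 proof (cases "ALL x:D. x <= \<tau> --> x : K & R x : D")
  case True
  have "tau_decomposition G \<phi> M D \<gamma> \<tau> (g <# S)"
  proof (rule tauI[OF s t g(1) d m(3,4), of "D \<inter> {..\<tau>}"])
   show "R ` (D \<inter> {..\<tau>}) \<subseteq> D \<inter> {\<tau>..}" using True up by auto
  qed (use True tD' h(3) in auto)
  then show ?thesis by blast
 next
  case False
  then obtain x where x: "x : D" "x <= \<tau>" "x : K ==> R x ~: D" by blast
  define B where "B = {y : K. R y : D} \<inter> {..\<tau>}"
  have BD: "B \<subseteq> D \<inter> {..\<tau>}"
  proof
   fix y assume "y : B"
   then have y: "y : K" "R y : D" "y <= \<tau>" unfolding B_def by auto
   have "x <= y"
   proof (rule ccontr)
    assume "~ x <= y"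
    then have xy: "y < x" by simp
    have xK: "x : K" using ivl_sub[OF dvD(3)[OF d] y(1) m(3)] xy x(2) by auto
    have "R x <= R y" using monotone_onD[OF m(2) y(1) xK xy] by simp
    then have "R x : D" using ivl_sub[OF sD(4) tD' y(2)] up[OF xK x(2)] by auto
    then show False using x(3)[OF xK] by blast
   qed
   then show "y : D \<inter> {..\<tau>}" using ivl_sub[OF sD(4) x(1) tD'] y(3) by auto
  qed
  have Bt: "\<tau> : B" unfolding B_def using m(3,4) tD' by auto
  have "is_interval {y : K. R y : D}" by (rule pre_interval[OF dvD(3)[OF d] sD(4)]) (use m(2) in blast)
  then have Bi: "is_interval B" unfolding B_def by (intro is_interval_Int is_interval_ic)
  obtain e where e: "e > 0" "ball \<tau> e \<subseteq> K" "R ` ball \<tau> e \<subseteq> interior D"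
   using dv_local[OF d m(3) open_interior, of D] tD m(4) by auto
  define z where "z = \<tau> - e / 2"
  have z: "z : ball \<tau> e" "z < \<tau>" using e(1) unfolding z_def by (auto simp: dist_real_def)
  have "z : K" "R z : D" using z(1) e(2,3) interior_subset[of D] by blast+
  then have zB: "z : B" unfolding B_def using z(2) by auto
  have "interior B ~= {}" using interior_between[OF Bi zB Bt] z(2) dense by fastforce
  then have BI: "interval B" unfolding interval_iff using Bi by blast
  have im: "R ` B = D \<inter> {\<tau>..}"
  proof
   show "R ` B \<subseteq> D \<inter> {\<tau>..}" unfolding B_def using up by auto
   show "D \<inter> {\<tau>..} \<subseteq> R ` B"
   proof
    fix q assume q: "q : D \<inter> {\<tau>..}"
    obtain p where p: "p : D" "p < \<tau>" using BD zB z(2) by blast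
    have "p : I" "q : I" "x : I" using p q x sD(2) by auto
    then have I: "{p..q} \<subseteq> I" "x : I" using ivl_sub[OF interval_I] by auto
    \<comment> \<open>Followed from \<open>\<tau>\<close> to the left, the reflection must take the
      value \<open>q\<close> before it reaches \<open>x\<close>, where it is undefined or has left
      \<open>D\<close>.\<close>
    obtain x' where x': "x' : K" "x <= x'" "x' <= \<tau>" "R ` {x'..\<tau>} \<subseteq> {p..q}" "x' = x | R x' = p | R x' = q"
     using box_left[OF m(1,3) I(2) x(2) I(1)] p(2) q m(4) by auto
    have "R x' ~= p" using up[OF x'(1,3)] p(2) by auto
    moreover have False if "x' = x"
    proof -
     have "R x : {p..q}" using x'(3,4) that by (metis atLeastAtMost_iff image_subset_iff order_refl)
     then have "R x : D" using ivl_sub[OF sD(4) p(1)] q by blast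
     then show False using x(3) x'(1) that by blast
    qed
    ultimately have "R x' = q" using x'(5) by blast
    then show "q : R ` B" unfolding B_def using x'(1,3) q by blast
   qed
  qed
  have "tau_decomposition G \<phi> M D \<gamma> \<tau> (g <# S)"
  proof (rule tauI[OF s t g(1) d m(3,4)])
   show "B \<subseteq> K" unfolding B_def by blast
  qed (use BD Bt BI im in auto)
  then show ?thesis by blast
 qed
qed

text \<open>The given map lives on the left of \<open>\<tau>\<close> only; \<open>ext\<close>
  continues it to a displacement around \<open>\<tau>\<close>, which is decreasing because
  increasing ones with a fixed point belong to \<open>S\<close>.\<close>

lemma tauD:
 assumes s: "sub D \<gamma>" and t: "tau_decomposition G \<phi> M D \<gamma> \<tau> c"
 shows "tau_split (interior D) \<tau>" "EX g. g ~: S & dec g \<tau> \<tau> & c = g <# S"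
proof -
 note sD = subD[OF s]
 have tD: "\<tau> : interior D" using t unfolding tau_decomposition_def by blast
 note h = ivl_half[OF sD(4) tD]
 note t' = t[unfolded tau_decomposition_def free_interval_iff[OF s] class_eq[OF s] stab_eq[OF s] h(1,2)]
 have f: "fr (interior D \<inter> {..<\<tau>})" "fr (interior D \<inter> {\<tau><..})" using t' by simp_all
 have "EX g:carrier G. c = g <# S & c \<subseteq> stabilizer G \<phi> (\<gamma> \<tau>) - S &
   (EX B\<^sub>m B\<^sub>p \<mu>. B\<^sub>m \<subseteq> D \<inter> {..\<tau>} & B\<^sub>p \<subseteq> D \<inter> {\<tau>..} & \<tau> : B\<^sub>m & \<tau> : B\<^sub>p &
    analytic_diffeo B\<^sub>m B\<^sub>p \<mu> & \<mu> \<tau> = \<tau> & (ALL t:B\<^sub>m. \<phi> g (\<gamma> t) = \<gamma> (\<mu> t)) &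
    (B\<^sub>m = D \<inter> {..\<tau>} | B\<^sub>p = D \<inter> {\<tau>..}))" using t' by (elim conjE)
 then obtain g B B' \<mu> where g: "g : carrier G" "c = g <# S" "c \<subseteq> stabilizer G \<phi> (\<gamma> \<tau>) - S"
  and B: "B \<subseteq> D \<inter> {..\<tau>}" "B' \<subseteq> D \<inter> {\<tau>..}" "\<tau> : B" "analytic_diffeo B B' \<mu>" "\<mu> \<tau> = \<tau>"
  "ALL t:B. \<phi> g (\<gamma> t) = \<gamma> (\<mu> t)"
  by (elim bexE exE conjE) (rule that)
 note dD = diffeoD[OF B(4)]
 have gS: "g ~: S"
 proof
  assume "g : S"
  moreover have "g = g \<otimes> \<one>" using g(1) by simp
  ultimately have "g : c" unfolding g(2) l_coset_iff using S_one by blast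
  then show False using g(3) \<open>g : S\<close> by blast
 qed
 have "\<tau> islimpt interior B"
 proof -
  obtain z where z: "z : interior B" using dD(1) unfolding interval_iff by blast
  have zB: "z : B" using z interior_subset by blast
  have zt: "z < \<tau>"
  proof -
   obtain e where e: "e > 0" "ball z e \<subseteq> B" using z by (meson interior_subset open_contains_ball open_interior subset_trans)
   have "z + e/2 : B" using e by (auto simp: subset_iff dist_real_def)
   then show ?thesis using B(1) e(1) by fastforce
  qed
  have i: "is_interval B" using dD(1) unfolding interval_iff by blast
  have "{z<..<\<tau>} \<subseteq> interior B" by (rule interior_between[OF i zB B(3)])
  moreover have "\<tau> islimpt {z<..<\<tau>}" using zt by (simp add: islimpt_greaterThanLessThan2)
  ultimately show ?thesis using islimpt_subset by blast
 qed
 then obtain x where x: "!!n::nat. x n : interior B - {\<tau>}" "x \<longlonglongrightarrow> \<tau>" unfolding islimpt_sequential by blast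
 have xB: "x n : B" for n using x(1) interior_subset by blast
 have BI: "B \<subseteq> I" "B' \<subseteq> I" using B(1,2) sD(2) by blast+
 have lim: "(%n. \<mu> (x n)) \<longlonglongrightarrow> \<tau>"
  using continuous_on_tendsto_compose[OF dD(4) x(2) B(3)] xB B(5) by simp
 have muB: "\<mu> (x n) : B'" for n using xB dD(6) by blast
 have eq: "\<phi> g (\<delta> (x n)) = \<delta> (\<mu> (x n))" for n
 proof -
  have "\<gamma> (x n) = \<delta> (x n)" "\<gamma> (\<mu> (x n)) = \<delta> (\<mu> (x n))" using sD(3) xB muB B(1,2) by blast+
  then show ?thesis using bspec[OF B(6) xB[of n]] by simp
 qed
 have tI: "\<tau> : I" using B(3) BI by blast
 obtain e R where e: "e > 0" "ball \<tau> e \<subseteq> I" "continuous_on (ball \<tau> e) R" "R \<tau> = \<tau>" "R ` ball \<tau> e \<subseteq> I"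
  "ALL x:ball \<tau> e. \<phi> g (\<delta> x) = \<delta> (R x)"
  using ext[OF g(1) tI tI, of x "%n. \<mu> (x n)"] x lim eq xB muB BI by blast
 have "dv g (ball \<tau> e) R" unfolding dv_def using g(1) e ball_ivl by blast
 then have "lnk g \<tau> \<tau>" unfolding lnk_def using e(1,4) centre_in_ball by blast
 then have dec: "dec g \<tau> \<tau>" using lnk_cases inc_fix gS by blast
 then show "tau_split (interior D) \<tau>" unfolding tau_split_def using gS tD f by blast
 show "EX g. g ~: S & dec g \<tau> \<tau> & c = g <# S" using gS dec g(2) by blast
qed

text \<open>Uniqueness of the class: for two reflections at one centre,
  \<open>inv g \<otimes> g'\<close> displaces increasingly with a fixed point, so it lies in
  \<open>S\<close>.\<close>

theorem tau_alternative:
 assumes s: "sub D \<gamma>" and A: "free_interval G \<phi> M D \<gamma> A" and nf: "~ free_segment G \<phi> M D \<gamma>"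
 shows "(EX! p. tau_decomposition G \<phi> M D \<gamma> (fst p) (snd p)) ~= (EX A. inner_compact_maximal G \<phi> M D \<gamma> A)"
proof -
 note sD = subD[OF s]
 define J where "J = interior D"
 have J: "open J" "is_interval J" "J \<subseteq> I" unfolding J_def using interior_ivl[OF sD(4)] sD(2) interior_subset by auto
 have icm: "(EX A. inner_compact_maximal G \<phi> M D \<gamma> A) \<longleftrightarrow> (EX a b. a : J & b : J & mx a b)"
  unfolding inner_compact_maximal_iff[OF s] J_def by blast
 have A': "interval A" "A \<subseteq> D" "fr (interior A)" using A unfolding free_interval_iff[OF s] by auto
 have U: "open (interior A)" "is_interval (interior A)" "interior A \<subseteq> J" "interior A ~= {}"
  using A'(1) interior_ivl interior_mono[OF A'(2)] unfolding interval_iff J_def by blast+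
 have "~ fr J" using nf unfolding free_segment_iff[OF s] J_def .
 from dichotomy[OF J U A'(3) this] have ex: "(EX a b. a : J & b : J & mx a b) | (EX \<tau>. tau_split J \<tau>)" .
 have excl: False if m: "mx a b" "a : J" "b : J" and t: "tau_split J \<tau>" for a b \<tau>
 proof -
  obtain g where g: "g ~: S" "dec g \<tau> \<tau>" and f: "fr (J \<inter> {..<\<tau>})" "fr (J \<inter> {\<tau><..})" using t unfolding tau_split_def by auto
  show False
  proof (cases "\<tau> : {a<..<b}")
   case True
   then show False using frD[OF mxD(4)[OF m(1)] True True dec_lnk[OF g(2)]] g(1) by blast
  next
   case False
   then show False using mx_no_tau[OF f False m(1) J m(2,3)] by blast
  qed
 qed
 have uni: "p = p'" if p: "tau_decomposition G \<phi> M D \<gamma> (fst p) (snd p)" "tau_decomposition G \<phi> M D \<gamma> (fst p') (snd p')" for p p'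
 proof -
  note t = tauD[OF s p(1)] and t' = tauD[OF s p(2)]
  have f': "fr (interior D \<inter> {..<fst p'})" "fr (interior D \<inter> {fst p'<..})" using t'(1) unfolding tau_split_def by auto
  have \<tau>: "fst p = fst p'" by (rule tau_unique[OF t(1) f'])
  obtain g g' where g: "dec g (fst p) (fst p)" "snd p = g <# S" "dec g' (fst p) (fst p)" "snd p' = g' <# S"
   using t(2) t'(2) \<tau> by auto
  have c: "g : carrier G" "g' : carrier G" using lnkD(1) dec_lnk g by blast+
  have "inc (inv g \<otimes> g') (fst p) (fst p)" by (rule dec_dec[OF g(3) dec_inv[OF g(1)]])
  then have "inv g \<otimes> g' : S" by (rule inc_fix)
  then have "snd p = snd p'" unfolding g(2,4) using S_class_iff[OF c] by blast
  then show ?thesis using \<tau> by (simp add: prod_eq_iff)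
 qed
 have tau: "(EX! p. tau_decomposition G \<phi> M D \<gamma> (fst p) (snd p)) \<longleftrightarrow> (EX \<tau>. tau_split J \<tau>)"
 proof
  assume "EX! p. tau_decomposition G \<phi> M D \<gamma> (fst p) (snd p)"
  then show "EX \<tau>. tau_split J \<tau>" using tauD(1)[OF s] unfolding J_def by blast
 next
  assume "EX \<tau>. tau_split J \<tau>"
  then obtain \<tau> c where "tau_decomposition G \<phi> M D \<gamma> \<tau> c" using tau_exists[OF s] unfolding J_def by blast
  then have "tau_decomposition G \<phi> M D \<gamma> (fst (\<tau>, c)) (snd (\<tau>, c))" by simp
  then show "EX! p. tau_decomposition G \<phi> M D \<gamma> (fst p) (snd p)" using uni by blast
 qed
 show ?thesis unfolding tau icm using ex excl by blast
qed

end

section \<open>Orientations and classes in a decomposition\<close>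

lemma Fin_Suc_le_aux: "(Fin n < N \<longleftrightarrow> Fin (n + 1) <= N) & (N < Fin n \<longleftrightarrow> N <= Fin (n - 1))" for n :: int
 by (cases N) auto

lemmas Fin_Suc_le = Fin_Suc_le_aux[THEN conjunct1] Fin_Suc_le_aux[THEN conjunct2]

lemma idx_pos: "1 <= n ==> nm < Fin 0 ==> n : idx nm np \<longleftrightarrow> Fin n <= np"
 unfolding idx_def by (cases nm) auto

lemma idx_neg: "n <= -1 ==> Fin 0 < np ==> n : idx nm np \<longleftrightarrow> nm <= Fin n"
 unfolding idx_def by (cases np) auto

lemma idx_step:
 "[|nm < Fin 0; 1 <= n; n + 1 : idx nm np|] ==> n : idx nm np & Fin n ~= np"
 "[|Fin 0 < np; n <= -1; n - 1 : idx nm np|] ==> n : idx nm np & Fin n ~= nm"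
 unfolding idx_def by (cases nm; cases np; auto) (cases nm; cases np; auto)

lemma piece_pos: "1 <= n ==> piece D a nm np n = (if Fin n = np then D \<inter> {a n..} else {a n..a (n + 1)})"
 and piece_neg: "n <= -1 ==> piece D a nm np n = (if Fin n = nm then D \<inter> {..a n} else {a (n - 1)..a n})"
 unfolding piece_def by auto

lemma piece_cases:
 assumes "nm < Fin 0" "Fin 0 < np" "n : idx nm np"
 shows "(1 <= n & Fin n ~= nm & (if Fin n = np then piece D a nm np n = D \<inter> {a n..}
   else n + 1 : idx nm np & piece D a nm np n = {a n..a (n + 1)})) |
  (n <= -1 & Fin n ~= np & (if Fin n = nm then piece D a nm np n = D \<inter> {..a n}
   else n - 1 : idx nm np & piece D a nm np n = {a (n - 1)..a n}))"
 using assms unfolding idx_def piece_def by (cases nm; cases np) auto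

lemma piece_sub:
 assumes D: "is_interval D" and n0: "nm < Fin 0" "Fin 0 < np" and aD: "ALL n:idx nm np. a n : interior D"
  and n: "n : idx nm np"
 shows "piece D a nm np n \<subseteq> D" "[|Fin n ~= nm; Fin n ~= np|] ==> EX l r. piece D a nm np n = {l..r}"
proof -
 have ivl: "{a i..a j} \<subseteq> D" if "i : idx nm np" "j : idx nm np" for i j
  using ivl_sub[OF D] aD that interior_subset by blast
 show "piece D a nm np n \<subseteq> D" "[|Fin n ~= nm; Fin n ~= np|] ==> EX l r. piece D a nm np n = {l..r}"
  using piece_cases[OF n0 n, of D a] ivl[OF n, of "n + 1"] ivl[OF _ n, of "n - 1"] by (simp_all split: if_splits) blast+
qed

context setting
begin

text \<open>What \<open>leadsto\<close> and \<open>harpoon\<close> have in common; it suffices to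
  determine classes and orientations.\<close>

definition plink :: "real => real => 'g => real set => real set => (real => real) => bool" where
 "plink a b h C P \<mu> \<longleftrightarrow> P \<subseteq> {a..b} & analytic_diffeo P C \<mu> & dv h (interior P) \<mu>"

lemma plink_near:
 assumes k: "plink a b h C P \<mu>" and p: "p : C" and \<sigma>: "if \<sigma> then smono P \<mu> else santi P \<mu>"
 shows "C \<subseteq> {p..} ==> nearR a b \<sigma> h p" "C \<subseteq> {..p} ==> nearL a b \<sigma> h p"
proof -
 have k': "P \<subseteq> {a..b}" "analytic_diffeo P C \<mu>" "dv h (interior P) \<mu>" using k unfolding plink_def by auto
 note D = diffeoD[OF k'(2)]
 have iC: "is_interval C" using D(2) unfolding interval_iff by blast
 obtain z where z: "z : interior C" using D(2) unfolding interval_iff by blast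
 have zC: "z : C" using z interior_subset by blast
 have \<sigma>': "if \<sigma> then smono (interior P) \<mu> else santi (interior P) \<mu>"
  using \<sigma> monotone_on_subset[OF _ interior_subset] by (cases \<sigma>) auto
 have hit: "EX s:{a<..<b}. orr \<sigma> h s y" if y: "y : interior C" for y
 proof -
  obtain s where s: "s : interior P" "\<mu> s = y" using y unfolding D(5)[symmetric] by blast
  have "s : {a<..<b}" using interior_mono[OF k'(1)] s(1) by auto
  moreover have "orr \<sigma> h s y" using orr_dv[OF k'(3) s(1) \<sigma>'] s(2) by simp
  ultimately show ?thesis by blast
 qed
 show "nearR a b \<sigma> h p" if C: "C \<subseteq> {p..}"
 proof -
  have "p < z" using interior_mono[OF C] z by auto
  moreover have "EX s:{a<..<b}. orr \<sigma> h s y" if "p < y" "y < z" for y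
   using hit interior_between[OF iC p zC] that by auto
  ultimately show ?thesis unfolding nearR_def by (intro exI[of _ "z - p"]) auto
 qed
 show "nearL a b \<sigma> h p" if C: "C \<subseteq> {..p}"
 proof -
  have "z < p" using interior_mono[OF C] z by auto
  moreover have "EX s:{a<..<b}. orr \<sigma> h s y" if "z < y" "y < p" for y
   using hit interior_between[OF iC zC p] that by auto
  ultimately show ?thesis unfolding nearL_def by (intro exI[of _ "p - z"]) auto
 qed
qed

lemma plink_orient: "plink a b h C P \<mu> ==> EX \<sigma>. if \<sigma> then smono P \<mu> else santi P \<mu>"
 using diffeoD(7) unfolding plink_def by (metis (full_types))

lemma plink_full:
 assumes d: "dv h K R" and K: "{a..b} \<subseteq> K" and ab: "a < b" shows "plink a b h (R ` {a..b}) {a..b} R"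
proof -
 have i: "interval {a..b}" unfolding interval_def using ab by simp
 have "{a<..<b} \<subseteq> K" using K greaterThanLessThan_subseteq_atLeastAtMost_iff by blast
 then have "dv h (interior {a..b}) R" unfolding interior_atLeastAtMost_real using dv_restrict[OF d _ open_greaterThanLessThan is_interval_oo] by blast
 then show ?thesis unfolding plink_def using dv_diffeo[OF d K i] by blast
qed

text \<open>Changing the left factor within its class is harmless only if \<open>k\<close>
  normalises \<open>S\<close>, which is what the displacement by \<open>k\<close> provides.\<close>

lemma S_mult_cong:
 assumes c: "g : carrier G" "g' : carrier G" "k' : carrier G" and gg: "inv g \<otimes> g' : S" and kk: "inv k \<otimes> k' : S" and l: "lnk k s t"
 shows "inv (g \<otimes> k) \<otimes> (g' \<otimes> k') : S"
proof -
 have k: "k : carrier G" using lnkD(1)[OF l] .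
 have "inv (g \<otimes> k) \<otimes> (g' \<otimes> k') = (inv k \<otimes> (inv g \<otimes> g') \<otimes> k) \<otimes> (inv k \<otimes> k')"
  using c k by (simp add: grp.m_assoc grp.inv_mult_group) (simp add: grp.m_assoc[symmetric])
 then show ?thesis using S_mult[OF norm_S[OF l gg] kk] by simp
qed

text \<open>A decomposition reduced to displacements of \<open>\<delta>\<close>; decompositions on
  arbitrary and on open intervals both have this form. Inner links use the whole central interval,
  whereas at the end pieces only a part \<open>P\<close> is known to be carried over.\<close>

definition dcp :: "real set => int extended => int extended => (int => real) => (int => 'g) => bool" where
 "dcp D nm np a g \<longleftrightarrow> interval D & D \<subseteq> I & nm < Fin 0 & Fin 0 < np & mx (a (-1)) (a 1) &
  (ALL n:idx nm np. a n : interior D & g n : carrier G) & smono (idx nm np) a &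
  (ALL n:idx nm np. EX P \<mu>. plink (a (-1)) (a 1) (g n) (piece D a nm np n) P \<mu> &
   (Fin n ~= nm & Fin n ~= np --> P = {a (-1)..a 1}))"

lemma dcpD:
 assumes "dcp D nm np a g"
 shows "interval D" "D \<subseteq> I" "nm < Fin 0" "Fin 0 < np" "mx (a (-1)) (a 1)"
  "n : idx nm np ==> a n : interior D" "n : idx nm np ==> g n : carrier G" "smono (idx nm np) a"
  "n : idx nm np ==> EX P \<mu>. plink (a (-1)) (a 1) (g n) (piece D a nm np n) P \<mu> &
   (Fin n ~= nm & Fin n ~= np --> P = {a (-1)..a 1})"
  "is_interval D" "1 : idx nm np" "-1 : idx nm np"
proof -
 show 0: "nm < Fin 0" "Fin 0 < np" using assms unfolding dcp_def by auto
 show "1 : idx nm np" using idx_pos[of 1] 0 Fin_Suc_le(1)[of 0 np] by simp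
 show "-1 : idx nm np" using idx_neg[of "-1"] 0 Fin_Suc_le(2)[of nm 0] by simp
 note all = assms[unfolded dcp_def]
 show "interval D" "D \<subseteq> I" "mx (a (-1)) (a 1)" "smono (idx nm np) a" by (rule all[THEN conjunct1] all[THEN conjunct2, THEN conjunct1] all[THEN conjunct2, THEN conjunct2, THEN conjunct2, THEN conjunct2, THEN conjunct1] all[THEN conjunct2, THEN conjunct2, THEN conjunct2, THEN conjunct2, THEN conjunct2, THEN conjunct2, THEN conjunct1])+
 then show "is_interval D" unfolding interval_iff by simp
 have b: "ALL n:idx nm np. a n : interior D & g n : carrier G" using all by (elim conjE)
 then show "n : idx nm np ==> a n : interior D" "n : idx nm np ==> g n : carrier G" by blast+
 have "ALL n:idx nm np. EX P \<mu>. plink (a (-1)) (a 1) (g n) (piece D a nm np n) P \<mu> &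
   (Fin n ~= nm & Fin n ~= np --> P = {a (-1)..a 1})" using all by (elim conjE)
 then show "n : idx nm np ==> EX P \<mu>. plink (a (-1)) (a 1) (g n) (piece D a nm np n) P \<mu> &
   (Fin n ~= nm & Fin n ~= np --> P = {a (-1)..a 1})" by (rule bspec)
qed

lemma dcp_piece:
 assumes d: "dcp D nm np a g" and n: "n : idx nm np"
 shows "a n : piece D a nm np n" "n >= 1 ==> piece D a nm np n \<subseteq> {a n..}" "n <= -1 ==> piece D a nm np n \<subseteq> {..a n}"
  "piece D a nm np n \<subseteq> D"
  "[|1 <= n; Fin n ~= np|] ==> n + 1 : idx nm np & a n < a (n + 1)"
  "[|n <= -1; Fin n ~= nm|] ==> n - 1 : idx nm np & a (n - 1) < a n"
proof -
 note D = dcpD[OF d]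
 have aD: "ALL n:idx nm np. a n : interior D" using D(6) by blast
 show "piece D a nm np n \<subseteq> D" by (rule piece_sub(1)[OF D(10,3,4) aD n])
 have an: "a n : D" using D(6)[OF n] interior_subset by blast
 have R: "a n < a (n + 1)" if "n + 1 : idx nm np" using strict_mono_onD[OF D(8) n that] by simp
 have L: "a (n - 1) < a n" if "n - 1 : idx nm np" using strict_mono_onD[OF D(8) that n] by simp
 have "a n : piece D a nm np n & (n >= 1 --> piece D a nm np n \<subseteq> {a n..}) & (n <= -1 --> piece D a nm np n \<subseteq> {..a n}) &
   (1 <= n --> Fin n ~= np --> n + 1 : idx nm np & a n < a (n + 1)) & (n <= -1 --> Fin n ~= nm --> n - 1 : idx nm np & a (n - 1) < a n)"
  using piece_cases[OF D(3,4) n, of D a]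
 proof (elim disjE conjE)
  assume "1 <= n" "if Fin n = np then piece D a nm np n = D \<inter> {a n..} else n + 1 : idx nm np & piece D a nm np n = {a n..a (n + 1)}"
  then show ?thesis using R an by (cases "Fin n = np") (simp_all add: less_imp_le)
 next
  assume "n <= -1" "if Fin n = nm then piece D a nm np n = D \<inter> {..a n} else n - 1 : idx nm np & piece D a nm np n = {a (n - 1)..a n}"
  then show ?thesis using L an by (cases "Fin n = nm") (simp_all add: less_imp_le)
 qed
 then show "a n : piece D a nm np n" "n >= 1 ==> piece D a nm np n \<subseteq> {a n..}" "n <= -1 ==> piece D a nm np n \<subseteq> {..a n}"
  "[|1 <= n; Fin n ~= np|] ==> n + 1 : idx nm np & a n < a (n + 1)"
  "[|n <= -1; Fin n ~= nm|] ==> n - 1 : idx nm np & a (n - 1) < a n" by blast+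
qed

lemma dcp_inner:
 assumes d: "dcp D nm np a g" and n: "n : idx nm np" "Fin n ~= nm" "Fin n ~= np"
 shows "EX l r K R. piece D a nm np n = {l..r} & l < r & dv (g n) K R & {a (-1)..a 1} \<subseteq> K & R ` {a (-1)..a 1} = {l..r} & mx l r"
proof -
 note D = dcpD[OF d] and P = dcp_piece[OF d n(1)]
 note m = mxD[OF D(5)]
 have "n >= 1 | n <= -1" using n unfolding idx_def by auto
 then have "EX l r. piece D a nm np n = {l..r} & l < r"
 proof
  assume n1: "n >= 1" then show ?thesis unfolding piece_pos[OF n1] using P(5)[OF n1 n(3)] n(3) by auto
 next
  assume n1: "n <= -1" then show ?thesis unfolding piece_neg[OF n1] using P(6)[OF n1 n(2)] n(2) by auto
 qed
 then obtain l r where lr: "piece D a nm np n = {l..r}" "l < r" by blast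
 obtain \<mu> where "plink (a (-1)) (a 1) (g n) {l..r} {a (-1)..a 1} \<mu>" using D(9)[OF n(1)] n(2,3) lr(1) by auto
 then have \<mu>: "analytic_diffeo {a (-1)..a 1} {l..r} \<mu>" "dv (g n) {a (-1)<..<a 1} \<mu>"
  unfolding plink_def by auto
 have im: "\<mu> ` {a (-1)<..<a 1} = {l<..<r}" using diffeoD(5)[OF \<mu>(1)] by simp
 have lrI: "{l..r} \<subseteq> I" using P(4) D(2) lr(1) by simp
 obtain K R where K: "dv (g n) K R" "{a (-1)..a 1} \<subseteq> K" "R ` {a (-1)..a 1} = {l..r}"
  using close_link[OF m(1,5) lrI lr(2) \<mu>(2) im] by blast
 then show ?thesis using lr mx_image(1)[OF K(1) D(5) K(2,3)] by blast
qed

lemma dcp_near: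
 assumes d: "dcp D nm np a g" and n: "n : idx nm np"
  and k: "plink (a (-1)) (a 1) h (piece D a nm np n) P \<mu>" and \<sigma>: "if \<sigma> then smono P \<mu> else santi P \<mu>"
 shows "n >= 1 ==> nearR (a (-1)) (a 1) \<sigma> h (a n)" "n <= -1 ==> nearL (a (-1)) (a 1) \<sigma> h (a n)"
 using plink_near[OF k dcp_piece(1)[OF d n] \<sigma>] dcp_piece(2,3)[OF d n] by blast+

lemma dcp_nearR: assumes d: "dcp D nm np a g" and n: "n : idx nm np" "1 <= n" shows "EX \<sigma>. nearR (a (-1)) (a 1) \<sigma> (g n) (a n)"
 using dcpD(9)[OF d n(1)] dcp_near(1)[OF d n(1) _ _ n(2)] plink_orient by meson

lemma dcp_nearL: assumes d: "dcp D nm np a g" and n: "n : idx nm np" "n <= -1" shows "EX \<sigma>. nearL (a (-1)) (a 1) \<sigma> (g n) (a n)"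
 using dcpD(9)[OF d n(1)] dcp_near(2)[OF d n(1) _ _ n(2)] plink_orient by meson

lemma dcp_stepR:
 assumes d: "dcp D nm np a g" and n: "n : idx nm np" "1 <= n" "Fin n ~= np"
  and h: "nearR (a (-1)) (a 1) \<omega> (g n) (a n)" and 1: "nearR (a (-1)) (a 1) \<tau>1 (g 1) (a 1)" and 2: "nearL (a (-1)) (a 1) \<tau>2 (g (-1)) (a (-1))"
 shows "nearR (a (-1)) (a 1) (if \<omega> then \<tau>1 else ~ \<tau>2) (g (n + 1)) (a (n + 1))"
  "inv (g (n + 1)) \<otimes> (g n \<otimes> (if \<omega> then g 1 else g (-1))) : S"
proof -
 note D = dcpD[OF d]
 have nm: "Fin n ~= nm" using D(3) n(2) by auto
 obtain l r K R where lr: "piece D a nm np n = {l..r}" "l < r" "dv (g n) K R" "{a (-1)..a 1} \<subseteq> K" "R ` {a (-1)..a 1} = {l..r}"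
  using dcp_inner[OF d n(1) nm n(3)] by blast
 have "{l..r} = {a n..a (n + 1)}" using lr(1) piece_pos[OF n(2)] n(3) by metis
 then have r: "r = a (n + 1)" using lr(2) by (metis atLeastatMost_empty_iff Icc_eq_Icc less_imp_le not_less)
 have n1: "n + 1 : idx nm np" using dcp_piece(5)[OF d n(1)] n by blast
 obtain \<sigma> where \<sigma>: "nearR (a (-1)) (a 1) \<sigma> (g (n + 1)) (a (n + 1))" using dcp_nearR[OF d n1] n(2) by auto
 have pf: "plink (a (-1)) (a 1) (g n) (piece D a nm np n) {a (-1)..a 1} R"
  using plink_full[OF lr(3,4) mxD(1)[OF D(5)]] lr(1,5) by simp
 have \<omega>: "\<omega> = \<tau>" if "if \<tau> then smono K R else santi K R" for \<tau>
 proof -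
  have "if \<tau> then smono {a (-1)..a 1} R else santi {a (-1)..a 1} R"
   using that monotone_on_subset[OF _ lr(4)] by (cases \<tau>) auto
  then have "nearR (a (-1)) (a 1) \<tau> (g n) (a n)" by (rule dcp_near(1)[OF d n(1) pf _ n(2)])
  then show ?thesis using nearR_same(2)[OF D(5) h] by blast
 qed
 have "nearR (a (-1)) (a 1) \<sigma> (g (n + 1)) r" using \<sigma> r by simp
 from stepR[OF D(5) lr(3,4,5) 1 2 this]
 have "\<sigma> = (if \<omega> then \<tau>1 else ~ \<tau>2) & inv (g (n + 1)) \<otimes> (g n \<otimes> (if \<omega> then g 1 else g (-1))) : S"
  using \<omega>[of True] \<omega>[of False] by auto
 then show "nearR (a (-1)) (a 1) (if \<omega> then \<tau>1 else ~ \<tau>2) (g (n + 1)) (a (n + 1))"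
  "inv (g (n + 1)) \<otimes> (g n \<otimes> (if \<omega> then g 1 else g (-1))) : S" using \<sigma> by auto
qed

lemma dcp_stepL:
 assumes d: "dcp D nm np a g" and n: "n : idx nm np" "n <= -1" "Fin n ~= nm"
  and h: "nearL (a (-1)) (a 1) \<omega> (g n) (a n)" and 1: "nearR (a (-1)) (a 1) \<tau>1 (g 1) (a 1)" and 2: "nearL (a (-1)) (a 1) \<tau>2 (g (-1)) (a (-1))"
 shows "nearL (a (-1)) (a 1) (if \<omega> then \<tau>2 else ~ \<tau>1) (g (n - 1)) (a (n - 1))"
  "inv (g (n - 1)) \<otimes> (g n \<otimes> (if \<omega> then g (-1) else g 1)) : S"
proof -
 note D = dcpD[OF d]
 have nm: "Fin n ~= np" using D(4) n(2) by auto
 obtain l r K R where lr: "piece D a nm np n = {l..r}" "l < r" "dv (g n) K R" "{a (-1)..a 1} \<subseteq> K" "R ` {a (-1)..a 1} = {l..r}"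
  using dcp_inner[OF d n(1) n(3) nm] by blast
 have "{l..r} = {a (n - 1)..a n}" using lr(1) piece_neg[OF n(2)] n(3) by metis
 then have r: "l = a (n - 1)" using lr(2) by (metis atLeastatMost_empty_iff Icc_eq_Icc less_imp_le not_less)
 have n1: "n - 1 : idx nm np" using dcp_piece(6)[OF d n(1)] n by blast
 obtain \<sigma> where \<sigma>: "nearL (a (-1)) (a 1) \<sigma> (g (n - 1)) (a (n - 1))" using dcp_nearL[OF d n1] n(2) by auto
 have pf: "plink (a (-1)) (a 1) (g n) (piece D a nm np n) {a (-1)..a 1} R"
  using plink_full[OF lr(3,4) mxD(1)[OF D(5)]] lr(1,5) by simp
 have \<omega>: "\<omega> = \<tau>" if "if \<tau> then smono K R else santi K R" for \<tau>
 proof -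
  have "if \<tau> then smono {a (-1)..a 1} R else santi {a (-1)..a 1} R"
   using that monotone_on_subset[OF _ lr(4)] by (cases \<tau>) auto
  then have "nearL (a (-1)) (a 1) \<tau> (g n) (a n)" by (rule dcp_near(2)[OF d n(1) pf _ n(2)])
  then show ?thesis using nearL_same(2)[OF D(5) h] by blast
 qed
 have "nearL (a (-1)) (a 1) \<sigma> (g (n - 1)) l" using \<sigma> r by simp
 from stepL[OF D(5) lr(3,4,5) 1 2 this]
 have "\<sigma> = (if \<omega> then \<tau>2 else ~ \<tau>1) & inv (g (n - 1)) \<otimes> (g n \<otimes> (if \<omega> then g (-1) else g 1)) : S"
  using \<omega>[of True] \<omega>[of False] by auto
 then show "nearL (a (-1)) (a 1) (if \<omega> then \<tau>2 else ~ \<tau>1) (g (n - 1)) (a (n - 1))"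
  "inv (g (n - 1)) \<otimes> (g n \<otimes> (if \<omega> then g (-1) else g 1)) : S" using \<sigma> by auto
qed

lemma near_lnk: assumes "a < b" shows "nearR a b \<sigma> g p ==> EX s t. lnk g s t" "nearL a b \<sigma> g p ==> EX s t. lnk g s t"
proof -
 show "EX s t. lnk g s t" if n: "nearR a b \<sigma> g p"
 proof -
  obtain e where e: "e > 0" "!!y. [|p < y; y < p + e|] ==> EX s:{a<..<b}. orr \<sigma> g s y" using n unfolding nearR_def by blast
  have "p < p + e/2" "p + e/2 < p + e" using e(1) by auto
  then show ?thesis using e(2) orr_lnk by blast
 qed
 show "EX s t. lnk g s t" if n: "nearL a b \<sigma> g p"
 proof -
  obtain e where e: "e > 0" "!!y. [|p - e < y; y < p|] ==> EX s:{a<..<b}. orr \<sigma> g s y" using n unfolding nearL_def by blast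
  have "p - e < p - e/2" "p - e/2 < p" using e(1) by auto
  then show ?thesis using e(2) orr_lnk by blast
 qed
qed

text \<open>Orientation and class of a piece follow from those of its predecessor by
  \<open>dcp_stepR\<close> and \<open>dcp_stepL\<close>. \<open>\<Omega>\<close> and
  \<open>X\<close> are closed formulas obeying the same recursion, up to \<open>S\<close> in the
  factor \<open>k\<close>, so that one induction serves both powers of a translation and alternating
  products.\<close>

lemma dcp_induct:
 fixes \<Omega> :: "int => bool" and X :: "int => 'g"
 assumes d: "dcp D nm np a g" and 1: "nearR (a (-1)) (a 1) \<tau>1 (g 1) (a 1)" and 2: "nearL (a (-1)) (a 1) \<tau>2 (g (-1)) (a (-1))"
  and X: "!!n. X n : carrier G" "inv (g 1) \<otimes> X 1 : S" "inv (g (-1)) \<otimes> X (-1) : S" and \<Omega>: "\<Omega> 1 = \<tau>1" "\<Omega> (-1) = \<tau>2"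
  and R: "!!n. 1 <= n ==> \<Omega> (n + 1) = (if \<Omega> n then \<tau>1 else ~ \<tau>2) &
   (EX k:carrier G. X (n + 1) = X n \<otimes> k & inv (if \<Omega> n then g 1 else g (-1)) \<otimes> k : S)"
  and L: "!!n. n <= -1 ==> \<Omega> (n - 1) = (if \<Omega> n then \<tau>2 else ~ \<tau>1) &
   (EX k:carrier G. X (n - 1) = X n \<otimes> k & inv (if \<Omega> n then g (-1) else g 1) \<otimes> k : S)"
  and n: "n : idx nm np"
 shows "inv (g n) \<otimes> X n : S" "n >= 1 ==> nearR (a (-1)) (a 1) (\<Omega> n) (g n) (a n)" "n <= -1 ==> nearL (a (-1)) (a 1) (\<Omega> n) (g n) (a n)"
proof -
 note D = dcpD[OF d]
 have gc: "n : idx nm np ==> g n : carrier G" for n by (rule D(7))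
 have mult_step: "inv y \<otimes> (X m \<otimes> k) : S"
  if y: "y : carrier G" "inv y \<otimes> (g m \<otimes> z) : S" and z: "z = g 1 | z = g (-1)" and k: "k : carrier G" "inv z \<otimes> k : S"
   and m: "m : idx nm np" "inv (g m) \<otimes> X m : S" for y z k m
 proof -
  obtain s t where l: "lnk z s t" using z near_lnk[OF mxD(1)[OF D(5)]] 1 2 by metis
  have "inv (g m \<otimes> z) \<otimes> (X m \<otimes> k) : S" by (rule S_mult_cong[OF gc[OF m(1)] X(1) k(1) m(2) k(2) l])
  then show ?thesis using S_trans[OF y(1) _ _ y(2)] gc[OF m(1)] lnkD(1)[OF l] X(1) k(1) by simp
 qed
 have R': "n : idx nm np --> inv (g n) \<otimes> X n : S & nearR (a (-1)) (a 1) (\<Omega> n) (g n) (a n)" if "1 <= n" for n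
  using that
 proof (induction n rule: int_ge_induct)
  case base
  show ?case using X(2) \<Omega>(1) 1 by simp
 next
  case (step n)
  show ?case
  proof
   assume n1: "n + 1 : idx nm np"
   then have n: "n : idx nm np" "Fin n ~= np" using idx_step(1)[OF D(3) step(1)] by blast+
   then have IH: "inv (g n) \<otimes> X n : S" "nearR (a (-1)) (a 1) (\<Omega> n) (g n) (a n)" using step.IH by auto
   note st = dcp_stepR[OF d n(1) step(1) n(2) IH(2) 1 2]
   obtain k where k: "k : carrier G" "X (n + 1) = X n \<otimes> k" "inv (if \<Omega> n then g 1 else g (-1)) \<otimes> k : S" using R[OF step(1)] by blast
   have "inv (g (n + 1)) \<otimes> X (n + 1) : S"
    unfolding k(2) by (rule mult_step[OF gc[OF n1] st(2) _ k(1,3) n(1) IH(1)]) simp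
   then show "inv (g (n + 1)) \<otimes> X (n + 1) : S & nearR (a (-1)) (a 1) (\<Omega> (n + 1)) (g (n + 1)) (a (n + 1))"
    using st(1) R[OF step(1)] by simp
  qed
 qed
 have L': "n : idx nm np --> inv (g n) \<otimes> X n : S & nearL (a (-1)) (a 1) (\<Omega> n) (g n) (a n)" if "n <= -1" for n
  using that
 proof (induction n rule: int_le_induct)
  case base
  show ?case using X(3) \<Omega>(2) 2 by simp
 next
  case (step n)
  show ?case
  proof
   assume n1: "n - 1 : idx nm np"
   then have n: "n : idx nm np" "Fin n ~= nm" using idx_step(2)[OF D(4) step(1)] by blast+
   then have IH: "inv (g n) \<otimes> X n : S" "nearL (a (-1)) (a 1) (\<Omega> n) (g n) (a n)" using step.IH by auto
   note st = dcp_stepL[OF d n(1) step(1) n(2) IH(2) 1 2]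
   obtain k where k: "k : carrier G" "X (n - 1) = X n \<otimes> k" "inv (if \<Omega> n then g (-1) else g 1) \<otimes> k : S" using L[OF step(1)] by blast
   have "inv (g (n - 1)) \<otimes> X (n - 1) : S"
    unfolding k(2) by (rule mult_step[OF gc[OF n1] st(2) _ k(1,3) n(1) IH(1)]) simp
   then show "inv (g (n - 1)) \<otimes> X (n - 1) : S & nearL (a (-1)) (a 1) (\<Omega> (n - 1)) (g (n - 1)) (a (n - 1))"
    using st(1) L[OF step(1)] by simp
  qed
 qed
 have "n >= 1 | n <= -1" using n unfolding idx_def by auto
 then show "inv (g n) \<otimes> X n : S" using R' L' n by blast
 show "n >= 1 ==> nearR (a (-1)) (a 1) (\<Omega> n) (g n) (a n)" "n <= -1 ==> nearL (a (-1)) (a 1) (\<Omega> n) (g n) (a n)" using R' L' n by blast+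
qed

text \<open>All pieces preserve orientation, so every step to the right multiplies by the class of
  \<open>h\<close> and every step to the left by that of its inverse.\<close>

lemma dcp_ps:
 assumes d: "dcp D nm np a g" and h: "ps h (a (-1)) (a 1)" and n: "n : idx nm np"
 shows "inv (g n) \<otimes> h [^] n : S" "n >= 1 ==> nearR (a (-1)) (a 1) True (g n) (a n)"
  "n <= -1 ==> nearL (a (-1)) (a 1) True (g n) (a n)"
proof -
 note D = dcpD[OF d]
 have hc: "h : carrier G" using h lnkD(1) inc_lnk unfolding ps_def by blast
 obtain \<tau>1 where t1: "nearR (a (-1)) (a 1) \<tau>1 (g 1) (a 1)" using dcp_nearR[OF d D(11)] by auto
 obtain \<tau>2 where t2: "nearL (a (-1)) (a 1) \<tau>2 (g (-1)) (a (-1))" using dcp_nearL[OF d D(12)] by auto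
 note s1 = nearR_same[OF D(5) nearR_ps[OF D(5) h] t1] and s2 = nearL_same[OF D(5) nearL_ps[OF D(5) h] t2]
 have p: "h [^] (n + 1) = h [^] n \<otimes> h" "h [^] (n - 1) = h [^] n \<otimes> inv h" "h [^] (-1::int) = inv h" for n :: int
  using grp.int_pow_mult[OF hc, of n 1] grp.int_pow_diff[OF hc, of n 1] grp.int_pow_neg[OF hc, of 1] hc by simp_all
 have all: "inv (g n) \<otimes> h [^] n : S & (n >= 1 --> nearR (a (-1)) (a 1) True (g n) (a n)) & (n <= -1 --> nearL (a (-1)) (a 1) True (g n) (a n))"
  using dcp_induct[OF d t1 t2, of "%n. h [^] n" "%_. True" n] s1 s2 hc p n by auto
 then show "inv (g n) \<otimes> h [^] n : S" "n >= 1 ==> nearR (a (-1)) (a 1) True (g n) (a n)"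
  "n <= -1 ==> nearL (a (-1)) (a 1) True (g n) (a n)" by blast+
qed

lemma foldr_mult:
 assumes "!!j. j : set xs ==> c j : carrier G" "y : carrier G"
 shows "foldr (%j x. c j \<otimes> x) xs \<one> : carrier G" "foldr (%j x. c j \<otimes> x) xs y = foldr (%j x. c j \<otimes> x) xs \<one> \<otimes> y"
 using assms by (induction xs) (auto simp: grp.m_assoc)

lemma sigma_cases: "sigma k = 1 | sigma k = -1"
 unfolding sigma_def using minus_one_power_iff by (metis (full_types))

lemma sigma_step:
 "1 <= n ==> sigma (n + 1) = (if even n then 1 else -1)" "n <= -1 ==> sigma (n - 1) = (if even n then -1 else 1)"
 unfolding sigma_def by (auto simp: minus_one_power_iff even_nat_iff)

lemma alternating_prod_step:
 assumes g: "g 1 : carrier G" "g (-1) : carrier G"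
 shows "alternating_prod G g n : carrier G" "alternating_prod G g 1 = g 1" "alternating_prod G g (-1) = g (-1)"
  "1 <= n ==> alternating_prod G g (n + 1) = alternating_prod G g n \<otimes> g (sigma (n + 1))"
  "n <= -1 ==> alternating_prod G g (n - 1) = alternating_prod G g n \<otimes> g (sigma (n - 1))"
proof -
 have c: "g (sigma k) : carrier G" for k using g sigma_cases[of k] by metis
 show "alternating_prod G g n : carrier G" unfolding alternating_prod_def using foldr_mult(1)[of _ "%j. g (sigma (j * sgn n))" \<one>] c by simp
 show "alternating_prod G g 1 = g 1" "alternating_prod G g (-1) = g (-1)"
  unfolding alternating_prod_def using g by (simp_all add: sigma_def)
 show "alternating_prod G g (n + 1) = alternating_prod G g n \<otimes> g (sigma (n + 1))" if n: "1 <= n"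
 proof -
  have u: "[1..\<bar>n + 1\<bar>] = [1..\<bar>n\<bar>] @ [n + 1]" using upto_rec2[of 1 "n + 1"] n by simp
  have s: "sgn (n + 1) = 1" "sgn n = 1" using n by auto
  show ?thesis unfolding alternating_prod_def u s using foldr_mult(2)[of _ "%j. g (sigma (j * 1))" "g (sigma (n + 1))"] c by simp
 qed
 show "alternating_prod G g (n - 1) = alternating_prod G g n \<otimes> g (sigma (n - 1))" if n: "n <= -1"
 proof -
  have u: "[1..\<bar>n - 1\<bar>] = [1..\<bar>n\<bar>] @ [1 - n]" using upto_rec2[of 1 "1 - n"] n by simp
  have s: "sgn (n - 1) = -1" "sgn n = -1" using n by auto
  show ?thesis unfolding alternating_prod_def u s using foldr_mult(2)[of _ "%j. g (sigma (j * -1))" "g (sigma (n - 1))"] c by simp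
 qed
qed

text \<open>\<open>g 1\<close> and \<open>g (-1)\<close> reverse orientation, so the orientations
  alternate, and after a decreasing piece the two ends of the central interval exchange their roles.
  This is the alternation in \<open>sigma\<close>.\<close>

lemma dcp_ng:
 assumes d: "dcp D nm np a g" and ng: "ng (a (-1)) (a 1)" and n: "n : idx nm np"
 shows "inv (g n) \<otimes> alternating_prod G g n : S" "n >= 1 ==> nearR (a (-1)) (a 1) (even n) (g n) (a n)"
  "n <= -1 ==> nearL (a (-1)) (a 1) (even n) (g n) (a n)"
  "EX w. w ~: S & dec w (a 1) (a 1) & inv w \<otimes> g 1 : S" "EX w. w ~: S & dec w (a (-1)) (a (-1)) & inv w \<otimes> g (-1) : S"
proof -
 note D = dcpD[OF d]
 let ?a = "a (-1)" and ?b = "a 1"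
 have ab: "?a < ?b" using mxD(1)[OF D(5)] .
 obtain v w where v: "v ~: S" "dec v ?a ?a" and w: "w ~: S" "dec w ?b ?b" using ng unfolding ng_def by blast
 obtain \<tau>1 where t1: "nearR ?a ?b \<tau>1 (g 1) ?b" using dcp_nearR[OF d D(11)] by auto
 obtain \<tau>2 where t2: "nearL ?a ?b \<tau>2 (g (-1)) ?a" using dcp_nearL[OF d D(12)] by auto
 note s1 = nearR_same[OF D(5) t1 nearR_dec[OF ab w(2)]] and s2 = nearL_same[OF D(5) t2 nearL_dec[OF ab v(2)]]
 have 1: "nearR ?a ?b False (g 1) ?b" and 2: "nearL ?a ?b False (g (-1)) ?a" using t1 t2 s1(2) s2(2) by simp_all
 show "EX w. w ~: S & dec w ?b ?b & inv w \<otimes> g 1 : S" "EX w. w ~: S & dec w ?a ?a & inv w \<otimes> g (-1) : S"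
  using v w s1(1) s2(1) by blast+
 have gc: "n : idx nm np ==> g n : carrier G" for n by (rule D(7))
 note c = gc[OF D(11)] gc[OF D(12)]
 note al = alternating_prod_step[of g, OF c]
 have i: "inv (g 1) \<otimes> g 1 : S" "inv (g (-1)) \<otimes> g (-1) : S" using c S_one by simp_all
 have R: "even (n + 1) = (if even n then False else ~ False) & (EX k:carrier G.
   alternating_prod G g (n + 1) = alternating_prod G g n \<otimes> k & inv (if even n then g 1 else g (-1)) \<otimes> k : S)" if "1 <= n" for n
  using al(4)[OF that] sigma_step(1)[OF that] c i by (cases "even n") auto
 have L: "even (n - 1) = (if even n then False else ~ False) & (EX k:carrier G.
   alternating_prod G g (n - 1) = alternating_prod G g n \<otimes> k & inv (if even n then g (-1) else g 1) \<otimes> k : S)" if "n <= -1" for n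
  using al(5)[OF that] sigma_step(2)[OF that] c i by (cases "even n") auto
 note all = dcp_induct[OF d 1 2, of "alternating_prod G g" even n, OF al(1) _ _ _ _ R L n]
 show "inv (g n) \<otimes> alternating_prod G g n : S" by (rule all(1)) (use al(2,3) i in simp_all)
 show "nearR ?a ?b (even n) (g n) (a n)" if "n >= 1" by (rule all(2)) (use al(2,3) i that in simp_all)
 show "nearL ?a ?b (even n) (g n) (a n)" if "n <= -1" by (rule all(3)) (use al(2,3) i that in simp_all)
qed

lemma dcp_orient:
 assumes d: "dcp D nm np a g" and n: "n : idx nm np"
  and \<omega>: "n >= 1 ==> nearR (a (-1)) (a 1) \<omega> (g n) (a n)" "n <= -1 ==> nearL (a (-1)) (a 1) \<omega> (g n) (a n)"
  and k: "plink (a (-1)) (a 1) h (piece D a nm np n) P \<mu>"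
 shows "if \<omega> then smono P \<mu> else santi P \<mu>"
proof -
 note D = dcpD[OF d]
 obtain \<sigma> where \<sigma>: "if \<sigma> then smono P \<mu> else santi P \<mu>" using plink_orient[OF k] by blast
 have "n >= 1 | n <= -1" using n unfolding idx_def by auto
 then have "\<sigma> = \<omega>"
  using nearR_same(2)[OF D(5) dcp_near(1)[OF d n k \<sigma>] \<omega>(1)] nearL_same(2)[OF D(5) dcp_near(2)[OF d n k \<sigma>] \<omega>(2)] by blast
 then show ?thesis using \<sigma> by blast
qed

end

section \<open>Existence of decompositions\<close>

lemma half_openI:
 assumes P: "interval P" "~ compact P" and e: "(EX x:P. P \<subseteq> {x..}) | (EX y:P. P \<subseteq> {..y})"
 shows "half_open P"
proof -
 have False if x: "x : P" "P \<subseteq> {x..}" and y: "y : P" "P \<subseteq> {..y}" for x y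
 proof -
  have "is_interval P" using P(1) unfolding interval_iff by simp
  from ivl_sub[OF this x(1) y(1)] have "P = {x..y}" using x(2) y(2) by fastforce
  then show False using P(2) by simp
 qed
 then show ?thesis unfolding half_open_def using P(1) e by blast
qed

lemma half_open_Icc: "half_open {l..r} ==> False" for l r :: real
proof -
 assume h: "half_open {l..r}"
 then have "{l..r} ~= {}" unfolding half_open_def by auto
 then have "l <= r" by simp
 then have "EX a:{l..r}. {l..r} \<subseteq> {a..}" "EX b:{l..r}. {l..r} \<subseteq> {..b}" by (intro bexI[of _ l] bexI[of _ r]; auto)+
 then show False using h unfolding half_open_def by blast
qed

lemma ray_not_compact:
 fixes D :: "real set"
 assumes "open D" "p : D" shows "~ compact (D \<inter> {p..})" "~ compact (D \<inter> {..p})"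
proof -
 show "~ compact (D \<inter> {p..})"
 proof
  assume c: "compact (D \<inter> {p..})"
  have "D \<inter> {p..} ~= {}" using assms(2) by auto
  from compact_attains_sup[OF c this] obtain m where m: "m : D \<inter> {p..}" "ALL x:D \<inter> {p..}. x <= m" by (elim bexE) (rule that)
  obtain e where e: "e > 0" "ball m e \<subseteq> D" using m(1) assms(1) open_contains_ball by (metis IntD1)
  have "m + e/2 : D \<inter> {p..}" using e m(1) by (auto simp: subset_iff dist_real_def)
  from bspec[OF m(2) this] show False using e(1) by simp
 qed
 show "~ compact (D \<inter> {..p})"
 proof
  assume c: "compact (D \<inter> {..p})"
  have "D \<inter> {..p} ~= {}" using assms(2) by auto
  from compact_attains_inf[OF c this] obtain m where m: "m : D \<inter> {..p}" "ALL x:D \<inter> {..p}. m <= x" by (elim bexE) (rule that)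
  obtain e where e: "e > 0" "ball m e \<subseteq> D" using m(1) assms(1) open_contains_ball by (metis IntD1)
  have "m - e/2 : D \<inter> {..p}" using e m(1) by (auto simp: subset_iff dist_real_def)
  from bspec[OF m(2) this] show False using e(1) by simp
 qed
qed

lemma idx_cases: "n : idx nm np ==> n >= 1 | n <= -1"
 unfolding idx_def by auto

context setting
begin

lemma diffeo_plink:
 assumes s: "sub D \<gamma>" and D: "{a..b} \<subseteq> D" "C \<subseteq> D" and h: "h : carrier G"
  and P: "P \<subseteq> {a..b}" "analytic_diffeo P C \<mu>" "ALL t:P. (\<phi> h \<circ> \<gamma>) t = \<gamma> (\<mu> t)"
 shows "plink a b h C P \<mu>"
proof -
 note sD = subD[OF s] and dD = diffeoD[OF P(2)]
 have PI: "P \<subseteq> I" "C \<subseteq> I" using P(1) D sD(2) by blast+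
 have "\<phi> h (\<delta> t) = \<delta> (\<mu> t)" if t: "t : P" for t
 proof -
  have "\<gamma> t = \<delta> t" "\<gamma> (\<mu> t) = \<delta> (\<mu> t)" using sD(3) t P(1) D dD(6) by blast+
  then show ?thesis using bspec[OF P(3) t] by simp
 qed
 then show ?thesis unfolding plink_def using diffeo_dv[OF P(2) h PI] P(1,2) by blast
qed

lemma leadsto_plink:
 assumes s: "sub D \<gamma>" and D: "{a..b} \<subseteq> D" "C \<subseteq> D" and h: "h : carrier G" and l: "leadsto a b (\<phi> h \<circ> \<gamma>) C \<gamma> P \<mu>"
 shows "plink a b h C P \<mu>" "C = {x..y} ==> P = {a..b}"
proof -
 have P: "P \<subseteq> {a..b}" "analytic_diffeo P C \<mu>" "ALL t:P. (\<phi> h \<circ> \<gamma>) t = \<gamma> (\<mu> t)"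
  and alt: "P = {a..b} | half_open C" using l unfolding leadsto_def by auto
 show "plink a b h C P \<mu>" by (rule diffeo_plink[OF s D h P])
 show "P = {a..b}" if "C = {x..y}" using alt half_open_Icc that by blast
qed

lemma harpoon_plink:
 assumes s: "sub D \<gamma>" and D: "{a..b} \<subseteq> D" "C \<subseteq> D" and h: "h : carrier G" and l: "harpoon a b (\<phi> h \<circ> \<gamma>) C \<gamma> P \<mu>"
 shows "plink a b h C P \<mu>"
 by (rule diffeo_plink[OF s D h]) (use l in \<open>simp_all add: harpoon_def\<close>)

lemma frameD:
 assumes s: "sub D \<gamma>" and f: "decomposition_frame G \<phi> M D \<gamma> A nm np a g"
 shows "A = {a (-1)..a 1}" "mx (a (-1)) (a 1)" "nm < Fin 0" "Fin 0 < np" "smono (idx nm np) a"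
  "n : idx nm np ==> a n : interior D" "n : idx nm np ==> g n : carrier G" "1 : idx nm np" "-1 : idx nm np"
  "{a (-1)..a 1} \<subseteq> D"
  "ALL n:idx nm np. a n : interior D"
proof -
 note all = f[unfolded decomposition_frame_def]
 show "nm < Fin 0" using all by (elim conjE)
 note n0 = this
 show "Fin 0 < np" using all by (elim conjE)
 note n0 = n0 this
 show "smono (idx nm np) a" using all by (elim conjE)
 have b: "ALL n:idx nm np. a n : interior D & g n : carrier G" using all by (elim conjE)
 show "ALL n:idx nm np. a n : interior D" using b by blast
 have b': "n : idx nm np ==> a n : interior D" "n : idx nm np ==> g n : carrier G" for n using b by blast+
 then show "n : idx nm np ==> a n : interior D" "n : idx nm np ==> g n : carrier G" by blast+
 show A: "A = {a (-1)..a 1}" using all unfolding piece_def by (elim conjE) simp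
 show i: "1 : idx nm np" using idx_pos[of 1] n0 Fin_Suc_le(1)[of 0 np] by simp
 show i': "-1 : idx nm np" using idx_neg[of "-1"] n0 Fin_Suc_le(2)[of nm 0] by simp
 obtain x y where xy: "A = {x..y}" "mx x y"
  using all unfolding inner_compact_maximal_iff[OF s] by (elim conjE exE) (rule that)
 have "{x..y} = {a (-1)..a 1}" "x < y" using A xy mxD(1) by auto
 then have "x = a (-1) & y = a 1" by (simp add: Icc_eq_Icc)
 then show "mx (a (-1)) (a 1)" using xy(2) by blast
 show "{a (-1)..a 1} \<subseteq> D" using ivl_sub[OF subD(4)[OF s]] b'(1)[OF i] b'(1)[OF i'] interior_subset by blast
qed

lemma links_dcp:
 assumes s: "sub D \<gamma>" and m: "mx (a (-1)) (a 1)" and n0: "nm < Fin 0" "Fin 0 < np" and sm: "smono (idx nm np) a"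
  and aD: "ALL n:idx nm np. a n : interior D" and gc: "ALL n:idx nm np. g n : carrier G" and AD: "{a (-1)..a 1} \<subseteq> D"
  and k: "ALL n:idx nm np. EX P \<mu>. piece_link D \<gamma> nm np a (\<phi> (g n) \<circ> \<gamma>) n P \<mu>"
 shows "dcp D nm np a g"
proof -
 note sD = subD[OF s]
 have "EX P \<mu>. plink (a (-1)) (a 1) (g n) (piece D a nm np n) P \<mu> & (Fin n ~= nm & Fin n ~= np --> P = {a (-1)..a 1})"
  if n: "n : idx nm np" for n
 proof -
  note ps = piece_sub[OF sD(4) n0 aD n]
  obtain P \<mu> where k: "piece_link D \<gamma> nm np a (\<phi> (g n) \<circ> \<gamma>) n P \<mu>" using k n by blast
  show ?thesis
  proof (cases "Fin n = nm | Fin n = np")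
   case True
   then have "harpoon (a (-1)) (a 1) (\<phi> (g n) \<circ> \<gamma>) (piece D a nm np n) \<gamma> P \<mu>" using k unfolding piece_link_def by simp
   from harpoon_plink[OF s AD ps(1) bspec[OF gc n] this] show ?thesis using True by blast
  next
   case False
   then have l: "leadsto (a (-1)) (a 1) (\<phi> (g n) \<circ> \<gamma>) (piece D a nm np n) \<gamma> P \<mu>" using k unfolding piece_link_def by simp
   obtain x y where xy: "piece D a nm np n = {x..y}" using ps(2) False by blast
   show ?thesis using leadsto_plink[OF s AD ps(1) bspec[OF gc n] l] xy by blast
  qed
 qed
 then show ?thesis unfolding dcp_def using sD m n0 sm aD gc by (intro conjI ballI) blast+
qed

lemma A_decomposition_dcp:
 assumes s: "sub D \<gamma>" and A: "A_decomposition G \<phi> M D \<gamma> A nm np a g" shows "dcp D nm np a g"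
proof -
 have f: "decomposition_frame G \<phi> M D \<gamma> A nm np a g"
  and k: "ALL n:idx nm np. EX P \<mu>. piece_link D \<gamma> nm np a (\<phi> (g n) \<circ> \<gamma>) n P \<mu>"
  using A unfolding A_decomposition_def by blast+
 note F = frameD[OF s f]
 show ?thesis by (rule links_dcp[OF s F(2-5) F(11) _ F(10) k]) (use F(7) in blast)
qed

lemma open_A_decomposition_dcp:
 assumes s: "sub D \<gamma>" and A: "open_A_decomposition G \<phi> M D \<gamma> A nm np a g" shows "dcp D nm np a g"
proof -
 have f: "decomposition_frame G \<phi> M D \<gamma> A nm np a g" using A unfolding open_A_decomposition_def by blast
 note F = frameD[OF s f] and sD = subD[OF s]
 have "EX P \<mu>. plink (a (-1)) (a 1) (g n) (piece D a nm np n) P \<mu> & (Fin n ~= nm & Fin n ~= np --> P = {a (-1)..a 1})"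
  if n: "n : idx nm np" for n
 proof -
  note ps = piece_sub[OF sD(4) F(3,4,11) n]
  obtain P \<mu> where l: "leadsto (a (-1)) (a 1) (\<phi> (g n) \<circ> \<gamma>) (piece D a nm np n) \<gamma> P \<mu>"
   using A n unfolding open_A_decomposition_def by blast
  show ?thesis using leadsto_plink[OF s F(10) ps(1) F(7)[OF n] l] ps(2) by blast
 qed
 then show ?thesis unfolding dcp_def using sD F(2-7) by (intro conjI ballI)
qed

lemma dcp_nontrivial: assumes d: "dcp D nm np a g" shows "g 1 ~: S" "g (-1) ~: S"
proof -
 note D = dcpD[OF d]
 note c = D(7)[OF D(11)] D(7)[OF D(12)]
 have "g 1 ~: S & g (-1) ~: S" using mx_cases[OF D(5)]
 proof
  assume "EX h. ps h (a (-1)) (a 1)"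
  then obtain h where h: "ps h (a (-1)) (a 1)" by blast
  have hS: "h ~: S" "h : carrier G" using h lnkD(1) inc_lnk unfolding ps_def by blast+
  have hi: "inv h ~: S" using hS S_inv[of "inv h"] by auto
  have "h [^] (-1::int) = inv h" using grp.int_pow_neg[OF hS(2), of 1] hS(2) by simp
  then have k: "inv (g 1) \<otimes> h : S" "inv (g (-1)) \<otimes> inv h : S"
   using dcp_ps(1)[OF d h D(11)] dcp_ps(1)[OF d h D(12)] hS(2) by simp_all
  show ?thesis using S_cancel_left[OF c(1) hS(2) k(1)] S_cancel_left[OF c(2) _ k(2)] hS hi by auto
 next
  assume ng: "ng (a (-1)) (a 1)"
  obtain w v where w: "w ~: S" "dec w (a 1) (a 1)" "inv w \<otimes> g 1 : S" and v: "v ~: S" "dec v (a (-1)) (a (-1))" "inv v \<otimes> g (-1) : S"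
   using dcp_ng(4,5)[OF d ng D(11)] by blast
  have "w : carrier G" "v : carrier G" using lnkD(1) dec_lnk w(2) v(2) by blast+
  then show ?thesis using S_cancel_right[OF _ c(1) w(3)] S_cancel_right[OF _ c(2) v(3)] w(1) v(1) by blast
 qed
 then show "g 1 ~: S" "g (-1) ~: S" by auto
qed

lemma dv_leadsto:
 assumes s: "sub D \<gamma>" and d: "dv h K R" and P: "P \<subseteq> K" "interval P" "P \<subseteq> {a..b}" and D: "{a..b} \<subseteq> D" "R ` P \<subseteq> D"
 shows "analytic_diffeo P (R ` P) R" "ALL t:P. (\<phi> h \<circ> \<gamma>) t = \<gamma> (R t)"
proof -
 note sD = subD[OF s]
 show "analytic_diffeo P (R ` P) R" by (rule dv_diffeo[OF d P(1,2)])
 show "ALL t:P. (\<phi> h \<circ> \<gamma>) t = \<gamma> (R t)"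
 proof
  fix t assume t: "t : P"
  have "\<gamma> t = \<delta> t" "\<gamma> (R t) = \<delta> (R t)" using sD(3) P(3) D t by blast+
  then show "(\<phi> h \<circ> \<gamma>) t = \<gamma> (R t)" using dvD(9)[OF d] P(1) t by auto
 qed
qed

lemma lk_leadsto:
 assumes s: "sub D \<gamma>" and ab: "a < b" and k: "lk a b h l r" and D: "{a..b} \<subseteq> D" "{l..r} \<subseteq> D"
 shows "EX P \<mu>. leadsto a b (\<phi> h \<circ> \<gamma>) {l..r} \<gamma> P \<mu>"
proof -
 obtain K R where K: "dv h K R" "{a..b} \<subseteq> K" "R ` {a..b} = {l..r}" using k unfolding lk_def by blast
 have i: "interval {a..b}" unfolding interval_def using ab by simp
 have "leadsto a b (\<phi> h \<circ> \<gamma>) {l..r} \<gamma> {a..b} R"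
  unfolding leadsto_def using dv_leadsto[OF s K(1,2) i order_refl D(1)] D(2) K(3) by simp
 then show ?thesis by blast
qed

text \<open>The end carried to \<open>r\<close> makes the link a harpoon. If \<open>C\<close> is not
  compact, neither is \<open>P\<close>; as \<open>P\<close> contains an end of
  \<open>{a..b}\<close>, it is then half-open, as \<open>leadsto\<close> requires.\<close>

lemma endlk_links:
 assumes s: "sub D \<gamma>" and ab: "a < b" and k: "endlk a b h C r" and D: "{a..b} \<subseteq> D" "C \<subseteq> D" and C: "interval C" and r: "r : C - interior C"
 shows "EX P \<mu>. harpoon a b (\<phi> h \<circ> \<gamma>) C \<gamma> P \<mu>" "half_open C ==> ~ compact C ==> EX P \<mu>. leadsto a b (\<phi> h \<circ> \<gamma>) C \<gamma> P \<mu>"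
proof -
 obtain K R P e where K: "dv h K R" "P \<subseteq> K" "P \<subseteq> {a..b}" "is_interval P" "R ` P = C" and e: "e : P \<inter> {a, b}" "R e = r"
  using k unfolding endlk_def by blast
 have "interior P ~= {}"
 proof -
  obtain z where z: "z : interior C" using C unfolding interval_iff by blast
  then obtain x where x: "x : P" "R x = z" using interior_subset K(5) by blast
  have "x ~= e" using x(2) e(2) z r by blast
  then consider "x < e" | "e < x" by linarith
  then show ?thesis
  proof cases
   case 1 then show ?thesis using interior_between[OF K(4) x(1), of e] e(1) dense[OF 1] by fastforce
  next
   case 2 then show ?thesis using interior_between[OF K(4) _ x(1), of e] e(1) dense[OF 2] by fastforce
  qed
 qed
 then have iP: "interval P" unfolding interval_iff using K(4) by blast
 have im: "R ` P \<subseteq> D" using K(5) D(2) by simp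
 note l = dv_leadsto[OF s K(1,2) iP K(3) D(1) im, unfolded K(5)]
 have ne: "P \<inter> {a, b} ~= {}" using e(1) by blast
 have "R ` (P \<inter> {a, b}) \<inter> (C - interior C) ~= {}" using e r by blast
 then have "harpoon a b (\<phi> h \<circ> \<gamma>) C \<gamma> P R" unfolding harpoon_def using K(3) l ne by (intro conjI)
 then show "EX P \<mu>. harpoon a b (\<phi> h \<circ> \<gamma>) C \<gamma> P \<mu>" by blast
 show "EX P \<mu>. leadsto a b (\<phi> h \<circ> \<gamma>) C \<gamma> P \<mu>" if h: "half_open C" "~ compact C"
 proof -
  have "~ compact P" using compact_continuous_image[OF continuous_on_subset[OF dvD(5)[OF K(1)] K(2)]] K(5) h(2) by blast
  moreover have "(EX x:P. P \<subseteq> {x..}) | (EX y:P. P \<subseteq> {..y})" using e(1) K(3) by (auto simp: subset_iff)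
  ultimately have "half_open P" using half_openI[OF iP] by blast
  then have "leadsto a b (\<phi> h \<circ> \<gamma>) C \<gamma> P R" unfolding leadsto_def using K(3) l ne h(1) by simp
  then show ?thesis by blast
 qed
qed

lemma chain_mono:
 fixes p :: "int => real"
 assumes p: "!!n. [|1 <= n; Fin n < N|] ==> p n < p (n + 1)" and n: "1 <= n" "n < m" and m: "Fin m <= N"
 shows "p n < p m"
 using n(2) m
proof (induction m rule: int_gr_induct)
 case base
 have "Fin n < N" using base Fin_Suc_le(1) by blast
 then show ?case using p n(1) by blast
next
 case (step m)
 have "Fin m < N" using step(3) Fin_Suc_le(1) by blast
 moreover have "Fin m <= N" using \<open>Fin m < N\<close> by (rule order.strict_implies_order)
 ultimately show ?case using p[of m] step(1) step.IH n(1) by simp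
qed

text \<open>A chain to the right and a chain to the left are joined; the left one is numbered by the
  negative indices, so its length \<open>N'\<close> becomes the lower bound with opposite
  sign.\<close>

lemma dcp_exists:
 assumes m: "mx a b" and D: "interval D" "D \<subseteq> I" and ab: "a : interior D" "b : interior D"
 shows "EX nm np aa gg. aa (-1) = a & aa 1 = b & nm < Fin 0 & Fin 0 < np & smono (idx nm np) aa &
  (ALL n:idx nm np. aa n : interior D & gg n : carrier G) &
  (ALL n:idx nm np. if Fin n = nm | Fin n = np then endlk a b (gg n) (piece D aa nm np n) (aa n)
   else EX l r. piece D aa nm np n = {l..r} & lk a b (gg n) l r)"
proof -
 have iD: "is_interval D" using D(1) unfolding interval_iff by simp
 obtain N p g where r: "rchain a b D N p g" using rchain_exists[OF m iD D(2) ab(2)] by blast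
 obtain N' p' g' where l: "lchain a b D N' p' g'" using lchain_exists[OF m iD D(2) ab(1)] by blast
 have R: "Fin 0 < N" "p 1 = b" "!!n. [|1 <= n; Fin n <= N|] ==> p n : interior D & g n : carrier G"
  "!!n. [|1 <= n; Fin n < N|] ==> p n < p (n + 1)" "!!n. [|1 <= n; Fin n < N|] ==> lk a b (g n) (p n) (p (n + 1))"
  "!!n. [|1 <= n; Fin n = N|] ==> endlk a b (g n) (D \<inter> {p n..}) (p n)"
  using r unfolding rchain_def by blast+
 have L: "Fin 0 < N'" "p' 1 = a" "!!n. [|1 <= n; Fin n <= N'|] ==> p' n : interior D & g' n : carrier G"
  "!!n. [|1 <= n; Fin n < N'|] ==> p' (n + 1) < p' n" "!!n. [|1 <= n; Fin n < N'|] ==> lk a b (g' n) (p' (n + 1)) (p' n)"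
  "!!n. [|1 <= n; Fin n = N'|] ==> endlk a b (g' n) (D \<inter> {..p' n}) (p' n)"
  using l unfolding lchain_def by blast+
 define nm where "nm = (case N' of Fin k => Fin (- k) | _ => Minf)"
 have nm: "nm <= Fin n \<longleftrightarrow> Fin (- n) <= N'" "Fin n = nm \<longleftrightarrow> Fin (- n) = N'" "nm < Fin 0" for n
  using L(1) unfolding nm_def by (cases N'; auto)+
 define aa where "aa n = (if n >= 1 then p n else p' (- n))" for n :: int
 define gg where "gg n = (if n >= 1 then g n else g' (- n))" for n :: int
 have pos: "aa n = p n" "gg n = g n" if "n >= 1" for n using that unfolding aa_def gg_def by auto
 have neg: "aa n = p' (- n)" "gg n = g' (- n)" if "n <= -1" for n using that unfolding aa_def gg_def by auto
 have ip: "n : idx nm N ==> n >= 1 ==> Fin n <= N" and im: "n : idx nm N ==> n <= -1 ==> Fin (- n) <= N'" for n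
  using nm(1)[of n] unfolding idx_def by auto
 have up: "b <= p n" if "1 <= n" "Fin n <= N" for n
  using chain_mono[of N p 1 n, OF R(4)] that R(2) by (cases "n = 1") force+
 have dn: "p' n < p' m" if "1 <= m" "m < n" "Fin n <= N'" for n m
  using chain_mono[of N' "%n. - p' n" m n] L(4) that by auto
 have dna: "p' n <= a" if "1 <= n" "Fin n <= N'" for n
  using dn[of 1 n] that L(2) by (cases "n = 1") force+
 have lt: "a < b" using mxD(1)[OF m] .
 have smono: "smono (idx nm N) aa"
 proof (rule strict_mono_onI)
  fix n k assume n: "n : idx nm N" and k: "k : idx nm N" and nk: "n < k"
  consider "n >= 1" | "n <= -1" "k >= 1" | "k <= -1" using idx_cases[OF n] idx_cases[OF k] nk by linarith
  then show "aa n < aa k"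
  proof cases
   case 1
   then have "k >= 1" using nk by simp
   then show ?thesis using chain_mono[of N p n k, OF R(4) 1 nk] ip[OF k] pos 1 by simp
  next
   case 2
   then show ?thesis using up[OF 2(2) ip[OF k 2(2)]] dna[of "- n"] im[OF n 2(1)] lt pos(1)[OF 2(2)] neg(1)[OF 2(1)] by simp
  next
   case 3
   then have n1: "n <= -1" using nk by simp
   have "p' (- n) < p' (- k)" by (rule dn) (use 3 nk im[OF n n1] in auto)
   then show ?thesis using neg 3 n1 by simp
  qed
 qed
 have mem: "aa n : interior D & gg n : carrier G" if n: "n : idx nm N" for n
  using idx_cases[OF n]
 proof
  assume "n >= 1" then show ?thesis using R(3) ip[OF n] pos by metis
 next
  assume n1: "n <= -1"
  then have "1 <= - n" by simp
  then show ?thesis using L(3) im[OF n n1] neg[OF n1] by metis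
 qed
 have links: "if Fin n = nm | Fin n = N then endlk a b (gg n) (piece D aa nm N n) (aa n)
   else EX l r. piece D aa nm N n = {l..r} & lk a b (gg n) l r" if n: "n : idx nm N" for n
  using idx_cases[OF n]
 proof
  assume n1: "n >= 1"
  have nn: "Fin n ~= nm" using nm(3) n1 by auto
  have le: "Fin n <= N" by (rule ip[OF n n1])
  show ?thesis
  proof (cases "Fin n = N")
   case True
   have "endlk a b (g n) (D \<inter> {p n..}) (p n)" by (rule R(6)[OF n1 True])
   then show ?thesis unfolding piece_pos[OF n1] using True pos[OF n1] by simp
  next
   case False
   then have "Fin n < N" using le by (simp add: order.strict_iff_order)
   then have "lk a b (g n) (p n) (p (n + 1))" by (rule R(5)[OF n1])
   then show ?thesis unfolding piece_pos[OF n1] using False nn pos[OF n1] pos(1)[of "n + 1"] n1 by auto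
  qed
 next
  assume n1: "n <= -1"
  then have n1': "1 <= - n" by simp
  have nn: "Fin n ~= N" using R(1) n1 by auto
  have le: "Fin (- n) <= N'" by (rule im[OF n n1])
  show ?thesis
  proof (cases "Fin n = nm")
   case True
   have "endlk a b (g' (- n)) (D \<inter> {..p' (- n)}) (p' (- n))" by (rule L(6)[OF n1']) (use True nm(2) in blast)
   then show ?thesis unfolding piece_neg[OF n1] using True neg[OF n1] by simp
  next
   case False
   then have "Fin (- n) ~= N'" using nm(2) by blast
   then have "Fin (- n) < N'" using le by (simp add: order.strict_iff_order)
   then have "lk a b (g' (- n)) (p' (- n + 1)) (p' (- n))" by (rule L(5)[OF n1'])
   moreover have "aa (n - 1) = p' (- n + 1)" using neg(1)[of "n - 1"] n1 by simp
   ultimately show ?thesis unfolding piece_neg[OF n1] using False nn neg[OF n1] by auto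
  qed
 qed
 have "aa (-1) = a" "aa 1 = b" using pos(1)[of 1] neg(1)[of "-1"] R(2) L(2) by auto
 note ends = this
 have mem': "ALL n:idx nm N. aa n : interior D & gg n : carrier G" using mem by blast
 show ?thesis
  by (rule exI[of _ nm], rule exI[of _ N], rule exI[of _ aa], rule exI[of _ gg])
   (intro conjI, rule ends(1), rule ends(2), rule nm(3), rule R(1), rule smono, rule mem', rule ballI, rule links)
qed

text \<open>For open \<open>D\<close> the end pieces are half-open, so the same data satisfy the
  stronger relation of open decompositions.\<close>

lemma A_decomposition_exists:
 assumes s: "sub D \<gamma>" and m: "mx a b" and ab: "a : interior D" "b : interior D"
 shows "EX nm np aa gg. A_decomposition G \<phi> M D \<gamma> {a..b} nm np aa gg &
  (open D --> open_A_decomposition G \<phi> M D \<gamma> {a..b} nm np aa gg)"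
proof -
 note sD = subD[OF s]
 obtain nm np aa gg where e: "aa (-1) = a" "aa 1 = b" and n0: "nm < Fin 0" "Fin 0 < np" and sm: "smono (idx nm np) aa"
  and mem: "ALL n:idx nm np. aa n : interior D & gg n : carrier G"
  and lks: "ALL n:idx nm np. if Fin n = nm | Fin n = np then endlk a b (gg n) (piece D aa nm np n) (aa n)
   else EX l r. piece D aa nm np n = {l..r} & lk a b (gg n) l r"
  using dcp_exists[OF m sD(1,2) ab] by (elim exE conjE) (rule that)
 have lt: "a < b" using mxD(1)[OF m] .
 have aD: "ALL n:idx nm np. aa n : interior D" and gc: "ALL n:idx nm np. gg n : carrier G" using mem by blast+
 have abD: "{a..b} \<subseteq> D" using ivl_sub[OF sD(4)] ab interior_subset by blast
 have links: "(EX P \<mu>. piece_link D \<gamma> nm np aa (\<phi> (gg n) \<circ> \<gamma>) n P \<mu>) &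
   (open D --> (EX P \<mu>. leadsto a b (\<phi> (gg n) \<circ> \<gamma>) (piece D aa nm np n) \<gamma> P \<mu>))" if n: "n : idx nm np" for n
 proof (cases "Fin n = nm | Fin n = np")
  case True
  let ?C = "piece D aa nm np n"
  have k: "endlk a b (gg n) ?C (aa n)" using lks n True by (metis (no_types, lifting))
  note h = ivl_half[OF sD(4) bspec[OF aD n]]
  have D: "aa n : D" using aD n interior_subset by blast
  have "(?C = D \<inter> {aa n..} & n >= 1) | (?C = D \<inter> {..aa n} & n <= -1)"
   using idx_cases[OF n]
  proof
   assume n1: "n >= 1"
   then have "Fin n = np" using True n0(1) by auto
   then show ?thesis using piece_pos[OF n1] n1 by metis
  next
   assume n1: "n <= -1"
   then have "Fin n = nm" using True n0(2) by auto
   then show ?thesis using piece_neg[OF n1] n1 by metis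
  qed
  then have "interval ?C & aa n : ?C - interior ?C & ?C \<subseteq> D & (open D --> half_open ?C & ~ compact ?C)"
  proof (elim disjE conjE)
   assume C: "?C = D \<inter> {aa n..}"
   have "half_open ?C & ~ compact ?C" if "open D"
    unfolding C using half_openI[OF h(4)] ray_not_compact(1)[OF that D] D by blast
   moreover have "interval ?C" "aa n : ?C - interior ?C" "?C \<subseteq> D" unfolding C h using h(4) D by auto
   ultimately show ?thesis by blast
  next
   assume C: "?C = D \<inter> {..aa n}"
   have "half_open ?C & ~ compact ?C" if "open D"
    unfolding C using half_openI[OF h(3)] ray_not_compact(2)[OF that D] D by blast
   moreover have "interval ?C" "aa n : ?C - interior ?C" "?C \<subseteq> D" unfolding C h using h(3) D by auto
   ultimately show ?thesis by blast
  qed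
  then have C: "interval ?C" "aa n : ?C - interior ?C" "?C \<subseteq> D" "open D ==> half_open ?C & ~ compact ?C" by blast+
  show ?thesis using endlk_links[OF s lt k abD C(3,1,2)] C(4) True unfolding piece_link_def e by auto
 next
  case False
  then obtain l r where lr: "piece D aa nm np n = {l..r}" "lk a b (gg n) l r" using lks n by (metis (no_types, lifting))
  have "{l..r} \<subseteq> D" using piece_sub(1)[OF sD(4) n0 aD n] lr(1) by simp
  from lk_leadsto[OF s lt lr(2) abD this] show ?thesis unfolding piece_link_def e lr(1) using False by auto
 qed
 have k: "ALL n:idx nm np. EX P \<mu>. piece_link D \<gamma> nm np aa (\<phi> (gg n) \<circ> \<gamma>) n P \<mu>" using links by blast
 have d: "dcp D nm np aa gg" by (rule links_dcp[OF s _ n0 sm aD gc _ k]) (use e m abD in simp_all)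
 note dD = dcpD[OF d]
 have icm: "inner_compact_maximal G \<phi> M D \<gamma> {a..b}" unfolding inner_compact_maximal_iff[OF s] using m ab by blast
 have cls: "gg n <# S ~= \<one> <# S" if "n : {-1, 1}" for n
 proof -
  have n: "n : idx nm np" "gg n ~: S" using that dD(11,12) dcp_nontrivial[OF d] by auto
  then have c: "gg n : carrier G" using gc by blast
  then show ?thesis using S_class_iff[OF grp.one_closed c] n(2) by simp
 qed
 have p0: "piece D aa nm np 0 = {a..b}" unfolding piece_def using e by simp
 have frame: "decomposition_frame G \<phi> M D \<gamma> {a..b} nm np aa gg"
  unfolding decomposition_frame_def class_eq[OF s] using icm n0 mem sm cls p0 by (intro conjI ballI) blast+
 then have "A_decomposition G \<phi> M D \<gamma> {a..b} nm np aa gg" unfolding A_decomposition_def using k by blast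
 moreover have "open_A_decomposition G \<phi> M D \<gamma> {a..b} nm np aa gg" if "open D"
  unfolding open_A_decomposition_def open_interval_def e using frame links that sD(1) by blast
 ultimately show ?thesis by blast
qed

section \<open>Positive and negative intervals\<close>

lemma ps_not_ng: "mx a b ==> (EX h. ps h a b) \<longleftrightarrow> ~ ng a b"
 using mx_cases ps_ng by blast

text \<open>Both signs in one statement, \<open>\<sigma>\<close> being true for positive intervals.
  The links next to the central interval have the orientation dictated by its walls in any open
  decomposition, and no map on an interval is both increasing and decreasing.\<close>

lemma signed_interval:
 assumes s: "sub J \<gamma>" and J: "open J"
 shows "(EX nm np a g. open_A_decomposition G \<phi> M J \<gamma> A nm np a g & (ALL n:{-1, 1}. EX P \<mu>.
   leadsto (a (-1)) (a 1) (\<phi> (g n) \<circ> \<gamma>) (piece J a nm np n) \<gamma> P \<mu> & (if \<sigma> then smono P \<mu> else santi P \<mu>))) \<longleftrightarrow>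
  (EX a b. A = {a..b} & mx a b & a : J & b : J & \<sigma> = (~ ng a b))" (is "?L \<longleftrightarrow> ?R")
proof -
 note sD = subD[OF s]
 have iJ: "interior J = J" using J by (rule interior_open)
 have orient: "dcp J nm np a g & A = {a (-1)..a 1} & mx (a (-1)) (a 1) & a (-1) : J & a 1 : J &
   (ALL n:{-1, 1}. ALL P \<mu>. leadsto (a (-1)) (a 1) (\<phi> (g n) \<circ> \<gamma>) (piece J a nm np n) \<gamma> P \<mu> -->
    interval P & (if ng (a (-1)) (a 1) then santi P \<mu> else smono P \<mu>))"
  if o: "open_A_decomposition G \<phi> M J \<gamma> A nm np a g" for A nm np a g
 proof -
  have f: "decomposition_frame G \<phi> M J \<gamma> A nm np a g" using o unfolding open_A_decomposition_def by blast
  note F = frameD[OF s f] and d = open_A_decomposition_dcp[OF s o]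
  have "interval P & (if ng (a (-1)) (a 1) then santi P \<mu> else smono P \<mu>)"
   if n: "n : {-1, 1}" and l: "leadsto (a (-1)) (a 1) (\<phi> (g n) \<circ> \<gamma>) (piece J a nm np n) \<gamma> P \<mu>" for n P \<mu>
  proof -
   have n': "n : idx nm np" using n F(8,9) by auto
   have k: "plink (a (-1)) (a 1) (g n) (piece J a nm np n) P \<mu>"
    by (rule leadsto_plink(1)[OF s F(10) piece_sub(1)[OF sD(4) F(3,4,11) n'] F(7)[OF n'] l])
   have "interval P" using k diffeoD(1) unfolding plink_def by blast
   moreover have "if ng (a (-1)) (a 1) then santi P \<mu> else smono P \<mu>"
   proof (cases "ng (a (-1)) (a 1)")
    case True
    have "odd n" using n by auto
    then show ?thesis using dcp_orient[OF d n' dcp_ng(2,3)[OF d True n'] k] True by simp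
   next
    case False
    then obtain h where h: "ps h (a (-1)) (a 1)" using ps_not_ng[OF F(2)] by blast
    show ?thesis using dcp_orient[OF d n' dcp_ps(2,3)[OF d h n'] k] False by simp
   qed
   ultimately show ?thesis by blast
  qed
  then show ?thesis using d F(1,2) F(6)[OF F(8)] F(6)[OF F(9)] iJ by blast
 qed
 have clash: False if c: "smono P \<mu>" "santi P \<mu>" "interval P" for P and \<mu> :: "real => real"
 proof -
  obtain x where x: "x : interior P" using c(3) unfolding interval_def by blast
  obtain e where e: "e > 0" "ball x e \<subseteq> P" using x by (meson interior_subset open_contains_ball open_interior subset_trans)
  have y: "x : P" "x + e/2 : P" using e by (auto simp: subset_iff dist_real_def)
  have "x < x + e/2" using e(1) by simp
  then show False using monotone_onD[OF c(1) y] monotone_onD[OF c(2) y] by simp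
 qed
 show ?thesis
 proof
  assume ?L
  then obtain nm np a g P \<mu> where o: "open_A_decomposition G \<phi> M J \<gamma> A nm np a g"
   and l: "leadsto (a (-1)) (a 1) (\<phi> (g 1) \<circ> \<gamma>) (piece J a nm np 1) \<gamma> P \<mu>" "if \<sigma> then smono P \<mu> else santi P \<mu>"
   by blast
  have "interval P & (if ng (a (-1)) (a 1) then santi P \<mu> else smono P \<mu>)" using orient[OF o] l(1) by blast
  then have "\<sigma> = (~ ng (a (-1)) (a 1))" using l(2) clash by (cases \<sigma>; cases "ng (a (-1)) (a 1)") auto
  then show ?R using orient[OF o] by blast
 next
  assume ?R
  then obtain a b where ab: "A = {a..b}" "mx a b" "a : J" "b : J" "\<sigma> = (~ ng a b)" by blast
  obtain nm np aa g where o: "open_A_decomposition G \<phi> M J \<gamma> A nm np aa g"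
   using A_decomposition_exists[OF s ab(2)] ab(1,3,4) J iJ by blast
  note O = orient[OF o]
  have "{a..b} = {aa (-1)..aa 1}" "a < b" using O ab(1) mxD(1)[OF ab(2)] by auto
  then have e: "aa (-1) = a" "aa 1 = b" by (simp_all add: Icc_eq_Icc)
  have "EX P \<mu>. leadsto (aa (-1)) (aa 1) (\<phi> (g n) \<circ> \<gamma>) (piece J aa nm np n) \<gamma> P \<mu> &
    (if \<sigma> then smono P \<mu> else santi P \<mu>)" if n: "n : {-1, 1}" for n
  proof -
   have "n : idx nm np" using n dcpD(11,12) O by blast
   then obtain P \<mu> where l: "leadsto (aa (-1)) (aa 1) (\<phi> (g n) \<circ> \<gamma>) (piece J aa nm np n) \<gamma> P \<mu>"
    using o unfolding open_A_decomposition_def by blast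
   then have "if ng a b then santi P \<mu> else smono P \<mu>" using O n unfolding e by blast
   then show ?thesis using l ab(5) by (intro exI[of _ P] exI[of _ \<mu>]) (cases \<sigma>; simp)
  qed
  then show ?L using o by blast
 qed
qed

lemma signed_interval_iff:
 assumes s: "sub J \<gamma>" and J: "open J"
 shows "positive_interval G \<phi> M J \<gamma> A \<longleftrightarrow> (EX a b. A = {a..b} & mx a b & a : J & b : J & ~ ng a b)"
  and "negative_interval G \<phi> M J \<gamma> A \<longleftrightarrow> (EX a b. A = {a..b} & mx a b & a : J & b : J & ng a b)"
 using signed_interval[OF s J, where \<sigma> = True] signed_interval[OF s J, where \<sigma> = False]
 unfolding positive_interval_def negative_interval_def leadsto_inc_def leadsto_dec_def by simp_all

section \<open>Maximality of the pieces and sliding intervals\<close>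

lemma dv_class:
 assumes d: "dv w K R" and g: "g : carrier G" "inv w \<otimes> g : S" shows "dv g K R"
proof -
 have "\<phi> g (\<delta> x) = \<delta> (R x)" if "x : K" for x
  using S_same_act[OF dvD(1)[OF d] g dvD(7)[OF d that]] dvD(9)[OF d that] by simp
 then show ?thesis using d g(1) unfolding dv_def by blast
qed

lemma class_transfer:
 assumes g: "g : carrier G" "inv w \<otimes> g : S"
 shows "inc w s t ==> inc g s t" "dec w s t ==> dec g s t" "lnk w s t ==> lnk g s t"
 unfolding inc_def dec_def lnk_def using dv_class[OF _ g] by blast+

lemma class_mem: "[|h : carrier G; x : h <# S|] ==> x : carrier G & inv h \<otimes> x : S"
 unfolding l_coset_iff using S_carrier by (auto simp: grp.m_assoc[symmetric])

lemma dcp_sub: assumes d: "dcp D nm np a g" shows "{a (-1)..a 1} \<subseteq> D"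
 using ivl_sub[OF dcpD(10)[OF d]] dcpD(6)[OF d dcpD(11)[OF d]] dcpD(6)[OF d dcpD(12)[OF d]] interior_subset by blast

lemma piece_link_plink:
 assumes s: "sub D \<gamma>" and d: "dcp D nm np a g" and n: "n : idx nm np" and h: "h : carrier G"
  and k: "piece_link D \<gamma> nm np a (\<phi> h \<circ> \<gamma>) n P \<mu>"
 shows "plink (a (-1)) (a 1) h (piece D a nm np n) P \<mu>"
 using k leadsto_plink(1)[OF s dcp_sub[OF d] dcp_piece(4)[OF d n] h] harpoon_plink[OF s dcp_sub[OF d] dcp_piece(4)[OF d n] h]
 unfolding piece_link_def by (auto split: if_splits)

lemma piece_link_cong:
 assumes "!!t. t : {a (-1)..a 1} ==> \<alpha> t = \<beta> t"
 shows "piece_link D \<gamma> nm np a \<alpha> n P \<mu> \<longleftrightarrow> piece_link D \<gamma> nm np a \<beta> n P \<mu>"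
proof -
 have "P \<subseteq> {a (-1)..a 1} ==> (ALL t:P. \<alpha> t = \<gamma> (\<mu> t)) \<longleftrightarrow> (ALL t:P. \<beta> t = \<gamma> (\<mu> t))"
  by (rule ball_cong[OF refl]) (metis assms subsetD)
 then show ?thesis unfolding piece_link_def leadsto_def harpoon_def by (auto split: if_splits)
qed

lemma inner_mx:
 assumes d: "dcp D nm np a g" and n: "n : idx nm np" and p: "piece D a nm np n = {l..r}" "l < r" and e: "Fin n ~= nm" "Fin n ~= np"
 shows "mx l r" "lk (a (-1)) (a 1) (g n) l r"
 using dcp_inner[OF d n e] p unfolding lk_def by (auto simp: Icc_eq_Icc)

lemma piece_shape:
 assumes d: "dcp D nm np a g" and n: "nm <= Fin n" "Fin n <= np"
 shows "(EX i:idx nm np. EX j:idx nm np. a i < a j & piece D a nm np n = {a i..a j} & mx (a i) (a j)) |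
  (EX i:idx nm np. piece D a nm np n = D \<inter> {a i..}) | (EX i:idx nm np. piece D a nm np n = D \<inter> {..a i})"
proof (cases "n = 0")
 case True
 note D = dcpD[OF d]
 have "piece D a nm np n = {a (-1)..a 1}" unfolding piece_def using True by simp
 then show ?thesis using mxD(1)[OF D(5)] D(5) D(11,12) by blast
next
 case False
 then have ni: "n : idx nm np" using n unfolding idx_def by auto
 from piece_cases[OF dcpD(3,4)[OF d] ni, of D a] show ?thesis
 proof (elim disjE conjE)
  assume h: "1 <= n" "Fin n ~= nm" and i: "if Fin n = np then piece D a nm np n = D \<inter> {a n..}
   else n + 1 : idx nm np & piece D a nm np n = {a n..a (n + 1)}"
  show ?thesis
  proof (cases "Fin n = np")
   case True then show ?thesis using i ni by auto
  next
   case False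
   then have p: "piece D a nm np n = {a n..a (n + 1)}" using i by simp
   note st = dcp_piece(5)[OF d ni h(1) False]
   show ?thesis using inner_mx(1)[OF d ni p conjunct2[OF st] h(2) False] p st ni by blast
  qed
 next
  assume h: "n <= -1" "Fin n ~= np" and i: "if Fin n = nm then piece D a nm np n = D \<inter> {..a n}
   else n - 1 : idx nm np & piece D a nm np n = {a (n - 1)..a n}"
  show ?thesis
  proof (cases "Fin n = nm")
   case True then show ?thesis using i ni by auto
  next
   case False
   then have p: "piece D a nm np n = {a (n - 1)..a n}" using i by simp
   note st = dcp_piece(6)[OF d ni h(1) False]
   show ?thesis using inner_mx(1)[OF d ni p conjunct2[OF st] False h(2)] p st ni by blast
  qed
 qed
qed

lemma piece_free:
 assumes d: "dcp D nm np a g" and n: "nm <= Fin n" "Fin n <= np"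
 shows "fr (interior (piece D a nm np n))" "interval (piece D a nm np n)" "piece D a nm np n \<subseteq> D"
proof -
 note D = dcpD[OF d] and m = mxD[OF dcpD(5)[OF d]]
 have "fr (interior (piece D a nm np n)) & interval (piece D a nm np n) & piece D a nm np n \<subseteq> D"
 proof (cases "n = 0")
  case True
  then have p: "piece D a nm np n = {a (-1)..a 1}" unfolding piece_def by simp
  then show ?thesis unfolding p interval_def using m(1,4) dcp_sub[OF d] by simp
 next
  case False
  then have ni: "n : idx nm np" using n unfolding idx_def by auto
  obtain P \<mu> where k: "plink (a (-1)) (a 1) (g n) (piece D a nm np n) P \<mu>" using D(9)[OF ni] by blast
  then have k': "P \<subseteq> {a (-1)..a 1}" "analytic_diffeo P (piece D a nm np n) \<mu>" "dv (g n) (interior P) \<mu>" unfolding plink_def by auto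
  have "interior P \<subseteq> {a (-1)<..<a 1}" using interior_mono[OF k'(1)] by simp
  then have "fr (interior P)" using fr_mono[OF m(4)] by blast
  from fr_img[OF k'(3) order_refl this] show ?thesis using diffeoD(2,5)[OF k'(2)] dcp_piece(4)[OF d ni] by simp
 qed
 then show "fr (interior (piece D a nm np n))" "interval (piece D a nm np n)" "piece D a nm np n \<subseteq> D" by blast+
qed

text \<open>Every cut point is an end of the central interval or of an inner piece, which is a
  displaced copy of it and so maximal; one negative maximal interval forces all maximal intervals to
  be negative.\<close>

lemma dcp_wall:
 assumes d: "dcp D nm np a g" and ng: "ng (a (-1)) (a 1)" and n: "n : idx nm np"
 shows "EX w. w ~: S & dec w (a n) (a n)"
proof -
 note D = dcpD[OF d]
 have ng': "ng l r" if "mx l r" for l r using mx_cases[OF that] ps_ng[OF that _ D(5) ng] by blast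
 from idx_cases[OF n] show ?thesis
 proof
  assume n1: "n >= 1"
  show ?thesis
  proof (cases "n = 1")
   case True then show ?thesis using ng unfolding ng_def by blast
  next
   case False
   then have n2: "1 <= n - 1" "n - 1 + 1 : idx nm np" using n n1 by auto
   note st = idx_step(1)[OF D(3) n2]
   have p: "piece D a nm np (n - 1) = {a (n - 1)..a n}" unfolding piece_pos[OF n2(1)] using st by simp
   have lt: "a (n - 1) < a n" using dcp_piece(5)[OF d _ n2(1)] st by simp
   have nn: "Fin (n - 1) ~= nm" using D(3) n2(1) by auto
   show ?thesis using ng'[OF inner_mx(1)[OF d _ p lt nn]] st unfolding ng_def by blast
  qed
 next
  assume n1: "n <= -1"
  show ?thesis
  proof (cases "n = -1")
   case True then show ?thesis using ng unfolding ng_def by blast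
  next
   case False
   then have n2: "n + 1 <= -1" "n + 1 - 1 : idx nm np" using n n1 by auto
   note st = idx_step(2)[OF D(4) n2]
   have p: "piece D a nm np (n + 1) = {a n..a (n + 1)}" unfolding piece_neg[OF n2(1)] using st by simp
   have lt: "a n < a (n + 1)" using dcp_piece(6)[OF d _ n2(1)] st by simp
   have nn: "Fin (n + 1) ~= np" using D(4) n2(1) by auto
   show ?thesis using ng'[OF inner_mx(1)[OF d _ p lt _ nn]] st unfolding ng_def by blast
  qed
 qed
qed

lemma seq_gap:
 fixes a :: "int => real"
 assumes "a 1 <= x" "x < a (1 + int k)" shows "EX n. 1 <= n & n < 1 + int k & a n <= x & x < a (n + 1)"
 using assms(2)
proof (induction k)
 case 0
 then show ?case using assms(1) by simp
next
 case (Suc k)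
 show ?case
 proof (cases "x < a (1 + int k)")
  case True then show ?thesis using Suc.IH by force
 next
  case False
  then show ?thesis using Suc.prems by (intro exI[of _ "1 + int k"]) (simp add: add.commute)
 qed
qed

text \<open>A monotone sequence of cut points in a compact part of \<open>I\<close> converges there,
  and the pieces between consecutive ones would collapse. Minimum and maximum let one statement
  serve increasing and decreasing sequences.\<close>

lemma no_infinite_chain:
 assumes ab: "mx u v" and lk: "!!k. lk u v (g k) (min (p k) (p (Suc k))) (max (p k) (p (Suc k)))"
  and mono: "monoseq p" and bd: "!!k. p k : {y..x}" and I: "x : I" "y : I"
 shows False
proof -
 have "norm (p k) <= \<bar>x\<bar> + \<bar>y\<bar>" for k
 proof -
  have "y <= p k" "p k <= x" using bd[of k] by simp_all
  then show ?thesis unfolding real_norm_def by linarith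
 qed
 then have "Bseq p" by (rule BseqI')
 then obtain z where z: "p \<longlonglongrightarrow> z" using Bseq_monoseq_convergent[OF _ mono] unfolding convergent_def by blast
 have "z : {y..x}" by (rule closed_sequentially[OF closed_atLeastAtMost _ z]) (use bd in blast)
 then have zI: "z : I" using ivl_sub[OF interval_I I(2,1)] by blast
 have z': "(%k. p (Suc k)) \<longlonglongrightarrow> z" using z by (rule LIMSEQ_Suc)
 have "(%k. min (p k) (p (Suc k))) \<longlonglongrightarrow> min z z" "(%k. max (p k) (p (Suc k))) \<longlonglongrightarrow> max z z"
  by (rule tendsto_min[OF z z'] tendsto_max[OF z z'])+
 then show False using no_accumulation[OF mxD(1,6)[OF ab] lk zI] by simp
qed

text \<open>Infinitely many cut points between the central interval and \<open>x\<close> would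
  accumulate in \<open>I\<close>. So \<open>x\<close> lies between neighbouring cut points, in an
  end piece or in the central interval.\<close>

lemma dcp_cover:
 assumes d: "dcp D nm np a g" and x: "x : D"
 shows "EX n. nm <= Fin n & Fin n <= np & x : piece D a nm np n"
proof -
 note D = dcpD[OF d]
 have n0: "nm <= Fin 0" "Fin 0 <= np" by (rule order.strict_implies_order[OF D(3)] order.strict_implies_order[OF D(4)])+
 have I: "x : I" "a 1 : I" "a (-1) : I" using x D(2) mxD(2,3)[OF D(5)] by auto
 have posI: "n : idx nm np & nm <= Fin n" if "1 <= n" "Fin n <= np" for n
  using that idx_pos[OF _ D(3)] unfolding idx_def by blast
 have negI: "n : idx nm np & Fin n <= np" if "n <= -1" "nm <= Fin n" for n
  using that idx_neg[OF _ D(4)] unfolding idx_def by blast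
 have R: "EX n. nm <= Fin n & Fin n <= np & x : piece D a nm np n" if x1: "a 1 < x"
 proof (cases "EX k. Fin (1 + int k) <= np & x < a (1 + int k)")
  case True
  then obtain k where k: "Fin (1 + int k) <= np" "x < a (1 + int k)" by blast
  obtain n where n: "1 <= n" "n < 1 + int k" "a n <= x" "x < a (n + 1)" using seq_gap[of a x k] x1 k(2) by auto
  have "Fin n < np" using k(1) n(2) by (cases np) auto
  then have le: "Fin n <= np" "Fin n ~= np" by auto
  have "x : piece D a nm np n" unfolding piece_pos[OF n(1)] using le n by auto
  then show ?thesis using posI[OF n(1) le(1)] le(1) by blast
 next
  case False
  then have bd: "a (1 + int k) <= x" if "Fin (1 + int k) <= np" for k using that by force
  show ?thesis
  proof (cases np)
   case (Fin N)
   have N1: "1 <= N" using D(4) Fin by simp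
   have "x : piece D a nm np N" unfolding piece_pos[OF N1] using Fin x bd[of "nat (N - 1)"] N1 by simp
   then show ?thesis using posI[OF N1] Fin by auto
  next
   case Pinf
   have i: "1 + int k : idx nm np" for k using posI[of "1 + int k"] Pinf by simp
   have st: "a (1 + int k) < a (1 + int (Suc k))" for k using strict_mono_onD[OF D(8) i[of k] i[of "Suc k"]] by simp
   have "lk (a (-1)) (a 1) (g (1 + int k)) (min (a (1 + int k)) (a (1 + int (Suc k)))) (max (a (1 + int k)) (a (1 + int (Suc k))))" for k
   proof -
    have nn: "Fin (1 + int k) ~= nm" "Fin (1 + int k) ~= np" using D(3) Pinf by auto
    have p: "piece D a nm np (1 + int k) = {a (1 + int k)..a (1 + int (Suc k))}"
     using piece_pos[of "1 + int k" D a nm np] nn(2) by (simp add: ac_simps)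
    show ?thesis using inner_mx(2)[OF d i p st nn] st[of k] by (simp add: min_def max_def)
   qed
   moreover have "incseq (%k. a (1 + int k))" by (rule incseq_SucI) (use st in \<open>simp add: less_imp_le\<close>)
   moreover have "a (1 + int k) : {a 1..x}" for k
   proof -
    have "a 1 <= a (1 + int k)" using strict_mono_onD[OF D(8) D(11) i[of k]] by (cases "k = 0") auto
    then show ?thesis using bd[of k] Pinf by simp
   qed
   ultimately have False
    using no_infinite_chain[OF D(5), of "%k. g (1 + int k)" "%k. a (1 + int k)" "a 1" x] I incseq_imp_monoseq by blast
   then show ?thesis ..
  next
   case Minf then show ?thesis using D(4) by simp
  qed
 qed
 have L: "EX n. nm <= Fin n & Fin n <= np & x : piece D a nm np n" if x1: "x < a (-1)"
 proof (cases "EX k. nm <= Fin (- (1 + int k)) & a (- (1 + int k)) < x")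
  case True
  then obtain k where k: "nm <= Fin (- (1 + int k))" "a (- (1 + int k)) < x" by blast
  \<comment> \<open>The left side is reduced to the right one by changing the signs of the indices
    and of the values.\<close>
  obtain n where n: "1 <= n" "n < 1 + int k" "x <= a (- n)" "a (- (n + 1)) < x"
   using seq_gap[of "%n. - a (- n)" "- x" k] x1 k(2) by auto
  have n': "- n <= -1" and e: "- n - 1 = - (n + 1)" using n(1) by simp_all
  have "nm < Fin (- n)" using k(1) n(2) by (cases nm) auto
  then have le: "nm <= Fin (- n)" "Fin (- n) ~= nm" by auto
  have "x : piece D a nm np (- n)" unfolding piece_neg[OF n'] e using le n by auto
  then show ?thesis using negI[OF n' le(1)] le(1) by blast
 next
  case False
  then have bd: "x <= a (- (1 + int k))" if "nm <= Fin (- (1 + int k))" for k using that by force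
  show ?thesis
  proof (cases nm)
   case (Fin N)
   have N1: "N <= -1" using D(3) Fin by simp
   have "x : piece D a nm np N" unfolding piece_neg[OF N1] using Fin x bd[of "nat (- N - 1)"] N1 by simp
   then show ?thesis using negI[OF N1] Fin by auto
  next
   case Minf
   have i: "- (1 + int k) : idx nm np" for k using negI[of "- (1 + int k)"] Minf by simp
   have st: "a (- (1 + int (Suc k))) < a (- (1 + int k))" for k using strict_mono_onD[OF D(8) i[of "Suc k"] i[of k]] by simp
   have "lk (a (-1)) (a 1) (g (- (1 + int k))) (min (a (- (1 + int k))) (a (- (1 + int (Suc k))))) (max (a (- (1 + int k))) (a (- (1 + int (Suc k)))))" for k
   proof -
    have nn: "Fin (- (1 + int k)) ~= nm" "Fin (- (1 + int k)) ~= np" using D(4) Minf by auto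
    have p: "piece D a nm np (- (1 + int k)) = {a (- (1 + int (Suc k)))..a (- (1 + int k))}"
     using piece_neg[of "- (1 + int k)" D a nm np] nn(1) by (simp add: algebra_simps)
    show ?thesis using inner_mx(2)[OF d i p st nn] st[of k] by (simp add: min_def max_def)
   qed
   moreover have "decseq (%k. a (- (1 + int k)))" by (rule decseq_SucI) (use st in \<open>simp add: less_imp_le\<close>)
   moreover have "a (- (1 + int k)) : {x..a (-1)}" for k
   proof -
    have "a (- (1 + int k)) <= a (-1)" using strict_mono_onD[OF D(8) i[of k] D(12)] by (cases "k = 0") auto
    then show ?thesis using bd[of k] Minf by simp
   qed
   ultimately have False
    using no_infinite_chain[OF D(5), of "%k. g (- (1 + int k))" "%k. a (- (1 + int k))" x "a (-1)"] I decseq_imp_monoseq by blast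
   then show ?thesis ..
  next
   case Pinf then show ?thesis using D(3) by simp
  qed
 qed
 consider "a 1 < x" | "x < a (-1)" | "x : {a (-1)..a 1}" by fastforce
 then show ?thesis
 proof cases
  case 3
  then show ?thesis using n0 unfolding piece_def by (intro exI[of _ 0]) simp
 qed (use R L in blast)+
qed

lemma piece_sep:
 assumes d: "dcp D nm np a g" and n: "nm <= Fin n" "Fin n <= np" and x: "x : D" "x ~: piece D a nm np n"
  and y: "y : interior (piece D a nm np n)"
 shows "EX k:idx nm np. (x < a k & a k < y) | (y < a k & a k < x)"
 using piece_shape[OF d n]
proof (elim disjE bexE conjE)
 fix i j assume i: "i : idx nm np" "j : idx nm np" and p: "piece D a nm np n = {a i..a j}"
 have "a i < y" "y < a j" "x < a i | a j < x" using x(2) y unfolding p interior_atLeastAtMost_real by auto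
 then show ?thesis using i by blast
next
 fix i assume i: "i : idx nm np" and p: "piece D a nm np n = D \<inter> {a i..}"
 have "a i < y" "x < a i" using x y unfolding p interior_Int by auto
 then show ?thesis using i by blast
next
 fix i assume i: "i : idx nm np" and p: "piece D a nm np n = D \<inter> {..a i}"
 have "y < a i" "a i < x" using x y unfolding p interior_Int by auto
 then show ?thesis using i by blast
qed

lemma piece_interior:
 assumes d: "dcp D nm np a g" and n: "nm <= Fin n" "Fin n <= np" and z: "z : piece D a nm np n" "z : interior D"
  and ne: "!!k. k : idx nm np ==> z ~= a k"
 shows "z : interior (piece D a nm np n)"
 using piece_shape[OF d n]
proof (elim disjE bexE conjE)
 fix i j assume i: "i : idx nm np" "j : idx nm np" and p: "piece D a nm np n = {a i..a j}"
 then show ?thesis using z ne[OF i(1)] ne[OF i(2)] unfolding p interior_atLeastAtMost_real by auto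
next
 fix i assume i: "i : idx nm np" and p: "piece D a nm np n = D \<inter> {a i..}"
 then show ?thesis using z ne[OF i] unfolding p interior_Int by auto
next
 fix i assume i: "i : idx nm np" and p: "piece D a nm np n = D \<inter> {..a i}"
 then show ?thesis using z ne[OF i] unfolding p interior_Int by auto
qed

text \<open>Every cut point carries a reflection, so it is interior to no free interval; a free
  interval meeting the interior of a piece is therefore contained in this piece.\<close>

lemma maximal_pieces:
 assumes s: "sub D \<gamma>" and d: "dcp D nm np a g" and ng: "ng (a (-1)) (a 1)"
 shows "maximal_interval G \<phi> M D \<gamma> B \<longleftrightarrow> (EX n. nm <= Fin n & Fin n <= np & B = piece D a nm np n)"
proof -
 note D = dcpD[OF d]
 have no: "a k ~: interior B" if B: "interval B" "fr (interior B)" and k: "k : idx nm np" for B k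
  using dcp_wall[OF d ng k] frD[OF B(2)] dec_lnk by blast
 have fp: "free_interval G \<phi> M D \<gamma> (piece D a nm np n)" if "nm <= Fin n" "Fin n <= np" for n
  unfolding free_interval_iff[OF s] using piece_free[OF d that] by blast
 have fit: "B \<subseteq> piece D a nm np n"
  if B: "interval B" "B \<subseteq> D" "fr (interior B)" and n: "nm <= Fin n" "Fin n <= np" and y: "y : B" "y : interior (piece D a nm np n)" for B n y
 proof
  fix x assume x: "x : B"
  have i: "is_interval B" using B(1) unfolding interval_iff by blast
  show "x : piece D a nm np n"
  proof (rule ccontr)
   assume nx: "x ~: piece D a nm np n"
   have xD: "x : D" using x B(2) by blast
   obtain k where k: "k : idx nm np" "(x < a k & a k < y) | (y < a k & a k < x)" using piece_sep[OF d n xD nx y(2)] by blast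
   then have "a k : interior B" using interior_between[OF i x y(1)] interior_between[OF i y(1) x] by auto
   then show False using no[OF B(1,3) k(1)] by blast
  qed
 qed
 show ?thesis
 proof
  assume m: "maximal_interval G \<phi> M D \<gamma> B"
  then have B: "interval B" "B \<subseteq> D" "fr (interior B)" and max: "!!A'. [|free_interval G \<phi> M D \<gamma> A'; B \<subseteq> A'|] ==> A' = B"
   unfolding maximal_interval_def free_interval_iff[OF s] by blast+
  obtain z where z: "z : interior B" using B(1) unfolding interval_iff by blast
  have zB: "z : B" using z interior_subset by blast
  obtain n where n: "nm <= Fin n" "Fin n <= np" "z : piece D a nm np n" using dcp_cover[OF d] zB B(2) by blast
  have zD: "z : interior D" using z interior_mono[OF B(2)] by blast
  have "z ~= a k" if "k : idx nm np" for k using no[OF B(1,3) that] z by blast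
  then have "z : interior (piece D a nm np n)" by (rule piece_interior[OF d n zD])
  then have "B \<subseteq> piece D a nm np n" by (rule fit[OF B n(1,2) zB])
  from max[OF fp[OF n(1,2)] this] show "EX n. nm <= Fin n & Fin n <= np & B = piece D a nm np n" using n(1,2) by blast
 next
  assume "EX n. nm <= Fin n & Fin n <= np & B = piece D a nm np n"
  then obtain n where n: "nm <= Fin n" "Fin n <= np" and B: "B = piece D a nm np n" by blast
  obtain y where y: "y : interior B" using piece_free(2)[OF d n] unfolding B interval_iff by blast
  have "~ B \<subset> A'" if A': "free_interval G \<phi> M D \<gamma> A'" for A'
  proof
   assume sub: "B \<subset> A'"
   have A: "interval A'" "A' \<subseteq> D" "fr (interior A')" using A' unfolding free_interval_iff[OF s] by blast+
   have "y : A'" using y sub interior_subset by blast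
   from fit[OF A n this y[unfolded B]] show False using sub B by blast
  qed
  then show "maximal_interval G \<phi> M D \<gamma> B" unfolding maximal_interval_def using fp[OF n] B by blast
 qed
qed

section \<open>Classes in the positive case\<close>

lemma dcp_power_step:
 assumes d: "dcp D nm np a g" and h: "ps h (a (-1)) (a 1)" and m: "m : idx nm np" and n: "n : idx nm np"
 shows "inv (g n \<otimes> inv (g m)) \<otimes> h [^] (n - m) : S"
proof -
 note D = dcpD[OF d]
 have hc: "h : carrier G" using h lnkD(1) inc_lnk unfolding ps_def by blast
 have c: "g m : carrier G" "g n : carrier G" "h [^] m : carrier G" "h [^] n : carrier G" using D(7) m n hc by simp_all
 note q = dcp_ps(1)[OF d h m] dcp_ps(1)[OF d h n]
 have "EX s t. lnk (g m) s t"
  using idx_cases[OF m] dcp_nearR[OF d m] dcp_nearL[OF d m] near_lnk[OF mxD(1)[OF D(5)]] by blast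
 then obtain s t where l: "lnk (h [^] m) s t" using class_transfer(3)[OF c(3) q(1)] by blast
 \<comment> \<open>The two deviations from powers of \<open>h\<close> end up conjugated by
   \<open>h [^] m\<close>, which displaces the curve and so normalises \<open>S\<close>.\<close>
 have "inv (g n \<otimes> inv (g m)) \<otimes> h [^] (n - m) = h [^] m \<otimes> (inv (inv (g m) \<otimes> h [^] m) \<otimes> (inv (g n) \<otimes> h [^] n)) \<otimes> inv (h [^] m)"
  unfolding grp.int_pow_diff[OF hc] using c by (simp add: grp.m_assoc grp.inv_mult_group) (simp add: grp.m_assoc[symmetric])
 then show ?thesis using norm_S'[OF l S_mult[OF S_inv[OF q(1)] q(2)]] by simp
qed

lemma dcp_step_elem:
 assumes d: "dcp D nm np a g" and h: "ps h (a (-1)) (a 1)" and n: "n : idx nm np"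
 shows "inv (step_elem G g n) \<otimes> h [^] sgn n : S" "step_elem G g n : carrier G"
proof -
 note D = dcpD[OF d]
 have "inv (step_elem G g n) \<otimes> h [^] sgn n : S & step_elem G g n : carrier G"
 proof (cases "\<bar>n\<bar> = 1")
  case True
  then have "sgn n = n" "step_elem G g n = g n" unfolding step_elem_def by (auto simp: sgn_if abs_if split: if_splits)
  then show ?thesis using dcp_ps(1)[OF d h n] D(7)[OF n] by simp
 next
  case False
  from idx_cases[OF n] show ?thesis
  proof
   assume n1: "n >= 1"
   then have n2: "1 <= n - 1" "n - 1 + 1 : idx nm np" using n False by auto
   then have m: "n - 1 : idx nm np" using idx_step(1)[OF D(3)] by blast
   have "step_elem G g n = g n \<otimes> inv (g (n - 1))" "sgn n = n - (n - 1)" unfolding step_elem_def using False n1 by simp_all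
   then show ?thesis using dcp_power_step[OF d h m n] D(7)[OF n] D(7)[OF m] by simp
  next
   assume n1: "n <= -1"
   then have n2: "n + 1 <= -1" "n + 1 - 1 : idx nm np" using n False by auto
   then have m: "n + 1 : idx nm np" using idx_step(2)[OF D(4)] by blast
   have "step_elem G g n = g n \<otimes> inv (g (n + 1))" "sgn n = n - (n + 1)" unfolding step_elem_def using False n1 by simp_all
   then show ?thesis using dcp_power_step[OF d h m n] D(7)[OF n] D(7)[OF m] by simp
  qed
 qed
 then show "inv (step_elem G g n) \<otimes> h [^] sgn n : S" "step_elem G g n : carrier G" by blast+
qed

lemma ps_class:
 assumes h: "ps h a b" and x: "x : h <# S" shows "ps x a b"
proof -
 have hc: "h : carrier G" "h ~: S" "inc h a b" using h lnkD(1) inc_lnk unfolding ps_def by blast+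
 note x' = class_mem[OF hc(1) x]
 have "x ~: S" using S_cancel_right[OF hc(1)] x' hc(2) by blast
 then show ?thesis unfolding ps_def using class_transfer(1)[of x h] x' hc(3) by blast
qed

lemma dcp_ps_class:
 assumes m: "mx a b" and h: "ps h a b" and d: "dcp D nm np aa g" and x: "x : h <# S"
 shows "ps x (aa (-1)) (aa 1)"
 using ps_all[OF m ps_class[OF h x] dcpD(5)[OF d]] .

text \<open>For \<open>n = 1\<close> the step element is \<open>g 1\<close>, whose class is that of
  \<open>h\<close>, so a single decomposition pins the class down. Conversely every representative
  of this class translates every maximal interval.\<close>

lemma step_class_iff:
 assumes s: "sub D \<gamma>" and m: "mx a b" and ab: "a : interior D" "b : interior D" and h: "ps h a b"
 shows "step_class G \<phi> M D \<gamma> c \<longleftrightarrow> c = h <# S"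
proof -
 have hc: "h : carrier G" "h ~: S" using h lnkD(1) inc_lnk unfolding ps_def by blast+
 have cls: "step_elem G g n <# S = x [^] sgn n <# S"
  if x: "x : h <# S" and A: "A_decomposition G \<phi> M D \<gamma> A nm np aa g" and n: "n : idx nm np" for x A nm np aa g n
 proof -
  note d = A_decomposition_dcp[OF s A]
  note p = dcp_ps_class[OF m h d x]
  have "x [^] sgn n : carrier G" using class_mem[OF hc(1) x] by simp
  then show ?thesis using S_class_iff[OF dcp_step_elem(2)[OF d p n]] dcp_step_elem(1)[OF d p n] by blast
 qed
 have h_in: "x : x <# S" if "x : carrier G" for x unfolding l_coset_iff using S_one that by (intro bexI[of _ \<one>]) auto
 show ?thesis
 proof
  assume c: "step_class G \<phi> M D \<gamma> c"
  then obtain x where x: "x : carrier G" "c = x <# S" unfolding step_class_def class_eq[OF s] by blast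
  obtain nm np aa g where A: "A_decomposition G \<phi> M D \<gamma> {a..b} nm np aa g" using A_decomposition_exists[OF s m ab] by blast
  have i: "1 : idx nm np" by (rule dcpD(11)[OF A_decomposition_dcp[OF s A]])
  have "step_elem G g 1 <# S = x [^] sgn (1::int) <# S"
   using c x(2) h_in[OF x(1)] A i unfolding step_class_def class_eq[OF s] by blast
  moreover have "step_elem G g 1 <# S = h [^] sgn (1::int) <# S" by (rule cls[OF h_in[OF hc(1)] A i])
  ultimately show "c = h <# S" using x hc(1) by simp
 next
  assume c: "c = h <# S"
  have "h <# S ~= \<one> <# S" using S_class_iff[OF grp.one_closed hc(1)] hc by auto
  then show "step_class G \<phi> M D \<gamma> c" unfolding step_class_def class_eq[OF s] c using hc(1) cls by blast
 qed
qed

lemma power_links: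
 assumes s: "sub D \<gamma>" and A: "A_decomposition G \<phi> M D \<gamma> A nm np a g" and h: "ps h (a (-1)) (a 1)" and n: "n : idx nm np"
 shows "g n <# S = h [^] n <# S" "EX P \<mu>. piece_link D \<gamma> nm np a (\<phi> (h [^] n) \<circ> \<gamma>) n P \<mu>"
  "piece_link D \<gamma> nm np a (\<phi> (h [^] n) \<circ> \<gamma>) n P \<mu> ==> smono P \<mu>"
proof -
 note d = A_decomposition_dcp[OF s A]
 note sD = subD[OF s]
 have "h : carrier G" using h lnkD(1) inc_lnk unfolding ps_def by blast
 then have c: "g n : carrier G" "h [^] n : carrier G" using dcpD(7)[OF d n] by simp_all
 note q = dcp_ps(1)[OF d h n]
 show "g n <# S = h [^] n <# S" using S_class_iff[OF c] q by blast
 have "(\<phi> (g n) \<circ> \<gamma>) t = (\<phi> (h [^] n) \<circ> \<gamma>) t" if t: "t : {a (-1)..a 1}" for t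
 proof -
  have "t : D" using t dcp_sub[OF d] by blast
  then have "t : I" "\<gamma> t = \<delta> t" using sD(2,3) by auto
  then show ?thesis using S_same_act[OF c q] by simp
 qed
 then have k: "piece_link D \<gamma> nm np a (\<phi> (g n) \<circ> \<gamma>) n P \<mu> \<longleftrightarrow> piece_link D \<gamma> nm np a (\<phi> (h [^] n) \<circ> \<gamma>) n P \<mu>" for P \<mu>
  by (rule piece_link_cong)
 have "EX P \<mu>. piece_link D \<gamma> nm np a (\<phi> (g n) \<circ> \<gamma>) n P \<mu>" using A n unfolding A_decomposition_def by blast
 then show "EX P \<mu>. piece_link D \<gamma> nm np a (\<phi> (h [^] n) \<circ> \<gamma>) n P \<mu>" unfolding k .
 assume "piece_link D \<gamma> nm np a (\<phi> (h [^] n) \<circ> \<gamma>) n P \<mu>"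
 from dcp_orient[OF d n dcp_ps(2,3)[OF d h n] piece_link_plink[OF s d n c(2) this]]
 show "smono P \<mu>" by simp
qed

lemma negative_links:
 assumes s: "sub D \<gamma>" and A: "A_decomposition G \<phi> M D \<gamma> A nm np a g" and ng: "ng (a (-1)) (a 1)" and n: "n : idx nm np"
 shows "piece_link D \<gamma> nm np a (\<phi> (g n) \<circ> \<gamma>) n P \<mu> ==> if even n then smono P \<mu> else santi P \<mu>"
  "g n <# S = alternating_prod G g n <# S"
proof -
 note d = A_decomposition_dcp[OF s A]
 note D = dcpD[OF d]
 assume "piece_link D \<gamma> nm np a (\<phi> (g n) \<circ> \<gamma>) n P \<mu>"
 from dcp_orient[OF d n dcp_ng(2,3)[OF d ng n] piece_link_plink[OF s d n D(7)[OF n] this]]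
 show "if even n then smono P \<mu> else santi P \<mu>" .
next
 note d = A_decomposition_dcp[OF s A]
 note D = dcpD[OF d]
 show "g n <# S = alternating_prod G g n <# S"
  using S_class_iff[OF D(7)[OF n] alternating_prod_step(1)[OF D(7)[OF D(11)] D(7)[OF D(12)]]] dcp_ng(1)[OF d ng n] by blast
qed

text \<open>The square of a reflection displaces increasingly and fixes the centre, so it lies in
  \<open>S\<close>.\<close>

lemma reflection_class:
 assumes g: "g : carrier G" and w: "w ~: S" "dec w t t" "inv w \<otimes> g : S"
 shows "g <# S \<subseteq> stabilizer G \<phi> (\<delta> t) - S" "inv g <# S = g <# S"
proof -
 have wc: "w : carrier G" using lnkD(1) dec_lnk w(2) by blast
 have gS: "g ~: S" using S_cancel_right[OF wc g w(3)] w(1) by blast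
 have dg: "dec g t t" by (rule class_transfer(2)[OF g w(3,2)])
 have t: "t : I" "\<phi> g (\<delta> t) = \<delta> t" using lnkD(2,4) dec_lnk dg by blast+
 show "g <# S \<subseteq> stabilizer G \<phi> (\<delta> t) - S"
 proof
  fix x assume x: "x : g <# S"
  note x' = class_mem[OF g x]
  have "x ~: S" using S_cancel_right[OF g] x' gS by blast
  moreover have "\<phi> x (\<delta> t) = \<delta> t" using S_same_act[OF g _ _ t(1)] x' t(2) by metis
  ultimately show "x : stabilizer G \<phi> (\<delta> t) - S" unfolding stabilizer_def using x' by blast
 qed
 have "g \<otimes> g : S" by (rule inc_fix[OF dec_dec[OF dg dg]])
 then show "inv g <# S = g <# S" using S_class_iff[of "inv g" g] g by simp
qed

section \<open>Sliding intervals in the positive case\<close>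

lemma inner_piece:
 assumes d: "dcp D nm np a g"
 shows "[|nm < Fin n; n <= 0|] ==> EX r. mx (a (n - 1)) r & piece D a nm np n = {a (n - 1)..r} & n - 1 : idx nm np & r : interior D"
  "[|0 <= n; Fin n < np|] ==> EX l. mx l (a (n + 1)) & piece D a nm np n = {l..a (n + 1)} & n + 1 : idx nm np & l : interior D"
proof -
 note D = dcpD[OF d]
 show "EX r. mx (a (n - 1)) r & piece D a nm np n = {a (n - 1)..r} & n - 1 : idx nm np & r : interior D"
  if n: "nm < Fin n" "n <= 0"
 proof (cases "n = 0")
  case True
  then show ?thesis using D(5) D(6)[OF D(11)] D(12) unfolding piece_def by auto
 next
  case False
  then have n1: "n <= -1" using n(2) by simp
  have ni: "n : idx nm np" using idx_neg[OF n1 D(4)] n(1) by auto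
  have nn: "Fin n ~= nm" "Fin n ~= np" using n(1) D(4) n1 by auto
  note st = dcp_piece(6)[OF d ni n1 nn(1)]
  have p: "piece D a nm np n = {a (n - 1)..a n}" unfolding piece_neg[OF n1] using nn by simp
  show ?thesis using inner_mx(1)[OF d ni p conjunct2[OF st] nn] p st D(6)[OF ni] by blast
 qed
 show "EX l. mx l (a (n + 1)) & piece D a nm np n = {l..a (n + 1)} & n + 1 : idx nm np & l : interior D"
  if n: "0 <= n" "Fin n < np"
 proof (cases "n = 0")
  case True
  then show ?thesis using D(5) D(6)[OF D(12)] D(11) unfolding piece_def by auto
 next
  case False
  then have n1: "1 <= n" using n(1) by simp
  have ni: "n : idx nm np" using idx_pos[OF n1 D(3)] n(2) by auto
  have nn: "Fin n ~= nm" "Fin n ~= np" using n(2) D(3) n1 by auto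
  note st = dcp_piece(5)[OF d ni n1 nn(2)]
  have p: "piece D a nm np n = {a n..a (n + 1)}" unfolding piece_pos[OF n1] using nn by simp
  show ?thesis using inner_mx(1)[OF d ni p conjunct2[OF st] nn] p st D(6)[OF ni] by blast
 qed
qed

text \<open>The maximal interval is slid until one end is the prescribed point. The other end must
  pass the cut point, as otherwise the slid interval would lie in the free interior of the
  neighbouring piece, with an end in that interior, against its maximality.\<close>

lemma positive_slide:
 assumes d: "dcp D nm np a g" and p: "ps h (a (-1)) (a 1)"
 shows "[|nm < Fin n; n <= 0; b' : interior (piece D a nm np (n - 1))|] ==>
   EX b:interior (piece D a nm np n). mx b' b & b' : interior D & b : interior D"
  "[|0 <= n; Fin n < np; b : interior (piece D a nm np (n + 1))|] ==>
   EX b':interior (piece D a nm np n). mx b' b & b' : interior D & b : interior D"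
proof -
 note D = dcpD[OF d]
 have open_piece: "open (interior (piece D a nm np k))" "is_interval (interior (piece D a nm np k))" "interior (piece D a nm np k) \<subseteq> I"
   "fr (interior (piece D a nm np k))" "is_interval (piece D a nm np k)" "interior (piece D a nm np k) \<subseteq> interior D"
  if "k : idx nm np" for k
 proof -
  have k: "nm <= Fin k" "Fin k <= np" using that unfolding idx_def by auto
  note f = piece_free[OF d k]
  show i: "is_interval (piece D a nm np k)" using f(2) unfolding interval_iff by blast
  show "open (interior (piece D a nm np k))" "is_interval (interior (piece D a nm np k))" "fr (interior (piece D a nm np k))"
   using f(1) interior_ivl[OF i] by simp_all
  show "interior (piece D a nm np k) \<subseteq> interior D" by (rule interior_mono[OF f(3)])
  then show "interior (piece D a nm np k) \<subseteq> I" using D(2) interior_subset by blast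
 qed
 show "EX b:interior (piece D a nm np n). mx b' b & b' : interior D & b : interior D"
  if n: "nm < Fin n" "n <= 0" and b': "b' : interior (piece D a nm np (n - 1))"
 proof -
  obtain r where r: "mx (a (n - 1)) r" "piece D a nm np n = {a (n - 1)..r}" "n - 1 : idx nm np" "r : interior D"
   using inner_piece(1)[OF d n] by blast
  let ?C = "piece D a nm np (n - 1)"
  note V = open_piece[OF r(3)]
  have n1: "n - 1 <= -1" using n(2) by simp
  have "?C \<subseteq> {..a (n - 1)}" by (rule dcp_piece(3)[OF d r(3) n1])
  from interior_mono[OF this] have lt: "b' < a (n - 1)" using b' by auto
  have b'I: "b' : I" using b' V(3) by blast
  obtain y where y: "mx b' y" "y < r" using ps_left(1)[OF r(1) ps_all[OF D(5) p r(1)] b'I lt, of 1] by auto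
  have b'C: "b' : ?C" using b' interior_subset by blast
  have "a (n - 1) < y"
  proof (rule ccontr)
   assume "~ a (n - 1) < y"
   then have "{b'<..<y} \<subseteq> {b'<..<a (n - 1)}" by auto
   then have "{b'<..<y} \<subseteq> interior ?C" using interior_between[OF V(5) b'C dcp_piece(1)[OF d r(3)]] by blast
   then show False using mxV[OF y(1) V(1-3) _ V(4)] b' by blast
  qed
  moreover have b'D: "b' : interior D" using V(6) b' by blast
  moreover have "y : interior D"
   using ivl_sub[OF interior_ivl[OF D(10)] b'D r(4)] mxD(1)[OF y(1)] y(2) by auto
  ultimately show ?thesis using y unfolding r(2) interior_atLeastAtMost_real by auto
 qed
 show "EX b':interior (piece D a nm np n). mx b' b & b' : interior D & b : interior D"
  if n: "0 <= n" "Fin n < np" and b: "b : interior (piece D a nm np (n + 1))"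
 proof -
  obtain l where l: "mx l (a (n + 1))" "piece D a nm np n = {l..a (n + 1)}" "n + 1 : idx nm np" "l : interior D"
   using inner_piece(2)[OF d n] by blast
  let ?C = "piece D a nm np (n + 1)"
  note V = open_piece[OF l(3)]
  have n1: "n + 1 >= 1" using n(1) by simp
  have "?C \<subseteq> {a (n + 1)..}" by (rule dcp_piece(2)[OF d l(3) n1])
  from interior_mono[OF this] have lt: "a (n + 1) < b" using b by auto
  have bI: "b : I" using b V(3) by blast
  obtain x where x: "mx x b" "l < x" using ps_right(1)[OF l(1) ps_all[OF D(5) p l(1)] bI lt, of 1] by auto
  have bC: "b : ?C" using b interior_subset by blast
  have "x < a (n + 1)"
  proof (rule ccontr)
   assume "~ x < a (n + 1)"
   then have "{x<..<b} \<subseteq> {a (n + 1)<..<b}" by auto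
   then have "{x<..<b} \<subseteq> interior ?C" using interior_between[OF V(5) dcp_piece(1)[OF d l(3)] bC] by blast
   then show False using mxV[OF x(1) V(1-3) _ V(4)] b by blast
  qed
  moreover have bD: "b : interior D" using V(6) b by blast
  moreover have "x : interior D"
   using ivl_sub[OF interior_ivl[OF D(10)] l(4) bD] mxD(1)[OF x(1)] x(2) by auto
  ultimately show ?thesis using x unfolding l(2) interior_atLeastAtMost_real by auto
 qed
qed

text \<open>A point outside the given interval is covered by sliding the interval there; its two
  ends are covered by the intervals starting at \<open>a - e\<close> and
  \<open>a + e\<close>.\<close>

lemma positive_cover:
 assumes J: "open J" "is_interval J" "J \<subseteq> I" and m: "mx a b" and ab: "a : J" "b : J" and h: "ps h a b" and t: "t : J"
 shows "EX x y. mx x y & x : J & y : J & x < t & t < y"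
proof -
 note mD = mxD[OF m]
 obtain K R where K: "mdv h K R" "smono K R" "a : K" "R a = b" "ALL x:K. x < R x & mx x (R x)"
  using ps_translation[OF m h] by blast
 note d = mdvD[OF K(1)]
 have "open (J \<inter> {a<..})" "R a : J \<inter> {a<..}" using J(1) ab(2) K(4) mD(1) by auto
 then obtain e1 where e1: "e1 > 0" "ball a e1 \<subseteq> K" "R ` ball a e1 \<subseteq> J \<inter> {a<..}" using dv_local[OF d K(3)] by blast
 obtain e2 where e2: "e2 > 0" "ball a e2 \<subseteq> J \<inter> {..<b}" using open_contains_ball[of "J \<inter> {..<b}"] J(1) ab(1) mD(1) by (metis IntI lessThan_iff open_Int open_lessThan)
 define e where "e = min e1 e2 / 2"
 have e: "e > 0" "a - e : ball a e1" "a + e : ball a e1" "a - e : ball a e2" "a + e : ball a e2"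
  using e1(1) e2(1) unfolding e_def by (auto simp: dist_real_def min_def)
 have L: "mx (a - e) (R (a - e)) & a - e : J & R (a - e) : J & a < R (a - e)"
  using K(5) e1(2,3) e2(2) e(2,4) by blast
 have "R a < R (a + e)" using monotone_onD[OF K(2,3)] e(1,3) e1(2) by auto
 then have R: "mx (a + e) (R (a + e)) & a + e : J & R (a + e) : J & a + e < b & b < R (a + e)"
  using K(4,5) e1(2,3) e2(2) e(3,5) by blast
 obtain r where r: "r > 0" "ball t r \<subseteq> J" using J(1) t open_contains_ball by blast
 have near: "s : J" if "t - r < s" "s < t + r" for s using that r(2) by (auto simp: subset_iff dist_real_def)
 have tI: "t : I" using t J(3) by blast
 consider "t < a" | "t = a" | "a < t" "t < b" | "t = b" | "b < t" by linarith
 then show ?thesis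
 proof cases
  case 1
  obtain x y where xy: "t - r < x" "x < t" "t < y" "y < b" "mx x y" using ps_left(2)[OF m h tI 1 r(1)] by blast
  have "x : J" using near xy(1,2) r(1) by auto
  moreover have "y : J" using ivl_sub[OF J(2) t ab(2)] xy(3,4) by auto
  ultimately show ?thesis using xy by blast
 next
  case 2
  then show ?thesis using L e(1) by (intro exI[of _ "a - e"] exI[of _ "R (a - e)"]) simp
 next
  case 3
  then show ?thesis using m ab by blast
 next
  case 4
  then show ?thesis using R by blast
 next
  case 5
  obtain x y where xy: "a < x" "x < t" "t < y" "y < t + r" "mx x y" using ps_right(2)[OF m h tI 5 r(1)] by blast
  have "y : J" using near xy(3,4) r(1) by auto
  moreover have "x : J" using ivl_sub[OF J(2) ab(1) t] xy(1,2) by auto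
  ultimately show ?thesis using xy by blast
 qed
qed

text \<open>Here \<open>t\<close> may be an end of \<open>D\<close>; when it lies outside the given
  interval, it becomes an end of the slid one, which thus stays in \<open>D\<close>.\<close>

lemma positive_cover_closed:
 assumes D: "is_interval D" "D \<subseteq> I" and m: "mx a b" and ab: "a : interior D" "b : interior D" and h: "ps h a b" and t: "t : D"
 shows "EX x y. mx x y & {x..y} \<subseteq> D & t : {x..y}"
proof -
 note mD = mxD[OF m]
 have abD: "a : D" "b : D" using ab interior_subset by blast+
 have tI: "t : I" using t D(2) by blast
 consider "t < a" | "t : {a..b}" | "b < t" by fastforce
 then show ?thesis
 proof cases
  case 1
  obtain y where y: "mx t y" "y < b" using ps_left(1)[OF m h tI 1, of 1] by auto
  have "t < y" using mxD(1)[OF y(1)] .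
  then have "{t..y} \<subseteq> D" using ivl_sub[OF D(1) t abD(2)] y(2) by fastforce
  then show ?thesis using y(1) \<open>t < y\<close> by (intro exI[of _ t] exI[of _ y]) auto
 next
  case 2
  then show ?thesis using m ivl_sub[OF D(1) abD] by blast
 next
  case 3
  obtain x where x: "mx x t" "a < x" using ps_right(1)[OF m h tI 3, of 1] by auto
  have "x < t" using mxD(1)[OF x(1)] .
  then have "{x..t} \<subseteq> D" using ivl_sub[OF D(1) abD(1) t] x(2) by fastforce
  then show ?thesis using x(1) \<open>x < t\<close> by (intro exI[of _ x] exI[of _ t]) auto
 qed
qed

section \<open>Sign of the curve and proof of the theorem\<close>

lemma interior_sub:
 assumes s: "sub D \<gamma>" shows "sub (interior D) \<gamma>"
proof -
 note sD = subD[OF s]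
 have "interval (interior D)" unfolding interval_iff using interior_ivl[OF sD(4)] sD(5) by simp
 then show ?thesis using sub_subset[OF s] interior_subset by blast
qed

text \<open>Any one maximal interval decides the sign, since a translation of one maximal interval
  translates all of them.\<close>

lemma signed_curve_iff:
 assumes s: "sub D \<gamma>" and m: "mx u v" "u : interior D" "v : interior D"
 shows "positive_curve G \<phi> M D \<gamma> \<longleftrightarrow> (EX h. ps h u v)" "negative_curve G \<phi> M D \<gamma> \<longleftrightarrow> ng u v"
 unfolding positive_curve_def negative_curve_def signed_interval_iff[OF interior_sub[OF s] open_interior]
 using m mx_cases ps_ng by metis+

lemma decomposition_signs:
 assumes s: "sub D \<gamma>" and A: "A_decomposition G \<phi> M D \<gamma> A nm np a g"
 shows "positive_curve G \<phi> M D \<gamma> \<longleftrightarrow> (EX h. ps h (a (-1)) (a 1))" "negative_curve G \<phi> M D \<gamma> \<longleftrightarrow> ng (a (-1)) (a 1)"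
 using signed_curve_iff[OF s] dcpD(5,6,11,12)[OF A_decomposition_dcp[OF s A]] by blast+

lemma end_reflections:
 assumes s: "sub D \<gamma>" and A: "A_decomposition G \<phi> M D \<gamma> A nm np a g" and ng: "ng (a (-1)) (a 1)" and n: "n : {-1, 1}"
 shows "g n <# S \<subseteq> stabilizer G \<phi> (\<gamma> (a n)) - S" "inv (g n) <# S = g n <# S"
proof -
 note d = A_decomposition_dcp[OF s A]
 note D = dcpD[OF d]
 have ni: "n : idx nm np" using n D(11,12) by auto
 obtain w where w: "w ~: S" "dec w (a n) (a n)" "inv w \<otimes> g n : S" using dcp_ng(4,5)[OF d ng ni] n by auto
 have "\<gamma> (a n) = \<delta> (a n)" using subD(3)[OF s] D(6)[OF ni] interior_subset by blast
 then show "g n <# S \<subseteq> stabilizer G \<phi> (\<gamma> (a n)) - S" "inv (g n) <# S = g n <# S"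
  using reflection_class[OF D(7)[OF ni] w] by simp_all
qed

lemma step_class_ps:
 assumes s: "sub D \<gamma>" and pos: "positive_curve G \<phi> M D \<gamma>" and c: "step_class G \<phi> M D \<gamma> c" "h : c"
  and A: "A_decomposition G \<phi> M D \<gamma> A nm np a g"
 shows "ps h (a (-1)) (a 1)"
proof -
 note D = dcpD[OF A_decomposition_dcp[OF s A]]
 obtain k where k: "ps k (a (-1)) (a 1)" using decomposition_signs(1)[OF s A] pos by blast
 then show ?thesis using step_class_iff[OF s D(5) D(6)[OF D(12)] D(6)[OF D(11)] k] ps_class[OF k] c by blast
qed

end

theorem theorem4:
  fixes M :: "('m::t2_space, 'e::euclidean_space) atlas"
    and G :: "('g::t2_space) monoid"
    and N :: "('g, 'f::euclidean_space) atlas"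
    and \<phi> :: "'g \<Rightarrow> 'm \<Rightarrow> 'm"
    and D :: "real set"
    and \<gamma> :: "real \<Rightarrow> 'm"
  assumes "analytic_manifold M"
    and "lie_group G N"
    and "group_action G (manifold_points M) \<phi>"
    and "\<And>x. x \<in> manifold_points M \<Longrightarrow> continuous_on (carrier G) (\<lambda>g. \<phi> g x)"
    and "sated G \<phi> M"
    and "\<And>g. g \<in> carrier G \<Longrightarrow> analytic_map M M (\<phi> g)"
    and "interval D"
    and "analytic_immersion M D \<gamma>"
    and "free_curve G \<phi> M D \<gamma>"
    and "\<not> free_segment G \<phi> M D \<gamma>"
  shows
    "((\<exists>!p. tau_decomposition G \<phi> M D \<gamma> (fst p) (snd p)) \<noteq>
        (\<exists>A. inner_compact_maximal G \<phi> M D \<gamma> A)) \<and>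
     ((\<exists>A. inner_compact_maximal G \<phi> M D \<gamma> A) \<longrightarrow>
       (positive_curve G \<phi> M D \<gamma> \<noteq> negative_curve G \<phi> M D \<gamma>) \<and>
       (negative_curve G \<phi> M D \<gamma> \<longrightarrow>
         (\<forall>A n\<^sub>m n\<^sub>p a g. A_decomposition G \<phi> M D \<gamma> A n\<^sub>m n\<^sub>p a g \<longrightarrow>
           (\<forall>B. maximal_interval G \<phi> M D \<gamma> B \<longleftrightarrow>
             (\<exists>n. n\<^sub>m \<le> Fin n \<and> Fin n \<le> n\<^sub>p \<and> B = piece D a n\<^sub>m n\<^sub>p n)) \<and>
           (\<forall>n \<in> idx n\<^sub>m n\<^sub>p.
             (\<forall>P \<mu>. piece_link D \<gamma> n\<^sub>m n\<^sub>p a (\<phi> (g n) \<circ> \<gamma>) n P \<mu> \<longrightarrow>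
               (if even n then strict_mono_on P \<mu> else strict_antimono_on P \<mu>)) \<and>
             curve_class G \<phi> D \<gamma> (g n) = curve_class G \<phi> D \<gamma> (alternating_prod G g n)) \<and>
           (\<forall>n \<in> {-1, 1}.
             curve_class G \<phi> D \<gamma> (g n) \<subseteq> stabilizer G \<phi> (\<gamma> (a n)) - curve_stab G \<phi> D \<gamma> \<and>
             curve_class G \<phi> D \<gamma> (inv\<^bsub>G\<^esub> (g n)) = curve_class G \<phi> D \<gamma> (g n)))) \<and>
       (positive_curve G \<phi> M D \<gamma> \<longrightarrow>
         (\<exists>!c. step_class G \<phi> M D \<gamma> c) \<and>
         (\<forall>c. step_class G \<phi> M D \<gamma> c \<longrightarrow>
           (\<forall>h \<in> c. \<forall>A n\<^sub>m n\<^sub>p a g. A_decomposition G \<phi> M D \<gamma> A n\<^sub>m n\<^sub>p a g \<longrightarrow>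
             (\<forall>n \<in> idx n\<^sub>m n\<^sub>p.
               curve_class G \<phi> D \<gamma> (g n) = curve_class G \<phi> D \<gamma> (h [^]\<^bsub>G\<^esub> n) \<and>
               (\<exists>P \<mu>. piece_link D \<gamma> n\<^sub>m n\<^sub>p a (\<phi> (h [^]\<^bsub>G\<^esub> n) \<circ> \<gamma>) n P \<mu>) \<and>
               (\<forall>P \<mu>. piece_link D \<gamma> n\<^sub>m n\<^sub>p a (\<phi> (h [^]\<^bsub>G\<^esub> n) \<circ> \<gamma>) n P \<mu> \<longrightarrow>
                 strict_mono_on P \<mu>)))) \<and>
         (\<forall>A n\<^sub>m n\<^sub>p a g. A_decomposition G \<phi> M D \<gamma> A n\<^sub>m n\<^sub>p a g \<longrightarrow>
           (\<forall>n. n\<^sub>m < Fin n \<and> n \<le> 0 \<longrightarrow>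
             (\<forall>b' \<in> interior (piece D a n\<^sub>m n\<^sub>p (n - 1)). \<exists>b \<in> interior (piece D a n\<^sub>m n\<^sub>p n).
               inner_compact_maximal G \<phi> M D \<gamma> {b'..b} \<and>
               positive_interval G \<phi> M (interior D) \<gamma> {b'..b})) \<and>
           (\<forall>n. 0 \<le> n \<and> Fin n < n\<^sub>p \<longrightarrow>
             (\<forall>b \<in> interior (piece D a n\<^sub>m n\<^sub>p (n + 1)). \<exists>b' \<in> interior (piece D a n\<^sub>m n\<^sub>p n).
               inner_compact_maximal G \<phi> M D \<gamma> {b'..b} \<and>
               positive_interval G \<phi> M (interior D) \<gamma> {b'..b}))) \<and>
         (\<forall>t \<in> interior D. \<exists>B. t \<in> interior B \<and> inner_compact_maximal G \<phi> M D \<gamma> B \<and>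
           positive_interval G \<phi> M (interior D) \<gamma> B) \<and>
         (\<exists>I \<delta>. maximal_extension M D \<gamma> I \<delta> \<and>
           (\<forall>t \<in> D. \<exists>B. t \<in> B \<and> compact B \<and> B \<subseteq> D \<and> maximal_interval G \<phi> M D \<gamma> B \<and>
             positive_interval G \<phi> M I \<delta> B))))"
proof -
 interpret amanifold M by unfold_locales (rule assms(1))
 \<comment> \<open>Working with the maximal extension from the outset lets the last claim,
   positivity with respect to it, refer to the same displacements.\<close>
 obtain I \<delta> where me: "maximal_extension M D \<gamma> I \<delta>" using maximal_extension_exists[OF assms(8)] by blast
 then have I: "open_immersion M I \<delta>" "D \<subseteq> I" "ALL t:D. \<delta> t = \<gamma> t" unfolding maximal_extension_def by blast+
 interpret setting M G \<phi> I \<delta>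
  by (rule setting.intro[OF amanifold_axioms setting_axioms.intro[OF assms(3) assms(5) assms(6) I(1)]])
 have s: "sub D \<gamma>" unfolding sub_def using assms(7) I(2,3) by simp
 note sD = subD[OF s] and sJ = interior_sub[OF s]
 have sI: "sub I \<delta>" unfolding sub_def using immersionD(1)[OF imm] by simp
 note alt = tau_alternative[OF s _ assms(10)]
 let ?icm = "inner_compact_maximal G \<phi> M D \<gamma>" and ?pos = "positive_interval G \<phi> M (interior D) \<gamma>"
 have free: "EX A. free_interval G \<phi> M D \<gamma> A" using assms(9) unfolding free_curve_def by blast
 have excl: "positive_curve G \<phi> M D \<gamma> ~= negative_curve G \<phi> M D \<gamma>" if ex: "EX A. ?icm A"
 proof -
  obtain u v where uv: "mx u v" "u : interior D" "v : interior D" using ex unfolding inner_compact_maximal_iff[OF s] by blast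
  show ?thesis using signed_curve_iff[OF s uv] ps_not_ng[OF uv(1)] by blast
 qed
 have ob: "EX u v h. mx u v & u : interior D & v : interior D & ps h u v" if "positive_curve G \<phi> M D \<gamma>"
  using that mx_cases unfolding positive_curve_def signed_interval_iff[OF sJ open_interior] by meson
 have int: "?icm {x..y} & ?pos {x..y}" if "positive_curve G \<phi> M D \<gamma>" "mx x y" "x : interior D" "y : interior D" for x y
  unfolding inner_compact_maximal_iff[OF s] signed_interval_iff[OF sJ open_interior]
  using signed_curve_iff(1)[OF s that(2-4)] ps_not_ng[OF that(2)] that by blast
 note dcp = A_decomposition_dcp[OF s] and sg = decomposition_signs[OF s, THEN iffD1]
 have uniq: "EX! c. step_class G \<phi> M D \<gamma> c" if pos: "positive_curve G \<phi> M D \<gamma>"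
 proof -
  obtain u v h where uv: "mx u v" "u : interior D" "v : interior D" "ps h u v" using ob[OF pos] by blast
  show ?thesis unfolding step_class_iff[OF s uv] by blast
 qed
 have left: "EX b : interior (piece D a nm np n). ?icm {b'..b} & ?pos {b'..b}"
  if p: "positive_curve G \<phi> M D \<gamma>" and A: "A_decomposition G \<phi> M D \<gamma> A nm np a g"
   and n: "nm < Fin n & n <= 0" and b: "b' : interior (piece D a nm np (n - 1))" for A nm np a g n b'
 proof -
  obtain h where "ps h (a (-1)) (a 1)" using sg(1)[OF A p] by blast
  from positive_slide(1)[OF dcp[OF A] this conjunct1[OF n] conjunct2[OF n] b] show ?thesis using int[OF p] by (elim bexE) blast
 qed
 have right: "EX b' : interior (piece D a nm np n). ?icm {b'..b} & ?pos {b'..b}"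
  if p: "positive_curve G \<phi> M D \<gamma>" and A: "A_decomposition G \<phi> M D \<gamma> A nm np a g"
   and n: "0 <= n & Fin n < np" and b: "b : interior (piece D a nm np (n + 1))" for A nm np a g n b
 proof -
  obtain h where "ps h (a (-1)) (a 1)" using sg(1)[OF A p] by blast
  from positive_slide(2)[OF dcp[OF A] this conjunct1[OF n] conjunct2[OF n] b] show ?thesis using int[OF p] by (elim bexE) blast
 qed
 have cover: "EX B. t : interior B & ?icm B & ?pos B" if p: "positive_curve G \<phi> M D \<gamma>" and t: "t : interior D" for t
 proof -
  obtain u v h where uv: "mx u v" "u : interior D" "v : interior D" "ps h u v" using ob[OF p] by blast
  obtain x y where xy: "mx x y" "x : interior D" "y : interior D" "x < t" "t < y"
   using positive_cover[OF open_interior subD(4,2)[OF sJ] uv t] by blast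
  have "t : interior {x..y}" using xy(4,5) by simp
  then show ?thesis using int[OF p xy(1-3)] by blast
 qed
 have ends: "EX I \<delta>. maximal_extension M D \<gamma> I \<delta> & (ALL t : D. EX B. t : B & compact B & B \<subseteq> D &
   maximal_interval G \<phi> M D \<gamma> B & positive_interval G \<phi> M I \<delta> B)" if p: "positive_curve G \<phi> M D \<gamma>"
 proof -
  obtain u v h where uv: "mx u v" "u : interior D" "v : interior D" "ps h u v" using ob[OF p] by blast
  have "EX B. t : B & compact B & B \<subseteq> D & maximal_interval G \<phi> M D \<gamma> B & positive_interval G \<phi> M I \<delta> B" if t: "t : D" for t
  proof -
   obtain x y where xy: "mx x y" "{x..y} \<subseteq> D" "t : {x..y}" using positive_cover_closed[OF sD(4,2) uv t] by blast
   have "positive_interval G \<phi> M I \<delta> {x..y}" unfolding signed_interval_iff[OF sI open_I]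
    using xy(1) mxD(2,3)[OF xy(1)] ps_ng[OF uv(1,4) xy(1)] by blast
   then show ?thesis using xy mx_maximal[OF s xy(1,2)] compact_Icc by blast
  qed
  then show ?thesis using me by blast
 qed
 show ?thesis
 proof (rule conjI)
  show "(EX! p. tau_decomposition G \<phi> M D \<gamma> (fst p) (snd p)) ~= (EX A. ?icm A)" using free alt by blast
 \<comment> \<open>Classes become cosets of \<open>S\<close>, after which each conjunct is one of
   the facts collected above.\<close>
 qed (unfold class_eq[OF s] stab_eq[OF s], intro conjI impI allI ballI;
   (rule excl maximal_pieces[OF s dcp sg(2)] negative_links[OF s _ sg(2)] end_reflections[OF s _ sg(2)] uniq
    power_links[OF s _ step_class_ps[OF s]] left right cover ends; assumption))
qed

end
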